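(* Let $\Delta$ be a $(d-1)$-dimensional Buchsbaum simplicial complex (over $\mathbf{k}$) on $n$ vertices. Then $h'_0(\Delta)=1$, $h'_1(\Delta)=n-d$, and $$h'_{j+1}(\Delta)\;\le\;\left(h'_j(\Delta)-\binom{d}{j}\beta_{j-1}(\Delta)\right)^{<j>}\qquad\text{for } 1\le j\le d-1.$$
   Context: $\mathbf{k}$ is an infinite field of arbitrary characteristic. A simplicial complex $\Delta$ on $[n]$ is a collection of subsets (faces) of $[n]$ closed under inclusion and containing all singletons; $\dim F=|F|-1$ and $\dim\Delta$ is the maximal dimension of a face. $f_i$ is the number of $i$-dimensional faces ($f_{-1}=1$), and, for $\dim\Delta=d-1$, the $h$-vector $(h_0,\dots,h_d)$ is defined by $\sum_{i=0}^d h_i x^{d-i}=\sum_{i=0}^d f_{i-1}(x-1)^{d-i}$. $\beta_i(\Delta)=\dim_{\mathbf{k}}\widetilde H_i(\Delta;\mathbf{k})$ are the reduced Betti numbers, and $$h'_j(\Delta)=h_j(\Delta)+\binom{d}{j}\sum_{i=0}^{j-1}(-1)^{j-i-1}\beta_{i-1}(\Delta),\qquad 0\le j\le d.$$ For integers $l,j\ge 1$ there is a unique expression $l=\binom{n_j}{j}+\binom{n_{j-1}}{j-1}+\dots+\binom{n_s}{s}$ with $n_j>n_{j-1}>\dots>n_s\ge s\ge1$; define $l^{<j>}=\binom{n_j+1}{j+1}+\binom{n_{j-1}+1}{j}+\dots+\binom{n_s+1}{s+1}$, and $0^{<j>}=0$. $\Delta$ is Buchsbaum (over $\mathbf{k}$)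 if its Stanley–Reisner ring $\mathbf{k}[\Delta]=S/I_\Delta$ is a Buchsbaum $S$-module, where $S=\mathbf{k}[x_1,\dots,x_n]$ and $I_\Delta$ is generated by the squarefree monomials $x_{i_1}\cdots x_{i_k}$ with $\{i_1<\dots<i_k\}\notin\Delta$. Here a Noetherian graded $S$-module $M$ of Krull dimension $d$ is Buchsbaum if for every sequence $\theta_1,\dots,\theta_d$ of homogeneous elements of $\mathfrak{M}=(x_1,\dots,x_n)$ with $\dim M/(\theta_1,\dots,\theta_d)M=0$ one has $(\theta_1,\dots,\theta_{i-1})M:\theta_i=(\theta_1,\dots,\theta_{i-1})M:\mathfrak{M}$ for all $i$. (Equivalently, by Schenzel: $\Delta$ is pure and for each vertex $v$ the link $L$ of $v$ is Cohen–Macaulay over $\mathbf{k}$, i.e. $\widetilde H_i(\operatorname{lk}_L F;\mathbf{k})=0$ for all $F\in L$ and $i<\dim L-|F|$.) *)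

theory Defs
  imports
    "HOL-Library.Cardinality"
    "HOL-Library.Poly_Mapping"
    "HOL-Library.Extended_Nat"
    "HOL-Computational_Algebra.Polynomial"
begin

section \<open>Simplicial complexes, face numbers and reduced Betti numbers\<close>

text \<open>
  The vertex set \<open>[n]\<close> is the universe of a finite linearly ordered type \<open>'v\<close>, so \<open>n = CARD('v) \<ge> 1\<close>.
  The order is only used to orient simplices in the boundary map.
\<close>

definition simplicial_complex :: "'v set set \<Rightarrow> bool" where
  "simplicial_complex \<Delta> \<longleftrightarrow> (\<forall>F\<in>\<Delta>. \<forall>G\<subseteq>F. G \<in> \<Delta>) \<and> (\<forall>v. {v} \<in> \<Delta>)"

definition face_dim :: "'v set \<Rightarrow> int" where
  "face_dim F = int (card F) - 1"

definition complex_dim :: "'v set set \<Rightarrow> int" where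
  "complex_dim \<Delta> = Max (face_dim ` \<Delta>)"

definition f_num :: "'v set set \<Rightarrow> int \<Rightarrow> nat" where
  "f_num \<Delta> i = card {F \<in> \<Delta>. face_dim F = i}"

text \<open>
  \<open>h_poly d \<Delta>\<close> is \<open>\<Sum>i\<le>d. f\<^sub>i\<^sub>-\<^sub>1 (x - 1)\<^sup>d\<^sup>-\<^sup>i\<close>, and \<open>h\<^sub>j\<close> is its coefficient at \<open>x\<^sup>d\<^sup>-\<^sup>j\<close>. In all of the
  following, \<open>d\<close> stands for \<open>dim \<Delta> + 1\<close>, and \<open>h_num\<close> and \<open>h'_num\<close> are meaningful only for \<open>j \<le> d\<close>.
\<close>

definition h_poly :: "nat \<Rightarrow> 'v set set \<Rightarrow> int poly" where
  "h_poly d \<Delta> = (\<Sum>i\<le>d. smult (int (f_num \<Delta> (int i - 1))) ([:-1, 1:] ^ (d - i)))"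

definition h_num :: "nat \<Rightarrow> 'v set set \<Rightarrow> nat \<Rightarrow> int" where
  "h_num d \<Delta> j = poly.coeff (h_poly d \<Delta>) (d - j)"

text \<open>
  Chains are formal \<open>'k\<close>-linear combinations of faces. The empty face has dimension \<open>-1\<close> and is
  included, so the complex is the augmented one and computes reduced homology. Deleting \<open>v\<close> from a
  face \<open>F\<close> carries the sign \<open>(-1)\<^sup>p\<close>, where \<open>p\<close> is the position of \<open>v\<close> in \<open>F\<close> counted from \<open>0\<close>.
\<close>

definition chains :: "'v set set \<Rightarrow> int \<Rightarrow> ('v set \<Rightarrow>\<^sub>0 'k::field) set" where
  "chains \<Delta> i = {c. \<forall>F \<in> Poly_Mapping.keys c. F \<in> \<Delta> \<and> face_dim F = i}"

definition boundary :: "('v::linorder set \<Rightarrow>\<^sub>0 'k::field) \<Rightarrow> ('v set \<Rightarrow>\<^sub>0 'k)" where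
  "boundary c = (\<Sum>F\<in>Poly_Mapping.keys c. \<Sum>v\<in>F.
     Poly_Mapping.single (F - {v}) ((-1) ^ card {u \<in> F. u < v} * Poly_Mapping.lookup c F))"

definition chain_scale :: "'k::field \<Rightarrow> ('v set \<Rightarrow>\<^sub>0 'k) \<Rightarrow> ('v set \<Rightarrow>\<^sub>0 'k)" where
  "chain_scale a = Poly_Mapping.map (\<lambda>x. a * x)"

definition cycles :: "'v::linorder set set \<Rightarrow> int \<Rightarrow> ('v set \<Rightarrow>\<^sub>0 'k::field) set" where
  "cycles \<Delta> i = {c \<in> chains \<Delta> i. boundary c = 0}"

definition boundaries :: "'v::linorder set set \<Rightarrow> int \<Rightarrow> ('v set \<Rightarrow>\<^sub>0 'k::field) set" where
  "boundaries \<Delta> i = boundary ` chains \<Delta> (i + 1)"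

text \<open>
  \<open>reduced_betti TYPE('k) \<Delta> i\<close> is the dimension of the quotient of cycles by boundaries in
  degree \<open>i\<close>; all spaces involved are finite-dimensional since \<open>'v\<close> is finite.
\<close>

definition reduced_betti :: "'k::field itself \<Rightarrow> 'v::{finite,linorder} set set \<Rightarrow> int \<Rightarrow> int" where
  "reduced_betti _ \<Delta> i =
     int (vector_space.dim chain_scale (cycles \<Delta> i :: ('v set \<Rightarrow>\<^sub>0 'k) set))
   - int (vector_space.dim chain_scale (boundaries \<Delta> i :: ('v set \<Rightarrow>\<^sub>0 'k) set))"

definition h'_num :: "'k::field itself \<Rightarrow> nat \<Rightarrow> 'v::{finite,linorder} set set \<Rightarrow> nat \<Rightarrow> int" where
  "h'_num K d \<Delta> j = h_num d \<Delta> j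
     + int (d choose j) * (\<Sum>i<j. (-1) ^ (j - i - 1) * reduced_betti K \<Delta> (int i - 1))"

lemma lookup_chain_scale [simp]: "Poly_Mapping.lookup (chain_scale a c) F = a * Poly_Mapping.lookup c F"
  by (simp add: chain_scale_def map.rep_eq when_def)

lemma vector_space_chain_scale: "vector_space chain_scale"
  by standard (auto intro!: poly_mapping_eqI simp: Poly_Mapping.lookup_add algebra_simps)


section \<open>The pseudo-power \<open>l\<close> to \<open>l\<^sup><\<^sup>j\<^sup>>\<close>\<close>

text \<open>
  \<open>macaulay_rep l j s m\<close> says that \<open>l\<close> is the sum of the \<open>binomial (m i) i\<close> over \<open>i = s, \<dots>, j\<close>, where
  \<open>m i\<close> plays the role of the top entry with index \<open>i\<close>. For \<open>l, j \<ge> 1\<close> the number \<open>s\<close> and the values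
  of \<open>m\<close> on \<open>{s..j}\<close> are unique, so the description below determines a unique number.
\<close>

definition macaulay_rep :: "nat \<Rightarrow> nat \<Rightarrow> nat \<Rightarrow> (nat \<Rightarrow> nat) \<Rightarrow> bool" where
  "macaulay_rep l j s m \<longleftrightarrow> 1 \<le> s \<and> s \<le> j \<and> s \<le> m s \<and> strict_mono_on {s..j} m
     \<and> l = (\<Sum>i=s..j. m i choose i)"

definition pseudo_power :: "nat \<Rightarrow> nat \<Rightarrow> nat" where
  "pseudo_power l j = (if l = 0 then 0
     else THE r. \<exists>s m. macaulay_rep l j s m \<and> r = (\<Sum>i=s..j. (m i + 1) choose (i + 1)))"


section \<open>Stanley--Reisner ideals and the Buchsbaum property\<close>

text \<open>
  The polynomial ring \<open>S = k[x\<^sub>v : v \<in> [n]]\<close>, with exponent vectors \<open>'v \<Rightarrow>\<^sub>0 nat\<close>.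
\<close>

type_synonym ('v, 'k) mpoly = "('v \<Rightarrow>\<^sub>0 nat) \<Rightarrow>\<^sub>0 'k"

definition var :: "'v \<Rightarrow> ('v, 'k::field) mpoly" where
  "var v = Poly_Mapping.single (Poly_Mapping.single v 1) 1"

definition homogeneous :: "('v::finite, 'k::field) mpoly \<Rightarrow> bool" where
  "homogeneous p \<longleftrightarrow> (\<exists>e. \<forall>t \<in> Poly_Mapping.keys p. (\<Sum>v\<in>UNIV. Poly_Mapping.lookup t v) = e)"

abbreviation is_ideal :: "'a::comm_ring_1 set \<Rightarrow> bool" where
  "is_ideal \<equiv> module.subspace (*)"

abbreviation ideal_gen :: "'a::comm_ring_1 set \<Rightarrow> 'a set" where
  "ideal_gen \<equiv> module.span (*)"

lemma module_mult: "module ((*) :: 'a::comm_ring_1 \<Rightarrow> 'a \<Rightarrow> 'a)"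
  by standard (simp_all add: algebra_simps)

definition irrelevant_ideal :: "('v, 'k::field) mpoly set" where
  "irrelevant_ideal = ideal_gen (var ` UNIV)"

definition SR_ideal :: "'v::finite set set \<Rightarrow> ('v, 'k::field) mpoly set" where
  "SR_ideal \<Delta> = ideal_gen {(\<Prod>v\<in>A. var v) |A. A \<notin> \<Delta>}"

definition prime_ideal :: "'a::comm_ring_1 set \<Rightarrow> bool" where
  "prime_ideal P \<longleftrightarrow> is_ideal P \<and> 1 \<notin> P \<and> (\<forall>a b. a * b \<in> P \<longrightarrow> a \<in> P \<or> b \<in> P)"

text \<open>
  Krull dimension of the ring \<open>R/I\<close>, or equally of the \<open>R\<close>-module \<open>R/I\<close>, whose annihilator is \<open>I\<close>:
  the supremum of the lengths of chains of primes containing \<open>I\<close>. It is \<open>0\<close> if \<open>R/I = 0\<close>, but below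
  it is only applied to proper ideals (contained in the irrelevant ideal, if \<open>\<Delta>\<close> contains \<open>{}\<close>).
\<close>

definition krull_dim_quotient :: "'a::comm_ring_1 set \<Rightarrow> enat" where
  "krull_dim_quotient I = Sup {enat r |r. \<exists>P. (\<forall>i\<le>r. prime_ideal (P i) \<and> I \<subseteq> P i)
     \<and> (\<forall>i<r. P i \<subset> P (Suc i))}"

text \<open>
  The graded module \<open>M = S/I\<close>, for a homogeneous ideal \<open>I\<close>, is Buchsbaum. Submodules of \<open>M\<close> are
  written as the ideals of \<open>S\<close> containing \<open>I\<close>: \<open>(\<theta>\<^sub>1, \<dots>, \<theta>\<^sub>i)M\<close> is \<open>J i = I + (\<theta>\<^sub>1, \<dots>, \<theta>\<^sub>i)\<close>, and
  \<open>M/(\<theta>\<^sub>1, \<dots>, \<theta>\<^sub>i)M\<close> is \<open>S / J i\<close>. List indices start at \<open>0\<close>, so \<open>\<theta> ! i\<close> is \<open>\<theta>\<^sub>i\<^sub>+\<^sub>1\<close>.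
\<close>

definition colon :: "'a::comm_ring_1 set \<Rightarrow> 'a set \<Rightarrow> 'a set" where
  "colon J B = {g. \<forall>b\<in>B. b * g \<in> J}"

definition buchsbaum_quotient :: "('v::finite, 'k::field) mpoly set \<Rightarrow> bool" where
  "buchsbaum_quotient I \<longleftrightarrow>
     (\<forall>\<theta> :: ('v, 'k) mpoly list.
        let J = (\<lambda>i. ideal_gen (I \<union> set (take i \<theta>))) in
        enat (length \<theta>) = krull_dim_quotient I
        \<and> (\<forall>p \<in> set \<theta>. homogeneous p \<and> p \<in> irrelevant_ideal)
        \<and> krull_dim_quotient (J (length \<theta>)) = 0
        \<longrightarrow> (\<forall>i < length \<theta>. colon (J i) {\<theta> ! i} = colon (J i) irrelevant_ideal))"

definition buchsbaum_complex :: "'k::field itself \<Rightarrow> 'v::finite set set \<Rightarrow> bool" where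
  "buchsbaum_complex _ \<Delta> \<longleftrightarrow> buchsbaum_quotient (SR_ideal \<Delta> :: ('v, 'k) mpoly set)"

end

theory Submission
  imports Defs "HOL-Library.FuncSet"
begin

text \<open>
  Fix distinct points \<open>t\<^sub>v\<close> of the field and the linear forms \<open>\<theta>\<^sub>l = \<Sum>\<^sub>v t\<^sub>v\<^sup>l x\<^sub>v\<close> for \<open>l < d\<close>. Every basis of
  their span is a system of parameters, and the Buchsbaum property, applied to bases adapted to a
  face \<open>F \<noteq> {}\<close>, shows that the \<open>\<theta>\<^sub>l\<close> form a regular sequence on the Stanley--Reisner ring of the star
  of \<open>F\<close>. These rings form a cochain complex indexed by the faces, which is exact in every nonzero
  multidegree. Tensoring it with the Koszul complex of \<open>\<theta>\<^sub>0, \<dots>, \<theta>\<^sub>i\<^sub>-\<^sub>1\<close> and comparing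
  the two filtrations shows that, modulo these forms, the elements of degree \<open>s\<close> that vanish on all
  vertex stars form a space of dimension \<open>(i choose s) \<beta>\<^sub>s\<^sub>-\<^sub>1\<close>; they are the annihilator of \<open>\<theta>\<^sub>i\<close> when
  \<open>i < d\<close>, and are socle elements when \<open>i = d\<close>. The first fact gives a recursion which identifies the
  Hilbert function of the Artinian reduction with \<open>h'\<close>; the second allows one to kill these socle
  elements in degree \<open>j\<close> without changing degree \<open>j + 1\<close>, and Macaulay's theorem applies.
\<close>

section \<open>Dimensions of finite-dimensional subspaces\<close>

text \<open>The moment curve replaces a generic choice: interpolation makes the forms independent on
  every face at once and writes down the adapted bases. The Buchsbaum condition concerns one ordered
  sequence at a time, and the order that suits a face depends on it; regularity of the fixed
  sequence \<open>\<theta>\<close> on all stars is recovered by comparing Hilbert functions, which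
  see only the ideal generated by all \<open>d\<close> forms. The two filtrations play these defects
  against each other. In internal degree \<open>s\<close> and total degree 0 the constants sit at
  pairs of a face with \<open>s\<close> vertices and an \<open>s\<close>-subset of the
  \<open>i\<close> Koszul indices, whence \<open>i choose s\<close> and the Betti index
  \<open>s - 1\<close>. Instead of a spectral sequence, a linear relation made of zigzags identifies
  the two quotients. Macaulay's theorem is obtained for monomials from Green's hyperplane bound,
  proved for stable sets; compression leads to these and keeps cardinalities.\<close>

definition pm_scale :: "'k::field \<Rightarrow> ('a \<Rightarrow>\<^sub>0 'k) \<Rightarrow> ('a \<Rightarrow>\<^sub>0 'k)" where
  "pm_scale a = Poly_Mapping.map (\<lambda>x. a * x)"

lemma lookup_pm_scale [simp]:
  "Poly_Mapping.lookup (pm_scale a c) t = a * Poly_Mapping.lookup c t"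
  by (simp add: pm_scale_def map.rep_eq when_def)

text \<open>\<open>chain_scale\<close> acts on chains only; polynomials and families of cochains
  need the same scaling at other index types.\<close>

lemma chain_scale_eq_pm_scale: "chain_scale = pm_scale"
  by (simp add: fun_eq_iff chain_scale_def pm_scale_def)

global_interpretation pm: vector_space "pm_scale :: 'k::field \<Rightarrow> ('a \<Rightarrow>\<^sub>0 'k) \<Rightarrow> _"
  by standard (auto intro!: poly_mapping_eqI simp: Poly_Mapping.lookup_add algebra_simps)

global_interpretation pmp: vector_space_pair
  "pm_scale :: 'k::field \<Rightarrow> ('a \<Rightarrow>\<^sub>0 'k) \<Rightarrow> _" "pm_scale :: 'k::field \<Rightarrow> ('b \<Rightarrow>\<^sub>0 'k) \<Rightarrow> _"
  by unfold_locales

abbreviation pm_linear :: "(('a \<Rightarrow>\<^sub>0 'k::field) \<Rightarrow> ('b \<Rightarrow>\<^sub>0 'k)) \<Rightarrow> bool" where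
  "pm_linear \<equiv> Vector_Spaces.linear pm_scale pm_scale"

text \<open>An infinite basis has \<open>card\<close> 0, so \<open>pm.dim\<close> says nothing about
  infinite-dimensional spaces; this predicate guards the comparisons of dimensions.\<close>

definition fin_span :: "('a \<Rightarrow>\<^sub>0 'k::field) set \<Rightarrow> bool" where
  "fin_span W \<longleftrightarrow> (\<exists>B. finite B \<and> W \<subseteq> pm.span B)"

lemma fin_span_subset: "fin_span W \<Longrightarrow> V \<subseteq> W \<Longrightarrow> fin_span V"
  unfolding fin_span_def by blast

lemma finite_independent_fin_span:
  assumes "fin_span W" "pm.independent B" "B \<subseteq> W" shows "finite B"
proof -
  obtain C where "finite C" "W \<subseteq> pm.span C" using assms(1) unfolding fin_span_def by blast
  then show ?thesis using pm.independent_span_bound[of C B] assms by blast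
qed

lemma dim_mono_fin:
  assumes "fin_span W" "V \<subseteq> W" shows "pm.dim V \<le> pm.dim W"
proof -
  obtain B where B: "B \<subseteq> V" "pm.independent B" "V \<subseteq> pm.span B" "card B = pm.dim V"
    by (rule pm.basis_exists)
  obtain C where C: "C \<subseteq> W" "pm.independent C" "W \<subseteq> pm.span C" "card C = pm.dim W"
    by (rule pm.basis_exists)
  have "finite C" using C assms finite_independent_fin_span by blast
  then show ?thesis using pm.independent_span_bound[of C B] B C assms by auto
qed

text \<open>The representation of \<open>x\<close> over \<open>C\<close> agrees with those over
  \<open>A\<close> and over \<open>B\<close>, so its support lies in the empty intersection.\<close>

lemma independent_disjoint_span:
  assumes "pm.independent C" "A \<subseteq> C" "B \<subseteq> C" "A \<inter> B = {}" "x \<in> pm.span A" "x \<in> pm.span B"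
  shows "x = 0"
proof -
  have "pm.representation C x = pm.representation A x" "pm.representation C x = pm.representation B x"
    using pm.representation_extend assms by auto
  then have "pm.representation C x b = 0" for b
    using pm.representation_ne_zero[of A x b] pm.representation_ne_zero[of B x b] assms(4) by fastforce
  moreover have "x \<in> pm.span C" using assms pm.span_mono by blast
  ultimately have "x = (\<Sum>b\<in>{b. pm.representation C x b \<noteq> 0}. pm_scale 0 b)"
    using pm.sum_nonzero_representation_eq[OF assms(1), of x] by simp
  then show ?thesis by simp
qed

lemma subspace_dim_equal_fin:
  assumes "fin_span W" "pm.subspace V" "V \<subseteq> W" "pm.dim W \<le> pm.dim V"
  shows "V = W"
proof -
  obtain B where B: "B \<subseteq> V" "pm.independent B" "V \<subseteq> pm.span B" "card B = pm.dim V"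
    by (rule pm.basis_exists)
  obtain C where C: "B \<subseteq> C" "C \<subseteq> W" "pm.independent C" "W \<subseteq> pm.span C"
    using pm.maximal_independent_subset_extend[of B W] B assms by blast
  have "finite C" using C assms finite_independent_fin_span by blast
  moreover have "card C = pm.dim W" using pm.basis_card_eq_dim C by blast
  ultimately have "B = C" using B C assms card_seteq[of C B] by auto
  then show ?thesis using B C assms pm.span_subspace[of B V] by blast
qed

text \<open>Rank-nullity relative to \<open>W\<close>: a basis of the kernel is extended to one of
  \<open>W\<close>, and \<open>f\<close> is injective on the span of the added vectors.\<close>

lemma dim_kernel_image:
  assumes "pm_linear f" "pm.subspace W" "fin_span W"
  shows "pm.dim W = pm.dim {x\<in>W. f x = 0} + pm.dim (f ` W)"
proof -
  interpret f: Vector_Spaces.linear pm_scale pm_scale f by fact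
  let ?K = "{x\<in>W. f x = 0}"
  obtain k where k: "k \<subseteq> ?K" "pm.independent k" "?K \<subseteq> pm.span k" "card k = pm.dim ?K"
    by (rule pm.basis_exists)
  obtain c where c: "k \<subseteq> c" "c \<subseteq> W" "pm.independent c" "W \<subseteq> pm.span c"
    using pm.maximal_independent_subset_extend[of k W] k by blast
  have fc: "finite c" using c assms(3) finite_independent_fin_span by blast
  have cc: "card c = pm.dim W" using pm.basis_card_eq_dim c by blast
  let ?X = "c - k"
  have sX: "pm.span ?X \<subseteq> W"
    by (rule pm.span_minimal) (use c assms in auto)
  have X0: "x = 0" if "x \<in> pm.span ?X" "f x = 0" for x
  proof -
    have "x \<in> pm.span k" using that sX k by blast
    then show ?thesis using independent_disjoint_span[of c ?X k x] c that by blast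
  qed
  have inj: "inj_on f (pm.span ?X)"
    using f.inj_on_iff_eq_0[OF pm.subspace_span, of ?X] X0 by blast
  have "pm.independent ?X" using c pm.independent_mono by blast
  then have ind: "pm.independent (f ` ?X)"
    using pmp.linear_independent_injective_image[OF assms(1)] inj by blast
  have "f x \<in> pm.span (f ` ?X)" if "x \<in> W" for x
  proof -
    have "k \<union> ?X = c" using c(1) by blast
    then have "x \<in> pm.span (k \<union> ?X)" using that c(4) by auto
    then obtain a b where ab: "x = a + b" "a \<in> pm.span k" "b \<in> pm.span ?X"
      unfolding pm.span_Un by (elim CollectE exE conjE)
    have "pm.subspace ?K" unfolding pm.subspace_def
      using pm.subspace_0[OF assms(2)] pm.subspace_add[OF assms(2)] pm.subspace_scale[OF assms(2)]
      by (auto simp: f.add f.scale)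
    then have "pm.span k \<subseteq> ?K" using k(1) pm.span_minimal by blast
    then have "f a = 0" using ab by blast
    then have "f x = f b" using ab by (simp add: f.add)
    then show ?thesis using ab pmp.linear_span_image[OF assms(1)] by blast
  qed
  then have "f ` W \<subseteq> pm.span (f ` ?X)" by blast
  moreover have "f ` ?X \<subseteq> f ` W" using c(2) by blast
  ultimately have "pm.dim (f ` W) = card (f ` ?X)"
    using pm.basis_card_eq_dim[of "f ` ?X" "f ` W"] ind by simp
  also have "\<dots> = card ?X"
    by (rule card_image) (meson inj pm.span_superset inj_on_subset)
  also have "\<dots> = card c - card k" using c fc by (meson card_Diff_subset finite_subset)
  finally show ?thesis using cc k c fc card_mono[of c k] by simp
qed

text \<open>Serves as projection modulo \<open>U\<close> without a quotient type: a basis of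
  \<open>U\<close> is extended to one of the whole space, sent to 0, and the added basis vectors are
  fixed.\<close>

lemma exists_linear_with_kernel:
  fixes U :: "('a \<Rightarrow>\<^sub>0 'k::field) set"
  assumes "pm.subspace U"
  obtains q :: "('a \<Rightarrow>\<^sub>0 'k) \<Rightarrow> ('a \<Rightarrow>\<^sub>0 'k)"
  where "pm_linear q" "\<And>x. q x = 0 \<longleftrightarrow> x \<in> U"
proof -
  obtain b where b: "b \<subseteq> U" "pm.independent b" "U \<subseteq> pm.span b" "card b = pm.dim U"
    by (rule pm.basis_exists)
  obtain e where e: "b \<subseteq> e" "e \<subseteq> UNIV" "pm.independent e" "UNIV \<subseteq> pm.span e"
    by (rule pm.maximal_independent_subset_extend[OF subset_UNIV b(2)])
  define q where "q = pmp.construct e (\<lambda>x. if x \<in> b then 0 else x)"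
  have q: "pm_linear q" unfolding q_def by (rule pmp.linear_construct[OF e(3)])
  interpret q: Vector_Spaces.linear pm_scale pm_scale q by fact
  have qb: "q x = (if x \<in> b then 0 else x)" if "x \<in> e" for x
    unfolding q_def by (rule pmp.construct_basis[OF e(3) that])
  have q0: "q x = 0" if "x \<in> pm.span b" for x
    by (rule q.eq_0_on_span[OF _ that]) (use qb e(1) in auto)
  have qi: "q x = x" if "x \<in> pm.span (e - b)" for x
  proof -
    have "q x = id x"
      by (rule pmp.linear_eq_on[OF q pm.linear_id that]) (use qb in auto)
    then show ?thesis by simp
  qed
  have "x \<in> U" if "q x = 0" for x
  proof -
    have "b \<union> (e - b) = e" using e(1) by blast
    then have "x \<in> pm.span (b \<union> (e - b))" using e(4) by auto
    then obtain y z where yz: "x = y + z" "y \<in> pm.span b" "z \<in> pm.span (e - b)"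
      unfolding pm.span_Un by (elim CollectE exE conjE)
    have "q x = q y + q z" unfolding yz(1) by (rule q.add)
    then have "z = 0" using that q0[OF yz(2)] qi[OF yz(3)] by simp
    then show ?thesis using yz pm.span_minimal[OF b(1) assms] by auto
  qed
  then have "q x = 0 \<longleftrightarrow> x \<in> U" for x using q0[of x] b(3) by blast
  then show ?thesis by (rule that[OF q])
qed

text \<open>\<open>R\<close> is a linear correspondence that induces an injection of
  \<open>Z / B\<close> into \<open>Z' / B'\<close>: \<open>fwd\<close> makes the class of the image
  well defined, \<open>bwd\<close> makes the map injective. Applied to a relation and to its
  converse it gives equality of the two differences.\<close>

lemma dim_diff_le_of_relation:
  fixes Z B :: "('a \<Rightarrow>\<^sub>0 'k::field) set" and Z' B' :: "('b \<Rightarrow>\<^sub>0 'k) set"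
  assumes Z: "pm.subspace Z" "fin_span Z" and B: "B \<subseteq> Z" and Bs: "pm.subspace B"
    and Z': "pm.subspace Z'" "fin_span Z'" and B': "B' \<subseteq> Z'" "pm.subspace B'"
    and R0: "R 0 0"
    and Radd: "\<And>x y x' y'. R x x' \<Longrightarrow> R y y' \<Longrightarrow> R (x + y) (x' + y')"
    and Rsc: "\<And>a x x'. R x x' \<Longrightarrow> R (pm_scale a x) (pm_scale a x')"
    and tot: "\<And>x. x \<in> Z \<Longrightarrow> \<exists>x'\<in>Z'. R x x'"
    and bwd: "\<And>x x'. x \<in> Z \<Longrightarrow> x' \<in> B' \<Longrightarrow> R x x' \<Longrightarrow> x \<in> B"
    and fwd: "\<And>x x'. x' \<in> Z' \<Longrightarrow> x \<in> B \<Longrightarrow> R x x' \<Longrightarrow> x' \<in> B'"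
  shows "int (pm.dim Z) - int (pm.dim B) \<le> int (pm.dim Z') - int (pm.dim B')"
proof -
  obtain c where c: "c \<subseteq> Z" "pm.independent c" "Z \<subseteq> pm.span c" "card c = pm.dim Z"
    by (rule pm.basis_exists)
  \<comment> \<open>A choice function need not be linear; it is used on the basis \<open>c\<close>
    only and extended linearly, and \<open>R\<close> survives the extension because it is closed
    under addition and scaling.\<close>
  define r where "r x = (SOME x'. x' \<in> Z' \<and> R x x')" for x
  have r: "r x \<in> Z' \<and> R x (r x)" if "x \<in> Z" for x
    using someI_ex[OF tot[OF that, unfolded Bex_def]] unfolding r_def .
  define f where "f = pmp.construct c r"
  have f: "pm_linear f" unfolding f_def by (rule pmp.linear_construct[OF c(2)])
  interpret f: Vector_Spaces.linear pm_scale pm_scale f by fact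
  have fc: "f x = r x" if "x \<in> c" for x
    unfolding f_def using pmp.construct_basis[OF c(2) that] .
  have Rf: "f x \<in> Z' \<and> R x (f x)" if "x \<in> Z" for x
  proof -
    have "x \<in> pm.span c" using that c by blast
    then show ?thesis
    proof (induction rule: pm.span_induct_alt)
      case base
      then show ?case using R0 pm.subspace_0[OF Z'(1)] by (simp add: f.zero)
    next
      case (step a x y)
      then have *: "f x \<in> Z'" "R x (f x)" "f y \<in> Z'" "R y (f y)"
        using r[of x] fc[of x] c(1) by auto
      have "f (pm_scale a x + y) = pm_scale a (f x) + f y" by (simp add: f.add f.scale)
      then show ?case
        using pm.subspace_add[OF Z'(1) pm.subspace_scale[OF Z'(1) *(1)] *(3)]
          Radd[OF Rsc[OF *(2)] *(4)] by simp
    qed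
  qed
  obtain q :: "('b \<Rightarrow>\<^sub>0 'k) \<Rightarrow> ('b \<Rightarrow>\<^sub>0 'k)"
    where q: "pm_linear q" "\<And>x. q x = 0 \<longleftrightarrow> x \<in> B'"
    by (rule exists_linear_with_kernel[OF B'(2)]) (rule that)
  have "pm.dim Z' = pm.dim {x\<in>Z'. q x = 0} + pm.dim (q ` Z')"
    by (rule dim_kernel_image[OF q(1) Z'])
  moreover have "{x\<in>Z'. q x = 0} = B'" using q B' by blast
  moreover have "pm.dim Z = pm.dim {x\<in>Z. (q \<circ> f) x = 0} + pm.dim ((q \<circ> f) ` Z)"
    by (rule dim_kernel_image[OF _ Z]) (rule Vector_Spaces.linear_compose[OF f q(1)])
  moreover have "{x\<in>Z. (q \<circ> f) x = 0} = B"
  proof -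
    have "f x \<in> B' \<longleftrightarrow> x \<in> B" if "x \<in> Z" for x
      using Rf[OF that] bwd[OF that, of "f x"] fwd[of "f x" x] by blast
    then show ?thesis using q(2) B by auto
  qed
  moreover have "pm.dim ((q \<circ> f) ` Z) \<le> pm.dim (q ` Z')"
  proof (rule dim_mono_fin)
    obtain D where "finite D" "Z' \<subseteq> pm.span D" using Z'(2) unfolding fin_span_def by (elim exE conjE)
    then have "finite (q ` D)" "q ` Z' \<subseteq> pm.span (q ` D)"
      using pmp.linear_span_image[OF q(1), of D] by auto
    then show "fin_span (q ` Z')" unfolding fin_span_def by blast
    show "(q \<circ> f) ` Z \<subseteq> q ` Z'" using Rf by auto
  qed
  ultimately show ?thesis by simp
qed

section \<open>Coordinate subspaces, leading indices and annihilators\<close>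

definition supp_in :: "'a set \<Rightarrow> ('a \<Rightarrow>\<^sub>0 'k::field) set" where
  "supp_in X = {p. Poly_Mapping.keys p \<subseteq> X}"

lemma supp_in_iff: "p \<in> supp_in X \<longleftrightarrow> (\<forall>t. t \<notin> X \<longrightarrow> Poly_Mapping.lookup p t = 0)"
  by (auto simp: supp_in_def in_keys_iff)

lemma subspace_supp_in: "pm.subspace (supp_in X)"
  by (auto simp: pm.subspace_def supp_in_iff Poly_Mapping.lookup_add)

lemma poly_mapping_sum_single:
  assumes "finite X" "p \<in> supp_in X"
  shows "p = (\<Sum>t\<in>X. pm_scale (Poly_Mapping.lookup p t) (Poly_Mapping.single t 1))"
proof (rule poly_mapping_eqI)
  fix k
  have "Poly_Mapping.lookup (\<Sum>t\<in>X. pm_scale (Poly_Mapping.lookup p t) (Poly_Mapping.single t 1)) k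
      = (\<Sum>t\<in>X. if t = k then Poly_Mapping.lookup p t else 0)"
    unfolding Poly_Mapping.lookup_sum by (rule sum.cong) (auto simp: lookup_single when_def)
  also have "\<dots> = Poly_Mapping.lookup p k"
    using assms sum.delta[OF assms(1), of k "Poly_Mapping.lookup p"] by (simp add: supp_in_iff)
  finally show "Poly_Mapping.lookup p k = Poly_Mapping.lookup
      (\<Sum>t\<in>X. pm_scale (Poly_Mapping.lookup p t) (Poly_Mapping.single t 1)) k" by simp
qed

lemma fin_span_supp_in: "finite X \<Longrightarrow> fin_span (supp_in X :: ('a \<Rightarrow>\<^sub>0 'k::field) set)"
  unfolding fin_span_def
proof (intro exI conjI subsetI)
  let ?B = "(\<lambda>t. Poly_Mapping.single t (1::'k)) ` X"
  show "finite ?B" if "finite X" using that by simp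
  fix p :: "'a \<Rightarrow>\<^sub>0 'k" assume "finite X" "p \<in> supp_in X"
  then have "p = (\<Sum>t\<in>X. pm_scale (Poly_Mapping.lookup p t) (Poly_Mapping.single t 1))"
    by (rule poly_mapping_sum_single)
  moreover have "\<dots> \<in> pm.span ?B"
    by (rule pm.span_sum, rule pm.span_scale, rule pm.span_base, rule imageI)
  ultimately show "p \<in> pm.span ?B" by simp
qed

lemma dim_zero_space [simp]: "pm.dim {0} = 0"
  using pm.dim_span_eq_card_independent[of "{}"] pm.independent_empty by simp

text \<open>The coordinate at \<open>x\<close> maps \<open>W\<close> onto zero or onto a line; this
  is the induction step for dimension counts over a finite index set.\<close>

lemma dim_coordinate:
  fixes W :: "('a \<Rightarrow>\<^sub>0 'k::field) set"
  assumes "pm.subspace W" "fin_span W"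
  shows "pm.dim W = pm.dim {w\<in>W. Poly_Mapping.lookup w x = 0}
    + (if \<exists>w\<in>W. Poly_Mapping.lookup w x \<noteq> 0 then 1 else 0)"
proof -
  define f :: "('a \<Rightarrow>\<^sub>0 'k) \<Rightarrow> ('a \<Rightarrow>\<^sub>0 'k)" where "f w = Poly_Mapping.single x (Poly_Mapping.lookup w x)" for w
  have f: "pm_linear f"
    unfolding Vector_Spaces.linear_iff
    by (auto simp: f_def Poly_Mapping.lookup_add single_add pm.vector_space_axioms
        intro!: poly_mapping_eqI simp: lookup_single when_def)
  have f0: "f w = 0 \<longleftrightarrow> Poly_Mapping.lookup w x = 0" for w
    by (metis f_def lookup_single_eq lookup_zero single_zero)
  have d: "pm.dim W = pm.dim {w\<in>W. f w = 0} + pm.dim (f ` W)"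
    by (rule dim_kernel_image[OF f assms])
  show ?thesis
  proof (cases "\<exists>w\<in>W. Poly_Mapping.lookup w x \<noteq> 0")
    case True
    then obtain w where w: "w \<in> W" "Poly_Mapping.lookup w x \<noteq> 0" by blast
    let ?e = "Poly_Mapping.single x (1::'k)"
    have "pm.dim (f ` W) = 1"
    proof (rule pm.dim_unique)
      have "f (pm_scale (1 / Poly_Mapping.lookup w x) w) = ?e" using w by (simp add: f_def)
      then show "{?e} \<subseteq> f ` W" using pm.subspace_scale[OF assms(1) w(1)] by (metis image_eqI empty_subsetI insert_subset)
      have "f v = pm_scale (Poly_Mapping.lookup v x) ?e" for v
        by (rule poly_mapping_eqI) (simp add: f_def lookup_single when_def)
      then show "f ` W \<subseteq> pm.span {?e}"
        using pm.span_scale[OF pm.span_base[of ?e "{?e}"]] by auto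
      have "?e \<noteq> 0" by (metis lookup_single_eq lookup_zero one_neq_zero)
      then show "pm.independent {?e}" by simp
    qed simp
    then show ?thesis using d True by (auto simp: f0)
  next
    case False
    then have "f ` W = {0}" using pm.subspace_0[OF assms(1)] f0 by (auto simp: image_iff)
    then show ?thesis using d False by (simp add: f0)
  qed
qed

lemma dim_supp_in: "finite X \<Longrightarrow> pm.dim (supp_in X :: ('a \<Rightarrow>\<^sub>0 'k::field) set) = card X"
proof (induction X rule: finite_induct)
  case empty
  have "supp_in {} = {0 :: 'a \<Rightarrow>\<^sub>0 'k}" by (auto simp: supp_in_def)
  then show ?case by simp
next
  case (insert x X)
  have "{w\<in>supp_in (insert x X). Poly_Mapping.lookup w x = 0} = (supp_in X :: ('a \<Rightarrow>\<^sub>0 'k) set)"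
    using insert.hyps by (auto simp: supp_in_iff)
  moreover have "Poly_Mapping.single x (1::'k) \<in> supp_in (insert x X)"
    by (auto simp: supp_in_iff lookup_single when_def)
  then have "\<exists>w\<in>(supp_in (insert x X) :: ('a \<Rightarrow>\<^sub>0 'k) set). Poly_Mapping.lookup w x \<noteq> 0"
    by (metis lookup_single_eq one_neq_zero)
  ultimately show ?case
    using insert dim_coordinate[of "supp_in (insert x X) :: ('a \<Rightarrow>\<^sub>0 'k) set" x,
        OF subspace_supp_in fin_span_supp_in] by simp
qed

text \<open>Echelon form without a basis: the vectors with nonzero coordinate at the top index
  \<open>b\<close> all have leading index \<open>b\<close> and add exactly one dimension to the
  rest. The passage to leading monomials in Macaulay's theorem rests on this count.\<close>

lemma card_Max_keys_eq_dim:
  fixes W :: "('a::linorder \<Rightarrow>\<^sub>0 'k::field) set"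
  assumes "finite X" "pm.subspace W" "W \<subseteq> supp_in X"
  shows "card ((\<lambda>p. Max (Poly_Mapping.keys p)) ` (W - {0})) = pm.dim W"
  using assms
proof (induction X arbitrary: W rule: finite_linorder_max_induct)
  case empty
  then have "W = {0}" using pm.subspace_0 by (auto simp: supp_in_def)
  then show ?case by simp
next
  case (insert b X)
  let ?lm = "\<lambda>p. Max (Poly_Mapping.keys p)"
  let ?W0 = "{w\<in>W. Poly_Mapping.lookup w b = 0}"
  have "pm.subspace ?W0" using insert.prems(1) by (auto simp: pm.subspace_def Poly_Mapping.lookup_add)
  moreover have W0: "?W0 \<subseteq> supp_in X" using insert.prems(2) by (fastforce simp: supp_in_iff subset_iff)
  ultimately have IH: "card (?lm ` (?W0 - {0})) = pm.dim ?W0" using insert.IH by blast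
  have top: "?lm w = b" if "w \<in> W" "Poly_Mapping.lookup w b \<noteq> 0" for w
  proof (rule Max_eqI)
    fix y assume "y \<in> Poly_Mapping.keys w"
    then have "y \<in> insert b X" using that insert.prems(2) by (auto simp: supp_in_def)
    then show "y \<le> b" using insert.hyps(2) by (auto simp: less_imp_le)
  qed (use that in \<open>auto simp: in_keys_iff\<close>)
  have low: "?lm w \<in> X" if "w \<in> ?W0 - {0}" for w
  proof -
    have "Poly_Mapping.keys w \<subseteq> X" using that W0 unfolding supp_in_def by blast
    moreover have "Poly_Mapping.keys w \<noteq> {}" using that by simp
    ultimately show ?thesis using Max_in[of "Poly_Mapping.keys w"] by auto
  qed
  have "b \<notin> X" using insert.hyps(2) by auto
  have fW: "fin_span W" using fin_span_subset[OF fin_span_supp_in insert.prems(2)] insert.hyps by simp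
  show ?case
  proof (cases "\<exists>w\<in>W. Poly_Mapping.lookup w b \<noteq> 0")
    case True
    then obtain w where w: "w \<in> W" "Poly_Mapping.lookup w b \<noteq> 0" by blast
    then have "w \<noteq> 0" by auto
    have "?lm ` (W - {0}) = insert b (?lm ` (?W0 - {0}))"
    proof (intro equalityI subsetI)
      fix y assume "y \<in> ?lm ` (W - {0})"
      then show "y \<in> insert b (?lm ` (?W0 - {0}))" using top by fastforce
    next
      fix y assume "y \<in> insert b (?lm ` (?W0 - {0}))"
      then show "y \<in> ?lm ` (W - {0})" using top[OF w] w \<open>w \<noteq> 0\<close> by auto
    qed
    moreover have "b \<notin> ?lm ` (?W0 - {0})" using low \<open>b \<notin> X\<close> by blast
    moreover have "finite (?lm ` (?W0 - {0}))" using low insert.hyps(1) by (meson finite_subset image_subsetI)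
    ultimately show ?thesis using IH dim_coordinate[OF insert.prems(1) fW, of b] True by simp
  next
    case False
    then have "?W0 = W" by auto
    then show ?thesis using IH by simp
  qed
qed

text \<open>The annihilator under the standard pairing, kept inside \<open>supp_in X\<close> to stay
  finite-dimensional; it will relate cocycles to boundaries and cycles to coboundaries.\<close>

definition perp :: "'a set \<Rightarrow> ('a \<Rightarrow>\<^sub>0 'k::field) set \<Rightarrow> ('a \<Rightarrow>\<^sub>0 'k) set" where
  "perp X W = {c\<in>supp_in X. \<forall>w\<in>W. (\<Sum>t\<in>X. Poly_Mapping.lookup c t * Poly_Mapping.lookup w t) = 0}"

lemma subspace_perp: "pm.subspace (perp X W)"
  by (auto simp: pm.subspace_def perp_def supp_in_iff Poly_Mapping.lookup_add distrib_right
      sum.distrib mult.assoc simp flip: sum_distrib_left)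

lemma dim_perp:
  fixes W :: "('a \<Rightarrow>\<^sub>0 'k::field) set"
  assumes "finite X" "pm.subspace W" "W \<subseteq> supp_in X"
  shows "pm.dim (perp X W) + pm.dim W = card X"
  using assms
proof (induction X arbitrary: W rule: finite_induct)
  case empty
  then have "W = {0}" using pm.subspace_0 by (auto simp: supp_in_def)
  moreover have "perp {} W = {0}" by (auto simp: perp_def supp_in_def)
  ultimately show ?case by simp
next
  case (insert x X)
  let ?W0 = "{w\<in>W. Poly_Mapping.lookup w x = 0}"
  let ?P = "perp (insert x X) W"
  have s0: "pm.subspace ?W0" using insert.prems(1) by (auto simp: pm.subspace_def Poly_Mapping.lookup_add)
  have W0: "?W0 \<subseteq> supp_in X" using insert.prems(2) by (fastforce simp: supp_in_iff subset_iff)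
  have IH: "pm.dim (perp X ?W0) + pm.dim ?W0 = card X" using insert.IH s0 W0 by blast
  have fin: "finite (insert x X)" using insert.hyps by simp
  have fW: "fin_span W" using fin_span_subset[OF fin_span_supp_in[OF fin] insert.prems(2)] .
  have fP: "fin_span ?P"
    by (rule fin_span_subset[OF fin_span_supp_in[OF fin]]) (auto simp: perp_def)
  note dP = dim_coordinate[OF subspace_perp fP, of x]
  note dW = dim_coordinate[OF insert.prems(1) fW, of x]
  show ?case
  proof (cases "\<exists>w\<in>W. Poly_Mapping.lookup w x \<noteq> 0")
    case False
    then have W: "?W0 = W" by auto
    have "{w\<in>?P. Poly_Mapping.lookup w x = 0} = perp X W"
      using insert.hyps by (auto simp: perp_def supp_in_iff)
    moreover have "Poly_Mapping.single x 1 \<in> ?P"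
      using False insert.hyps
      by (auto simp: perp_def supp_in_iff lookup_single when_def intro!: sum.neutral)
    then have "\<exists>w\<in>?P. Poly_Mapping.lookup w x \<noteq> 0" by (metis lookup_single_eq one_neq_zero)
    ultimately show ?thesis using dP IH W insert.hyps by simp
  next
    case True
    then obtain v where v: "v \<in> W" "Poly_Mapping.lookup v x \<noteq> 0" by blast
    \<comment> \<open>Normalised to coordinate 1 at \<open>x\<close>: orthogonality to
      \<open>w\<close> determines the \<open>x\<close>-coordinate of a vector from the others, so
      the map \<open>g\<close> that erases this coordinate is injective on
      \<open>?P\<close>.\<close>
    define w where "w = pm_scale (1 / Poly_Mapping.lookup v x) v"
    have w: "w \<in> W" "Poly_Mapping.lookup w x = 1"
      using v pm.subspace_scale[OF insert.prems(1)] by (auto simp: w_def)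
    define g :: "('a \<Rightarrow>\<^sub>0 'k) \<Rightarrow> ('a \<Rightarrow>\<^sub>0 'k)" where
      "g c = c - Poly_Mapping.single x (Poly_Mapping.lookup c x)" for c
    have gl: "Poly_Mapping.lookup (g c) t = (if t = x then 0 else Poly_Mapping.lookup c t)" for c t
      by (simp add: g_def lookup_minus lookup_single when_def)
    have g: "pm_linear g"
      unfolding Vector_Spaces.linear_iff
      by (auto simp: gl Poly_Mapping.lookup_add pm.vector_space_axioms intro!: poly_mapping_eqI)
    have "{c\<in>?P. g c = 0} = {0}"
    proof (intro equalityI subsetI)
      fix c assume c: "c \<in> {c\<in>?P. g c = 0}"
      then have z: "Poly_Mapping.lookup c t = 0" if "t \<noteq> x" for t
        using gl[of c t] that by simp
      have "(\<Sum>t\<in>insert x X. Poly_Mapping.lookup c t * Poly_Mapping.lookup w t) = 0"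
        using c w by (auto simp: perp_def)
      moreover have "(\<Sum>t\<in>X. Poly_Mapping.lookup c t * Poly_Mapping.lookup w t) = 0"
        by (rule sum.neutral) (use z insert.hyps in \<open>metis mult_zero_left\<close>)
      ultimately have "Poly_Mapping.lookup c x = 0" using insert.hyps w by simp
      then have "c = 0" using z by (intro poly_mapping_eqI) (metis lookup_zero)
      then show "c \<in> {0}" by simp
    next
      fix c :: "'a \<Rightarrow>\<^sub>0 'k" assume "c \<in> {0}"
      then show "c \<in> {c\<in>?P. g c = 0}" using pm.subspace_0[OF subspace_perp] by (auto simp: g_def)
    qed
    moreover have "g ` ?P = perp X ?W0"
    proof (intro equalityI subsetI)
      fix c assume "c \<in> g ` ?P"
      then obtain c' where c': "c' \<in> ?P" "c = g c'" by blast
      have "(\<Sum>t\<in>X. Poly_Mapping.lookup c t * Poly_Mapping.lookup u t) = 0" if "u \<in> ?W0" for u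
      proof -
        have "(\<Sum>t\<in>insert x X. Poly_Mapping.lookup c' t * Poly_Mapping.lookup u t) = 0"
          using c' that by (auto simp: perp_def)
        then have "(\<Sum>t\<in>X. Poly_Mapping.lookup c' t * Poly_Mapping.lookup u t) = 0"
          using that insert.hyps by simp
        moreover have "(\<Sum>t\<in>X. Poly_Mapping.lookup c t * Poly_Mapping.lookup u t) =
            (\<Sum>t\<in>X. Poly_Mapping.lookup c' t * Poly_Mapping.lookup u t)"
          by (rule sum.cong) (use insert.hyps c' gl in auto)
        ultimately show ?thesis by simp
      qed
      moreover have "c \<in> supp_in X" using c' gl by (auto simp: perp_def supp_in_iff)
      ultimately show "c \<in> perp X ?W0" by (auto simp: perp_def)
    next
      fix c assume c: "c \<in> perp X ?W0"
      \<comment> \<open>Orthogonality to \<open>w\<close> forces the value \<open>- a\<close> on the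
        erased coordinate.\<close>
      define a where "a = (\<Sum>t\<in>X. Poly_Mapping.lookup c t * Poly_Mapping.lookup w t)"
      define c' where "c' = c - Poly_Mapping.single x a"
      have cx: "Poly_Mapping.lookup c x = 0" using c insert.hyps by (auto simp: perp_def supp_in_iff)
      have cl: "Poly_Mapping.lookup c' t = (if t = x then - a else Poly_Mapping.lookup c t)" for t
        using cx by (simp add: c'_def lookup_minus lookup_single when_def)
      have "(\<Sum>t\<in>insert x X. Poly_Mapping.lookup c' t * Poly_Mapping.lookup u t) = 0" if u: "u \<in> W" for u
      proof -
        let ?b = "Poly_Mapping.lookup u x"
        have "u - pm_scale ?b w \<in> ?W0" using u w insert.prems(1)
          by (auto intro!: pm.subspace_diff pm.subspace_scale simp: lookup_minus)
        then have "(\<Sum>t\<in>X. Poly_Mapping.lookup c t * Poly_Mapping.lookup (u - pm_scale ?b w) t) = 0"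
          using c by (auto simp: perp_def)
        then have "(\<Sum>t\<in>X. Poly_Mapping.lookup c t * Poly_Mapping.lookup u t) = ?b * a"
          by (simp add: lookup_minus right_diff_distrib sum_subtractf a_def sum_distrib_left
              mult.left_commute)
        moreover have "(\<Sum>t\<in>X. Poly_Mapping.lookup c' t * Poly_Mapping.lookup u t) =
            (\<Sum>t\<in>X. Poly_Mapping.lookup c t * Poly_Mapping.lookup u t)"
          by (rule sum.cong) (use insert.hyps cl in auto)
        ultimately show ?thesis using insert.hyps by (simp add: cl mult.commute)
      qed
      moreover have "c' \<in> supp_in (insert x X)" using c by (auto simp: perp_def supp_in_iff cl)
      moreover have "g c' = c" by (rule poly_mapping_eqI) (simp add: gl cl cx)
      ultimately show "c \<in> g ` ?P" by (force simp: perp_def)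
    qed
    ultimately have "pm.dim ?P = pm.dim (perp X ?W0)"
      using dim_kernel_image[OF g subspace_perp fP] by simp
    then show ?thesis using dW True IH insert.hyps by auto
  qed
qed

section \<open>Finite families of vectors as direct sums\<close>

definition slice :: "'b \<Rightarrow> ('a \<times> 'b \<Rightarrow>\<^sub>0 'k::field) \<Rightarrow> ('a \<Rightarrow>\<^sub>0 'k)" where
  "slice A = Poly_Mapping.map_key (\<lambda>F. (F, A))"

lemma lookup_slice [simp]: "Poly_Mapping.lookup (slice A c) F = Poly_Mapping.lookup c (F, A)"
  unfolding slice_def by (subst map_key.rep_eq) (auto simp: inj_def)

text \<open>A direct sum of copies of \<open>W\<close> indexed by \<open>I\<close>, stored as one
  finitely supported function on pairs so that \<open>pm.dim\<close> applies to it.\<close>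

definition slices_in :: "'b set \<Rightarrow> ('a \<Rightarrow>\<^sub>0 'k::field) set \<Rightarrow> ('a \<times> 'b \<Rightarrow>\<^sub>0 'k) set" where
  "slices_in I W = {c. (\<forall>A\<in>I. slice A c \<in> W) \<and> (\<forall>A. A \<notin> I \<longrightarrow> slice A c = 0)}"

lemma pm_linear_slice: "pm_linear (slice A)"
  unfolding Vector_Spaces.linear_iff
  by (auto simp: Poly_Mapping.lookup_add pm.vector_space_axioms intro!: poly_mapping_eqI)

lemma slice_simps [simp]:
  "slice A 0 = 0" "slice A (x + y) = slice A x + slice A y"
  "slice A (pm_scale a x) = pm_scale a (slice A x)"
  by (auto simp: Poly_Mapping.lookup_add intro!: poly_mapping_eqI)

lemma subspace_slices_in: "pm.subspace W \<Longrightarrow> pm.subspace (slices_in I W)"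
  by (auto simp: pm.subspace_def slices_in_def)

lemma fin_span_slices_in:
  assumes "finite X" "finite I" "W \<subseteq> supp_in X" shows "fin_span (slices_in I W)"
proof (rule fin_span_subset[OF fin_span_supp_in])
  show "finite (X \<times> I)" using assms by simp
  show "slices_in I W \<subseteq> supp_in (X \<times> I)"
  proof
    fix c assume c: "c \<in> slices_in I W"
    have "Poly_Mapping.lookup c (F, A) = 0" if "(F, A) \<notin> X \<times> I" for F A
    proof (cases "A \<in> I")
      case True
      then have "slice A c \<in> supp_in X" using c assms by (auto simp: slices_in_def)
      then have "Poly_Mapping.lookup (slice A c) F = 0" using True that unfolding supp_in_iff by blast
      then show ?thesis by simp
    next
      case False
      then have "slice A c = 0" using c by (auto simp: slices_in_def)
      then show ?thesis by (metis lookup_slice lookup_zero)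
    qed
    then show "c \<in> supp_in (X \<times> I)" by (auto simp: supp_in_iff)
  qed
qed

lemma dim_slices_in:
  fixes W :: "('a \<Rightarrow>\<^sub>0 'k::field) set" and I :: "'b set"
  assumes "finite X" "finite I" "pm.subspace W" "W \<subseteq> supp_in X"
  shows "pm.dim (slices_in I W) = card I * pm.dim W"
  using assms(2)
proof (induction I rule: finite_induct)
  case empty
  have "slices_in {} W = ({0} :: ('a \<times> 'b \<Rightarrow>\<^sub>0 'k) set)"
  proof (intro equalityI subsetI)
    fix c :: "'a \<times> 'b \<Rightarrow>\<^sub>0 'k" assume "c \<in> slices_in {} W"
    then have "slice A c = 0" for A by (auto simp: slices_in_def)
    then have "Poly_Mapping.lookup c (F, A) = 0" for F A by (metis lookup_slice lookup_zero)
    then show "c \<in> {0}" by (auto intro!: poly_mapping_eqI)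
  qed (auto simp: slices_in_def intro!: poly_mapping_eqI)
  then show ?case by simp
next
  case (insert A I)
  have f: "fin_span (slices_in (insert A I) W)"
    by (rule fin_span_slices_in[OF assms(1) _ assms(4)]) (use insert.hyps in simp)
  have "{c\<in>slices_in (insert A I) W. slice A c = 0} = slices_in I W"
    using insert.hyps pm.subspace_0[OF assms(3)] by (auto simp: slices_in_def)
  moreover have "slice A ` slices_in (insert A I) W = W"
  proof (intro equalityI subsetI)
    fix w assume w: "w \<in> W"
    define c where "c = (\<Sum>F\<in>Poly_Mapping.keys w. Poly_Mapping.single (F, A) (Poly_Mapping.lookup w F))"
    have l: "Poly_Mapping.lookup c (F, B) = (if B = A then Poly_Mapping.lookup w F else 0)" for F B
    proof -
      have "Poly_Mapping.lookup c (F, B) =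
          (\<Sum>G\<in>Poly_Mapping.keys w. if G = F then if B = A then Poly_Mapping.lookup w G else 0 else 0)"
        unfolding c_def Poly_Mapping.lookup_sum
        by (rule sum.cong) (auto simp: lookup_single when_def)
      then show ?thesis by (auto simp: sum.delta in_keys_iff)
    qed
    have "slice A c = w" by (rule poly_mapping_eqI) (simp add: l)
    moreover have "slice B c = 0" if "B \<noteq> A" for B
      using that by (intro poly_mapping_eqI) (simp add: l)
    moreover have "slice B c \<in> W" for B
      using calculation w pm.subspace_0[OF assms(3)] by (cases "B = A") simp_all
    ultimately have "c \<in> slices_in (insert A I) W" using w by (simp add: slices_in_def)
    then show "w \<in> slice A ` slices_in (insert A I) W" using \<open>slice A c = w\<close> by blast
  qed (auto simp: slices_in_def)
  ultimately show ?case
    using dim_kernel_image[OF pm_linear_slice subspace_slices_in[OF assms(3)] f, of A]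
      insert by simp
qed

section \<open>Pseudo-powers and the combinatorial number system\<close>

text \<open>
  Every number is uniquely \<open>rval m j\<close> for a strictly increasing \<open>m\<close> on \<open>{1..j}\<close>; the Macaulay
  representation is obtained by dropping the vanishing terms, which are those with \<open>m i = i - 1\<close>.
\<close>

definition rval :: "(nat \<Rightarrow> nat) \<Rightarrow> nat \<Rightarrow> nat" where
  "rval m j = (\<Sum>i=1..j. m i choose i)"

definition rup :: "(nat \<Rightarrow> nat) \<Rightarrow> nat \<Rightarrow> nat" where
  "rup m j = (\<Sum>i=1..j. (m i + 1) choose (i + 1))"

text \<open>The lower operation of Green's hyperplane restriction theorem, as \<open>rup\<close> is
  the upper one of Macaulay's theorem.\<close>

definition rdn :: "(nat \<Rightarrow> nat) \<Rightarrow> nat \<Rightarrow> nat" where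
  "rdn m j = (\<Sum>i=1..j. (m i - 1) choose i)"

definition incr :: "(nat \<Rightarrow> nat) \<Rightarrow> nat \<Rightarrow> bool" where
  "incr m j \<longleftrightarrow> (\<forall>i. 1 \<le> i \<and> i < j \<longrightarrow> m i < m (Suc i))"

lemma incr_Suc: "incr m (Suc j) \<Longrightarrow> incr m j"
  by (auto simp: incr_def)

lemma incr_less: "incr m j \<Longrightarrow> 1 \<le> i \<Longrightarrow> i < k \<Longrightarrow> k \<le> j \<Longrightarrow> m i < m k"
proof (induction k)
  case (Suc k)
  then have "m k < m (Suc k)" by (auto simp: incr_def)
  then show ?case using Suc by (cases "i = k") auto
qed simp

lemma incr_ge: "incr m j \<Longrightarrow> 1 \<le> i \<Longrightarrow> i \<le> j \<Longrightarrow> i - 1 \<le> m i"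
proof (induction i)
  case (Suc i)
  show ?case
  proof (cases "i = 0")
    case False
    then have "i - 1 \<le> m i" "m i < m (Suc i)" using Suc by (auto simp: incr_def)
    then show ?thesis using False by simp
  qed simp
qed simp

text \<open>Telescoping by Pascal's rule: the terms below the top one add up to less than
  \<open>m j choose (j - 1)\<close>. Hence the order of values is lexicographic from the top
  entry.\<close>

lemma rval_less: "incr m j \<Longrightarrow> 1 \<le> j \<Longrightarrow> rval m j < (m j + 1) choose j"
proof (induction j)
  case (Suc j)
  show ?case
  proof (cases "j = 0")
    case True
    then show ?thesis by (simp add: rval_def)
  next
    case False
    then have "rval m j < (m j + 1) choose j" using Suc incr_Suc by simp
    also have "\<dots> \<le> m (Suc j) choose j"
      by (rule binomial_right_mono) (use Suc.prems False in \<open>auto simp: incr_def Suc_le_eq\<close>)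
    finally show ?thesis by (simp add: rval_def)
  qed
qed simp

text \<open>The same telescoping, carrying along the slack \<open>m 1 + 1\<close> from the equality
  at \<open>j = 1\<close>. The slack later absorbs the lowest term in the step from Green's bound to
  Macaulay's.\<close>

lemma rup_less: "incr m j \<Longrightarrow> 1 \<le> j \<Longrightarrow> rup m j + m 1 + 1 \<le> (m j + 2) choose (j + 1)"
proof (induction j)
  case (Suc j)
  show ?case
  proof (cases "j = 0")
    case True
    then show ?thesis by (simp add: rup_def choose_two numeral_2_eq_2)
  next
    case False
    then have "rup m j + m 1 + 1 \<le> (m j + 2) choose (j + 1)" using Suc incr_Suc by simp
    also have "\<dots> \<le> (m (Suc j) + 1) choose (j + 1)"
      by (rule binomial_right_mono) (use Suc.prems False in \<open>auto simp: incr_def Suc_le_eq\<close>)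
    finally show ?thesis by (simp add: rup_def)
  qed
qed simp

lemma rdn_le: "incr m j \<Longrightarrow> 1 \<le> j \<Longrightarrow> rdn m j \<le> m j choose j"
proof (induction j)
  case (Suc j)
  show ?case
  proof (cases "j = 0")
    case True
    then show ?thesis by (simp add: rdn_def)
  next
    case False
    then have lt: "m j < m (Suc j)" using Suc.prems by (auto simp: incr_def)
    then obtain k where k: "m (Suc j) = Suc k" by (cases "m (Suc j)") auto
    have "rdn m j \<le> m j choose j" using Suc incr_Suc False by simp
    also have "\<dots> \<le> k choose j"
      by (rule binomial_right_mono) (use lt k in simp)
    finally show ?thesis by (simp add: rdn_def k)
  qed
qed simp

lemma rep_compare:
  assumes "incr m j" "incr m' j" "\<exists>i. 1 \<le> i \<and> i \<le> j \<and> m i \<noteq> m' i"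
  obtains i where "1 \<le> i" "i \<le> j" "m i \<noteq> m' i" "\<And>k. i < k \<Longrightarrow> k \<le> j \<Longrightarrow> m k = m' k"
proof -
  let ?S = "{i. 1 \<le> i \<and> i \<le> j \<and> m i \<noteq> m' i}"
  have "finite ?S" by (rule finite_subset[of _ "{..j}"]) auto
  moreover have "?S \<noteq> {}" using assms by auto
  ultimately have M: "Max ?S \<in> ?S" by (rule Max_in)
  have "m k = m' k" if "Max ?S < k" "k \<le> j" for k
    using Max_ge[OF \<open>finite ?S\<close>, of k] M that by fastforce
  then show ?thesis using that[of "Max ?S"] M by blast
qed

text \<open>The highest index of disagreement decides all three comparisons: the terms above it
  agree, and by the telescoping bounds the larger entry dominates everything at or below it.\<close>

lemma rep_split:
  assumes "1 \<le> i" "i \<le> j" "\<And>k. i < k \<Longrightarrow> k \<le> j \<Longrightarrow> m k = m' k" "m i < m' i"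
    and "incr m j" "incr m' j"
  shows "rval m j < rval m' j" "rup m j + m 1 + 1 \<le> rup m' j" "rdn m j \<le> rdn m' j"
proof -
  have inc: "incr m i" using assms by (auto simp: incr_def)
  have s: "(\<Sum>k=1..j. g k) = (\<Sum>k=1..i. g k) + (\<Sum>k\<in>{i<..j}. g k)" for g :: "nat \<Rightarrow> nat"
    using assms(1,2) by (subst sum.union_disjoint[symmetric]) (auto intro!: sum.cong)
  have e: "(\<Sum>k\<in>{i<..j}. g (m k) k) = (\<Sum>k\<in>{i<..j}. g (m' k) k)" for g :: "nat \<Rightarrow> nat \<Rightarrow> nat"
    by (rule sum.cong) (use assms in auto)
  have l: "g i \<le> (\<Sum>k=1..i. g k)" for g :: "nat \<Rightarrow> nat"
    using assms by (intro member_le_sum) auto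
  have "rval m i < (m i + 1) choose i" using rval_less inc assms by blast
  also have "\<dots> \<le> m' i choose i" by (rule binomial_right_mono) (use assms in simp)
  also have "\<dots> \<le> rval m' i" unfolding rval_def by (rule l)
  finally show "rval m j < rval m' j"
    using s e[of "\<lambda>a k. a choose k"] by (simp add: rval_def)
  have "rup m i + m 1 + 1 \<le> (m i + 2) choose (i + 1)" using rup_less inc assms by blast
  also have "\<dots> \<le> (m' i + 1) choose (i + 1)" by (rule binomial_right_mono) (use assms in simp)
  also have "\<dots> \<le> rup m' i" unfolding rup_def by (rule l)
  finally show "rup m j + m 1 + 1 \<le> rup m' j"
    using s e[of "\<lambda>a k. (a + 1) choose (k + 1)"] by (simp add: rup_def)
  have "rdn m i \<le> m i choose i" using rdn_le inc assms by blast
  also have "\<dots> \<le> (m' i - 1) choose i" by (rule binomial_right_mono) (use assms in simp)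
  also have "\<dots> \<le> rdn m' i" unfolding rdn_def by (rule l)
  finally show "rdn m j \<le> rdn m' j"
    using s e[of "\<lambda>a k. (a - 1) choose k"] by (simp add: rdn_def)
qed

lemma rep_eq_cong:
  assumes "\<And>i. 1 \<le> i \<Longrightarrow> i \<le> j \<Longrightarrow> m i = m' i"
  shows "rval m j = rval m' j" "rup m j = rup m' j" "rdn m j = rdn m' j"
  using assms by (auto simp: rval_def rup_def rdn_def)

lemma rep_cases:
  assumes "incr m j" "incr m' j"
  shows "(\<forall>i. 1 \<le> i \<and> i \<le> j \<longrightarrow> m i = m' i)
    \<or> (rval m j < rval m' j \<and> rup m j + m 1 + 1 \<le> rup m' j \<and> rdn m j \<le> rdn m' j)
    \<or> (rval m' j < rval m j \<and> rup m' j + m' 1 + 1 \<le> rup m j \<and> rdn m' j \<le> rdn m j)"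
proof (cases "\<exists>i. 1 \<le> i \<and> i \<le> j \<and> m i \<noteq> m' i")
  case True
  then obtain i where i: "1 \<le> i" "i \<le> j" "m i \<noteq> m' i" "\<And>k. i < k \<Longrightarrow> k \<le> j \<Longrightarrow> m k = m' k"
    using rep_compare[OF assms True] by metis
  then consider "m i < m' i" | "m' i < m i" by linarith
  then show ?thesis
  proof cases
    case 1
    then show ?thesis using rep_split[of i j m m'] i assms by auto
  next
    case 2
    then show ?thesis using rep_split[of i j m' m] i assms by auto
  qed
qed blast

lemma rep_mono:
  assumes "incr m j" "incr m' j" "rval m j \<le> rval m' j"
  shows "rup m j \<le> rup m' j" "rdn m j \<le> rdn m' j"
  using rep_cases[OF assms(1,2)] rep_eq_cong[of j m m'] assms(3) by auto

lemma rep_strict: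
  assumes "incr m j" "incr m' j" "rval m j < rval m' j"
  shows "rup m j + m 1 + 1 \<le> rup m' j"
  using rep_cases[OF assms(1,2)] rep_eq_cong[of j m m'] assms(3) by auto

lemma rep_exists: "1 \<le> j \<Longrightarrow> \<exists>m. incr m j \<and> rval m j = l"
proof (induction j arbitrary: l)
  case (Suc j)
  show ?case
  proof (cases "j = 0")
    case True
    then show ?thesis by (intro exI[of _ "\<lambda>_. l"]) (simp add: incr_def rval_def)
  next
    case False
    \<comment> \<open>A crude bound on the candidates, from \<open>M choose Suc j\<close> being at
      least \<open>M - j\<close>; it guarantees that a greatest one exists.\<close>
    have bd: "M \<le> l + Suc j" if "M choose Suc j \<le> l" for M
    proof (rule ccontr)
      assume *: "\<not> ?thesis"
      have "M - j \<le> M choose Suc j"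
      proof -
        have "(j + n) choose Suc j \<ge> n" for n
        proof (induction n)
          case (Suc n)
          have "(j + n) choose j > 0" by simp
          then have "Suc n \<le> ((j + n) choose j) + ((j + n) choose Suc j)" using Suc by linarith
          then show ?case by simp
        qed simp
        from this[of "M - j"] show ?thesis using * by simp
      qed
      then show False using that * by simp
    qed
    \<comment> \<open>Greedy top entry. By Pascal's rule its maximality leaves a remainder below
      \<open>M choose j\<close>, which keeps the entries strictly increasing.\<close>
    define M where "M = (GREATEST M. M choose Suc j \<le> l)"
    have M1: "M choose Suc j \<le> l" unfolding M_def
      by (rule GreatestI_nat[of _ 0 "l + Suc j"]) (use bd in auto)
    have M2: "\<not> (M + 1) choose Suc j \<le> l"
    proof
      assume "(M + 1) choose Suc j \<le> l"
      then have "M + 1 \<le> M" unfolding M_def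
        by (intro Greatest_le_nat[of _ _ "l + Suc j"]) (use bd in auto)
      then show False by simp
    qed
    obtain m where m: "incr m j" "rval m j = l - (M choose Suc j)" using Suc.IH False by fastforce
    have "m j choose j \<le> rval m j" unfolding rval_def using False by (intro member_le_sum) auto
    then have "m j choose j < M choose j" using m M1 M2 by simp
    then have lt: "m j < M" using binomial_right_mono[of M "m j" j] by (meson leD le_less_linear)
    define m' where "m' = m(Suc j := M)"
    have "incr m' (Suc j)" using m lt by (auto simp: incr_def m'_def less_Suc_eq)
    moreover have "rval m' (Suc j) = l"
    proof -
      have "rval m' j = rval m j" by (rule rep_eq_cong) (simp add: m'_def)
      moreover have "rval m' (Suc j) = rval m' j + (M choose Suc j)" by (simp add: rval_def m'_def)
      ultimately show ?thesis using m M1 by simp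
    qed
    ultimately show ?thesis by blast
  qed
qed simp

definition mrep :: "nat \<Rightarrow> nat \<Rightarrow> nat \<Rightarrow> nat" where
  "mrep j l = (SOME m. incr m j \<and> rval m j = l)"

lemma mrep: "1 \<le> j \<Longrightarrow> incr (mrep j l) j" "1 \<le> j \<Longrightarrow> rval (mrep j l) j = l"
  unfolding mrep_def using someI_ex[OF rep_exists, of j l] by auto

definition pdn :: "nat \<Rightarrow> nat \<Rightarrow> nat" where
  "pdn l j = rdn (mrep j l) j"

lemma macaulay_rep_imp:
  assumes "macaulay_rep l j s m"
  shows "\<exists>m'. incr m' j \<and> rval m' j = l \<and> rup m' j = (\<Sum>i=s..j. (m i + 1) choose (i + 1))"
proof -
  have s: "1 \<le> s" "s \<le> j" "s \<le> m s" "strict_mono_on {s..j} m" "l = (\<Sum>i=s..j. m i choose i)"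
    using assms by (auto simp: macaulay_rep_def)
  define m' where "m' i = (if i < s then i - 1 else m i)" for i
  have "incr m' j"
    unfolding incr_def
  proof (intro allI impI, elim conjE)
    fix i assume i: "1 \<le> i" "i < j"
    consider "Suc i < s" | "Suc i = s" | "s \<le> i" by linarith
    then show "m' i < m' (Suc i)"
      by cases (use i s strict_mono_onD[OF s(4), of i "Suc i"] in \<open>auto simp: m'_def\<close>)
  qed
  moreover have "(\<Sum>i=1..j. g (m' i) i) = (\<Sum>i=s..j. g (m i) i)"
    if "\<And>i. 1 \<le> i \<Longrightarrow> g (i - 1) i = 0" for g :: "nat \<Rightarrow> nat \<Rightarrow> nat"
  proof -
    have "(\<Sum>i=1..j. g (m' i) i) = (\<Sum>i\<in>{s..j}. g (m' i) i)"
      by (rule sum.mono_neutral_right) (use s that in \<open>auto simp: m'_def\<close>)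
    then show ?thesis by (simp add: m'_def)
  qed
  from this[of "\<lambda>a i. a choose i"] this[of "\<lambda>a i. (a + 1) choose (i + 1)"]
  have "rval m' j = l" "rup m' j = (\<Sum>i=s..j. (m i + 1) choose (i + 1))"
    by (auto simp: rval_def rup_def s binomial_eq_0)
  ultimately show ?thesis by blast
qed

lemma macaulay_rep_exists:
  assumes "1 \<le> j" "0 < l" "incr m j" "rval m j = l"
  shows "\<exists>s. macaulay_rep l j s m \<and> rup m j = (\<Sum>i=s..j. (m i + 1) choose (i + 1))"
proof -
  have "\<exists>i. 1 \<le> i \<and> i \<le> j \<and> i \<le> m i"
  proof (rule ccontr)
    assume *: "\<not> ?thesis"
    have "rval m j = 0" unfolding rval_def
      by (rule sum.neutral) (use * in \<open>force simp: binomial_eq_0_iff\<close>)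
    then show False using assms by simp
  qed
  define s where "s = (LEAST i. 1 \<le> i \<and> i \<le> j \<and> i \<le> m i)"
  have s: "1 \<le> s" "s \<le> j" "s \<le> m s" using LeastI_ex[OF \<open>\<exists>i. _ i\<close>] by (auto simp: s_def)
  have lt: "m i < i" if "1 \<le> i" "i < s" for i
    using not_less_Least[OF that(2)[unfolded s_def]] that s by simp
  have eq: "(\<Sum>i=1..j. g (m i) i) = (\<Sum>i=s..j. g (m i) i)"
    if "\<And>a i. a < i \<Longrightarrow> g a i = 0" for g :: "nat \<Rightarrow> nat \<Rightarrow> nat"
    by (rule sum.mono_neutral_right) (use s that lt in auto)
  have "strict_mono_on {s..j} m"
    using incr_less[OF assms(3)] s by (auto simp: strict_mono_on_def)
  moreover have "l = (\<Sum>i=s..j. m i choose i)"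
    using eq[of "\<lambda>a i. a choose i"] assms by (simp add: rval_def binomial_eq_0)
  moreover have "rup m j = (\<Sum>i=s..j. (m i + 1) choose (i + 1))"
    using eq[of "\<lambda>a i. (a + 1) choose (i + 1)"] by (simp add: rup_def binomial_eq_0)
  ultimately show ?thesis using s unfolding macaulay_rep_def by blast
qed

lemma pseudo_power_rval:
  assumes "1 \<le> j" "incr m j"
  shows "pseudo_power (rval m j) j = rup m j"
proof (cases "rval m j = 0")
  case True
  have "rup m j = 0" unfolding rup_def
  proof (rule sum.neutral, rule ballI)
    fix i assume "i \<in> {1..j}"
    then have "m i choose i = 0" using True by (simp add: rval_def)
    then show "(m i + 1) choose (i + 1) = 0" by (auto simp: binomial_eq_0_iff)
  qed
  then show ?thesis using True by (simp add: pseudo_power_def)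
next
  case False
  let ?P = "\<lambda>r. \<exists>s m'. macaulay_rep (rval m j) j s m' \<and> r = (\<Sum>i=s..j. (m' i + 1) choose (i + 1))"
  have "?P (rup m j)" using macaulay_rep_exists[OF assms(1) _ assms(2) refl] False by blast
  moreover have "r = rup m j" if "?P r" for r
  proof -
    from that obtain m' where "incr m' j" "rval m' j = rval m j" "rup m' j = r"
      using macaulay_rep_imp by blast
    then show ?thesis using rep_mono[of m j m'] rep_mono[of m' j m] assms by simp
  qed
  ultimately have "(THE r. ?P r) = rup m j" by (rule the_equality)
  then show ?thesis using False by (simp add: pseudo_power_def)
qed

lemma pdn_rval: "1 \<le> j \<Longrightarrow> incr m j \<Longrightarrow> pdn (rval m j) j = rdn m j"
  using rep_mono[of m j "mrep j (rval m j)"] rep_mono[of "mrep j (rval m j)" j m]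
    mrep[of j "rval m j"] by (simp add: pdn_def)

lemma pseudo_power_mono: "1 \<le> j \<Longrightarrow> l \<le> l' \<Longrightarrow> pseudo_power l j \<le> pseudo_power l' j"
  using pseudo_power_rval[of j "mrep j l"] pseudo_power_rval[of j "mrep j l'"]
    rep_mono[of "mrep j l" j "mrep j l'"] mrep[of j] by simp

lemma pdn_mono: "1 \<le> j \<Longrightarrow> l \<le> l' \<Longrightarrow> pdn l j \<le> pdn l' j"
  using rep_mono[of "mrep j l" j "mrep j l'"] mrep[of j] by (simp add: pdn_def)

section \<open>The arithmetic behind the bounds of Green and Macaulay\<close>

lemma pseudo_power_rdn:
  assumes "1 \<le> j" "incr m j"
  shows "pseudo_power (rdn m j) j = (\<Sum>i=1..j. m i choose (i + 1))"
proof -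
  \<comment> \<open>Every entry drops by one except the vanishing ones \<open>i - 1\<close>, which
    stay so that the sequence remains increasing.\<close>
  define m' where "m' i = (if i \<le> m i then m i - 1 else i - 1)" for i
  have ge: "i - 1 \<le> m i" if "1 \<le> i" "i \<le> j" for i using incr_ge assms that by blast
  have "incr m' j"
    unfolding incr_def
  proof (intro allI impI, elim conjE)
    fix i assume i: "1 \<le> i" "i < j"
    then have "m i < m (Suc i)" using assms by (auto simp: incr_def)
    then show "m' i < m' (Suc i)" using i ge[of i] by (auto simp: m'_def)
  qed
  moreover have "rval m' j = rdn m j"
    unfolding rval_def rdn_def
  proof (rule sum.cong)
    fix i assume "i \<in> {1..j}"
    then show "m' i choose i = (m i - 1) choose i" using ge[of i] by (auto simp: m'_def binomial_eq_0)
  qed simp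
  moreover have "rup m' j = (\<Sum>i=1..j. m i choose (i + 1))"
    unfolding rup_def
  proof (rule sum.cong)
    fix i assume "i \<in> {1..j}"
    then show "(m' i + 1) choose (i + 1) = m i choose (i + 1)"
      using ge[of i] by (cases "i \<le> m i") (auto simp: m'_def binomial_eq_0 simp del: binomial_Suc_Suc)
  qed simp
  ultimately show ?thesis using pseudo_power_rval[OF assms(1)] by metis
qed

text \<open>Pascal's rule termwise: \<open>a choose i\<close> minus \<open>(a - 1) choose i\<close>
  is \<open>(a - 1) choose (i - 1)\<close>, and shifting the index gives a representation of length
  \<open>j\<close>. The lowest term has no place there and contributes the extra 1 unless
  \<open>m 1 = 0\<close>.\<close>

lemma rval_minus_rdn:
  assumes "incr m (Suc j)"
  shows "rval m (Suc j) = rdn m (Suc j) + (if 1 \<le> m 1 then 1 else 0) + rval (\<lambda>k. m (Suc k) - 1) j"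
    and "incr (\<lambda>k. m (Suc k) - 1) j"
proof -
  have pos: "1 \<le> m (Suc k)" if "1 \<le> k" "k \<le> j" for k
    using incr_ge[OF assms, of "Suc k"] that by simp
  have sh: "(\<Sum>i=1..Suc j. g i) = g 1 + (\<Sum>k=1..j. g (Suc k))" for g :: "nat \<Rightarrow> nat"
    by (subst sum.atLeast_Suc_atMost) (simp_all add: sum.shift_bounds_cl_Suc_ivl del: sum.cl_ivl_Suc)
  have "(\<Sum>k=1..j. m (Suc k) choose Suc k) =
      (\<Sum>k=1..j. ((m (Suc k) - 1) choose Suc k) + ((m (Suc k) - 1) choose k))"
  proof (rule sum.cong)
    fix k assume "k \<in> {1..j}"
    then obtain a where "m (Suc k) = Suc a" using pos[of k] by (cases "m (Suc k)") auto
    then show "m (Suc k) choose Suc k = ((m (Suc k) - 1) choose Suc k) + ((m (Suc k) - 1) choose k)"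
      by simp
  qed simp
  then show "rval m (Suc j) = rdn m (Suc j) + (if 1 \<le> m 1 then 1 else 0) + rval (\<lambda>k. m (Suc k) - 1) j"
    unfolding rval_def rdn_def sh by (auto simp: sum.distrib)
  show "incr (\<lambda>k. m (Suc k) - 1) j"
    unfolding incr_def
  proof (intro allI impI, elim conjE)
    fix k assume k: "1 \<le> k" "k < j"
    then have "m (Suc k) < m (Suc (Suc k))" using assms by (auto simp: incr_def)
    then show "m (Suc k) - 1 < m (Suc (Suc k)) - 1" using pos[of k] k by simp
  qed
qed

text \<open>Arithmetic step of Green's induction: \<open>c\<close> counts all monomials,
  \<open>c'\<close> those without the last variable. If \<open>c'\<close> exceeded its bound,
  \<open>c - c'\<close> would be so small that the third assumption pushes \<open>c'\<close> below
  the bound.\<close>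

lemma pdn_le_of_recursion:
  assumes "1 \<le> j" "c' \<le> c" "c' \<le> pseudo_power (pdn (c - c') j) j"
  shows "c' \<le> pdn c (Suc j)"
proof (rule ccontr)
  define m where "m = mrep (Suc j) c"
  have m: "incr m (Suc j)" "rval m (Suc j) = c" using mrep[of "Suc j" c] by (auto simp: m_def)
  let ?n = "\<lambda>k. m (Suc k) - 1"
  note r = rval_minus_rdn[OF m(1)]
  assume "\<not> ?thesis"
  then have "rdn m (Suc j) < c'" by (simp add: pdn_def m_def)
  then have "c - c' \<le> rval ?n j" using r(1) m(2) assms(2) by (auto split: if_splits)
  then have "pdn (c - c') j \<le> rdn ?n j" using pdn_mono[OF assms(1)] pdn_rval[OF assms(1) r(2)] by metis
  then have "c' \<le> pseudo_power (rdn ?n j) j"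
    using assms pseudo_power_mono[OF assms(1)] order_trans by blast
  also have "\<dots> = (\<Sum>k=1..j. (m (Suc k) - 1) choose (Suc k))"
    using pseudo_power_rdn[OF assms(1) r(2)] by simp
  also have "\<dots> = (\<Sum>i=Suc 1..Suc j. (m i - 1) choose i)"
    by (simp add: sum.shift_bounds_cl_Suc_ivl del: sum.cl_ivl_Suc)
  also have "\<dots> \<le> rdn m (Suc j)" unfolding rdn_def by (rule sum_mono2) auto
  finally show False using \<open>rdn m (Suc j) < c'\<close> by simp
qed

text \<open>Arithmetic step from Green to Macaulay: of \<open>b\<close> monomials,
  \<open>pdn b (Suc j)\<close> bounds those without the last variable and \<open>a\<close> bounds
  the others.\<close>

lemma le_pseudo_power_of_le_pdn:
  assumes "1 \<le> j" "b \<le> pdn b (Suc j) + a"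
  shows "b \<le> pseudo_power a j"
proof -
  define m where "m = mrep (Suc j) b"
  have m: "incr m (Suc j)" "rval m (Suc j) = b" using mrep[of "Suc j" b] by (auto simp: m_def)
  let ?n = "\<lambda>k. m (Suc k) - 1"
  note r = rval_minus_rdn[OF m(1)]
  have le: "(if 1 \<le> m 1 then 1 else 0) + rval ?n j \<le> a" using assms r m by (simp add: pdn_def m_def)
  have n1: "m 1 < m 2" using m(1) assms(1) by (auto simp: incr_def numeral_2_eq_2)
  have "b = m 1 + (\<Sum>k=1..j. m (Suc k) choose Suc k)"
    unfolding m(2)[symmetric] rval_def
    by (subst sum.atLeast_Suc_atMost) (simp_all add: sum.shift_bounds_cl_Suc_ivl del: sum.cl_ivl_Suc)
  also have "(\<Sum>k=1..j. m (Suc k) choose Suc k) = rup ?n j"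
    unfolding rup_def
  proof (rule sum.cong)
    fix k assume "k \<in> {1..j}"
    then have "1 \<le> m (Suc k)" using incr_ge[OF m(1), of "Suc k"] by simp
    then show "m (Suc k) choose Suc k = (m (Suc k) - 1 + 1) choose (k + 1)" by simp
  qed simp
  finally have b: "b = m 1 + rup ?n j" .
  show ?thesis
  proof (cases "1 \<le> m 1")
    case True
    \<comment> \<open>One more unit of value raises \<open>rup\<close> by at least
      \<open>?n 1 + 1\<close>, which covers the leftover \<open>m 1\<close> because
      \<open>m 1 < m 2\<close>.\<close>
    let ?q = "mrep j (rval ?n j + 1)"
    have q: "incr ?q j" "rval ?q j = rval ?n j + 1" using mrep[OF assms(1)] by auto
    have "rup ?n j + ?n 1 + 1 \<le> rup ?q j" by (rule rep_strict) (use q r in auto)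
    then have "b \<le> rup ?q j" using b n1 by (simp add: numeral_2_eq_2)
    also have "\<dots> = pseudo_power (rval ?n j + 1) j" using pseudo_power_rval[OF assms(1) q(1)] q(2) by simp
    also have "\<dots> \<le> pseudo_power a j" by (rule pseudo_power_mono) (use le True assms in auto)
    finally show ?thesis .
  next
    case False
    then have "b = pseudo_power (rval ?n j) j" using b pseudo_power_rval[OF assms(1) r(2)] by simp
    also have "\<dots> \<le> pseudo_power a j" by (rule pseudo_power_mono) (use le assms in auto)
    finally show ?thesis .
  qed
qed

lemma pdn_one: "pdn c 1 = c - 1"
  using mrep[of 1 c] by (simp add: pdn_def rdn_def rval_def)

section \<open>Macaulay's bound for shadows of sets of monomials\<close>

text \<open>Monomials are represented by their exponent functions.\<close>

definition fdeg :: "('v::finite \<Rightarrow> nat) \<Rightarrow> nat" where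
  "fdeg f = (\<Sum>v\<in>UNIV. f v)"

definition inc :: "'v \<Rightarrow> ('v \<Rightarrow> nat) \<Rightarrow> ('v \<Rightarrow> nat)" where
  "inc v f = f(v := Suc (f v))"

lemma fdeg_upd: "fdeg (f(v := a)) + f v = fdeg f + a"
proof -
  have "fdeg g = g v + (\<Sum>u\<in>UNIV - {v}. g u)" for g :: "'a \<Rightarrow> nat"
    unfolding fdeg_def by (rule sum.remove) auto
  moreover have "(\<Sum>u\<in>UNIV - {v}. (f(v := a)) u) = (\<Sum>u\<in>UNIV - {v}. f u)"
    by (rule sum.cong) auto
  ultimately show ?thesis by (metis (no_types, lifting) add.commute add.left_commute fun_upd_same)
qed

lemma fdeg_inc [simp]: "fdeg (inc v f) = Suc (fdeg f)"
  using fdeg_upd[of f v "Suc (f v)"] by (simp add: inc_def)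

lemma inc_commute: "inc u (inc v f) = inc v (inc u f)"
  by (auto simp: inc_def fun_eq_iff)

lemma inc_inj: "inc v f = inc v g \<longleftrightarrow> f = g"
  by (auto simp: inc_def fun_eq_iff)

lemma le_fdeg: "f v \<le> fdeg f"
  unfolding fdeg_def by (rule member_le_sum) auto

lemma finite_fdeg: "finite {f :: 'v::finite \<Rightarrow> nat. fdeg f = n}"
proof -
  have "{f :: 'v \<Rightarrow> nat. fdeg f = n} \<subseteq> UNIV \<rightarrow>\<^sub>E {..n}" using le_fdeg by (auto simp: PiE_def extensional_def)
  then show ?thesis by (rule finite_subset) (rule finite_PiE, auto)
qed

text \<open>\<open>B\<close> is meant as the set of monomials outside an ideal, so exchanges go to
  later variables; its complement is then closed under exchanges for earlier ones.\<close>

definition stable_on :: "'v::linorder set \<Rightarrow> ('v \<Rightarrow> nat) set \<Rightarrow> bool" where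
  "stable_on V B \<longleftrightarrow> (\<forall>f i k. i \<in> V \<longrightarrow> k \<in> V \<longrightarrow> i < k \<longrightarrow> inc i f \<in> B \<longrightarrow> inc k f \<in> B)"

definition supported_on :: "'v set \<Rightarrow> ('v \<Rightarrow> nat) set \<Rightarrow> bool" where
  "supported_on V B \<longleftrightarrow> (\<forall>f\<in>B. \<forall>v. v \<notin> V \<longrightarrow> f v = 0)"

lemma card_split_inc:
  fixes B :: "('v \<Rightarrow> nat) set"
  assumes "finite B"
  shows "card B = card {f\<in>B. f m = 0} + card {u. inc m u \<in> B}" and "finite {u. inc m u \<in> B}"
proof -
  have im: "inc m ` {u. inc m u \<in> B} = {f\<in>B. f m \<noteq> 0}"
  proof (intro equalityI subsetI)
    fix f assume f: "f \<in> {f\<in>B. f m \<noteq> 0}"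
    then have "f = inc m (f(m := f m - 1))" by (auto simp: inc_def)
    then show "f \<in> inc m ` {u. inc m u \<in> B}" using f by (metis (mono_tags, lifting) image_eqI mem_Collect_eq)
  qed (auto simp: inc_def)
  have inj: "inj_on (inc m) {u. inc m u \<in> B}" by (auto simp: inj_on_def inc_inj)
  show "finite {u. inc m u \<in> B}" using inj im assms by (metis (no_types, lifting) finite_imageD finite_subset mem_Collect_eq subsetI)
  have "card {u. inc m u \<in> B} = card {f\<in>B. f m \<noteq> 0}" using card_image[OF inj] im by simp
  moreover have "card B = card ({f\<in>B. f m = 0} \<union> {f\<in>B. f m \<noteq> 0})" by (rule arg_cong[of _ _ card]) auto
  moreover have "\<dots> = card {f\<in>B. f m = 0} + card {f\<in>B. f m \<noteq> 0}"
    by (rule card_Un_disjoint) (use assms in auto)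
  ultimately show "card B = card {f\<in>B. f m = 0} + card {u. inc m u \<in> B}" by simp
qed

text \<open>Division by the variable \<open>m\<close> embeds the elements of \<open>B\<close> that
  contain it into \<open>A\<close>; the remaining ones are bounded by the last assumption.\<close>

lemma card_no_last_le_imp_shadow_bound:
  fixes B A :: "('v::{finite,linorder} \<Rightarrow> nat) set"
  assumes "1 \<le> j" "finite A" "finite B" "\<And>f v. inc v f \<in> B \<Longrightarrow> f \<in> A"
    and "card {f\<in>B. f m = 0} \<le> pdn (card B) (Suc j)"
  shows "card B \<le> pseudo_power (card A) j"
proof (rule le_pseudo_power_of_le_pdn[OF assms(1)])
  have "card {u. inc m u \<in> B} \<le> card A" by (rule card_mono) (use assms in auto)
  then show "card B \<le> pdn (card B) (Suc j) + card A"
    using card_split_inc(1)[OF assms(3), of m] assms(5) by simp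
qed

lemma fdeg_pos_in_support: "supported_on V B \<Longrightarrow> f \<in> B \<Longrightarrow> 0 < fdeg f \<Longrightarrow> \<exists>v\<in>V. 0 < f v"
  unfolding fdeg_def supported_on_def by (metis gr_zeroI sum.neutral less_irrefl)

text \<open>
  Green's hyperplane restriction bound for stable sets, the last variable playing the role of the
  general linear form.
\<close>

lemma card_no_last_le:
  fixes B :: "('v::{finite,linorder} \<Rightarrow> nat) set"
  assumes "V \<noteq> {}" "1 \<le> j" "\<And>f. f \<in> B \<Longrightarrow> fdeg f = j" "supported_on V B" "stable_on V B"
  shows "card {f\<in>B. f (Max V) = 0} \<le> pdn (card B) j"
  using assms
proof (induction "card V" arbitrary: V j B rule: less_induct)
  case less
  note outer = less.hyps
  define m where "m = Max V"
  have mV: "m \<in> V" "\<And>v. v \<in> V \<Longrightarrow> v \<le> m" unfolding m_def using less.prems(1) by auto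
  \<comment> \<open>Inner induction on the degree. The outer one, on the number of variables,
    supplies Green's bound for the elements without \<open>m\<close>.\<close>
  have "card {f\<in>B. f m = 0} \<le> pdn (card B) j"
    using less.prems(2-)
  proof (induction j arbitrary: B rule: nat_induct_at_least)
    case base
    have fB: "finite B" by (rule finite_subset[OF _ finite_fdeg[of 1]]) (use base in auto)
    show ?case
    proof (cases "B = {}")
      case False
      then obtain f where f: "f \<in> B" by blast
      then obtain i where i: "i \<in> V" "0 < f i"
        using fdeg_pos_in_support[OF base(2) f] base(1)[OF f] by auto
      have "f = inc i (f(i := f i - 1))" using i by (auto simp: inc_def)
      then have "inc i (f(i := f i - 1)) \<in> B" using f by simp
      then have "inc m (f(i := f i - 1)) \<in> B"
        using base(3) i(1) mV(1) mV(2)[OF i(1)] unfolding stable_on_def by (cases "i = m") auto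
      moreover have "inc m (f(i := f i - 1)) m \<noteq> 0" by (simp add: inc_def)
      ultimately obtain g where g: "g \<in> B" "g m \<noteq> 0" by (rule that)
      then have "{f\<in>B. f m = 0} \<subseteq> B - {g}" by auto
      then have "card {f\<in>B. f m = 0} \<le> card (B - {g})" using fB by (intro card_mono) auto
      then show ?thesis using g(1) by (simp add: pdn_one[simplified])
    qed simp
  next
    case (Suc j)
    have fB: "finite B" by (rule finite_subset[OF _ finite_fdeg[of "Suc j"]]) (use Suc in auto)
    let ?B0 = "{f\<in>B. f m = 0}" and ?B1 = "{u. inc m u \<in> B}"
    have c: "card B = card ?B0 + card ?B1" "finite ?B1" using card_split_inc[OF fB] by auto
    have "card {u\<in>?B1. u m = 0} \<le> pdn (card ?B1) j"
    proof (rule Suc.IH)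
      show "fdeg f = j" if "f \<in> ?B1" for f using that Suc.prems(1)[of "inc m f"] by simp
      show "supported_on V ?B1" unfolding supported_on_def
      proof (intro ballI allI impI)
        fix f v assume "f \<in> ?B1" "v \<notin> V"
        then have "inc m f v = 0" "v \<noteq> m" using Suc.prems(2) mV(1) by (auto simp: supported_on_def)
        then show "f v = 0" by (simp add: inc_def)
      qed
      show "stable_on V ?B1" using Suc.prems(3) unfolding stable_on_def
        by (simp add: inc_commute[of m])
    qed
    \<comment> \<open>By stability, dividing an element of \<open>?B0\<close> by any of its
      variables and multiplying by \<open>m\<close> stays in \<open>B\<close>. So the quotients of
      \<open>?B0\<close> lie in the part of \<open>?B1\<close> without \<open>m\<close>, and Green's
      bound in one variable less yields Macaulay's bound for \<open>?B0\<close>.\<close>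
    moreover have "card ?B0 \<le> pseudo_power (card {u\<in>?B1. u m = 0}) j"
    proof (cases "V - {m} = {}")
      case True
      have "?B0 = {}"
      proof (rule ccontr)
        assume "?B0 \<noteq> {}"
        then obtain f where f: "f \<in> B" "f m = 0" by blast
        then obtain v where "v \<in> V" "0 < f v"
          using fdeg_pos_in_support[OF Suc.prems(2) f(1)] Suc.prems(1)[OF f(1)] by auto
        then show False using f True by auto
      qed
      then show ?thesis by (simp only: card.empty)
    next
      case False
      show ?thesis
      proof (rule card_no_last_le_imp_shadow_bound[where m = "Max (V - {m})"])
        show "card {f \<in> ?B0. f (Max (V - {m})) = 0} \<le> pdn (card ?B0) (Suc j)"
        proof (rule outer)
          show "card (V - {m}) < card V" using mV(1) by (intro psubset_card_mono) auto
          show "supported_on (V - {m}) ?B0" using Suc.prems(2) by (auto simp: supported_on_def)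
          show "stable_on (V - {m}) ?B0"
            using Suc.prems(3) by (auto simp: stable_on_def inc_def)
        qed (use False Suc.prems in auto)
        fix f v assume f: "inc v f \<in> ?B0"
        then have "v \<noteq> m" "f m = 0" by (auto simp: inc_def split: if_splits)
        moreover have "v \<in> V"
        proof (rule ccontr)
          assume "v \<notin> V"
          then have "inc v f v = 0" using f Suc.prems(2) by (auto simp: supported_on_def)
          then show False by (simp add: inc_def)
        qed
        ultimately have "inc m f \<in> B"
          using Suc.prems(3) f mV(1) mV(2)[of v] unfolding stable_on_def by auto
        then show "f \<in> {u\<in>?B1. u m = 0}" using \<open>f m = 0\<close> by simp
      qed (use Suc c fB in auto)
    qed
    ultimately have "card ?B0 \<le> pseudo_power (pdn (card B - card ?B0) j) j"
      using c(1) pseudo_power_mono[OF Suc.hyps(1)] by (simp add: order_trans)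
    then show ?case using pdn_le_of_recursion[of j "card ?B0" "card B"] c Suc.hyps by simp
  qed
  then show ?case by (simp add: m_def)
qed

text \<open>Measures the effect of compression on one line: replacing the exponents that occur by an
  initial segment lowers their sum.\<close>

lemma sum_ge_initial_segment:
  fixes T :: "nat set"
  assumes "finite T"
  shows "\<Sum>{..<card T} \<le> \<Sum>T" and "T \<noteq> {..<card T} \<Longrightarrow> \<Sum>{..<card T} < \<Sum>T"
proof -
  let ?c = "card T" and ?I = "{..<card T}"
  have sT: "\<Sum>T = \<Sum>(T \<inter> ?I) + \<Sum>(T - ?I)" using assms by (metis sum.Int_Diff)
  have sI: "\<Sum>?I = \<Sum>(T \<inter> ?I) + \<Sum>(?I - T)" by (metis finite_lessThan inf_commute sum.Int_Diff)
  have "card T = card (T \<inter> ?I) + card (T - ?I)"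
    using assms by (metis card_Diff_subset_Int card_Int_Diff)
  moreover have "card ?I = card (T \<inter> ?I) + card (?I - T)" by (metis card_Int_Diff finite_lessThan inf_commute)
  ultimately have c: "card (T - ?I) = card (?I - T)" by simp
  have 1: "card (T - ?I) * ?c \<le> \<Sum>(T - ?I)"
    using sum_bounded_below[of "T - ?I" ?c "\<lambda>x. x"] by simp
  have 2: "\<Sum>(?I - T) + card (?I - T) \<le> card (?I - T) * ?c"
    using sum_bounded_above[of "?I - T" Suc ?c] sum.distrib[of "\<lambda>x. x" "\<lambda>_. 1" "?I - T"] by simp
  show "\<Sum>?I \<le> \<Sum>T" using 1 2 sT sI c by simp
  show "\<Sum>?I < \<Sum>T" if "T \<noteq> ?I"
  proof -
    have "T - ?I \<noteq> {}"
    proof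
      assume "T - ?I = {}"
      then have "T \<subseteq> ?I" by blast
      then show False using that card_subset_eq[of ?I T] by simp
    qed
    then have "card (T - ?I) > 0" using assms by (simp add: card_gt_0_iff)
    then show ?thesis using 1 2 sT sI c by simp
  qed
qed

subsection \<open>Shifting\<close>

context
  fixes i k :: "'v::{finite,linorder}"
  assumes ik: "i < k"
begin

text \<open>A line consists of the exponent functions that agree off \<open>i, k\<close> and have the same degree.\<close>

definition line_rep :: "('v \<Rightarrow> nat) \<Rightarrow> ('v \<Rightarrow> nat)" where
  "line_rep f = f(i := 0, k := f i + f k)"

definition on_line :: "('v \<Rightarrow> nat) \<Rightarrow> nat \<Rightarrow> ('v \<Rightarrow> nat)" where
  "on_line r a = r(i := a, k := r k - a)"

definition line_set :: "('v \<Rightarrow> nat) set \<Rightarrow> ('v \<Rightarrow> nat) \<Rightarrow> nat set" where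
  "line_set B r = {a. a \<le> r k \<and> on_line r a \<in> B}"

text \<open>Compression along lines: the exponents of \<open>i\<close> that occur on a line become
  an initial segment of the same size, so degree moves from \<open>i\<close> to the later variable
  \<open>k\<close>.\<close>

definition shift :: "('v \<Rightarrow> nat) set \<Rightarrow> ('v \<Rightarrow> nat) set" where
  "shift B = {f. f i < card (line_set B (line_rep f))}"

lemma ik': "i \<noteq> k" "k \<noteq> i" using ik by auto

lemma line_rep_simps: "line_rep f i = 0" "line_rep f k = f i + f k" "v \<noteq> i \<Longrightarrow> v \<noteq> k \<Longrightarrow> line_rep f v = f v"
  using ik' by (auto simp: line_rep_def)

lemma on_line_rep: "on_line (line_rep f) (f i) = f"
  using ik' by (auto simp: on_line_def line_rep_def fun_eq_iff)

lemma line_rep_on_line: "r i = 0 \<Longrightarrow> a \<le> r k \<Longrightarrow> line_rep (on_line r a) = r"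
  using ik' by (auto simp: on_line_def line_rep_def fun_eq_iff)

lemma on_line_i: "on_line r a i = a"
  using ik' by (simp add: on_line_def)

lemma finite_line_set: "finite (line_set B r)"
  by (rule finite_subset[of _ "{..r k}"]) (auto simp: line_set_def)

lemma card_line_set_le: "card (line_set B r) \<le> Suc (r k)"
  using card_mono[of "{..r k}" "line_set B r"] by (auto simp: line_set_def)

lemma fdeg_line_rep: "fdeg (line_rep f) = fdeg f"
  using fdeg_upd[of f i 0] fdeg_upd[of "f(i := 0)" k "f i + f k"] ik' by (simp add: line_rep_def)

lemma fdeg_on_line: "r i = 0 \<Longrightarrow> a \<le> r k \<Longrightarrow> fdeg (on_line r a) = fdeg r"
  by (metis fdeg_line_rep line_rep_on_line)

lemma shift_fdeg:
  assumes "\<And>f. f \<in> B \<Longrightarrow> fdeg f = n" "f \<in> shift B" shows "fdeg f = n"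
proof -
  have "line_set B (line_rep f) \<noteq> {}" using assms(2) by (auto simp: shift_def)
  then obtain a where "a \<le> line_rep f k" "on_line (line_rep f) a \<in> B" by (auto simp: line_set_def)
  then show ?thesis using assms(1) fdeg_on_line[of "line_rep f" a] fdeg_line_rep line_rep_simps(1) by metis
qed

lemma fibre_eq:
  assumes "r i = 0"
  shows "{f\<in>B. line_rep f = r} = on_line r ` line_set B r"
    and "{f\<in>shift B. line_rep f = r} = on_line r ` {..<card (line_set B r)}"
proof -
  show "{f\<in>B. line_rep f = r} = on_line r ` line_set B r"
  proof (intro equalityI subsetI)
    fix f assume f: "f \<in> {f\<in>B. line_rep f = r}"
    then have "on_line r (f i) = f" "f i \<le> r k" using on_line_rep[of f] line_rep_simps(2)[of f] by auto
    then show "f \<in> on_line r ` line_set B r" using f by (force simp: line_set_def)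
  qed (use assms line_rep_on_line in \<open>auto simp: line_set_def\<close>)
  show "{f\<in>shift B. line_rep f = r} = on_line r ` {..<card (line_set B r)}"
  proof (intro equalityI subsetI)
    fix f assume f: "f \<in> {f\<in>shift B. line_rep f = r}"
    then have "on_line r (f i) = f" using on_line_rep[of f] by auto
    then show "f \<in> on_line r ` {..<card (line_set B r)}" using f by (force simp: shift_def)
  next
    fix f assume "f \<in> on_line r ` {..<card (line_set B r)}"
    then obtain a where a: "a < card (line_set B r)" "f = on_line r a" by auto
    then have "a \<le> r k" using card_line_set_le[of B r] by simp
    then show "f \<in> {f\<in>shift B. line_rep f = r}"
      using a line_rep_on_line assms by (simp add: shift_def on_line_i)
  qed
qed

lemma sum_fibres:
  fixes h :: "('v \<Rightarrow> nat) \<Rightarrow> nat"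
  assumes "finite B" "\<And>f. f \<in> B \<Longrightarrow> fdeg f = n"
  shows "sum h B = (\<Sum>r\<in>{r. fdeg r = n \<and> r i = 0}. \<Sum>a\<in>line_set B r. h (on_line r a))"
    and "sum h (shift B) = (\<Sum>r\<in>{r. fdeg r = n \<and> r i = 0}. \<Sum>a<card (line_set B r). h (on_line r a))"
    and "finite (shift B)"
proof -
  let ?R = "{r :: 'v \<Rightarrow> nat. fdeg r = n \<and> r i = 0}"
  have fR: "finite ?R" by (rule finite_subset[OF _ finite_fdeg[of n]]) auto
  show fs: "finite (shift B)"
    by (rule finite_subset[OF _ finite_fdeg[of n]]) (use shift_fdeg[OF assms(2)] in auto)
  have inj: "inj_on (on_line r) X" for r X
    by (rule inj_onI) (metis on_line_i)
  have "sum h B = (\<Sum>r\<in>?R. sum h {f\<in>B. line_rep f = r})"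
    by (rule sum.group[symmetric, OF assms(1) fR]) (use assms fdeg_line_rep line_rep_simps(1) in auto)
  then show "sum h B = (\<Sum>r\<in>?R. \<Sum>a\<in>line_set B r. h (on_line r a))"
    by (simp add: fibre_eq sum.reindex[OF inj])
  have "sum h (shift B) = (\<Sum>r\<in>?R. sum h {f\<in>shift B. line_rep f = r})"
    by (rule sum.group[symmetric, OF fs fR])
      (use shift_fdeg[OF assms(2)] fdeg_line_rep line_rep_simps(1) in auto)
  then show "sum h (shift B) = (\<Sum>r\<in>?R. \<Sum>a<card (line_set B r). h (on_line r a))"
    by (simp add: fibre_eq(2) sum.reindex[OF inj])
qed

lemma card_shift:
  assumes "finite B" "\<And>f. f \<in> B \<Longrightarrow> fdeg f = n"
  shows "card (shift B) = card B"
  using sum_fibres(1,2)[OF assms, of "\<lambda>_. 1"] by simp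

text \<open>A variable other than \<open>i\<close> and \<open>k\<close> carries lines to lines and
  keeps the exponent of \<open>i\<close>. For \<open>i\<close> and \<open>k\<close> a single line
  matters: division turns the exponent set \<open>?T\<close> into \<open>?T\<close> together with
  \<open>?T\<close> lowered by one, and inside \<open>{..?e}\<close> this has at least
  \<open>min (card ?T) (Suc ?e)\<close> elements.\<close>

lemma shadow_shift:
  assumes cl: "\<And>f v. inc v f \<in> B \<Longrightarrow> f \<in> A" and f: "inc l f \<in> shift B"
  shows "f \<in> shift A"
proof -
  let ?r = "line_rep f"
  show ?thesis
  proof (cases "l = i \<or> l = k")
    case False
    have r: "line_rep (inc l f) = inc l ?r" "(inc l f) i = f i"
      using False by (auto simp: line_rep_def inc_def fun_eq_iff)
    have "on_line (inc l ?r) a = inc l (on_line ?r a)" for a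
      using False by (auto simp: on_line_def inc_def fun_eq_iff)
    then have "line_set B (inc l ?r) \<subseteq> line_set A ?r"
      using cl False by (auto simp: line_set_def inc_def)
    then have "card (line_set B (inc l ?r)) \<le> card (line_set A ?r)"
      by (intro card_mono finite_line_set)
    then show ?thesis using f r by (simp add: shift_def)
  next
    case True
    have r: "line_rep (inc l f) = inc k ?r"
      using True ik' by (auto simp: line_rep_def inc_def fun_eq_iff)
    let ?T = "line_set B (inc k ?r)" and ?e = "?r k"
    have T: "?T \<subseteq> {..Suc ?e}" by (auto simp: line_set_def inc_def)
    let ?X = "{a. a \<le> ?e \<and> (a \<in> ?T \<or> Suc a \<in> ?T)}"
    have "on_line (inc k ?r) a = inc k (on_line ?r a)" if "a \<le> ?e" for a
      using that ik' by (auto simp: on_line_def inc_def fun_eq_iff)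
    moreover have "on_line (inc k ?r) (Suc a) = inc i (on_line ?r a)" if "a \<le> ?e" for a
      using that ik' by (auto simp: on_line_def inc_def fun_eq_iff)
    ultimately have "?X \<subseteq> line_set A ?r" using cl by (auto simp: line_set_def)
    then have XA: "card ?X \<le> card (line_set A ?r)" by (intro card_mono finite_line_set)
    have "min (card ?T) (Suc ?e) \<le> card ?X"
    proof (cases "{..Suc ?e} \<subseteq> ?T")
      case True
      then have "?X = {..?e}" by auto
      then show ?thesis by simp
    next
      case False
      then obtain m where m: "m \<le> Suc ?e" "m \<notin> ?T" by auto
      \<comment> \<open>Exponents below the missing value \<open>m\<close> are kept and those above
        are lowered by one; no two of them collide.\<close>
      let ?g = "\<lambda>a. if a < m then a else a - 1"
      have gt: "a < m \<or> (m < a \<and> a \<noteq> 0)" if "a \<in> ?T" for a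
        using that m by (metis gr_implies_not0 linorder_neqE_nat)
      have "card ?T \<le> card ?X"
      proof (rule card_inj_on_le[of ?g])
        show "inj_on ?g ?T"
        proof (rule inj_onI)
          fix a b assume "a \<in> ?T" "b \<in> ?T" "?g a = ?g b"
          then show "a = b" using gt[of a] gt[of b] by (auto split: if_splits)
        qed
        show "?g ` ?T \<subseteq> ?X"
        proof (rule image_subsetI)
          fix a assume a: "a \<in> ?T"
          then have "a \<le> Suc ?e" using T by auto
          then show "?g a \<in> ?X" using a gt[OF a] m(1) by auto
        qed
        show "finite ?X" by simp
      qed
      then show ?thesis by simp
    qed
    moreover have "f i < min (card ?T) (Suc ?e)"
    proof -
      have "(inc l f) i < card ?T" using f r by (simp add: shift_def)
      moreover have "f i \<le> (inc l f) i" by (simp add: inc_def)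
      ultimately show ?thesis by (simp add: line_rep_simps)
    qed
    ultimately have "f i < card (line_set A ?r)" using XA by (meson less_le_trans)
    then show ?thesis by (simp add: shift_def)
  qed
qed

text \<open>A potential that decreases when a factor moves to a later variable; it makes repeated
  compression terminate.\<close>

definition weight :: "('v \<Rightarrow> nat) \<Rightarrow> nat" where
  "weight f = (\<Sum>v\<in>UNIV. f v * card {u. v < u})"

lemma weight_on_line:
  assumes "r i = 0" "a \<le> r k"
  shows "weight (on_line r a) = weight r + a * (card {u. i < u} - card {u. k < u})"
proof -
  let ?c = "\<lambda>v. card {u. v < u}"
  have "?c k < ?c i" by (rule psubset_card_mono) (use ik in auto)
  have s: "(\<Sum>v\<in>UNIV. g v) = g i + (g k + (\<Sum>v\<in>UNIV - {i} - {k}. g v))" for g :: "'v \<Rightarrow> nat"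
    using ik' by (subst sum.remove[of _ i]; simp) (subst sum.remove[of _ k]; simp)
  have "(\<Sum>v\<in>UNIV - {i} - {k}. on_line r a v * ?c v) = (\<Sum>v\<in>UNIV - {i} - {k}. r v * ?c v)"
    by (rule sum.cong) (auto simp: on_line_def)
  moreover have "on_line r a i = a" "on_line r a k = r k - a" using ik' by (auto simp: on_line_def)
  ultimately have "weight (on_line r a) + r k * ?c k = weight r + (a * ?c i + (r k - a) * ?c k)"
    unfolding weight_def s using assms by simp
  moreover have "r k * ?c k = (r k - a) * ?c k + a * ?c k"
    using assms by (metis add_mult_distrib le_add_diff_inverse2)
  moreover have "a * (?c i - ?c k) + a * ?c k = a * ?c i"
    using \<open>?c k < ?c i\<close> by (simp flip: distrib_left)
  ultimately show ?thesis by linarith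
qed

lemma weight_shift_less:
  assumes "finite B" "\<And>f. f \<in> B \<Longrightarrow> fdeg f = n" "inc i f \<in> B" "inc k f \<notin> B"
  shows "sum weight (shift B) < sum weight B"
proof -
  let ?R = "{r :: 'v \<Rightarrow> nat. fdeg r = n \<and> r i = 0}"
  let ?d = "card {u. i < u} - card {u. k < u}"
  have d: "0 < ?d" using psubset_card_mono[of "{u. i < u}" "{u. k < u}"] ik by force
  have w: "(\<Sum>a\<in>X. weight (on_line r a)) = card X * weight r + \<Sum>X * ?d"
    if "r i = 0" "X \<subseteq> {..r k}" for r X
  proof -
    have "(\<Sum>a\<in>X. weight (on_line r a)) = (\<Sum>a\<in>X. weight r + a * ?d)"
      by (rule sum.cong) (use that weight_on_line in auto)
    then show ?thesis by (simp add: sum.distrib sum_distrib_right)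
  qed
  have w1: "(\<Sum>a\<in>line_set B r. weight (on_line r a)) =
      card (line_set B r) * weight r + \<Sum>(line_set B r) * ?d" if "r i = 0" for r
    by (rule w) (use that in \<open>auto simp: line_set_def\<close>)
  have w2: "(\<Sum>a<card (line_set B r). weight (on_line r a)) =
      card (line_set B r) * weight r + \<Sum>{..<card (line_set B r)} * ?d" if "r i = 0" for r
  proof -
    have "{..<card (line_set B r)} \<subseteq> {..r k}" using card_line_set_le[of B r] by fastforce
    then show ?thesis using w[of r "{..<card (line_set B r)}"] that by simp
  qed
  show ?thesis
    unfolding sum_fibres(1,2)[OF assms(1,2), of weight, simplified]
  proof (rule sum_strict_mono_ex1)
    show "finite ?R" by (rule finite_subset[OF _ finite_fdeg[of n]]) auto
    show "\<forall>r\<in>?R. (\<Sum>a<card (line_set B r). weight (on_line r a)) \<le> (\<Sum>a\<in>line_set B r. weight (on_line r a))"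
      using w1 w2 sum_ge_initial_segment(1)[OF finite_line_set] by simp
    \<comment> \<open>The line on which the exchange fails contains \<open>Suc (f i)\<close> but not
      \<open>f i\<close>; it is no initial segment, so its sum drops strictly.\<close>
    let ?r = "line_rep (inc i f)"
    have on: "on_line ?r (Suc (f i)) = inc i f" "on_line ?r (f i) = inc k f"
      using on_line_rep[of "inc i f"] ik' by (auto simp: on_line_def line_rep_def inc_def fun_eq_iff)
    have "Suc (f i) \<in> line_set B ?r" "f i \<notin> line_set B ?r"
      using assms(3,4) on by (auto simp: line_set_def line_rep_simps inc_def)
    then have "line_set B ?r \<noteq> {..<card (line_set B ?r)}" by (metis Suc_lessD lessThan_iff)
    then have "\<Sum>{..<card (line_set B ?r)} < \<Sum>(line_set B ?r)"
      by (rule sum_ge_initial_segment(2)[OF finite_line_set])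
    then have "(\<Sum>a<card (line_set B ?r). weight (on_line ?r a)) < (\<Sum>a\<in>line_set B ?r. weight (on_line ?r a))"
      using w1[of ?r] w2[of ?r] d line_rep_simps(1) by simp
    moreover have "?r \<in> ?R" using assms(2)[OF assms(3)] fdeg_line_rep line_rep_simps(1) by simp
    ultimately show "\<exists>r\<in>?R. (\<Sum>a<card (line_set B r). weight (on_line r a)) < (\<Sum>a\<in>line_set B r. weight (on_line r a))"
      by blast
  qed
qed

end

text \<open>As long as \<open>B\<close> is not stable some compression lowers the weight; both
  cardinalities and the shadow condition survive it. For stable \<open>B\<close> Green's bound
  applies.\<close>

theorem card_le_pseudo_power_of_shadow:
  fixes A B :: "('v::{finite,linorder} \<Rightarrow> nat) set"
  assumes "1 \<le> j" "\<And>f. f \<in> A \<Longrightarrow> fdeg f = j" "\<And>f. f \<in> B \<Longrightarrow> fdeg f = Suc j"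
    and "\<And>f v. inc v f \<in> B \<Longrightarrow> f \<in> A"
  shows "card B \<le> pseudo_power (card A) j"
  using assms(2-)
proof (induction "sum weight B" arbitrary: A B rule: less_induct)
  case less
  have fA: "finite A" by (rule finite_subset[OF _ finite_fdeg[of j]]) (use less in auto)
  have fB: "finite B" by (rule finite_subset[OF _ finite_fdeg[of "Suc j"]]) (use less in auto)
  show ?case
  proof (cases "stable_on UNIV B")
    case True
    have "card {f\<in>B. f (Max UNIV) = 0} \<le> pdn (card B) (Suc j)"
      by (rule card_no_last_le) (use True less.prems assms(1) in \<open>auto simp: supported_on_def\<close>)
    then show ?thesis
      by (intro card_no_last_le_imp_shadow_bound[OF assms(1) fA fB less.prems(3)])
  next
    case False
    then obtain f i k where f: "i < k" "inc i f \<in> B" "inc k f \<notin> B" by (auto simp: stable_on_def)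
    have "card (shift i k B) \<le> pseudo_power (card (shift i k A)) j"
    proof (rule less.hyps)
      show "sum weight (shift i k B) < sum weight B"
        by (rule weight_shift_less[OF f(1) fB less.prems(2) f(2,3)])
      show "f \<in> shift i k A" if "inc v f \<in> shift i k B" for f v
        by (rule shadow_shift[OF f(1) less.prems(3) that])
    qed (use shift_fdeg[OF f(1) less.prems(1)] shift_fdeg[OF f(1) less.prems(2)] in auto)
    then show ?thesis
      using card_shift[OF f(1) fB less.prems(2)] card_shift[OF f(1) fA less.prems(1)] by simp
  qed
qed

section \<open>Homogeneous ideals and linear forms\<close>

global_interpretation idl: module "(*) :: 'a::comm_ring_1 \<Rightarrow> 'a \<Rightarrow> 'a"
  by (rule module_mult)

text \<open>With multiplication as the module action this is associativity oriented to the left,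
  which would work against \<open>mult.assoc\<close>.\<close>

declare idl.scale_scale [simp del]

definition dg :: "('v::finite \<Rightarrow>\<^sub>0 nat) \<Rightarrow> nat" where
  "dg t = (\<Sum>v\<in>UNIV. Poly_Mapping.lookup t v)"

lemma dg_0 [simp]: "dg 0 = 0" by (simp add: dg_def)

lemma dg_plus [simp]: "dg (s + t) = dg s + dg t"
  by (simp add: dg_def Poly_Mapping.lookup_add sum.distrib)

lemma dg_single [simp]: "dg (Poly_Mapping.single v n) = n"
  by (simp add: dg_def lookup_single when_def)

lemma dg_eq_0_iff: "dg t = 0 \<longleftrightarrow> t = 0"
proof
  assume "dg t = 0"
  then have "Poly_Mapping.lookup t v = 0" for v by (simp add: dg_def)
  then show "t = 0" by (intro poly_mapping_eqI) simp
qed simp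

lemma keys_plus_nat: "Poly_Mapping.keys (s + t :: 'v \<Rightarrow>\<^sub>0 nat) = Poly_Mapping.keys s \<union> Poly_Mapping.keys t"
  by (auto simp: in_keys_iff Poly_Mapping.lookup_add)

lemma dg_eq_fdeg: "dg t = fdeg (Poly_Mapping.lookup t)"
  by (simp add: dg_def fdeg_def)

lemma finite_dg: "finite {t :: 'v::finite \<Rightarrow>\<^sub>0 nat. dg t = n}"
proof -
  have "inj_on Poly_Mapping.lookup {t :: 'v \<Rightarrow>\<^sub>0 nat. dg t = n}"
    by (rule inj_onI) (rule lookup_inject[THEN iffD1])
  moreover have "Poly_Mapping.lookup ` {t :: 'v \<Rightarrow>\<^sub>0 nat. dg t = n} \<subseteq> {f. fdeg f = n}"
    by (auto simp: dg_eq_fdeg)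
  then have "finite (Poly_Mapping.lookup ` {t :: 'v \<Rightarrow>\<^sub>0 nat. dg t = n})"
    by (rule finite_subset) (rule finite_fdeg)
  ultimately show ?thesis using finite_imageD by blast
qed

lemma monomial_mult_eq_sum:
  fixes p :: "('v, 'k::field) mpoly"
  shows "Poly_Mapping.single s c * p = (\<Sum>t\<in>Poly_Mapping.keys p. Poly_Mapping.single (s + t) (c * Poly_Mapping.lookup p t))"
proof -
  have "p = (\<Sum>t\<in>Poly_Mapping.keys p. pm_scale (Poly_Mapping.lookup p t) (Poly_Mapping.single t 1))"
    by (rule poly_mapping_sum_single) (auto simp: supp_in_def)
  also have "\<dots> = (\<Sum>t\<in>Poly_Mapping.keys p. Poly_Mapping.single t (Poly_Mapping.lookup p t))"
    by (rule sum.cong) (auto intro!: poly_mapping_eqI simp: lookup_single when_def)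
  finally have "Poly_Mapping.single s c * p =
    Poly_Mapping.single s c * (\<Sum>t\<in>Poly_Mapping.keys p. Poly_Mapping.single t (Poly_Mapping.lookup p t))"
    by (rule arg_cong[where f = "\<lambda>q. Poly_Mapping.single s c * q"])
  also have "\<dots> = (\<Sum>t\<in>Poly_Mapping.keys p. Poly_Mapping.single (s + t) (c * Poly_Mapping.lookup p t))"
    by (simp add: sum_distrib_left mult_single)
  finally show ?thesis .
qed

lemma lookup_monomial_mult:
  fixes p :: "('v, 'k::field) mpoly"
  shows "Poly_Mapping.lookup (Poly_Mapping.single s c * p) (s + t) = c * Poly_Mapping.lookup p t"
proof -
  have e: "Poly_Mapping.lookup (Poly_Mapping.single s c * p) (s + t) =
      (\<Sum>u\<in>Poly_Mapping.keys p. if u = t then c * Poly_Mapping.lookup p u else 0)"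
    unfolding monomial_mult_eq_sum Poly_Mapping.lookup_sum
    by (rule sum.cong) (auto simp: lookup_single when_def)
  show ?thesis unfolding e sum.delta[OF finite_keys] by (simp add: in_keys_iff)
qed

lemma lookup_monomial_mult_0:
  fixes p :: "('v, 'k::field) mpoly"
  assumes "\<And>t. u \<noteq> s + t"
  shows "Poly_Mapping.lookup (Poly_Mapping.single s c * p) u = 0"
  unfolding monomial_mult_eq_sum Poly_Mapping.lookup_sum
proof (rule sum.neutral, rule ballI)
  fix t assume "t \<in> Poly_Mapping.keys p"
  show "Poly_Mapping.lookup (Poly_Mapping.single (s + t) (c * Poly_Mapping.lookup p t)) u = 0"
    by (rule lookup_single_not_eq) (use assms[of t] in simp)
qed

lemma pm_scale_eq_mult:
  fixes p :: "('v, 'k::field) mpoly"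
  shows "pm_scale a p = Poly_Mapping.single 0 a * p"
  by (rule poly_mapping_eqI) (use lookup_monomial_mult[of 0 a p] in simp)

lemma pm_scale_mult:
  fixes p q :: "('v, 'k::field) mpoly"
  shows "pm_scale a p * q = pm_scale a (p * q)" "q * pm_scale a p = pm_scale a (q * p)"
  unfolding pm_scale_eq_mult by (simp_all only: mult.assoc mult.left_commute)

lemma pm_subspace_of_ideal:
  fixes J :: "('v, 'k::field) mpoly set"
  shows "is_ideal J \<Longrightarrow> pm.subspace J"
  unfolding pm.subspace_def idl.subspace_def pm_scale_eq_mult by blast

lemma pm_linear_mult: "pm_linear (\<lambda>p. (q :: ('v, 'k::field) mpoly) * p)"
  unfolding Vector_Spaces.linear_iff
  by (intro conjI allI pm.vector_space_axioms distrib_left pm_scale_mult(2))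

lemma keys_times:
  "u \<in> Poly_Mapping.keys (p * q) \<Longrightarrow> \<exists>a\<in>Poly_Mapping.keys p. \<exists>b\<in>Poly_Mapping.keys q. u = a + b"
proof -
  assume "u \<in> Poly_Mapping.keys (p * q)"
  then have "u \<in> {a + b |a b. a \<in> Poly_Mapping.keys p \<and> b \<in> Poly_Mapping.keys q}"
    by (rule subsetD[OF keys_mult])
  then show ?thesis by blast
qed

lift_definition restr :: "('a \<Rightarrow> bool) \<Rightarrow> ('a \<Rightarrow>\<^sub>0 'b::zero) \<Rightarrow> ('a \<Rightarrow>\<^sub>0 'b)" is
  "\<lambda>P f t. if P t then f t else 0"
  by (erule rev_finite_subset) auto

lemma lookup_restr: "Poly_Mapping.lookup (restr P p) t = (if P t then Poly_Mapping.lookup p t else 0)"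
  by transfer simp

lemma keys_restr: "Poly_Mapping.keys (restr P p) = {t\<in>Poly_Mapping.keys p. P t}"
  by (auto simp: in_keys_iff lookup_restr split: if_splits)

lemma restr_add: "restr P (p + q) = restr P p + restr P (q :: 'a \<Rightarrow>\<^sub>0 'b::monoid_add)"
  by (rule poly_mapping_eqI) (simp add: lookup_restr Poly_Mapping.lookup_add)

lemma restr_0 [simp]: "restr P 0 = 0"
  by (rule poly_mapping_eqI) (simp add: lookup_restr)

lemma restr_sum: "restr P (sum f A) = (\<Sum>x\<in>A. restr P (f x :: 'a \<Rightarrow>\<^sub>0 'b::comm_monoid_add))"
  by (induction A rule: infinite_finite_induct) (auto simp: restr_add)

lemma restr_diff: "restr P (p - q) = restr P p - restr P (q :: 'a \<Rightarrow>\<^sub>0 'b::ab_group_add)"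
  by (rule poly_mapping_eqI) (simp add: lookup_restr lookup_minus)

lemma restr_pm_scale: "restr P (pm_scale a p) = pm_scale a (restr P p)"
  by (rule poly_mapping_eqI) (simp add: lookup_restr)

lemma restr_id: "(\<And>t. t \<in> Poly_Mapping.keys p \<Longrightarrow> P t) \<Longrightarrow> restr P p = p"
  by (rule poly_mapping_eqI) (auto simp: lookup_restr in_keys_iff)

definition hom :: "nat \<Rightarrow> ('v::finite, 'k::field) mpoly set" where
  "hom s = supp_in {t. dg t = s}"

lemma hom_iff: "p \<in> hom s \<longleftrightarrow> (\<forall>t\<in>Poly_Mapping.keys p. dg t = s)"
  by (auto simp: hom_def supp_in_def)

lemma subspace_hom: "pm.subspace (hom s)"
  unfolding hom_def by (rule subspace_supp_in)

lemma fin_span_hom: "fin_span (hom s)"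
  unfolding hom_def by (rule fin_span_supp_in[OF finite_dg])

lemma dim_hom: "pm.dim (hom s :: ('v::finite, 'k::field) mpoly set) = card {t :: 'v \<Rightarrow>\<^sub>0 nat. dg t = s}"
  unfolding hom_def by (rule dim_supp_in[OF finite_dg])

definition cmp :: "nat \<Rightarrow> ('v::finite, 'k::field) mpoly \<Rightarrow> ('v, 'k) mpoly" where
  "cmp s = restr (\<lambda>t. dg t = s)"

lemma cmp_hom: "cmp s p \<in> hom s"
  by (auto simp: hom_iff cmp_def keys_restr)

lemma cmp_id: "p \<in> hom s \<Longrightarrow> cmp s p = p"
  unfolding cmp_def by (rule restr_id) (auto simp: hom_iff)

lemma cmp_simps: "cmp s (p + q) = cmp s p + cmp s q" "cmp s 0 = 0"
  by (auto simp: cmp_def restr_add)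

lemma sum_cmp:
  obtains N where "p = (\<Sum>s\<le>N. cmp s p)"
proof
  let ?N = "Max (dg ` Poly_Mapping.keys p)"
  show "p = (\<Sum>s\<le>?N. cmp s p)"
  proof (rule poly_mapping_eqI)
    fix t
    have "Poly_Mapping.lookup (\<Sum>s\<le>?N. cmp s p) t = (\<Sum>s\<le>?N. if s = dg t then Poly_Mapping.lookup p t else 0)"
      unfolding Poly_Mapping.lookup_sum by (rule sum.cong) (auto simp: cmp_def lookup_restr)
    also have "\<dots> = (if dg t \<le> ?N then Poly_Mapping.lookup p t else 0)" by (simp add: sum.delta)
    also have "\<dots> = Poly_Mapping.lookup p t"
      by (auto simp: in_keys_iff intro!: Max_ge)
    finally show "Poly_Mapping.lookup p t = Poly_Mapping.lookup (\<Sum>s\<le>?N. cmp s p) t" by simp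
  qed
qed

definition lin :: "('v::finite \<Rightarrow> 'k) \<Rightarrow> ('v, 'k::field) mpoly" where
  "lin c = (\<Sum>w\<in>UNIV. Poly_Mapping.single (Poly_Mapping.single w 1) (c w))"

lemma lin_mult: "lin c * p = (\<Sum>w\<in>UNIV. pm_scale (c w) (var w * p))"
proof -
  have "Poly_Mapping.single (Poly_Mapping.single w 1) (c w) = pm_scale (c w) (var w)" for w :: 'a
    by (rule poly_mapping_eqI) (simp add: var_def lookup_single when_def)
  then show ?thesis by (simp add: lin_def sum_distrib_right pm_scale_mult)
qed

lemma lin_hom: "lin c \<in> hom 1"
  unfolding lin_def by (rule pm.subspace_sum[OF subspace_hom]) (simp add: hom_iff)

lemma var_in_keys:
  assumes "t \<in> Poly_Mapping.keys (var v * (p :: ('v, 'k::field) mpoly))"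
  obtains u where "u \<in> Poly_Mapping.keys p" "t = Poly_Mapping.single v 1 + u"
  using keys_times[OF assms] that by (auto simp: var_def)

lemma lookup_var_mult:
  fixes p :: "('v, 'k::field) mpoly"
  shows "Poly_Mapping.lookup (var v * p) (Poly_Mapping.single v 1 + t) = Poly_Mapping.lookup p t"
  unfolding var_def using lookup_monomial_mult[of "Poly_Mapping.single v 1" 1 p t] by simp

lemma lookup_var_mult_0:
  fixes p :: "('v, 'k::field) mpoly"
  assumes "\<And>u. t \<noteq> Poly_Mapping.single v 1 + u"
  shows "Poly_Mapping.lookup (var v * p) t = 0"
  unfolding var_def by (rule lookup_monomial_mult_0) (rule assms)

lemma restr_var_mult:
  fixes p :: "('v, 'k::field) mpoly"
  assumes "\<And>t. P (Poly_Mapping.single v 1 + t) \<longleftrightarrow> Q t"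
  shows "restr P (var v * p) = var v * restr Q p"
proof (rule poly_mapping_eqI)
  fix t
  show "Poly_Mapping.lookup (restr P (var v * p)) t = Poly_Mapping.lookup (var v * restr Q p) t"
  proof (cases "\<exists>u. t = Poly_Mapping.single v 1 + u")
    case True
    then obtain u where "t = Poly_Mapping.single v 1 + u" by blast
    then show ?thesis using assms[of u] lookup_var_mult[of v p u] lookup_var_mult[of v "restr Q p" u]
      by (simp add: lookup_restr)
  next
    case False
    then show ?thesis using lookup_var_mult_0[of t v p] lookup_var_mult_0[of t v "restr Q p"]
      by (simp add: lookup_restr)
  qed
qed

text \<open>Covers two gradings at once: by total degree, and by the exponent of a variable absent
  from the form.\<close>

lemma restr_lin_mult:
  assumes "\<And>v t. c v \<noteq> 0 \<Longrightarrow> P (Poly_Mapping.single v 1 + t) \<longleftrightarrow> Q t"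
  shows "restr P (lin c * p) = lin c * restr Q p"
  unfolding lin_mult restr_sum
proof (rule sum.cong)
  fix w :: 'a
  show "restr P (pm_scale (c w) (var w * p)) = pm_scale (c w) (var w * restr Q p)"
    using restr_var_mult[of P w Q p] assms[of w] by (cases "c w = 0") (auto simp: restr_pm_scale)
qed simp

lemma cmp_lin_mult: "cmp (Suc s) (lin c * p) = lin c * cmp s p"
  unfolding cmp_def by (rule restr_lin_mult) simp

lemma cmp_0_lin_mult: "cmp 0 (lin c * p) = 0"
proof (rule poly_mapping_eqI)
  fix t
  have "Poly_Mapping.lookup (lin c * p) t = 0" if t: "dg t = 0"
  proof (rule ccontr)
    assume "Poly_Mapping.lookup (lin c * p) t \<noteq> 0"
    then have "t \<in> Poly_Mapping.keys (lin c * p)" by (simp add: in_keys_iff)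
    from keys_times[OF this] obtain a b
      where "a \<in> Poly_Mapping.keys (lin c)" "b \<in> Poly_Mapping.keys p" "t = a + b" by (elim bexE)
    then show False using lin_hom[of c] t by (simp add: hom_iff)
  qed
  then show "Poly_Mapping.lookup (cmp 0 (lin c * p)) t = Poly_Mapping.lookup 0 t"
    by (simp add: cmp_def lookup_restr)
qed

lemma var_eq_lin: "var v = lin (\<lambda>w. if w = v then 1 else 0)"
proof -
  have "lin (\<lambda>w. if w = v then 1 else 0) = (\<Sum>w\<in>UNIV. if w = v then Poly_Mapping.single (Poly_Mapping.single w 1) (1::'b) else 0)"
    unfolding lin_def by (rule sum.cong) auto
  then show ?thesis by (simp add: var_def sum.delta)
qed

lemma mult_hom_lin: "p \<in> hom s \<Longrightarrow> lin c * p \<in> hom (Suc s)"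
  using cmp_hom[of "Suc s" "lin c * p"] by (simp add: cmp_lin_mult cmp_id)

definition graded_ideal :: "('v::finite, 'k::field) mpoly set \<Rightarrow> bool" where
  "graded_ideal J \<longleftrightarrow> is_ideal J \<and> (\<forall>p\<in>J. \<forall>s. cmp s p \<in> J)"

text \<open>The sum of \<open>J\<close> and the principal ideal of \<open>q\<close>, in the shape in
  which elements are taken apart; \<open>gens_eq_ideal_gen\<close> connects it with generated
  ideals.\<close>

definition adj :: "'a::comm_ring_1 set \<Rightarrow> 'a \<Rightarrow> 'a set" where
  "adj J q = {u + q * g |u g. u \<in> J}"

lemma adjI: "u \<in> J \<Longrightarrow> u + q * g \<in> adj J q"
  unfolding adj_def by (rule CollectI, rule exI[of _ u], rule exI[of _ g]) simp

lemma adjE: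
  assumes "x \<in> adj J q" obtains u g where "x = u + q * g" "u \<in> J"
  using assms unfolding adj_def by (elim CollectE exE conjE)

lemma adj_ideal:
  assumes J: "is_ideal J" shows "is_ideal (adj J q)"
  unfolding idl.subspace_def
proof (intro conjI ballI allI)
  show "0 \<in> adj J q" using adjI[OF idl.subspace_0[OF J], of q 0] by simp
  fix x assume "x \<in> adj J q"
  then obtain u g where x: "x = u + q * g" "u \<in> J" by (rule adjE)
  show "c * x \<in> adj J q" for c
    using adjI[OF idl.subspace_scale[OF J x(2), of c], of q "c * g"] x(1) by (simp add: algebra_simps)
  fix y assume "y \<in> adj J q"
  then obtain u' g' where y: "y = u' + q * g'" "u' \<in> J" by (rule adjE)
  show "x + y \<in> adj J q"
    using adjI[OF idl.subspace_add[OF J x(2) y(2)], of q "g + g'"] x(1) y(1) by (simp add: algebra_simps)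
qed

lemma subset_adj: "J \<subseteq> adj J q"
proof
  fix u assume "u \<in> J"
  then show "u \<in> adj J q" using adjI[of u J q 0] by simp
qed

lemma in_adj: "is_ideal J \<Longrightarrow> q \<in> adj J q"
  using adjI[OF idl.subspace_0, of J q 1] by simp

lemma adj_least:
  assumes K: "is_ideal K" "J \<subseteq> K" "q \<in> K" shows "adj J q \<subseteq> K"
proof
  fix x assume "x \<in> adj J q"
  then obtain u g where x: "x = u + q * g" "u \<in> J" by (rule adjE)
  have "q * g \<in> K" using idl.subspace_scale[OF K(1,3), of g] by (simp add: mult.commute)
  then show "x \<in> K" unfolding x(1) by (intro idl.subspace_add[OF K(1)] subsetD[OF K(2) x(2)])
qed

lemma graded_adj:
  assumes "graded_ideal J" shows "graded_ideal (adj J (lin c))"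
proof -
  have J: "is_ideal J" "\<And>p s. p \<in> J \<Longrightarrow> cmp s p \<in> J" using assms by (auto simp: graded_ideal_def)
  have "cmp s p \<in> adj J (lin c)" if asm: "p \<in> adj J (lin c)" for p s
  proof -
    obtain u g where p: "p = u + lin c * g" "u \<in> J" by (rule adjE[OF asm])
    show ?thesis
    proof (cases s)
      case 0
      then have "cmp s p = cmp 0 u" using p by (simp add: cmp_simps cmp_0_lin_mult)
      then show ?thesis using J(2)[OF p(2), of 0] subset_adj[of J "lin c"] by auto
    next
      case (Suc r)
      then have "cmp s p = cmp s u + lin c * cmp r g" using p by (simp add: cmp_simps cmp_lin_mult)
      then show ?thesis using adjI[OF J(2)[OF p(2), of s]] by simp
    qed
  qed
  then show ?thesis using adj_ideal[OF J(1)] by (simp add: graded_ideal_def)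
qed

primrec gens :: "'a::comm_ring_1 set \<Rightarrow> (nat \<Rightarrow> 'a) \<Rightarrow> nat \<Rightarrow> 'a set" where
  "gens I \<theta> 0 = I"
| "gens I \<theta> (Suc i) = adj (gens I \<theta> i) (\<theta> i)"

lemma gens_ideal: "is_ideal I \<Longrightarrow> is_ideal (gens I \<theta> i)"
  by (induction i) (auto simp: adj_ideal)

lemma gens_graded: "graded_ideal I \<Longrightarrow> graded_ideal (gens I (\<lambda>l. lin (c l)) i)"
  by (induction i) (auto simp: graded_adj)

lemma gens_mono: "i \<le> j \<Longrightarrow> gens I \<theta> i \<subseteq> gens I \<theta> j"
proof (induction rule: dec_induct)
  case (step n)
  then show ?case using subset_trans[OF _ subset_adj] by simp
qed simp

lemma adj_mono: "J \<subseteq> J' \<Longrightarrow> adj J q \<subseteq> adj J' q"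
  by (auto elim!: adjE intro: adjI)

lemma gens_mono_base: "I \<subseteq> I' \<Longrightarrow> gens I \<theta> i \<subseteq> gens I' \<theta> i"
  by (induction i) (simp_all add: adj_mono)

lemma gens_theta: "is_ideal I \<Longrightarrow> l < i \<Longrightarrow> \<theta> l \<in> gens I \<theta> i"
proof -
  assume "is_ideal I" "l < i"
  then have "\<theta> l \<in> gens I \<theta> (Suc l)" unfolding gens.simps by (intro in_adj gens_ideal)
  then show ?thesis by (rule subsetD[OF gens_mono[OF Suc_leI[OF \<open>l < i\<close>]]])
qed

lemma gens_least: "is_ideal K \<Longrightarrow> I \<subseteq> K \<Longrightarrow> (\<And>l. l < i \<Longrightarrow> \<theta> l \<in> K) \<Longrightarrow> gens I \<theta> i \<subseteq> K"
  by (induction i) (simp_all add: adj_least)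

lemma gens_eq_ideal_gen:
  assumes "is_ideal I" "i \<le> n"
  shows "gens I \<theta> i = ideal_gen (I \<union> set (take i (map \<theta> [0..<n])))"
proof
  have s: "set (take i (map \<theta> [0..<n])) = \<theta> ` {..<i}"
    using assms(2) by (auto simp: take_map take_upt)
  show "gens I \<theta> i \<subseteq> ideal_gen (I \<union> set (take i (map \<theta> [0..<n])))"
    unfolding s by (rule gens_least[OF idl.subspace_span]) (use idl.span_superset[of "I \<union> \<theta> ` {..<i}"] in auto)
  show "ideal_gen (I \<union> set (take i (map \<theta> [0..<n]))) \<subseteq> gens I \<theta> i"
    unfolding s using gens_ideal[OF assms(1)] gens_mono[of 0 i I \<theta>] gens_theta[OF assms(1)]
    by (intro idl.span_minimal) auto
qed

section \<open>Hilbert functions and regular sequences of linear forms\<close>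

definition HF :: "('v::finite, 'k::field) mpoly set \<Rightarrow> nat \<Rightarrow> int" where
  "HF J s = int (pm.dim (hom s :: ('v, 'k) mpoly set)) - int (pm.dim (J \<inter> hom s))"

lemma fin_span_Int_hom: "fin_span (J \<inter> hom s)"
  by (rule fin_span_subset[OF fin_span_hom]) auto

lemma HF_antimono: "J \<subseteq> J' \<Longrightarrow> HF J' s \<le> HF J s"
  unfolding HF_def using dim_mono_fin[OF fin_span_Int_hom, of "J \<inter> hom s" J' s] by auto

lemma HF_adj_0: "graded_ideal J \<Longrightarrow> HF (adj J (lin c)) 0 = HF J 0"
proof -
  assume J: "graded_ideal J"
  have "p \<in> J" if asm: "p \<in> adj J (lin c)" "p \<in> hom 0" for p
  proof -
    obtain u g where p: "p = u + lin c * g" "u \<in> J" by (rule adjE[OF asm(1)])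
    then have "p = cmp 0 u" using asm(2) cmp_id[of p 0] by (simp add: cmp_simps cmp_0_lin_mult)
    then show ?thesis using J p by (auto simp: graded_ideal_def)
  qed
  then have "adj J (lin c) \<inter> hom 0 = J \<inter> hom 0" using subset_adj by blast
  then show ?thesis by (simp add: HF_def)
qed

text \<open>Dimension count along multiplication by \<open>lin c\<close> from degree
  \<open>s\<close> to \<open>Suc s\<close> modulo \<open>J\<close>: the bracket is the kernel, that
  is, the annihilator of the form in the quotient by \<open>J\<close>.\<close>

lemma HF_adj_Suc:
  fixes J :: "('v::finite, 'k::field) mpoly set"
  assumes J: "graded_ideal J"
  shows "HF (adj J (lin c)) (Suc s) = HF J (Suc s) - HF J s
    + (int (pm.dim {g\<in>hom s. lin c * g \<in> J}) - int (pm.dim (J \<inter> hom s)))"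
proof -
  have iJ: "is_ideal J" using J by (simp add: graded_ideal_def)
  let ?X = "adj J (lin c) \<inter> hom (Suc s)"
  obtain q :: "('v, 'k) mpoly \<Rightarrow> ('v, 'k) mpoly" where q: "pm_linear q" "\<And>x. q x = 0 \<longleftrightarrow> x \<in> J"
    by (rule exists_linear_with_kernel[OF pm_subspace_of_ideal[OF iJ]]) (rule that)
  interpret q: Vector_Spaces.linear pm_scale pm_scale q by (rule q(1))
  have sX: "pm.subspace ?X"
    by (intro pm.subspace_inter pm_subspace_of_ideal adj_ideal iJ subspace_hom)
  have "{x\<in>?X. q x = 0} = J \<inter> hom (Suc s)" using subset_adj q(2) by blast
  moreover have "q ` ?X = (q \<circ> (\<lambda>p. lin c * p)) ` hom s"
  proof (intro equalityI subsetI)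
    fix y assume "y \<in> q ` ?X"
    then obtain x where x: "x \<in> ?X" "y = q x" by blast
    then have "x \<in> adj J (lin c)" by simp
    then obtain u g where ug: "x = u + lin c * g" "u \<in> J" by (rule adjE)
    have "x = cmp (Suc s) u + lin c * cmp s g"
      using x ug cmp_id[of x "Suc s"] by (simp add: cmp_simps cmp_lin_mult)
    moreover have "cmp (Suc s) u \<in> J" using J ug by (simp add: graded_ideal_def)
    ultimately have "y = q (lin c * cmp s g)" using x q(2) by (simp add: q.add)
    then show "y \<in> (q \<circ> (\<lambda>p. lin c * p)) ` hom s" using cmp_hom by force
  next
    fix y assume "y \<in> (q \<circ> (\<lambda>p. lin c * p)) ` hom s"
    then obtain g where g: "g \<in> hom s" "y = q (lin c * g)" by auto
    have "lin c * g \<in> adj J (lin c)"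
      using adjI[OF idl.subspace_0[OF iJ], of "lin c" g] by simp
    then show "y \<in> q ` ?X" using g mult_hom_lin by blast
  qed
  ultimately have 1: "pm.dim ?X = pm.dim (J \<inter> hom (Suc s)) + pm.dim ((q \<circ> (\<lambda>p. lin c * p)) ` hom s)"
    using dim_kernel_image[OF q(1) sX fin_span_Int_hom] by simp
  have "pm.dim (hom s :: ('v, 'k) mpoly set) = pm.dim {g\<in>hom s. (q \<circ> (\<lambda>p. lin c * p)) g = 0}
      + pm.dim ((q \<circ> (\<lambda>p. lin c * p)) ` hom s)"
    by (rule dim_kernel_image[OF Vector_Spaces.linear_compose[OF pm_linear_mult q(1)] subspace_hom fin_span_hom])
  moreover have "{g\<in>hom s. (q \<circ> (\<lambda>p. lin c * p)) g = 0} = {g\<in>hom s. lin c * g \<in> J}"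
    using q(2) by simp
  ultimately show ?thesis using 1 by (simp add: HF_def)
qed

definition nonzerodiv :: "'a::comm_ring_1 set \<Rightarrow> 'a \<Rightarrow> bool" where
  "nonzerodiv J q \<longleftrightarrow> (\<forall>g. q * g \<in> J \<longrightarrow> g \<in> J)"

lemma Int_hom_subset_preimage:
  assumes "is_ideal J" shows "J \<inter> hom s \<subseteq> {g\<in>hom s. q * g \<in> J}"
  using idl.subspace_scale[OF assms] by auto

text \<open>Makes regularity numerical: the annihilator contains \<open>J\<close> in each degree, so
  equal dimensions force equality, and gradedness reduces a general element to its
  components.\<close>

lemma nonzerodiv_lin_iff:
  fixes J :: "('v::finite, 'k::field) mpoly set"
  assumes J: "graded_ideal J"
  shows "nonzerodiv J (lin c) \<longleftrightarrow> (\<forall>s. pm.dim {g\<in>hom s. lin c * g \<in> J} = pm.dim (J \<inter> hom s))"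
proof
  have iJ: "is_ideal J" using J by (simp add: graded_ideal_def)
  show "\<forall>s. pm.dim {g\<in>hom s. lin c * g \<in> J} = pm.dim (J \<inter> hom s)" if "nonzerodiv J (lin c)"
  proof
    fix s
    have "{g\<in>hom s. lin c * g \<in> J} = J \<inter> hom s"
      using that Int_hom_subset_preimage[OF iJ, of s "lin c"] by (auto simp: nonzerodiv_def)
    then show "pm.dim {g\<in>hom s. lin c * g \<in> J} = pm.dim (J \<inter> hom s)" by simp
  qed
  assume d: "\<forall>s. pm.dim {g\<in>hom s. lin c * g \<in> J} = pm.dim (J \<inter> hom s)"
  show "nonzerodiv J (lin c)"
    unfolding nonzerodiv_def
  proof (intro allI impI)
    fix g assume g: "lin c * g \<in> J"
    have eq: "J \<inter> hom s = {g\<in>hom s. lin c * g \<in> J}" for s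
    proof (rule subspace_dim_equal_fin)
      show "fin_span {g\<in>hom s. lin c * g \<in> J}" by (rule fin_span_subset[OF fin_span_hom]) auto
      show "pm.subspace (J \<inter> hom s)"
        by (intro pm.subspace_inter pm_subspace_of_ideal iJ subspace_hom)
    qed (use d Int_hom_subset_preimage[OF iJ] in auto)
    have "cmp s g \<in> J" for s
    proof -
      have "lin c * cmp s g \<in> J" using g J cmp_lin_mult[of s c g] by (metis graded_ideal_def)
      then have "cmp s g \<in> {g\<in>hom s. lin c * g \<in> J}" using cmp_hom by simp
      then show ?thesis using eq by blast
    qed
    moreover obtain N where "g = (\<Sum>s\<le>N. cmp s g)" by (rule sum_cmp)
    ultimately show "g \<in> J" using idl.subspace_sum[OF iJ] by metis
  qed
qed

lemma dim_preimage_ge: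
  assumes "is_ideal J"
  shows "pm.dim (J \<inter> hom s) \<le> pm.dim {g\<in>hom s. (q :: ('v::finite, 'k::field) mpoly) * g \<in> J}"
  by (rule dim_mono_fin[OF fin_span_subset[OF fin_span_hom] Int_hom_subset_preimage[OF assms]]) auto

text \<open>
  A sequence of linear forms is regular as soon as its quotient has a Hilbert function that is at
  most that of the quotient by some regular sequence of the same length. This makes regularity
  independent of the chosen basis of the span of the forms.
\<close>

lemma regular_by_Hilbert_function:
  fixes I :: "('v::finite, 'k::field) mpoly set"
  assumes I: "graded_ideal I"
    and reg: "\<And>i. i < d \<Longrightarrow> nonzerodiv (gens I (\<lambda>l. lin (b l)) i) (lin (b i))"
    and le: "\<And>s. HF (gens I (\<lambda>l. lin (a l)) d) s \<le> HF (gens I (\<lambda>l. lin (b l)) d) s"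
    and "i < d"
  shows "nonzerodiv (gens I (\<lambda>l. lin (a l)) i) (lin (a i))"
proof -
  let ?A = "gens I (\<lambda>l. lin (a l))" and ?B = "gens I (\<lambda>l. lin (b l))"
  \<comment> \<open>The defect of regularity of \<open>lin (a i)\<close> in degree
    \<open>s\<close>.\<close>
  define \<kappa> where "\<kappa> i s = int (pm.dim {g\<in>hom s. lin (a i) * g \<in> ?A i}) - int (pm.dim (?A i \<inter> hom s))" for i s
  have gA: "graded_ideal (?A i)" and gB: "graded_ideal (?B i)" for i using gens_graded I by auto
  have k0: "\<kappa> i s \<ge> 0" for i s
    unfolding \<kappa>_def using dim_preimage_ge[of "?A i" s "lin (a i)"] gA by (auto simp: graded_ideal_def)
  have A: "HF (?A i) s = (\<Sum>r\<le>s. HF (?A (Suc i)) r) - (\<Sum>r<s. \<kappa> i r)" for i s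
    by (induction s) (use HF_adj_Suc[OF gA] HF_adj_0[OF gA] in \<open>auto simp: \<kappa>_def\<close>)
  have B: "HF (?B i) s = (\<Sum>r\<le>s. HF (?B (Suc i)) r)" if "i < d" for i s
    by (induction s)
      (use HF_adj_Suc[OF gB] HF_adj_0[OF gB] nonzerodiv_lin_iff[OF gB] reg[OF that] in auto)
  \<comment> \<open>The inequality assumed at \<open>i = d\<close> descends to smaller
    \<open>i\<close>, since defects enter with a negative sign.\<close>
  have mono: "i \<le> d \<Longrightarrow> HF (?A i) s \<le> HF (?B i) s" for i s
  proof (induction arbitrary: s rule: inc_induct)
    case base
    then show ?case by (rule le)
  next
    case (step n)
    have "(\<Sum>r\<le>s. HF (?A (Suc n)) r) \<le> (\<Sum>r\<le>s. HF (?B (Suc n)) r)" by (rule sum_mono) (rule step)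
    moreover have "(\<Sum>r<s. \<kappa> n r) \<ge> 0" by (rule sum_nonneg) (rule k0)
    ultimately show ?case using A[of n s] B[of n s] step by linarith
  qed
  \<comment> \<open>Both chains start at \<open>I\<close>, so equality ascends from
    \<open>i = 0\<close>; equality in consecutive stages leaves no room for a defect.\<close>
  have eq: "i \<le> d \<Longrightarrow> HF (?A i) s = HF (?B i) s" for i s
  proof (induction i arbitrary: s)
    case (Suc n)
    have sm: "(\<Sum>r\<le>s. HF (?A (Suc n)) r) = (\<Sum>r\<le>s. HF (?B (Suc n)) r)" for s
    proof (rule antisym)
      show "(\<Sum>r\<le>s. HF (?A (Suc n)) r) \<le> (\<Sum>r\<le>s. HF (?B (Suc n)) r)"
        by (rule sum_mono) (rule mono[OF Suc.prems])
      have "(\<Sum>r<s. \<kappa> n r) \<ge> 0" by (rule sum_nonneg) (rule k0)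
      then show "(\<Sum>r\<le>s. HF (?B (Suc n)) r) \<le> (\<Sum>r\<le>s. HF (?A (Suc n)) r)"
        using A[of n s] B[of n s] Suc by simp
    qed
    show ?case using sm[of s] sm[of "s - 1"] by (cases s) auto
  qed simp
  have "\<kappa> i s = 0" for s
  proof -
    have "(\<Sum>r<s. \<kappa> i r) = 0" for s
      using A[of i s] B[of i s] eq[of i s] eq[of "Suc i"] assms(4) by simp
    from this[of "Suc s"] this[of s] show ?thesis by simp
  qed
  then show ?thesis using nonzerodiv_lin_iff[OF gA] by (simp add: \<kappa>_def)
qed

section \<open>Face ideals and Krull dimension\<close>

lemma is_idealI:
  assumes "0 \<in> J" "\<And>x y. x \<in> J \<Longrightarrow> y \<in> J \<Longrightarrow> x + y \<in> J" "\<And>c x. x \<in> J \<Longrightarrow> c * x \<in> J"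
  shows "is_ideal J"
  using assms by (simp add: idl.subspace_def)

text \<open>The kernel of the polynomial ring onto the Stanley--Reisner ring of the star of \<open>F\<close>.\<close>

definition fideal :: "'v::finite set set \<Rightarrow> 'v set \<Rightarrow> ('v, 'k::field) mpoly set" where
  "fideal \<Delta> F = {p. \<forall>t\<in>Poly_Mapping.keys p. Poly_Mapping.keys t \<union> F \<notin> \<Delta>}"

lemma fideal_restr: "p \<in> fideal \<Delta> F \<Longrightarrow> restr P p \<in> fideal \<Delta> F"
  by (auto simp: fideal_def keys_restr)

lemma fideal_add: "p \<in> fideal \<Delta> F \<Longrightarrow> q \<in> fideal \<Delta> F \<Longrightarrow> p + q \<in> fideal \<Delta> F"
  by (auto simp: fideal_def dest!: subsetD[OF Poly_Mapping.keys_add])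

lemma scale_single: "pm_scale a (Poly_Mapping.single t b) = Poly_Mapping.single t (a * b)"
  by (rule poly_mapping_eqI) (simp add: lookup_single when_def)

lemma prod_var: "(\<Prod>v\<in>A. var v) = (Poly_Mapping.single (\<Sum>v\<in>A. Poly_Mapping.single v 1) 1 :: ('v, 'k::field) mpoly)"
  if "finite A" for A :: "'v::finite set"
  using that by (induction A rule: finite_induct) (simp_all add: var_def mult_single)

lemma lookup_sum_single:
  "Poly_Mapping.lookup (\<Sum>v\<in>A. Poly_Mapping.single v (1::nat)) w = (if w \<in> A then 1 else 0)"
  if "finite A" for A :: "'v::finite set"
  unfolding Poly_Mapping.lookup_sum using that by (simp add: lookup_single when_def sum.delta)

lemma keys_sum_single: "Poly_Mapping.keys (\<Sum>v\<in>A. Poly_Mapping.single v (1::nat)) = A" for A :: "'v::finite set"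
  using lookup_sum_single[of A] by (auto simp: in_keys_iff split: if_splits)

lemma monomial_in_ideal_sum:
  assumes J: "is_ideal J" and "\<And>t. t \<in> Poly_Mapping.keys p \<Longrightarrow> Poly_Mapping.single t 1 \<in> J"
  shows "(p :: ('v, 'k::field) mpoly) \<in> J"
proof -
  have "p = (\<Sum>t\<in>Poly_Mapping.keys p. pm_scale (Poly_Mapping.lookup p t) (Poly_Mapping.single t 1))"
    by (rule poly_mapping_sum_single) (auto simp: supp_in_def)
  moreover have "\<dots> \<in> J"
    by (rule pm.subspace_sum[OF pm_subspace_of_ideal[OF J]])
      (rule pm.subspace_scale[OF pm_subspace_of_ideal[OF J] assms(2)])
  ultimately show ?thesis by simp
qed

context
  fixes \<Delta> :: "'v::{finite,linorder} set set"
  assumes down: "\<And>F G. F \<in> \<Delta> \<Longrightarrow> G \<subseteq> F \<Longrightarrow> G \<in> \<Delta>"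
begin

lemma fideal_ideal: "is_ideal (fideal \<Delta> F)"
proof (rule is_idealI)
  fix c p :: "('v, 'b::field) mpoly" assume p: "p \<in> fideal \<Delta> F"
  have "Poly_Mapping.keys t \<union> F \<notin> \<Delta>" if "t \<in> Poly_Mapping.keys (c * p)" for t
  proof -
    from keys_times[OF that] obtain a b where ab: "a \<in> Poly_Mapping.keys c" "b \<in> Poly_Mapping.keys p" "t = a + b"
      by (elim bexE)
    then have "Poly_Mapping.keys b \<union> F \<notin> \<Delta>" using p by (auto simp: fideal_def)
    then show ?thesis using down[of "Poly_Mapping.keys t \<union> F" "Poly_Mapping.keys b \<union> F"] ab
      by (auto simp: keys_plus_nat)
  qed
  then show "c * p \<in> fideal \<Delta> F" by (auto simp: fideal_def)
qed (simp_all add: fideal_add, simp add: fideal_def)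

lemma fideal_graded: "graded_ideal (fideal \<Delta> F)"
  by (simp add: graded_ideal_def fideal_ideal cmp_def fideal_restr)

lemma fideal_mono: "F \<subseteq> G \<Longrightarrow> fideal \<Delta> F \<subseteq> fideal \<Delta> G"
  unfolding fideal_def by (auto dest: down[OF _ Un_mono[OF subset_refl]])

text \<open>Multiplication by the monomial of \<open>F\<close> moves relations on the star of
  \<open>F\<close> to relations on the whole complex, where the Buchsbaum property can be
  used.\<close>

lemma prod_var_mult_fideal:
  assumes "(p :: ('v, 'k::field) mpoly) \<in> fideal \<Delta> F"
  shows "(\<Prod>v\<in>F. var v) * p \<in> fideal \<Delta> {}"
  unfolding fideal_def
proof (intro CollectI ballI)
  fix t assume "t \<in> Poly_Mapping.keys ((\<Prod>v\<in>F. var v) * p)"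
  from keys_times[OF this] obtain a b where
    ab: "a \<in> Poly_Mapping.keys (\<Prod>v\<in>F. var v :: ('v, 'k) mpoly)" "b \<in> Poly_Mapping.keys p" "t = a + b"
    by (elim bexE)
  then have "a = (\<Sum>v\<in>F. Poly_Mapping.single v 1)" by (simp add: prod_var)
  then have "Poly_Mapping.keys t = F \<union> Poly_Mapping.keys b" using ab keys_sum_single[of F] by (simp add: keys_plus_nat)
  then show "Poly_Mapping.keys t \<union> {} \<notin> \<Delta>" using assms ab by (auto simp: fideal_def Un_commute)
qed

lemma SR_ideal_eq: "(SR_ideal \<Delta> :: ('v, 'k::field) mpoly set) = fideal \<Delta> {}"
proof
  show "SR_ideal \<Delta> \<subseteq> (fideal \<Delta> {} :: ('v, 'k) mpoly set)"
    unfolding SR_ideal_def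
  proof (rule idl.span_minimal[OF _ fideal_ideal], rule subsetI)
    fix p :: "('v, 'k) mpoly" assume "p \<in> {(\<Prod>v\<in>A. var v) |A. A \<notin> \<Delta>}"
    then obtain A where "p = (\<Prod>v\<in>A. var v)" "A \<notin> \<Delta>" by (elim CollectE exE conjE)
    then show "p \<in> fideal \<Delta> {}" using keys_sum_single[of A] by (simp add: prod_var fideal_def)
  qed
  show "fideal \<Delta> {} \<subseteq> (SR_ideal \<Delta> :: ('v, 'k) mpoly set)"
  proof
    fix p :: "('v, 'k) mpoly" assume p: "p \<in> fideal \<Delta> {}"
    have i: "is_ideal (SR_ideal \<Delta> :: ('v, 'k) mpoly set)" unfolding SR_ideal_def by (rule idl.subspace_span)
    show "p \<in> SR_ideal \<Delta>"
    proof (rule monomial_in_ideal_sum[OF i])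
      fix t assume t: "t \<in> Poly_Mapping.keys p"
      let ?A = "Poly_Mapping.keys t"
      let ?m = "\<Sum>v\<in>?A. Poly_Mapping.single v (1::nat)"
      have "?A \<notin> \<Delta>" using t p by (auto simp: fideal_def)
      then have g: "(\<Prod>v\<in>?A. var v) \<in> (SR_ideal \<Delta> :: ('v, 'k) mpoly set)"
        unfolding SR_ideal_def by (intro idl.span_base CollectI exI[of _ ?A] conjI refl)
      have "t = (t - ?m) + ?m"
        by (rule poly_mapping_eqI)
          (use lookup_sum_single[OF finite_keys, of t] in
            \<open>auto simp: Poly_Mapping.lookup_add lookup_minus in_keys_iff\<close>)
      then have "Poly_Mapping.single t (1::'k) = Poly_Mapping.single (t - ?m) 1 * (\<Prod>v\<in>?A. var v)"
        by (simp add: prod_var mult_single)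
      then show "Poly_Mapping.single t 1 \<in> (SR_ideal \<Delta> :: ('v, 'k) mpoly set)"
        using idl.subspace_scale[OF i g] by simp
    qed
  qed
qed

end

section \<open>Affine Hilbert functions and the growth forced by chains of primes\<close>

definition upto_deg :: "nat \<Rightarrow> ('v::finite, 'k::field) mpoly set" where
  "upto_deg n = supp_in {t. dg t \<le> n}"

lemma finite_dg_le: "finite {t :: 'v::finite \<Rightarrow>\<^sub>0 nat. dg t \<le> n}"
proof -
  have "{t :: 'v \<Rightarrow>\<^sub>0 nat. dg t \<le> n} = (\<Union>i\<le>n. {t. dg t = i})" by auto
  then show ?thesis using finite_dg by auto
qed

lemma subspace_upto_deg: "pm.subspace (upto_deg n)"
  unfolding upto_deg_def by (rule subspace_supp_in)

lemma fin_span_upto_deg: "fin_span (upto_deg n)"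
  unfolding upto_deg_def by (rule fin_span_supp_in[OF finite_dg_le])

text \<open>Primes in a chain need not be homogeneous, so degree at most \<open>n\<close> replaces
  degree \<open>n\<close>.\<close>

definition affine_HF :: "('v::finite, 'k::field) mpoly set \<Rightarrow> nat \<Rightarrow> int" where
  "affine_HF P n = int (pm.dim (upto_deg n :: ('v, 'k) mpoly set)) - int (pm.dim (P \<inter> upto_deg n))"

lemma fin_span_Int_upto: "fin_span (P \<inter> upto_deg n)"
  by (rule fin_span_subset[OF fin_span_upto_deg]) auto

lemma affine_HF_antimono: "P \<subseteq> Q \<Longrightarrow> affine_HF Q n \<le> affine_HF P n"
  unfolding affine_HF_def using dim_mono_fin[OF fin_span_Int_upto, of "P \<inter> upto_deg n" Q n] by auto

lemma affine_HF_pos: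
  fixes P :: "('v::finite, 'k::field) mpoly set"
  assumes "is_ideal P" "1 \<notin> P" shows "1 \<le> affine_HF P n"
proof (rule ccontr)
  assume "\<not> ?thesis"
  then have "P \<inter> upto_deg n = upto_deg n"
    by (intro subspace_dim_equal_fin[OF fin_span_upto_deg] pm.subspace_inter
        pm_subspace_of_ideal[OF assms(1)] subspace_upto_deg) (auto simp: affine_HF_def)
  moreover have "(1 :: ('v, 'k) mpoly) \<in> upto_deg n" by (simp add: upto_deg_def supp_in_def)
  ultimately show False using assms(2) by auto
qed

text \<open>
  Multiplication by \<open>f \<in> Q - P\<close> embeds \<open>S/P\<close> into \<open>Q/P\<close>, so the growth of the Hilbert function
  drops by one degree at every step of a chain of primes.
\<close>

lemma affine_HF_step:
  fixes P Q :: "('v::finite, 'k::field) mpoly set"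
  assumes P: "prime_ideal P" and Q: "is_ideal Q" "P \<subseteq> Q" "f \<in> Q" "f \<notin> P" and f: "f \<in> upto_deg e"
  shows "affine_HF Q (n + e) + affine_HF P n \<le> affine_HF P (n + e)"
proof -
  have iP: "is_ideal P" using P by (simp add: prime_ideal_def)
  obtain q :: "('v, 'k) mpoly \<Rightarrow> ('v, 'k) mpoly" where q: "pm_linear q" "\<And>x. q x = 0 \<longleftrightarrow> x \<in> P"
    by (rule exists_linear_with_kernel[OF pm_subspace_of_ideal[OF iP]]) (rule that)
  let ?Q = "Q \<inter> upto_deg (n + e)" and ?h = "q \<circ> (\<lambda>p. f * p)"
  have sQ: "pm.subspace ?Q" by (intro pm.subspace_inter pm_subspace_of_ideal Q subspace_upto_deg)
  have "{x\<in>?Q. q x = 0} = P \<inter> upto_deg (n + e)" using Q(2) q(2) by auto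
  then have 1: "pm.dim ?Q = pm.dim (P \<inter> upto_deg (n + e)) + pm.dim (q ` ?Q)"
    using dim_kernel_image[OF q(1) sQ fin_span_Int_upto] by simp
  have "{g\<in>upto_deg n. ?h g = 0} = P \<inter> upto_deg n"
    using q(2) P Q(4) idl.subspace_scale[OF iP] by (auto simp: prime_ideal_def)
  then have 2: "pm.dim (upto_deg n :: ('v, 'k) mpoly set) = pm.dim (P \<inter> upto_deg n) + pm.dim (?h ` upto_deg n)"
    using dim_kernel_image[OF Vector_Spaces.linear_compose[OF pm_linear_mult[of f] q(1)] subspace_upto_deg fin_span_upto_deg]
    by simp
  have "pm.dim (?h ` upto_deg n) \<le> pm.dim (q ` ?Q)"
  proof (rule dim_mono_fin)
    obtain D where D: "finite D" "?Q \<subseteq> pm.span D"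
      using fin_span_Int_upto[of Q "n + e"] unfolding fin_span_def by (elim exE conjE)
    then have "finite (q ` D)" "q ` ?Q \<subseteq> pm.span (q ` D)"
      using pmp.linear_span_image[OF q(1), of D] by auto
    then show "fin_span (q ` ?Q)" unfolding fin_span_def by (intro exI conjI)
    have "f * g \<in> ?Q" if g: "g \<in> upto_deg n" for g
    proof
      show "f * g \<in> Q" using idl.subspace_scale[OF Q(1,3), of g] by (simp add: mult.commute)
      have "dg t \<le> n + e" if t: "t \<in> Poly_Mapping.keys (f * g)" for t
      proof -
        from keys_times[OF t] obtain a b where ab: "a \<in> Poly_Mapping.keys f" "b \<in> Poly_Mapping.keys g" "t = a + b"
          by (elim bexE)
        have "dg a \<le> e" "dg b \<le> n" using ab(1,2) f g by (auto simp: upto_deg_def supp_in_def)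
        then show ?thesis using ab(3) by simp
      qed
      then show "f * g \<in> upto_deg (n + e)" by (auto simp: upto_deg_def supp_in_def)
    qed
    then show "?h ` upto_deg n \<subseteq> q ` ?Q" by auto
  qed
  then show ?thesis using 1 2 by (simp add: affine_HF_def)
qed

text \<open>By \<open>affine_HF_step\<close> every strict inclusion adds one summation over
  multiples of \<open>e\<close>; \<open>r\<close> of them accumulate to a binomial coefficient
  through Pascal's rule.\<close>

lemma prime_chain_growth:
  fixes P :: "nat \<Rightarrow> ('v::finite, 'k::field) mpoly set"
  assumes "\<And>i. i \<le> r \<Longrightarrow> prime_ideal (P i)" "\<And>i. i < r \<Longrightarrow> P i \<subset> P (Suc i)"
  shows "\<exists>e\<ge>1. \<forall>k. int ((k + r) choose r) \<le> affine_HF (P 0) (k * e)"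
proof -
  define f where "f i = (SOME x. x \<in> P (Suc i) \<and> x \<notin> P i)" for i
  have "f i \<in> P (Suc i) \<and> f i \<notin> P i" if "i < r" for i
    unfolding f_def by (rule someI_ex) (use assms(2)[OF that] in auto)
  then have f: "\<And>i. i < r \<Longrightarrow> f i \<in> P (Suc i)" "\<And>i. i < r \<Longrightarrow> f i \<notin> P i" by auto
  define D where "D i = Max (insert 0 (dg ` Poly_Mapping.keys (f i)))" for i
  \<comment> \<open>A common degree bound for elements separating consecutive primes;
    \<open>Suc\<close> keeps it positive.\<close>
  define e where "e = Suc (\<Sum>i<r. D i)"
  have fe: "f i \<in> upto_deg e" if "i < r" for i
  proof -
    have "D i \<le> (\<Sum>i<r. D i)" by (rule member_le_sum) (use that in auto)
    moreover have "dg t \<le> D i" if "t \<in> Poly_Mapping.keys (f i)" for t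
      unfolding D_def by (rule Max_ge) (use that in auto)
    ultimately have "dg t \<le> e" if "t \<in> Poly_Mapping.keys (f i)" for t
      using that unfolding e_def by fastforce
    then show ?thesis by (auto simp: upto_deg_def supp_in_def)
  qed
  have pos: "1 \<le> affine_HF (P i) n" if "i \<le> r" for i n
    using affine_HF_pos[of "P i"] assms(1)[OF that] by (simp add: prime_ideal_def)
  have "i \<le> r \<Longrightarrow> int ((k + i) choose i) \<le> affine_HF (P (r - i)) (k * e)" for i k
  proof (induction i arbitrary: k)
    case 0
    then show ?case using pos[of r] by simp
  next
    case (Suc i)
    note outer = Suc.IH and ir = Suc.prems
    have s: "Suc (r - Suc i) = r - i" "r - Suc i < r" using Suc.prems by auto
    show ?case
    proof (induction k)
      case 0
      then show ?case using pos[of "r - Suc i" 0] by simp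
    next
      case (Suc k)
      have "affine_HF (P (r - i)) (k * e + e) + affine_HF (P (r - Suc i)) (k * e)
          \<le> affine_HF (P (r - Suc i)) (k * e + e)"
      proof (rule affine_HF_step)
        show "prime_ideal (P (r - Suc i))" using assms(1) by simp
        show "is_ideal (P (r - i))" using assms(1)[of "r - i"] by (simp add: prime_ideal_def)
        show "P (r - Suc i) \<subseteq> P (r - i)" using assms(2)[OF s(2)] s(1) by auto
        show "f (r - Suc i) \<in> P (r - i)" using f(1)[OF s(2)] s(1) by simp
        show "f (r - Suc i) \<notin> P (r - Suc i)" by (rule f(2)[OF s(2)])
        show "f (r - Suc i) \<in> upto_deg e" by (rule fe[OF s(2)])
      qed
      moreover have "int ((Suc k + i) choose i) \<le> affine_HF (P (r - i)) (k * e + e)"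
        using outer[of "Suc k"] ir by (simp add: add.commute)
      ultimately show ?case using Suc.IH by (simp add: add.commute)
    qed
  qed
  from this[of r] show ?thesis by (intro exI[of _ e]) (simp add: e_def)
qed

lemma power_le_choose: "(k + 1) ^ m \<le> ((k + m) choose m) * fact m"
proof (induction m)
  case (Suc m)
  have "(k + 1) ^ Suc m \<le> (k + Suc m) * (((k + m) choose m) * fact m)"
    using mult_mono[OF _ Suc, of "k + 1" "k + Suc m"] by simp
  also have "\<dots> = (Suc (k + m) * ((k + m) choose m)) * fact m" by (simp only: mult.assoc add_Suc_right)
  also have "Suc (k + m) * ((k + m) choose m) = (Suc (k + m) choose Suc m) * Suc m"
    by (rule Suc_times_binomial_eq)
  finally show ?case by (simp only: fact_Suc of_nat_id add_Suc_right mult.assoc)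
qed simp

text \<open>A support \<open>G\<close> admits at most \<open>(n + 1) ^ card G\<close> monomials, so
  the growth is of order at most \<open>d\<close>. Set against \<open>prime_chain_growth\<close>
  this bounds the length of chains.\<close>

lemma card_monomials_le:
  fixes \<Delta> :: "'v::finite set set"
  assumes "\<And>F. F \<in> \<Delta> \<Longrightarrow> card F \<le> d"
  shows "card {t. dg t \<le> n \<and> Poly_Mapping.keys t \<in> \<Delta>} \<le> card \<Delta> * (n + 1) ^ d"
proof -
  let ?M = "\<lambda>G. {t :: 'v \<Rightarrow>\<^sub>0 nat. dg t \<le> n \<and> Poly_Mapping.keys t = G}"
  have "card (?M G) \<le> (n + 1) ^ d" if "G \<in> \<Delta>" for G
  proof -
    have "card (?M G) \<le> card (PiE G (\<lambda>_. {..n}))"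
    proof (rule card_inj_on_le[of "\<lambda>t. restrict (Poly_Mapping.lookup t) G"])
      show "inj_on (\<lambda>t. restrict (Poly_Mapping.lookup t) G) (?M G)"
      proof (rule inj_onI, rule poly_mapping_eqI)
        fix s t :: "'v \<Rightarrow>\<^sub>0 nat" and v
        assume s: "s \<in> ?M G" and t: "t \<in> ?M G" and e: "restrict (Poly_Mapping.lookup s) G = restrict (Poly_Mapping.lookup t) G"
        show "Poly_Mapping.lookup s v = Poly_Mapping.lookup t v"
        proof (cases "v \<in> G")
          case True
          then show ?thesis using fun_cong[OF e, of v] by simp
        next
          case False
          then have "v \<notin> Poly_Mapping.keys s" "v \<notin> Poly_Mapping.keys t" using s t by auto
          then show ?thesis by (simp add: in_keys_iff)
        qed
      qed
      have "Poly_Mapping.lookup t v \<le> n" if "dg t \<le> n" for t :: "'v \<Rightarrow>\<^sub>0 nat" and v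
        using that le_fdeg[of "Poly_Mapping.lookup t" v] by (simp add: dg_eq_fdeg)
      then show "(\<lambda>t. restrict (Poly_Mapping.lookup t) G) ` ?M G \<subseteq> PiE G (\<lambda>_. {..n})" by auto
      show "finite (PiE G (\<lambda>_. {..n}))" by (rule finite_PiE) auto
    qed
    also have "\<dots> = (n + 1) ^ card G" by (simp add: card_PiE)
    also have "\<dots> \<le> (n + 1) ^ d" by (rule power_increasing) (use assms that in auto)
    finally show ?thesis .
  qed
  then have "(\<Sum>G\<in>\<Delta>. card (?M G)) \<le> of_nat (card \<Delta>) * (n + 1) ^ d" by (rule sum_bounded_above)
  moreover have "{t. dg t \<le> n \<and> Poly_Mapping.keys t \<in> \<Delta>} = (\<Union>G\<in>\<Delta>. ?M G)" by auto
  moreover have "card (\<Union>G\<in>\<Delta>. ?M G) \<le> (\<Sum>G\<in>\<Delta>. card (?M G))" by (rule card_UN_le) auto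
  ultimately show ?thesis by simp
qed

section \<open>Face primes and the dimension of the Stanley-Reisner ring\<close>

lemma dim_Int_monomials:
  fixes X Y :: "('v \<Rightarrow>\<^sub>0 nat) set"
  assumes "finite X"
  shows "int (pm.dim (supp_in X :: ('v, 'k::field) mpoly set)) - int (pm.dim (supp_in Y \<inter> supp_in X :: ('v, 'k) mpoly set))
    = int (card (X - Y))"
proof -
  have "supp_in Y \<inter> supp_in X = (supp_in (X \<inter> Y) :: ('v, 'k) mpoly set)" by (auto simp: supp_in_def)
  moreover have "card X = card (X \<inter> Y) + card (X - Y)" using assms by (metis card_Int_Diff)
  ultimately show ?thesis using assms by (simp add: dim_supp_in)
qed

text \<open>Setting the variables outside \<open>W\<close> to zero is a ring homomorphism; its
  kernel \<open>face_prime W\<close> is prime for this reason.\<close>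

lemma restr_face_mult:
  fixes a b :: "('v::{finite,linorder}, 'k::field) mpoly"
  shows "restr (\<lambda>t. Poly_Mapping.keys t \<subseteq> W) (a * b) =
    restr (\<lambda>t. Poly_Mapping.keys t \<subseteq> W) a * restr (\<lambda>t. Poly_Mapping.keys t \<subseteq> W) b"
proof -
  let ?R = "restr (\<lambda>t. Poly_Mapping.keys t \<subseteq> W)" and ?O = "restr (\<lambda>t. \<not> Poly_Mapping.keys t \<subseteq> W)"
  have s: "p = ?R p + ?O p" for p :: "('v, 'k) mpoly"
    by (rule poly_mapping_eqI) (simp add: lookup_restr Poly_Mapping.lookup_add)
  have O: "?R (?O p * q) = 0" for p q :: "('v, 'k) mpoly"
  proof (rule poly_mapping_eqI)
    fix t
    have "t \<notin> Poly_Mapping.keys (?R (?O p * q))"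
    proof
      assume "t \<in> Poly_Mapping.keys (?R (?O p * q))"
      then have t: "t \<in> Poly_Mapping.keys (?O p * q)" "Poly_Mapping.keys t \<subseteq> W" by (auto simp: keys_restr)
      from keys_times[OF t(1)] obtain u v where "u \<in> Poly_Mapping.keys (?O p)" "v \<in> Poly_Mapping.keys q" "t = u + v"
        by (elim bexE)
      then show False using t(2) by (simp add: keys_restr keys_plus_nat)
    qed
    then show "Poly_Mapping.lookup (?R (?O p * q)) t = Poly_Mapping.lookup 0 t" by (simp add: in_keys_iff)
  qed
  have R: "?R (?R a * ?R b) = ?R a * ?R b"
  proof (rule restr_id)
    fix t assume "t \<in> Poly_Mapping.keys (?R a * ?R b)"
    from keys_times[OF this] obtain u v where "u \<in> Poly_Mapping.keys (?R a)" "v \<in> Poly_Mapping.keys (?R b)" "t = u + v"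
      by (elim bexE)
    then show "Poly_Mapping.keys t \<subseteq> W" by (auto simp: keys_restr keys_plus_nat)
  qed
  have "a * b = ?R a * b + ?O a * b"
    by (rule trans[OF arg_cong[OF s[of a], of "\<lambda>x. x * b"]]) (rule distrib_right)
  also have "?R a * b = ?R a * ?R b + ?O b * ?R a"
    by (rule trans[OF arg_cong[OF s[of b], of "\<lambda>x. ?R a * x"]]) (simp only: distrib_left mult.commute[of "?O b"])
  finally have "a * b = ?R a * ?R b + (?O b * ?R a + ?O a * b)" by (simp only: add.assoc)
  then have "?R (a * b) = ?R (?R a * ?R b) + (?R (?O b * ?R a) + ?R (?O a * b))"
    by (simp only: restr_add)
  then show ?thesis by (simp add: O R)
qed

definition face_prime :: "'v::{finite,linorder} set \<Rightarrow> ('v, 'k::field) mpoly set" where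
  "face_prime W = {p. \<forall>t\<in>Poly_Mapping.keys p. \<not> Poly_Mapping.keys t \<subseteq> W}"

lemma face_prime_iff: "p \<in> face_prime W \<longleftrightarrow> restr (\<lambda>t. Poly_Mapping.keys t \<subseteq> W) p = 0"
proof -
  have "restr (\<lambda>t. Poly_Mapping.keys t \<subseteq> W) p = 0 \<longleftrightarrow>
      Poly_Mapping.keys (restr (\<lambda>t. Poly_Mapping.keys t \<subseteq> W) p) = {}" by simp
  then show ?thesis by (auto simp: face_prime_def keys_restr)
qed

lemma prime_face_prime: "prime_ideal (face_prime W :: ('v::{finite,linorder}, 'k::field) mpoly set)"
  unfolding prime_ideal_def
proof (intro conjI allI impI)
  show "is_ideal (face_prime W :: ('v, 'k) mpoly set)"
    by (rule is_idealI) (simp_all add: face_prime_iff restr_add restr_face_mult)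
  show "(1 :: ('v, 'k) mpoly) \<notin> face_prime W" by (simp add: face_prime_def)
  show "a \<in> face_prime W \<or> b \<in> face_prime W" if "a * b \<in> face_prime W" for a b :: "('v, 'k) mpoly"
    using that by (simp add: face_prime_iff restr_face_mult)
qed

context
  fixes \<Delta> :: "'v::{finite,linorder} set set"
  assumes down: "\<And>F G. F \<in> \<Delta> \<Longrightarrow> G \<subseteq> F \<Longrightarrow> G \<in> \<Delta>"
begin

lemma fideal_empty_eq: "fideal \<Delta> {} = supp_in {t. Poly_Mapping.keys t \<notin> \<Delta>}"
  by (auto simp: fideal_def supp_in_def)

lemma krull_dim_le:
  assumes "\<And>F. F \<in> \<Delta> \<Longrightarrow> card F \<le> d"
  shows "krull_dim_quotient (fideal \<Delta> {} :: ('v, 'k::field) mpoly set) \<le> enat d"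
  unfolding krull_dim_quotient_def
proof (rule Sup_least, elim CollectE exE conjE)
  fix x r and P :: "nat \<Rightarrow> ('v, 'k) mpoly set"
  assume x: "x = enat r" and P: "\<forall>i\<le>r. prime_ideal (P i) \<and> fideal \<Delta> {} \<subseteq> P i" "\<forall>i<r. P i \<subset> P (Suc i)"
  obtain e where e: "1 \<le> e" "\<And>k. int ((k + r) choose r) \<le> affine_HF (P 0) (k * e)"
    using prime_chain_growth[of r P] P by auto
  \<comment> \<open>A chain longer than \<open>d\<close> gives
    \<open>(k + 1) ^ Suc d \<le> ?N * (k + 1) ^ d\<close> for every \<open>k\<close>; taking
    \<open>k = ?N\<close> contradicts it.\<close>
  let ?N = "fact (Suc d) * card \<Delta> * e ^ d"
  show "x \<le> enat d"
  proof (rule ccontr)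
    assume "\<not> ?thesis"
    then have r: "Suc d \<le> r" using x by simp
    define k where "k = ?N"
    have "(k + Suc d) choose Suc d = (k + Suc d) choose k"
      using binomial_symmetric[of "Suc d" "k + Suc d"] by simp
    also have "\<dots> \<le> (k + r) choose k" by (rule binomial_right_mono) (use r in simp)
    also have "\<dots> = (k + r) choose r" using binomial_symmetric[of r "k + r"] by simp
    finally have "int ((k + Suc d) choose Suc d) \<le> affine_HF (P 0) (k * e)"
      using e(2)[of k] by linarith
    also have "\<dots> \<le> affine_HF (fideal \<Delta> {} :: ('v, 'k) mpoly set) (k * e)" by (rule affine_HF_antimono) (use P in auto)
    also have "\<dots> = int (card ({t. dg t \<le> k * e} - {t. Poly_Mapping.keys t \<notin> \<Delta>}))"
      unfolding affine_HF_def upto_deg_def fideal_empty_eq by (rule dim_Int_monomials[OF finite_dg_le])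
    also have "{t. dg t \<le> k * e} - {t. Poly_Mapping.keys t \<notin> \<Delta>} = {t. dg t \<le> k * e \<and> Poly_Mapping.keys t \<in> \<Delta>}" by auto
    finally have "(k + Suc d) choose Suc d \<le> card {t. dg t \<le> k * e \<and> Poly_Mapping.keys t \<in> \<Delta>}" by simp
    also have "\<dots> \<le> card \<Delta> * (k * e + 1) ^ d" by (rule card_monomials_le) (rule assms)
    also have "\<dots> \<le> card \<Delta> * (e * (k + 1)) ^ d"
      by (intro mult_left_mono power_mono) (use e(1) in \<open>auto simp: algebra_simps\<close>)
    finally have c: "(k + Suc d) choose Suc d \<le> card \<Delta> * e ^ d * (k + 1) ^ d"
      by (simp only: power_mult_distrib mult.assoc)
    have "(k + 1) ^ Suc d \<le> ((k + Suc d) choose Suc d) * fact (Suc d)" by (rule power_le_choose)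
    also have "\<dots> \<le> (card \<Delta> * e ^ d * (k + 1) ^ d) * fact (Suc d)" by (rule mult_right_mono[OF c]) simp
    also have "\<dots> = ?N * (k + 1) ^ d" by (simp only: mult.assoc mult.commute mult.left_commute)
    finally have "(k + 1) * (k + 1) ^ d \<le> ?N * (k + 1) ^ d" by (simp only: power_Suc)
    then have "k + 1 \<le> ?N" by (simp only: mult_le_cancel2) simp
    then show False by (simp add: k_def)
  qed
qed

text \<open>Removing the vertices of \<open>F\<close> one at a time gives a strictly increasing
  chain of \<open>card F + 1\<close> face primes.\<close>

lemma krull_dim_ge:
  assumes "F \<in> \<Delta>"
  shows "enat (card F) \<le> krull_dim_quotient (fideal \<Delta> {} :: ('v, 'k::field) mpoly set)"
proof -
  obtain e where e: "bij_betw e {0..<card F} F" using ex_bij_betw_nat_finite[of F] by auto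
  define W where "W i = F - e ` {0..<i}" for i
  define P :: "nat \<Rightarrow> ('v, 'k) mpoly set" where "P i = face_prime (W i)" for i
  have W: "W i \<subseteq> F" for i by (auto simp: W_def)
  have "fideal \<Delta> {} \<subseteq> P i" for i
    unfolding P_def face_prime_def fideal_def using down[OF assms subset_trans[OF _ W]] by auto
  moreover have "P i \<subset> P (Suc i)" if i: "i < card F" for i
  proof
    have "W (Suc i) \<subseteq> W i" by (auto simp: W_def)
    then show "P i \<subseteq> P (Suc i)" by (auto simp: P_def face_prime_def)
    have ei: "e i \<in> W i"
    proof -
      have "e i \<in> F" using bij_betwE[OF e] i by simp
      moreover have "e i \<noteq> e k" if "k < i" for k
        using inj_onD[OF bij_betw_imp_inj_on[OF e], of i k] that i by auto
      ultimately show ?thesis unfolding W_def by (metis DiffI atLeastLessThan_iff imageE)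
    qed
    have "e i \<notin> W (Suc i)" by (simp add: W_def)
    then have "var (e i) \<in> P (Suc i)" "var (e i) \<notin> P i"
      using ei by (auto simp: P_def face_prime_def var_def)
    then show "P i \<noteq> P (Suc i)" by auto
  qed
  moreover have "prime_ideal (P i)" for i unfolding P_def by (rule prime_face_prime)
  ultimately have "\<exists>P. (\<forall>i\<le>card F. prime_ideal (P i) \<and> fideal \<Delta> {} \<subseteq> (P i :: ('v, 'k) mpoly set))
     \<and> (\<forall>i<card F. P i \<subset> P (Suc i))"
    by (intro exI[of _ P]) simp
  then have "enat (card F) \<in> {enat r |r. \<exists>P. (\<forall>i\<le>r. prime_ideal (P i) \<and> fideal \<Delta> {} \<subseteq> (P i :: ('v, 'k) mpoly set))
     \<and> (\<forall>i<r. P i \<subset> P (Suc i))}"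
    by (intro CollectI exI[of _ "card F"] conjI refl)
  then show ?thesis unfolding krull_dim_quotient_def by (rule Sup_upper)
qed

end

lemma const_coeff_hom: "Poly_Mapping.lookup (p * q) 0 = Poly_Mapping.lookup p 0 * Poly_Mapping.lookup (q :: ('v::finite, 'k::field) mpoly) 0"
proof -
  have e: "p = Poly_Mapping.single 0 (Poly_Mapping.lookup p 0) + restr (\<lambda>t. t \<noteq> 0) p"
    by (rule poly_mapping_eqI) (auto simp: Poly_Mapping.lookup_add lookup_restr lookup_single when_def)
  have "p * q = pm_scale (Poly_Mapping.lookup p 0) q + restr (\<lambda>t. t \<noteq> 0) p * q"
    using arg_cong[OF e, of "\<lambda>x. x * q"] by (simp only: distrib_right pm_scale_eq_mult)
  moreover have "Poly_Mapping.lookup (restr (\<lambda>t. t \<noteq> 0) p * q) 0 = 0"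
  proof (rule ccontr)
    assume "Poly_Mapping.lookup (restr (\<lambda>t. t \<noteq> 0) p * q) 0 \<noteq> 0"
    then have "0 \<in> Poly_Mapping.keys (restr (\<lambda>t. t \<noteq> 0) p * q)" by (simp add: in_keys_iff)
    from keys_times[OF this] obtain a b where ab: "a \<in> Poly_Mapping.keys (restr (\<lambda>t. t \<noteq> 0) p)"
      "b \<in> Poly_Mapping.keys q" "0 = a + b" by (elim bexE)
    have "dg (a + b) = 0" using ab(3) by (metis dg_0)
    then show False using ab(1) by (simp add: keys_restr dg_eq_0_iff)
  qed
  ultimately show ?thesis by (simp add: Poly_Mapping.lookup_add)
qed

lemma irrelevant_ideal_eq:
  "(irrelevant_ideal :: ('v::{finite,linorder}, 'k::field) mpoly set) = {p. Poly_Mapping.lookup p 0 = 0}"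
proof
  have sub: "is_ideal {p :: ('v, 'k) mpoly. Poly_Mapping.lookup p 0 = 0}"
    by (rule is_idealI) (simp_all add: Poly_Mapping.lookup_add const_coeff_hom)
  show "(irrelevant_ideal :: ('v, 'k) mpoly set) \<subseteq> {p. Poly_Mapping.lookup p 0 = 0}"
    unfolding irrelevant_ideal_def
    by (rule idl.span_minimal[OF _ sub]) (auto simp: var_def lookup_single when_def dest!: arg_cong[of _ _ dg])
  have i: "is_ideal (irrelevant_ideal :: ('v, 'k) mpoly set)" unfolding irrelevant_ideal_def by (rule idl.subspace_span)
  show "{p. Poly_Mapping.lookup p 0 = 0} \<subseteq> (irrelevant_ideal :: ('v, 'k) mpoly set)"
  proof
    fix p :: "('v, 'k) mpoly" assume p: "p \<in> {p. Poly_Mapping.lookup p 0 = 0}"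
    show "p \<in> irrelevant_ideal"
    proof (rule monomial_in_ideal_sum[OF i])
      fix t assume "t \<in> Poly_Mapping.keys p"
      then have "t \<noteq> 0" using p by (auto simp: in_keys_iff)
      then obtain v where v: "Poly_Mapping.lookup t v \<noteq> 0" by (metis lookup_zero poly_mapping_eqI)
      have "t = (t - Poly_Mapping.single v 1) + Poly_Mapping.single v 1"
        by (rule poly_mapping_eqI) (use v in \<open>auto simp: Poly_Mapping.lookup_add lookup_minus lookup_single when_def\<close>)
      then have "Poly_Mapping.single t (1::'k) = Poly_Mapping.single (t - Poly_Mapping.single v 1) 1 * var v"
        by (simp add: var_def mult_single)
      moreover have "var v \<in> (irrelevant_ideal :: ('v, 'k) mpoly set)"
        unfolding irrelevant_ideal_def by (rule idl.span_base) simp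
      ultimately show "Poly_Mapping.single t 1 \<in> (irrelevant_ideal :: ('v, 'k) mpoly set)"
        using idl.subspace_scale[OF i] by simp
    qed
  qed
qed

text \<open>A prime over \<open>J\<close> contains all variables, hence the irrelevant ideal; an
  element with nonzero constant term would put a unit into it. So there is no strict inclusion
  between primes over \<open>J\<close>.\<close>

lemma krull_dim_zero:
  fixes J :: "('v::{finite,linorder}, 'k::field) mpoly set"
  assumes "\<And>v. var v ^ N \<in> J"
  shows "krull_dim_quotient J = 0"
proof -
  have max: "P = irrelevant_ideal" if P: "prime_ideal P" "J \<subseteq> P" for P
  proof
    have iP: "is_ideal P" "1 \<notin> P" and pr: "\<And>a b. a * b \<in> P \<Longrightarrow> a \<in> P \<or> b \<in> P"
      using P(1) unfolding prime_ideal_def by simp_all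
    have "var v \<in> P" for v
    proof -
      have "var v ^ n \<in> P \<Longrightarrow> var v \<in> P" for n
      proof (induction n)
        case 0
        then show ?case using iP(2) by simp
      next
        case (Suc n)
        have d: "var v \<in> P \<or> var v ^ n \<in> P" by (rule pr) (use Suc.prems in simp)
        show ?case
        proof (cases "var v \<in> P")
          case False
          then have "var v ^ n \<in> P" using d by simp
          then show ?thesis by (rule Suc.IH)
        qed
      qed
      from this[OF subsetD[OF P(2) assms]] show ?thesis .
    qed
    then show sub: "irrelevant_ideal \<subseteq> P" unfolding irrelevant_ideal_def by (intro idl.span_minimal[OF _ iP(1)]) auto
    show "P \<subseteq> irrelevant_ideal"
    proof (rule ccontr)
      assume "\<not> ?thesis"
      then obtain p where p: "p \<in> P" "Poly_Mapping.lookup p 0 \<noteq> 0" by (auto simp: irrelevant_ideal_eq)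
      let ?c = "Poly_Mapping.lookup p 0"
      have "p - Poly_Mapping.single 0 ?c \<in> P" using sub by (auto simp: irrelevant_ideal_eq lookup_minus)
      then have "p - (p - Poly_Mapping.single 0 ?c) \<in> P" by (rule idl.subspace_diff[OF iP(1) p(1)])
      then have "Poly_Mapping.single 0 ?c \<in> P" by simp
      then have "Poly_Mapping.single 0 (1 / ?c) * Poly_Mapping.single 0 ?c \<in> P" by (rule idl.subspace_scale[OF iP(1)])
      then show False using iP(2) p(2) by (simp add: mult_single)
    qed
  qed
  have "x \<le> 0" if asm: "x \<in> {enat r |r. \<exists>P. (\<forall>i\<le>r. prime_ideal (P i) \<and> J \<subseteq> P i) \<and> (\<forall>i<r. P i \<subset> P (Suc i))}" for x
  proof -
    obtain r P where r: "x = enat r" "\<forall>i\<le>r. prime_ideal (P i) \<and> J \<subseteq> P i" "\<forall>i<r. P i \<subset> P (Suc i)"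
      using asm by (elim CollectE exE conjE) (rule that)
    have "r = 0"
    proof (rule ccontr)
      assume "r \<noteq> 0"
      then have "P 0 \<subset> P (Suc 0)" "P 0 = irrelevant_ideal" "P (Suc 0) = irrelevant_ideal"
        using r max[of "P 0"] max[of "P (Suc 0)"] by auto
      then show False by simp
    qed
    then show ?thesis using r by (simp add: zero_enat_def)
  qed
  then have "krull_dim_quotient J \<le> 0" unfolding krull_dim_quotient_def by (rule Sup_least)
  then show ?thesis by simp
qed

section \<open>Regular sequences on stars\<close>

text \<open>Division by \<open>var v\<close>, dropping the monomials without it: a left inverse of
  multiplication that commutes with every form free of \<open>v\<close>.\<close>

definition dv :: "'v \<Rightarrow> ('v, 'k::field) mpoly \<Rightarrow> ('v, 'k) mpoly" where
  "dv v = Poly_Mapping.map_key (\<lambda>t. Poly_Mapping.single v 1 + t)"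

lemma lookup_dv: "Poly_Mapping.lookup (dv v p) t = Poly_Mapping.lookup p (Poly_Mapping.single v 1 + t)"
  unfolding dv_def by (subst map_key.rep_eq) (simp_all add: inj_def comp_def)

lemma dv_simps: "dv v (p + q) = dv v p + dv v q" "dv v 0 = 0" "dv v (pm_scale a p) = pm_scale a (dv v p)"
  by (rule poly_mapping_eqI, simp add: lookup_dv Poly_Mapping.lookup_add)+

lemma dv_sum: "dv v (sum f A) = (\<Sum>x\<in>A. dv v (f x))"
  by (induction A rule: infinite_finite_induct) (simp_all add: dv_simps)

lemma dv_var_mult_same: "dv v (var v * p) = p"
  by (rule poly_mapping_eqI) (simp only: lookup_dv lookup_var_mult)

lemma dv_var_mult:
  assumes "w \<noteq> v" shows "dv v (var w * p) = var w * dv v p"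
proof (rule poly_mapping_eqI)
  fix t
  show "Poly_Mapping.lookup (dv v (var w * p)) t = Poly_Mapping.lookup (var w * dv v p) t"
  proof (cases "Poly_Mapping.lookup t w = 0")
    case True
    have "t \<noteq> Poly_Mapping.single w 1 + u" for u
      using True by (metis Poly_Mapping.lookup_add add_is_0 lookup_single_eq one_neq_zero)
    moreover have "Poly_Mapping.single v 1 + t \<noteq> Poly_Mapping.single w 1 + u" for u
    proof
      assume "Poly_Mapping.single v 1 + t = Poly_Mapping.single w 1 + u"
      then have "Poly_Mapping.lookup (Poly_Mapping.single v 1 + t) w = Poly_Mapping.lookup (Poly_Mapping.single w 1 + u) w"
        by (rule arg_cong)
      then show False using True assms by (simp add: Poly_Mapping.lookup_add lookup_single when_def)
    qed
    ultimately show ?thesis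
      by (simp only: lookup_dv lookup_var_mult_0[of t w "dv v p"]
          lookup_var_mult_0[of "Poly_Mapping.single v 1 + t" w p] simp_thms)
  next
    case False
    have t: "t = Poly_Mapping.single w 1 + (t - Poly_Mapping.single w 1)"
      by (rule poly_mapping_eqI)
        (use False in \<open>auto simp: Poly_Mapping.lookup_add lookup_minus lookup_single when_def\<close>)
    define u where "u = t - Poly_Mapping.single w 1"
    have tu: "t = Poly_Mapping.single w 1 + u" using t by (simp only: u_def)
    have c: "Poly_Mapping.single v 1 + t = Poly_Mapping.single w 1 + (Poly_Mapping.single v 1 + u)"
      unfolding tu by (rule add.left_commute)
    show ?thesis unfolding lookup_dv c lookup_var_mult unfolding tu lookup_var_mult lookup_dv ..
  qed
qed

lemma dv_lin_mult: "c v = 0 \<Longrightarrow> dv v (lin c * p) = lin c * dv v p"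
  unfolding lin_mult dv_sum
proof (rule sum.cong)
  fix w assume "c v = 0"
  then show "dv v (pm_scale (c w) (var w * p)) = pm_scale (c w) (var w * dv v p)"
    by (cases "w = v") (simp_all add: dv_simps dv_var_mult)
qed simp

lemma dv_fideal: "p \<in> fideal \<Delta> F \<Longrightarrow> v \<in> F \<Longrightarrow> dv v p \<in> fideal \<Delta> F"
  unfolding fideal_def
proof (intro CollectI ballI)
  fix t assume p: "p \<in> {p. \<forall>t\<in>Poly_Mapping.keys p. Poly_Mapping.keys t \<union> F \<notin> \<Delta>}" and v: "v \<in> F"
    and "t \<in> Poly_Mapping.keys (dv v p)"
  then have "Poly_Mapping.single v 1 + t \<in> Poly_Mapping.keys p" by (simp only: in_keys_iff lookup_dv) simp
  then have "Poly_Mapping.keys (Poly_Mapping.single v (1::nat) + t) \<union> F \<notin> \<Delta>" using p by blast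
  moreover have "Poly_Mapping.keys (Poly_Mapping.single v (1::nat) + t) \<union> F = Poly_Mapping.keys t \<union> F"
    using v by (simp add: keys_plus_nat insert_absorb)
  ultimately show "Poly_Mapping.keys t \<union> F \<notin> \<Delta>" by simp
qed

lemma dv_gens:
  assumes "v \<in> F" "\<And>l. l < i \<Longrightarrow> c l v = 0" "p \<in> gens (fideal \<Delta> F) (\<lambda>l. lin (c l)) i"
  shows "dv v p \<in> gens (fideal \<Delta> F) (\<lambda>l. lin (c l)) i"
  using assms(2,3)
proof (induction i arbitrary: p)
  case 0
  then show ?case using dv_fideal[OF _ assms(1)] by simp
next
  case (Suc i)
  from Suc.prems(2) obtain u g where p: "p = u + lin (c i) * g" "u \<in> gens (fideal \<Delta> F) (\<lambda>l. lin (c l)) i"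
    unfolding gens.simps by (rule adjE)
  have "dv v p = dv v u + lin (c i) * dv v g" using p(1) Suc.prems(1) by (simp add: dv_simps dv_lin_mult)
  moreover have "dv v u \<in> gens (fideal \<Delta> F) (\<lambda>l. lin (c l)) i" by (rule Suc.IH) (use Suc.prems p in auto)
  ultimately show ?case by (simp add: adjI)
qed

lemma restr_gens:
  assumes "\<And>l t w. l < i \<Longrightarrow> c l w \<noteq> 0 \<Longrightarrow> P (Poly_Mapping.single w 1 + t) \<longleftrightarrow> P t"
    and "p \<in> gens (fideal \<Delta> F) (\<lambda>l. lin (c l)) i"
  shows "restr P p \<in> gens (fideal \<Delta> F) (\<lambda>l. lin (c l)) i"
  using assms
proof (induction i arbitrary: p)
  case 0
  then show ?case by (simp add: fideal_restr)
next
  case (Suc i)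
  from Suc.prems(2) obtain u g where p: "p = u + lin (c i) * g" "u \<in> gens (fideal \<Delta> F) (\<lambda>l. lin (c l)) i"
    unfolding gens.simps by (rule adjE)
  have "restr P (lin (c i) * g) = lin (c i) * restr P g" by (rule restr_lin_mult) (rule Suc.prems(1)[OF lessI])
  then have "restr P p = restr P u + lin (c i) * restr P g" using p(1) by (simp add: restr_add)
  moreover have "restr P u \<in> gens (fideal \<Delta> F) (\<lambda>l. lin (c l)) i"
    by (rule Suc.IH[OF _ p(2)]) (use Suc.prems(1) less_SucI in blast)
  ultimately show ?case by (simp add: adjI)
qed

text \<open>\<open>dv v\<close> undoes the multiplication and preserves the ideal: the forms are
  free of \<open>v\<close>, and for \<open>v\<close> in \<open>F\<close> the star ideal does not see
  the exponent of \<open>v\<close>.\<close>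

lemma gens_var_cancel:
  assumes "v \<in> F" "\<And>l. l < i \<Longrightarrow> c l v = 0" "var v * p \<in> gens (fideal \<Delta> F) (\<lambda>l. lin (c l)) i"
  shows "p \<in> gens (fideal \<Delta> F) (\<lambda>l. lin (c l)) i"
  using dv_gens[OF assms] by (simp only: dv_var_mult_same)

lemma gens_prod_cancel:
  assumes "finite A" "A \<subseteq> F" "\<And>l v. l < i \<Longrightarrow> v \<in> F \<Longrightarrow> c l v = 0"
    and "(\<Prod>v\<in>A. var v) * p \<in> gens (fideal \<Delta> F) (\<lambda>l. lin (c l)) i"
  shows "p \<in> gens (fideal \<Delta> F) (\<lambda>l. lin (c l)) i"
  using assms(1,2,4)
proof (induction A arbitrary: p rule: finite_induct)
  case (insert v A)
  have "var v * ((\<Prod>v\<in>A. var v) * p) \<in> gens (fideal \<Delta> F) (\<lambda>l. lin (c l)) i"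
    using insert.prems(2) by (simp only: prod.insert[OF insert.hyps] mult.assoc)
  then have "(\<Prod>v\<in>A. var v) * p \<in> gens (fideal \<Delta> F) (\<lambda>l. lin (c l)) i"
    by (rule gens_var_cancel[rotated 2]) (use insert.prems(1) assms(3) in auto)
  then show ?case using insert.IH insert.prems(1) by simp
qed simp

text \<open>
  Modulo an ideal that is homogeneous in \<open>x\<^sub>v\<close> and on which \<open>x\<^sub>v\<close> is regular, \<open>x\<^sub>v + \<phi>\<close> is regular
  for every form \<open>\<phi>\<close> free of \<open>x\<^sub>v\<close>: compare coefficients, starting from the top power of \<open>x\<^sub>v\<close>.
\<close>

lemma nonzerodiv_monic:
  fixes c :: "nat \<Rightarrow> 'v::{finite,linorder} \<Rightarrow> 'k::field"
  assumes down: "\<And>F G. F \<in> \<Delta> \<Longrightarrow> G \<subseteq> F \<Longrightarrow> G \<in> \<Delta>"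
    and v: "v \<in> F" and c: "\<And>l. l < i \<Longrightarrow> c l v = 0" and b: "b v = 1"
  shows "nonzerodiv (gens (fideal \<Delta> F) (\<lambda>l. lin (c l)) i) (lin b)"
  unfolding nonzerodiv_def
proof (intro allI impI)
  let ?J = "gens (fideal \<Delta> F) (\<lambda>l. lin (c l)) i"
  fix g assume g: "lin b * g \<in> ?J"
  have J: "is_ideal ?J" by (rule gens_ideal[OF fideal_ideal]) (rule down)
  let ?R = "\<lambda>k. restr (\<lambda>t. Poly_Mapping.lookup t v = k)"
  define \<phi> where "\<phi> = b(v := 0)"
  have split: "lin b * p = var v * p + lin \<phi> * p" for p
  proof -
    have "lin b * p = pm_scale (b v) (var v * p) + (\<Sum>w\<in>UNIV - {v}. pm_scale (b w) (var w * p))"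
      unfolding lin_mult by (rule sum.remove) auto
    moreover have "lin \<phi> * p = pm_scale (\<phi> v) (var v * p) + (\<Sum>w\<in>UNIV - {v}. pm_scale (\<phi> w) (var w * p))"
      unfolding lin_mult by (rule sum.remove) auto
    moreover have "(\<Sum>w\<in>UNIV - {v}. pm_scale (\<phi> w) (var w * p)) = (\<Sum>w\<in>UNIV - {v}. pm_scale (b w) (var w * p))"
      by (rule sum.cong) (auto simp: \<phi>_def)
    ultimately show ?thesis using b by (simp add: \<phi>_def)
  qed
  have RJ: "?R k p \<in> ?J" if p: "p \<in> ?J" for k p
  proof (rule restr_gens[OF _ p])
    fix l t w assume "l < i" "c l w \<noteq> 0"
    then have "w \<noteq> v" using c by auto
    then show "(Poly_Mapping.lookup (Poly_Mapping.single w 1 + t) v = k) = (Poly_Mapping.lookup t v = k)"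
      by (simp add: Poly_Mapping.lookup_add lookup_single when_def)
  qed
  have top: "var v * ?R k g + lin \<phi> * ?R (Suc k) g \<in> ?J" for k
  proof -
    have 1: "?R (Suc k) (var v * g) = var v * ?R k g"
      by (rule restr_var_mult) (simp add: Poly_Mapping.lookup_add)
    have 2: "?R (Suc k) (lin \<phi> * g) = lin \<phi> * ?R (Suc k) g"
    proof (rule restr_lin_mult)
      fix w t assume "\<phi> w \<noteq> 0"
      then have "w \<noteq> v" by (auto simp: \<phi>_def)
      then show "(Poly_Mapping.lookup (Poly_Mapping.single w 1 + t) v = Suc k) = (Poly_Mapping.lookup t v = Suc k)"
        by (simp add: Poly_Mapping.lookup_add lookup_single when_def)
    qed
    show ?thesis using RJ[OF g, of "Suc k"] unfolding split restr_add 1 2 .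
  qed
  define N where "N = Suc (Max (insert 0 ((\<lambda>t. Poly_Mapping.lookup t v) ` Poly_Mapping.keys g)))"
  have N: "Poly_Mapping.lookup t v < N" if "t \<in> Poly_Mapping.keys g" for t
    unfolding N_def less_Suc_eq_le by (rule Max_ge) (use that in auto)
  have "?R N g = 0"
  proof (rule poly_mapping_eqI)
    fix t
    show "Poly_Mapping.lookup (?R N g) t = Poly_Mapping.lookup 0 t"
      using N[of t] by (auto simp: lookup_restr in_keys_iff)
  qed
  then have RN: "?R N g \<in> ?J" using idl.subspace_0[OF J] by simp
  have all: "k \<le> N \<Longrightarrow> ?R k g \<in> ?J" for k
  proof (induction rule: inc_induct)
    case base
    show ?case by (rule RN)
  next
    case (step k)
    have "lin \<phi> * ?R (Suc k) g \<in> ?J" by (rule idl.subspace_scale[OF J step.IH])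
    from idl.subspace_diff[OF J top[of k] this] have "var v * ?R k g \<in> ?J" by simp
    then show ?case by (rule gens_var_cancel[where v = v and F = F, rotated 2]) (rule v, rule c)
  qed
  have "g = (\<Sum>k<N. ?R k g)"
  proof (rule poly_mapping_eqI)
    fix t
    have "Poly_Mapping.lookup (\<Sum>k<N. ?R k g) t = (\<Sum>k<N. if k = Poly_Mapping.lookup t v then Poly_Mapping.lookup g t else 0)"
      unfolding Poly_Mapping.lookup_sum by (rule sum.cong) (simp_all add: lookup_restr)
    also have "\<dots> = (if Poly_Mapping.lookup t v < N then Poly_Mapping.lookup g t else 0)"
      by (simp add: sum.delta)
    also have "\<dots> = Poly_Mapping.lookup g t"
      using N[of t] by (auto simp: in_keys_iff)
    finally show "Poly_Mapping.lookup g t = Poly_Mapping.lookup (\<Sum>k<N. ?R k g) t" ..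
  qed
  moreover have "(\<Sum>k<N. ?R k g) \<in> ?J" by (rule idl.subspace_sum[OF J]) (simp add: all)
  ultimately show "g \<in> ?J" by simp
qed

section \<open>The forms on the moment curve and their parameter property\<close>

lemma lin_add: "lin (\<lambda>w. a w + b w) = lin a + lin b"
  unfolding lin_def by (simp add: single_add sum.distrib)

lemma lin_scale: "lin (\<lambda>w. a * b w) = pm_scale a (lin b)"
  unfolding lin_def by (simp add: pm.scale_sum_right scale_single)

lemma lin_zero: "lin (\<lambda>w. 0) = 0"
  unfolding lin_def by simp

locale moment_curve =
  fixes \<Delta> :: "'v::{finite,linorder} set set" and d :: nat and pt :: "'v \<Rightarrow> 'k::field"
  assumes down: "\<And>F G. F \<in> \<Delta> \<Longrightarrow> G \<subseteq> F \<Longrightarrow> G \<in> \<Delta>"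
    and verts: "\<And>v. {v} \<in> \<Delta>"
    and card_face: "\<And>F. F \<in> \<Delta> \<Longrightarrow> card F \<le> d"
    and top_face: "\<exists>F\<in>\<Delta>. card F = d"
    and inj_pt: "inj pt"
    and buchsbaum: "buchsbaum_quotient (fideal \<Delta> {} :: ('v, 'k) mpoly set)"
begin

text \<open>
  A polynomial of degree less than \<open>d\<close> stands for a form in the span of the \<open>\<theta>\<^sub>l\<close>, and its roots
  for the variables missing from that form.
\<close>

definition LQ :: "'k poly \<Rightarrow> ('v, 'k) mpoly" where
  "LQ q = lin (\<lambda>w. poly q (pt w))"

lemma LQ_add: "LQ (p + q) = LQ p + LQ q"
  by (simp add: LQ_def lin_add)

lemma LQ_smult: "LQ (smult a q) = pm_scale a (LQ q)"
  by (simp add: LQ_def lin_scale)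

lemma LQ_zero: "LQ 0 = 0"
  by (simp add: LQ_def lin_zero)

lemma LQ_sum: "LQ (\<Sum>x\<in>A. f x) = (\<Sum>x\<in>A. LQ (f x))"
  by (induction A rule: infinite_finite_induct) (simp_all add: LQ_add LQ_zero)

lemma LQ_sum_in:
  assumes "is_ideal J" "\<And>x. x \<in> A \<Longrightarrow> LQ (f x) \<in> J"
  shows "LQ (\<Sum>x\<in>A. smult (a x) (f x)) \<in> J"
  unfolding LQ_sum LQ_smult
  by (rule pm.subspace_sum[OF pm_subspace_of_ideal[OF assms(1)]])
    (rule pm.subspace_scale[OF pm_subspace_of_ideal[OF assms(1)] assms(2)])

definition lagr :: "'v set \<Rightarrow> 'v \<Rightarrow> 'k poly" where
  "lagr G v = (\<Prod>u\<in>G - {v}. smult (1 / (pt v - pt u)) [:- pt u, 1:])"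

lemma poly_lagr: "w \<in> G \<Longrightarrow> v \<in> G \<Longrightarrow> poly (lagr G v) (pt w) = (if w = v then 1 else 0)"
proof -
  assume w: "w \<in> G" and v: "v \<in> G"
  have e: "poly (lagr G v) x = (\<Prod>u\<in>G - {v}. (x - pt u) / (pt v - pt u))" for x
    unfolding lagr_def poly_prod by (rule prod.cong) (auto simp: diff_divide_distrib)
  show ?thesis
  proof (cases "w = v")
    case True
    have "(\<Prod>u\<in>G - {v}. (pt v - pt u) / (pt v - pt u)) = 1"
    proof (rule prod.neutral, rule ballI)
      fix u assume "u \<in> G - {v}"
      then have "pt v \<noteq> pt u" using inj_eq[OF inj_pt] by auto
      then show "(pt v - pt u) / (pt v - pt u) = 1" by simp
    qed
    then show ?thesis using True by (simp add: e)
  next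
    case False
    have "(\<Prod>u\<in>G - {v}. (pt w - pt u) / (pt v - pt u)) = 0"
      by (rule prod_zero) (use w False in \<open>auto intro!: bexI[of _ w]\<close>)
    then show ?thesis using False by (simp add: e)
  qed
qed

lemma degree_lagr: "v \<in> G \<Longrightarrow> degree (lagr G v) < card G"
proof -
  assume v: "v \<in> G"
  have "degree (lagr G v) \<le> (\<Sum>u\<in>G - {v}. degree (smult (1 / (pt v - pt u)) [:- pt u, 1:]))"
    unfolding lagr_def by (rule degree_prod_sum_le[unfolded comp_def]) simp
  also have "\<dots> \<le> (\<Sum>u\<in>G - {v}. 1)"
    by (rule sum_mono) (rule order_trans[OF degree_smult_le], simp)
  also have "\<dots> = card G - 1" using v by simp
  finally show ?thesis using v card_gt_0_iff[of G] by fastforce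
qed

definition vanish :: "'v set \<Rightarrow> 'k poly" where
  "vanish G = (\<Prod>u\<in>G. [:- pt u, 1:])"

lemma poly_vanish: "w \<in> G \<Longrightarrow> poly (vanish G) (pt w) = 0"
  unfolding vanish_def poly_prod by (rule prod_zero) (auto intro!: bexI[of _ w])

lemma degree_vanish: "degree (vanish G) = card G"
  unfolding vanish_def by (subst degree_prod_sum_eq) simp_all

lemma vanish_nz: "vanish G \<noteq> 0"
  unfolding vanish_def by (simp add: prod_zero_iff)

lemma lagrange_expansion:
  assumes "degree r < card G" shows "r = (\<Sum>v\<in>G. smult (poly r (pt v)) (lagr G v))"
proof (rule ccontr)
  let ?s = "\<Sum>v\<in>G. smult (poly r (pt v)) (lagr G v)"
  let ?D = "r - ?s"
  assume "r \<noteq> ?s"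
  then have D: "?D \<noteq> 0" by simp
  have G: "0 < card G" using assms by simp
  have "degree ?s \<le> card G - 1"
  proof (rule degree_sum_le)
    fix v assume "v \<in> G"
    then have "degree (lagr G v) < card G" by (rule degree_lagr)
    then show "degree (smult (poly r (pt v)) (lagr G v)) \<le> card G - 1"
      using degree_smult_le[of "poly r (pt v)" "lagr G v"] by linarith
  qed simp
  then have deg: "degree ?D < card G" using degree_diff_le[of r "card G - 1" ?s] assms G by linarith
  have "poly ?D (pt w) = 0" if w: "w \<in> G" for w
  proof -
    have "poly ?s (pt w) = (\<Sum>v\<in>G. if v = w then poly r (pt v) else 0)"
      unfolding poly_sum by (rule sum.cong) (use w poly_lagr in auto)
    then show ?thesis using w by (simp add: sum.delta)
  qed
  then have "pt ` G \<subseteq> {x. poly ?D x = 0}" by auto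
  then have "card (pt ` G) \<le> card {x. poly ?D x = 0}" by (rule card_mono[OF poly_roots_finite[OF D]])
  also have "\<dots> \<le> degree ?D" by (rule card_poly_roots_bound[OF D])
  finally show False using deg card_image[OF inj_on_subset[OF inj_pt subset_UNIV], of G] by simp
qed

definition I0 :: "('v, 'k) mpoly set" where "I0 = fideal \<Delta> {}"

text \<open>Ideal membership stands in for linear spanning: it is what forces high powers of the
  variables into the ideal.\<close>

definition spanning :: "(nat \<Rightarrow> 'k poly) \<Rightarrow> bool" where
  "spanning qs \<longleftrightarrow> (\<forall>q. degree q < d \<longrightarrow> LQ q \<in> gens I0 (\<lambda>l. LQ (qs l)) d)"

lemma I0_ideal: "is_ideal I0"
  unfolding I0_def by (rule fideal_ideal[OF down])

text \<open>A monomial whose degree exceeds the number of vertices has a repeated variable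
  \<open>v\<close>. If its support is a face, the Lagrange form of the support at \<open>v\<close>
  trades one factor \<open>v\<close> for vertices outside the support. So the support grows, and
  once it is no face the monomial lies in \<open>I0\<close>.\<close>

lemma high_degree_in:
  assumes J: "is_ideal J" "I0 \<subseteq> J" "\<And>q. degree q < d \<Longrightarrow> LQ q \<in> J"
    and "CARD('v) < dg t"
  shows "Poly_Mapping.single t 1 \<in> J"
  using assms(4)
proof (induction "CARD('v) - card (Poly_Mapping.keys t)" arbitrary: t rule: less_induct)
  case less
  let ?G = "Poly_Mapping.keys t"
  show ?case
  proof (cases "?G \<in> \<Delta>")
    case False
    then have "Poly_Mapping.single t 1 \<in> I0" by (simp add: I0_def fideal_def)
    then show ?thesis by (rule subsetD[OF J(2)])
  next
    case True
    have "\<exists>v. 2 \<le> Poly_Mapping.lookup t v"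
    proof (rule ccontr)
      assume "\<not> ?thesis"
      then have "Poly_Mapping.lookup t v \<le> 1" for v by (simp add: not_le less_Suc_eq_le numeral_2_eq_2)
      then have "dg t \<le> (\<Sum>v\<in>(UNIV::'v set). 1)" unfolding dg_def by (intro sum_mono) simp
      then show False using less.prems by simp
    qed
    then obtain v where v: "2 \<le> Poly_Mapping.lookup t v" by (rule exE)
    then have vG: "v \<in> ?G" by (simp add: in_keys_iff)
    define u where "u = t - Poly_Mapping.single v 1"
    have t: "t = Poly_Mapping.single v 1 + u"
      unfolding u_def by (rule poly_mapping_eqI)
        (use v in \<open>auto simp: Poly_Mapping.lookup_add lookup_minus lookup_single when_def\<close>)
    have ku: "Poly_Mapping.keys u = ?G"
    proof -
      have "Poly_Mapping.lookup u w \<noteq> 0 \<longleftrightarrow> Poly_Mapping.lookup t w \<noteq> 0" for w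
        using v by (cases "w = v") (simp_all add: u_def lookup_minus lookup_single when_def)
      then show ?thesis by (simp only: set_eq_iff in_keys_iff) simp
    qed
    let ?q = "lagr ?G v"
    let ?rest = "\<Sum>w\<in>UNIV - {v}. pm_scale (poly ?q (pt w)) (Poly_Mapping.single (Poly_Mapping.single w (1::nat) + u) (1::'k))"
    have "LQ ?q \<in> J"
      by (rule J(3)) (use degree_lagr[OF vG] card_face[OF True] in linarith)
    then have "Poly_Mapping.single u 1 * LQ ?q \<in> J" by (rule idl.subspace_scale[OF J(1)])
    moreover have "Poly_Mapping.single u 1 * LQ ?q =
        (\<Sum>w\<in>UNIV. pm_scale (poly ?q (pt w)) (Poly_Mapping.single (Poly_Mapping.single w 1 + u) 1))"
      unfolding LQ_def lin_def sum_distrib_left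
      by (rule sum.cong) (simp_all add: mult_single scale_single add.commute)
    moreover have "\<dots> = pm_scale (poly ?q (pt v)) (Poly_Mapping.single (Poly_Mapping.single v 1 + u) 1)
        + (\<Sum>w\<in>UNIV - {v}. pm_scale (poly ?q (pt w)) (Poly_Mapping.single (Poly_Mapping.single w 1 + u) 1))"
      by (rule sum.remove) auto
    moreover have "\<dots> = Poly_Mapping.single t 1
        + (\<Sum>w\<in>UNIV - {v}. pm_scale (poly ?q (pt w)) (Poly_Mapping.single (Poly_Mapping.single w 1 + u) 1))"
      by (simp only: poly_lagr[OF vG vG] t[symmetric] if_True simp_thms pm.scale_one)
    moreover have "(\<Sum>w\<in>UNIV - {v}. pm_scale (poly ?q (pt w)) (Poly_Mapping.single (Poly_Mapping.single w 1 + u) 1)) \<in> J"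
    proof (rule pm.subspace_sum[OF pm_subspace_of_ideal[OF J(1)]])
      fix w assume w: "w \<in> UNIV - {v}"
      show "pm_scale (poly ?q (pt w)) (Poly_Mapping.single (Poly_Mapping.single w 1 + u) 1) \<in> J"
      proof (cases "w \<in> ?G")
        case True
        then have "poly ?q (pt w) = 0" using poly_lagr[OF True vG] w by simp
        then show ?thesis using idl.subspace_0[OF J(1)] by simp
      next
        case False
        let ?t = "Poly_Mapping.single w (1::nat) + u"
        have k: "Poly_Mapping.keys ?t = insert w ?G" using ku by (simp add: keys_plus_nat)
        have "card (insert w ?G) = Suc (card ?G)" using False by simp
        moreover have "card (insert w ?G) \<le> CARD('v)" by (rule card_mono) auto
        ultimately have "CARD('v) - card (Poly_Mapping.keys ?t) < CARD('v) - card ?G" using k by simp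
        moreover have "dg ?t = dg t" by (simp add: t)
        ultimately have "Poly_Mapping.single ?t 1 \<in> J" using less.hyps[of ?t] less.prems by simp
        then show ?thesis by (rule pm.subspace_scale[OF pm_subspace_of_ideal[OF J(1)]])
      qed
    qed
    ultimately have "Poly_Mapping.single t 1 + ?rest \<in> J" "?rest \<in> J" by (simp_all only:)
    from idl.subspace_diff[OF J(1) this] show ?thesis by (simp only: add_diff_cancel_right')
  qed
qed

lemma var_power: "var v ^ n = (Poly_Mapping.single (Poly_Mapping.single v n) 1 :: ('v, 'k) mpoly)"
proof (induction n)
  case (Suc n)
  then show ?case by (simp add: var_def mult_single single_add[symmetric])
qed simp

text \<open>The forms are a system of parameters: the Krull dimension is \<open>d\<close>, and by
  \<open>high_degree_in\<close> high powers of the variables lie in the ideal that they generate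
  together with \<open>I0\<close>.\<close>

lemma buchsbaum_seq:
  assumes qs: "spanning qs" and "i < d" and g: "LQ (qs i) * g \<in> gens I0 (\<lambda>l. LQ (qs l)) i"
  shows "var v * g \<in> gens I0 (\<lambda>l. LQ (qs l)) i"
proof -
  let ?\<theta> = "map (\<lambda>l. LQ (qs l)) [0..<d]"
  have J: "ideal_gen (I0 \<union> set (take i ?\<theta>)) = gens I0 (\<lambda>l. LQ (qs l)) i" if "i \<le> d" for i
    using gens_eq_ideal_gen[OF I0_ideal that, of "\<lambda>l. LQ (qs l)"] by simp
  have "enat d = krull_dim_quotient I0"
  proof (rule antisym)
    obtain F where F: "F \<in> \<Delta>" "card F = d" using top_face by (rule bexE)
    show "enat d \<le> krull_dim_quotient I0" using krull_dim_ge[of \<Delta>, OF down F(1)] F(2) by (simp add: I0_def)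
    show "krull_dim_quotient I0 \<le> enat d" unfolding I0_def by (rule krull_dim_le[OF down card_face])
  qed
  moreover have "\<forall>p \<in> set ?\<theta>. homogeneous p \<and> p \<in> irrelevant_ideal"
  proof
    fix p assume "p \<in> set ?\<theta>"
    then obtain l where "p = LQ (qs l)" by auto
    then have h: "p \<in> hom 1" using lin_hom by (simp add: LQ_def)
    have "homogeneous p" unfolding homogeneous_def
      by (rule exI[of _ 1]) (use h in \<open>simp add: hom_iff dg_def\<close>)
    moreover have "0 \<notin> Poly_Mapping.keys p"
    proof
      assume "0 \<in> Poly_Mapping.keys p"
      then have "dg (0 :: 'v \<Rightarrow>\<^sub>0 nat) = 1" using h unfolding hom_iff by (rule bspec[rotated])
      then show False by simp
    qed
    then have "p \<in> irrelevant_ideal" by (simp add: irrelevant_ideal_eq in_keys_iff)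
    ultimately show "homogeneous p \<and> p \<in> irrelevant_ideal" by simp
  qed
  moreover have "krull_dim_quotient (ideal_gen (I0 \<union> set (take (length ?\<theta>) ?\<theta>))) = 0"
  proof (rule krull_dim_zero)
    fix v
    have "Poly_Mapping.single (Poly_Mapping.single v (Suc CARD('v))) 1 \<in> gens I0 (\<lambda>l. LQ (qs l)) d"
    proof (rule high_degree_in[OF gens_ideal[OF I0_ideal]])
      show "I0 \<subseteq> gens I0 (\<lambda>l. LQ (qs l)) d" using gens_mono[of 0 d I0] by simp
      show "LQ q \<in> gens I0 (\<lambda>l. LQ (qs l)) d" if "degree q < d" for q
        using qs that by (simp add: spanning_def)
      show "CARD('v) < dg (Poly_Mapping.single v (Suc CARD('v)))" by (simp only: dg_single lessI)
    qed
    then show "var v ^ Suc CARD('v) \<in> ideal_gen (I0 \<union> set (take (length ?\<theta>) ?\<theta>))"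
      using J[of d] by (simp only: var_power length_map length_upt diff_zero order_refl)
  qed
  ultimately have "\<forall>i < d. colon (ideal_gen (I0 \<union> set (take i ?\<theta>))) {?\<theta> ! i}
      = colon (ideal_gen (I0 \<union> set (take i ?\<theta>))) irrelevant_ideal"
    using buchsbaum[folded I0_def, unfolded buchsbaum_quotient_def Let_def, rule_format, of ?\<theta>] by simp
  then have "colon (gens I0 (\<lambda>l. LQ (qs l)) i) {LQ (qs i)} = colon (gens I0 (\<lambda>l. LQ (qs l)) i) irrelevant_ideal"
  proof -
    assume *: "\<forall>i < d. colon (ideal_gen (I0 \<union> set (take i ?\<theta>))) {?\<theta> ! i}
      = colon (ideal_gen (I0 \<union> set (take i ?\<theta>))) irrelevant_ideal"
    have "?\<theta> ! i = LQ (qs i)" using assms(2) by simp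
    then show ?thesis using *[rule_format, OF assms(2)] J[of i] assms(2) by (simp only: less_imp_le)
  qed
  moreover have "g \<in> colon (gens I0 (\<lambda>l. LQ (qs l)) i) {LQ (qs i)}" using g by (simp add: colon_def)
  ultimately have "g \<in> colon (gens I0 (\<lambda>l. LQ (qs l)) i) irrelevant_ideal" by simp
  moreover have "var v \<in> (irrelevant_ideal :: ('v, 'k) mpoly set)"
    unfolding irrelevant_ideal_def by (rule idl.span_base) simp
  ultimately show ?thesis by (simp add: colon_def)
qed

text \<open>
  The first \<open>d - |F|\<close> of the adapted forms do not involve the variables in \<open>F\<close>; each of the others
  involves exactly one of them.
\<close>

lemma adapted_regular:
  assumes F: "F \<in> \<Delta>" "F \<noteq> {}"
  obtains qs where "\<And>l. l < d \<Longrightarrow> degree (qs l) < d"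
    "\<And>i. i < d \<Longrightarrow> nonzerodiv (gens (fideal \<Delta> F) (\<lambda>l. LQ (qs l)) i) (LQ (qs i))"
proof -
  let ?m = "card F"
  have m: "0 < ?m" "?m \<le> d" using F card_face by (simp_all add: card_gt_0_iff)
  obtain e where e: "bij_betw e {0..<?m} F" using ex_bij_betw_nat_finite[of F] by auto
  \<comment> \<open>Multiples of \<open>vanish F\<close> give forms without the variables of
    \<open>F\<close>; the Lagrange polynomials of \<open>F\<close> supply the remaining
    \<open>?m\<close> members.\<close>
  define qs where "qs l = (if l < d - ?m then monom 1 l * vanish F else lagr F (e (l - (d - ?m))))" for l
  have eF: "e k \<in> F" if "k < ?m" for k using bij_betwE[OF e] that by simp
  have deg: "degree (qs l) < d" if "l < d" for l
  proof (cases "l < d - ?m")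
    case True
    then have "degree (qs l) \<le> l + ?m"
      using degree_mult_le[of "monom 1 l" "vanish F"] degree_monom_le[of "1::'k" l] by (simp add: qs_def degree_vanish)
    then show ?thesis using True by simp
  next
    case False
    then have "degree (qs l) < ?m" using degree_lagr[OF eF] that m by (simp add: qs_def)
    then show ?thesis using m by simp
  qed
  have span: "spanning qs"
    unfolding spanning_def
  proof (intro allI impI)
    fix q :: "'k poly" assume q: "degree q < d"
    let ?J = "gens I0 (\<lambda>l. LQ (qs l)) d"
    have J: "is_ideal ?J" by (rule gens_ideal[OF I0_ideal])
    have in_J: "LQ (qs l) \<in> ?J" if "l < d" for l by (rule gens_theta[OF I0_ideal that])
    \<comment> \<open>Division with remainder by \<open>vanish F\<close> separates the two kinds:
      the quotient expands in the first, the remainder, by interpolation, in the second.\<close>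
    define a where "a = q div vanish F"
    define r where "r = q mod vanish F"
    have qar: "q = vanish F * a + r" by (simp add: a_def r_def)
    have r: "degree r < ?m"
    proof (cases "r = 0")
      case False
      then show ?thesis using degree_mod_less[OF vanish_nz, of q F] degree_vanish[of F] by (simp add: r_def)
    qed (use m in simp)
    have "LQ r \<in> ?J"
    proof -
      have "LQ (lagr F v) \<in> ?J" if v: "v \<in> F" for v
      proof -
        have "v \<in> e ` {0..<?m}" using v e by (simp add: bij_betw_def)
        then obtain k where "k < ?m" "v = e k" by auto
        moreover have "qs (d - ?m + k) = lagr F (e k)" by (simp add: qs_def)
        ultimately show ?thesis using in_J[of "d - ?m + k"] m by simp
      qed
      then have "LQ (\<Sum>v\<in>F. smult (poly r (pt v)) (lagr F v)) \<in> ?J" by (rule LQ_sum_in[OF J])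
      then show ?thesis using lagrange_expansion[OF r] by simp
    qed
    moreover have "LQ (vanish F * a) \<in> ?J"
    proof (cases "a = 0")
      case True
      then show ?thesis using idl.subspace_0[OF J] by (simp add: LQ_zero)
    next
      case False
      have "degree (vanish F * a) = ?m + degree a" using False vanish_nz by (simp add: degree_mult_eq degree_vanish)
      moreover have "degree (vanish F * a) < d"
      proof -
        have "vanish F * a = q - r" using qar by simp
        then show ?thesis using degree_diff_less[of q d r] q r m by simp
      qed
      ultimately have da: "degree a < d - ?m" by simp
      have "vanish F * a = vanish F * (\<Sum>l\<le>degree a. monom (coeff a l) l)" by (simp only: poly_as_sum_of_monoms)
      also have "\<dots> = (\<Sum>l\<le>degree a. smult (coeff a l) (monom 1 l * vanish F))"
        unfolding sum_distrib_left
      proof (rule sum.cong)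
        fix l
        have "monom (coeff a l) l = smult (coeff a l) (monom 1 l)" by (simp add: smult_monom)
        then show "vanish F * monom (coeff a l) l = smult (coeff a l) (monom 1 l * vanish F)"
          by (simp only: mult_smult_right mult_smult_left mult.commute)
      qed simp
      finally have e: "vanish F * a = (\<Sum>l\<le>degree a. smult (coeff a l) (monom 1 l * vanish F))" .
      show ?thesis unfolding e
      proof (rule LQ_sum_in[OF J])
        fix l assume "l \<in> {..degree a}"
        then have "l < d - ?m" using da by simp
        then show "LQ (monom 1 l * vanish F) \<in> ?J" using in_J[of l] by (simp add: qs_def)
      qed
    qed
    ultimately show "LQ q \<in> ?J" unfolding qar LQ_add by (rule idl.subspace_add[OF J, rotated])
  qed
  let ?JF = "gens (fideal \<Delta> F) (\<lambda>l. LQ (qs l))"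
  define c where "c l w = poly (qs l) (pt w)" for l w
  have LQc: "(\<lambda>l. LQ (qs l)) = (\<lambda>l. lin (c l))"
  proof (rule ext)
    fix l
    have "c l = (\<lambda>w. poly (qs l) (pt w))" by (rule ext) (rule c_def)
    then show "LQ (qs l) = lin (c l)" by (simp only: LQ_def)
  qed
  have c1: "c l v = 0" if "l < d - ?m" "v \<in> F" for l v
    using that poly_vanish by (simp add: c_def qs_def)
  have "nonzerodiv (?JF i) (LQ (qs i))" if i: "i < d" for i
  proof (cases "i < d - ?m")
    case True
    show ?thesis unfolding nonzerodiv_def
    proof (intro allI impI)
      fix g assume g: "LQ (qs i) * g \<in> ?JF i"
      obtain v where v: "v \<in> F" using F(2) by blast
      have iF: "is_ideal (fideal \<Delta> F :: ('v, 'k) mpoly set)" by (rule fideal_ideal[OF down])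
      let ?x = "\<Prod>v\<in>F. var v :: ('v, 'k) mpoly"
      \<comment> \<open>The factor \<open>?x\<close> moves a relation on the star to the whole
        complex.\<close>
      have mult: "?x * p \<in> gens I0 (\<lambda>l. LQ (qs l)) i" if "p \<in> ?JF i" for p
        using that
      proof (induction i arbitrary: p)
        case 0
        then show ?case using prod_var_mult_fideal[of \<Delta>, OF down] by (simp add: I0_def)
      next
        case (Suc i)
        from Suc.prems obtain u h where p: "p = u + LQ (qs i) * h" "u \<in> ?JF i" unfolding gens.simps by (rule adjE)
        have "?x * p = ?x * u + LQ (qs i) * (?x * h)" unfolding p(1) by (simp only: distrib_left mult.left_commute)
        then show ?case using adjI[OF Suc.IH[OF p(2)]] by simp
      qed
      have "LQ (qs i) * (?x * g) \<in> gens I0 (\<lambda>l. LQ (qs l)) i"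
        using mult[OF g] by (simp only: mult.left_commute)
      \<comment> \<open>The Buchsbaum property trades the form for a vertex variable of
        \<open>F\<close>; this variable and the factor \<open>?x\<close> can both be cancelled on
        the star.\<close>
      then have "var v * (?x * g) \<in> gens I0 (\<lambda>l. LQ (qs l)) i" by (rule buchsbaum_seq[OF span i])
      moreover have "gens I0 (\<lambda>l. LQ (qs l)) i \<subseteq> ?JF i"
        unfolding I0_def by (rule gens_mono_base[OF fideal_mono[OF down]]) auto
      ultimately have "var v * (?x * g) \<in> ?JF i" by (rule subsetD[rotated])
      then have "?x * g \<in> ?JF i"
        unfolding LQc by (rule gens_var_cancel[OF v, rotated]) (use c1 v True in simp)
      then show "g \<in> ?JF i"
        unfolding LQc by (rule gens_prod_cancel[OF finite subset_refl, rotated]) (use c1 True in simp)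
    qed
  next
    case False
    \<comment> \<open>The form with index \<open>i\<close> has coefficient 1 at the vertex
      \<open>e k\<close>, where all earlier forms vanish.\<close>
    define k where "k = i - (d - ?m)"
    have k: "k < ?m" "i = d - ?m + k" using False i m by (simp_all add: k_def)
    have ci: "c i (e k) = 1" using poly_lagr[OF eF[OF k(1)] eF[OF k(1)]] k by (simp add: c_def qs_def)
    have "c l (e k) = 0" if l: "l < i" for l
    proof (cases "l < d - ?m")
      case True
      then show ?thesis by (rule c1) (rule eF[OF k(1)])
    next
      case nl: False
      define k' where "k' = l - (d - ?m)"
      have k': "k' < k" using nl l k by (simp add: k'_def)
      then have "e k \<noteq> e k'" using inj_onD[OF bij_betw_imp_inj_on[OF e], of k k'] k by auto
      then have "poly (lagr F (e k')) (pt (e k)) = 0"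
        using poly_lagr[OF eF[OF k(1)] eF[of k']] k' k by simp
      then show ?thesis using nl by (simp add: c_def qs_def k'_def)
    qed
    then have "nonzerodiv (gens (fideal \<Delta> F) (\<lambda>l. lin (c l)) i) (lin (c i))"
      by (intro nonzerodiv_monic[of \<Delta> "e k", OF down eF[OF k(1)]] ci)
    then show ?thesis unfolding LQc fun_cong[OF LQc, of i] .
  qed
  with deg show ?thesis by (rule that)
qed

definition \<theta> :: "nat \<Rightarrow> ('v, 'k) mpoly" where
  "\<theta> l = lin (\<lambda>w. pt w ^ l)"

lemma \<theta>_LQ: "\<theta> l = LQ (monom 1 l)"
  by (simp add: \<theta>_def LQ_def poly_monom)

text \<open>The adapted forms are combinations of the \<open>\<theta> l\<close>, so their ideal is
  contained in that of the \<open>\<theta> l\<close>, and the Hilbert functions compare as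
  \<open>regular_by_Hilbert_function\<close> requires. Off the complex the quotient is zero.\<close>

lemma \<theta>_regular:
  assumes F: "F \<noteq> {}" and i: "i < d"
  shows "nonzerodiv (gens (fideal \<Delta> F) \<theta> i) (\<theta> i)"
proof (cases "F \<in> \<Delta>")
  case False
  have "fideal \<Delta> F = (UNIV :: ('v, 'k) mpoly set)" using False down by (auto simp: fideal_def)
  then have "gens (fideal \<Delta> F) \<theta> i = (UNIV :: ('v, 'k) mpoly set)" using gens_mono[of 0 i "fideal \<Delta> F" \<theta>] by (simp add: top.extremum_unique)
  then show ?thesis by (simp add: nonzerodiv_def)
next
  case True
  obtain qs where qs: "\<And>l. l < d \<Longrightarrow> degree (qs l) < d"
    "\<And>i. i < d \<Longrightarrow> nonzerodiv (gens (fideal \<Delta> F) (\<lambda>l. LQ (qs l)) i) (LQ (qs i))"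
    by (rule adapted_regular[OF True F]) (rule that)
  have iF: "is_ideal (fideal \<Delta> F :: ('v, 'k) mpoly set)" by (rule fideal_ideal[OF down])
  have "gens (fideal \<Delta> F) (\<lambda>l. LQ (qs l)) d \<subseteq> gens (fideal \<Delta> F) \<theta> d"
  proof (rule gens_least[OF gens_ideal[OF iF]])
    show "fideal \<Delta> F \<subseteq> gens (fideal \<Delta> F) \<theta> d" using gens_mono[of 0 d "fideal \<Delta> F" \<theta>] by simp
    fix l assume l: "l < d"
    have "qs l = (\<Sum>k\<le>degree (qs l). smult (coeff (qs l) k) (monom 1 k))"
      using poly_as_sum_of_monoms[of "qs l"] by (simp add: smult_monom)
    moreover have "LQ (\<Sum>k\<le>degree (qs l). smult (coeff (qs l) k) (monom 1 k)) \<in> gens (fideal \<Delta> F) \<theta> d"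
    proof (rule LQ_sum_in[OF gens_ideal[OF iF]])
      fix k assume "k \<in> {..degree (qs l)}"
      then have "k < d" using qs(1)[OF l] by simp
      then show "LQ (monom 1 k) \<in> gens (fideal \<Delta> F) \<theta> d" unfolding \<theta>_LQ[symmetric] by (rule gens_theta[OF iF])
    qed
    ultimately show "LQ (qs l) \<in> gens (fideal \<Delta> F) \<theta> d" by simp
  qed
  note sub = this
  have "nonzerodiv (gens (fideal \<Delta> F) (\<lambda>l. lin (\<lambda>w. pt w ^ l)) i) (lin (\<lambda>w. pt w ^ i))"
  proof (rule regular_by_Hilbert_function[OF fideal_graded[OF down] _ _ i])
    show "nonzerodiv (gens (fideal \<Delta> F) (\<lambda>l. lin (\<lambda>w. poly (qs l) (pt w))) i) (lin (\<lambda>w. poly (qs i) (pt w)))" if "i < d" for i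
      using qs(2)[OF that] by (simp only: LQ_def)
    show "HF (gens (fideal \<Delta> F) (\<lambda>l. lin (\<lambda>w. pt w ^ l)) d) s \<le> HF (gens (fideal \<Delta> F) (\<lambda>l. lin (\<lambda>w. poly (qs l) (pt w))) d) s" for s
      using HF_antimono[OF sub, of s] by (simp only: LQ_def \<theta>_def[abs_def])
  qed
  then show ?thesis by (simp only: \<theta>_def[abs_def])
qed

end

section \<open>The Koszul complex over the cochain complex of stars\<close>

definition sg :: "'a::linorder \<Rightarrow> 'a set \<Rightarrow> 'k::field" where
  "sg a A = (-1) ^ card {b\<in>A. b < a}"

lemma sg_insert:
  assumes "finite A" "y \<notin> A"
  shows "sg x (insert y A) = (if y < x then - sg x A else sg x A :: 'k::field)"
proof (cases "y < x")
  case True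
  have "{b\<in>insert y A. b < x} = insert y {b\<in>A. b < x}" using True by auto
  then show ?thesis using assms True by (simp add: sg_def)
next
  case False
  have "{b\<in>insert y A. b < x} = {b\<in>A. b < x}" using False by auto
  then show ?thesis using False by (simp add: sg_def)
qed

lemma sg_sq: "sg a A * sg a A = (1 :: 'k::field)"
  by (simp add: sg_def flip: power_add mult_2)

text \<open>The common reason why the Koszul and the simplicial differential square to zero.\<close>

lemma sum_antisym:
  fixes f :: "'a \<Rightarrow> 'a \<Rightarrow> 'b::ab_group_add"
  assumes "finite F" "\<And>v w. v \<in> F \<Longrightarrow> w \<in> F \<Longrightarrow> v \<noteq> w \<Longrightarrow> f v w + f w v = 0"
  shows "(\<Sum>v\<in>F. \<Sum>w\<in>F - {v}. f v w) = 0"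
  using assms
proof (induction F rule: finite_induct)
  case (insert x F)
  have "(\<Sum>v\<in>insert x F. \<Sum>w\<in>insert x F - {v}. f v w) =
      (\<Sum>w\<in>insert x F - {x}. f x w) + (\<Sum>v\<in>F. \<Sum>w\<in>insert x F - {v}. f v w)"
    using insert.hyps by simp
  also have "insert x F - {x} = F" using insert.hyps by auto
  also have "(\<Sum>v\<in>F. \<Sum>w\<in>insert x F - {v}. f v w) = (\<Sum>v\<in>F. f v x + (\<Sum>w\<in>F - {v}. f v w))"
  proof (rule sum.cong)
    fix v assume v: "v \<in> F"
    then have "insert x F - {v} = insert x (F - {v})" using insert.hyps by auto
    then show "(\<Sum>w\<in>insert x F - {v}. f v w) = f v x + (\<Sum>w\<in>F - {v}. f v w)" using insert.hyps by simp
  qed simp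
  also have "(\<Sum>w\<in>F. f x w) + \<dots> = (\<Sum>v\<in>F. f x v + f v x) + (\<Sum>v\<in>F. \<Sum>w\<in>F - {v}. f v w)"
    by (simp add: sum.distrib add.assoc)
  also have "(\<Sum>v\<in>F. f x v + f v x) = 0" by (rule sum.neutral) (use insert in auto)
  also have "(\<Sum>v\<in>F. \<Sum>w\<in>F - {v}. f v w) = 0" by (rule insert.IH) (use insert.prems in auto)
  finally show ?case by simp
qed simp

text \<open>\<open>kos\<close> is the Koszul differential, on functions of subsets of \<open>{..<i}\<close>.\<close>

definition kos :: "(nat \<Rightarrow> ('v, 'k::field) mpoly) \<Rightarrow> nat \<Rightarrow> (nat set \<Rightarrow> ('v, 'k) mpoly) \<Rightarrow> nat set \<Rightarrow> ('v, 'k) mpoly" where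
  "kos \<theta> i z A = (\<Sum>a\<in>{..<i} - A. pm_scale (sg a A) (\<theta> a * z (insert a A)))"

lemma kos_add: "kos \<theta> i (\<lambda>A. y A + z A) B = kos \<theta> i y B + kos \<theta> i z B"
  by (simp add: kos_def distrib_left pm.scale_right_distrib sum.distrib)

lemma kos_diff: "kos \<theta> i (\<lambda>A. y A - z A) B = kos \<theta> i y B - kos \<theta> i z B"
  by (simp add: kos_def right_diff_distrib pm.scale_right_diff_distrib sum_subtractf)

lemma kos_scale: "kos \<theta> i (\<lambda>A. pm_scale c (z A)) B = pm_scale c (kos \<theta> i z B)"
  by (simp add: kos_def pm_scale_mult pm.scale_sum_right mult.commute)

lemma kos_sum: "kos \<theta> i (\<lambda>A. \<Sum>x\<in>X. z x A) B = (\<Sum>x\<in>X. kos \<theta> i (z x) B)"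
  unfolding kos_def sum_distrib_left pm.scale_sum_right by (rule sum.swap)

lemma kos_cong: "(\<And>a. a < i \<Longrightarrow> a \<notin> B \<Longrightarrow> y (insert a B) = z (insert a B)) \<Longrightarrow> kos \<theta> i y B = kos \<theta> i z B"
  unfolding kos_def by (rule sum.cong) auto

lemma kos_kos:
  fixes \<theta> :: "nat \<Rightarrow> ('v, 'k::field) mpoly"
  assumes "A \<subseteq> {..<i}" shows "kos \<theta> i (kos \<theta> i z) A = 0"
proof -
  have fA: "finite A" using assms finite_subset by blast
  let ?f = "\<lambda>a b. pm_scale (sg a A * sg b (insert a A)) (\<theta> a * \<theta> b * z (insert b (insert a A)))"
  have "kos \<theta> i (kos \<theta> i z) A = (\<Sum>a\<in>{..<i} - A. \<Sum>b\<in>{..<i} - A - {a}. ?f a b)"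
    unfolding kos_def
  proof (rule sum.cong)
    fix a assume a: "a \<in> {..<i} - A"
    have "{..<i} - insert a A = {..<i} - A - {a}" by auto
    then show "pm_scale (sg a A) (\<theta> a * (\<Sum>b\<in>{..<i} - insert a A. pm_scale (sg b (insert a A)) (\<theta> b * z (insert b (insert a A)))))
        = (\<Sum>b\<in>{..<i} - A - {a}. ?f a b)"
      by (simp add: sum_distrib_left pm.scale_sum_right pm_scale_mult mult.assoc)
  qed simp
  also have "\<dots> = 0"
  proof (rule sum_antisym)
    fix a b assume ab: "a \<in> {..<i} - A" "b \<in> {..<i} - A" "a \<noteq> b"
    have "sg a A * sg b (insert a A) + sg b A * sg a (insert b A) = (0::'k)"
      using ab sg_insert[OF fA, of a b, where 'k='k] sg_insert[OF fA, of b a, where 'k='k] by auto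
    then have "pm_scale (sg a A * sg b (insert a A) + sg b A * sg a (insert b A)) (\<theta> a * \<theta> b * z (insert b (insert a A))) = 0"
      by simp
    then show "?f a b + ?f b a = 0"
      by (simp add: pm.scale_left_distrib insert_commute[of a b] mult.commute[of "\<theta> a" "\<theta> b"])
  qed simp
  finally show ?thesis .
qed

lemma kos_in_ideal:
  assumes I: "is_ideal I" and "\<And>a. a < i \<Longrightarrow> a \<notin> B \<Longrightarrow> \<theta> a * z (insert a B) \<in> I"
  shows "kos \<theta> i z B \<in> I"
  unfolding kos_def
  by (rule pm.subspace_sum[OF pm_subspace_of_ideal[OF I]])
    (rule pm.subspace_scale[OF pm_subspace_of_ideal[OF I]], use assms(2) in auto)

lemma kos_in_ideal': "is_ideal I \<Longrightarrow> (\<And>a. a < i \<Longrightarrow> a \<notin> B \<Longrightarrow> z (insert a B) \<in> I) \<Longrightarrow> kos \<theta> i z B \<in> I"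
  by (rule kos_in_ideal) (simp_all add: idl.subspace_scale)

lemma kos_in_gens: "is_ideal I \<Longrightarrow> kos \<theta> i z B \<in> gens I \<theta> i"
proof (rule kos_in_ideal[OF gens_ideal])
  fix a assume I: "is_ideal I" and "a < i"
  then have "\<theta> a \<in> gens I \<theta> i" by (intro gens_theta)
  from idl.subspace_scale[OF gens_ideal[OF I] this, of "z (insert a B)"]
  show "\<theta> a * z (insert a B) \<in> gens I \<theta> i" by (simp only: mult.commute)
qed

lemma kos_Suc:
  assumes "A \<subseteq> {..<i}"
  shows "kos \<theta> (Suc i) z A = kos \<theta> i z A + pm_scale (sg i A) (\<theta> i * z (insert i A))"
    and "kos \<theta> (Suc i) z (insert i A) = kos \<theta> i (\<lambda>B. z (insert i B)) A"
proof -
  have fA: "finite A" using assms finite_subset by blast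
  have "{..<Suc i} - A = insert i ({..<i} - A)" using assms by auto
  then show "kos \<theta> (Suc i) z A = kos \<theta> i z A + pm_scale (sg i A) (\<theta> i * z (insert i A))"
    by (simp add: kos_def add.commute)
  have e: "{..<Suc i} - insert i A = {..<i} - A" by auto
  show "kos \<theta> (Suc i) z (insert i A) = kos \<theta> i (\<lambda>B. z (insert i B)) A"
    unfolding kos_def e
  proof (rule sum.cong)
    fix a assume a: "a \<in> {..<i} - A"
    have "i \<notin> A" using assms by auto
    then have "sg a (insert i A) = (sg a A :: 'b)" using a sg_insert[OF fA, of i a, where 'k='b] by simp
    then show "pm_scale (sg a (insert i A)) (\<theta> a * z (insert a (insert i A))) =
        pm_scale (sg a A) (\<theta> a * z (insert i (insert a A)))" by (simp add: insert_commute)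
  qed simp
qed

lemma koszul_exact:
  fixes I :: "('v::finite, 'k::field) mpoly set"
  assumes I: "is_ideal I"
    and reg: "\<And>l. 0 < q \<Longrightarrow> l < i \<Longrightarrow> nonzerodiv (gens I \<theta> l) (\<theta> l)"
    and base: "q = 0 \<Longrightarrow> w {} \<in> gens I \<theta> i"
    and cyc: "\<And>B. B \<subseteq> {..<i} \<Longrightarrow> Suc (card B) = q \<Longrightarrow> kos \<theta> i w B \<in> I"
  shows "\<exists>y. \<forall>A. A \<subseteq> {..<i} \<longrightarrow> card A = q \<longrightarrow> w A - kos \<theta> i y A \<in> I"
  using reg base cyc
proof (induction i arbitrary: q w)
  case 0
  show ?case
  proof (intro exI[of _ w] allI impI)
    fix A :: "nat set" assume A: "A \<subseteq> {..<0}" "card A = q"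
    then have "A = {}" "q = 0" by auto
    then show "w A - kos \<theta> 0 w A \<in> I" using "0.prems"(2) by (simp add: kos_def)
  qed
next
  case (Suc i)
  note reg = Suc.prems(1) and base = Suc.prems(2) and cyc = Suc.prems(3)
  show ?case
  proof (cases "q = 0")
    case True
    from base[OF True] obtain u g where ug: "w {} = u + \<theta> i * g" "u \<in> gens I \<theta> i"
      unfolding gens.simps by (rule adjE)
    have "\<exists>y. \<forall>A. A \<subseteq> {..<i} \<longrightarrow> card A = 0 \<longrightarrow> (\<lambda>_. u) A - kos \<theta> i y A \<in> I"
      by (rule Suc.IH) (use ug in auto)
    then obtain y0 where y0: "\<And>A. A \<subseteq> {..<i} \<Longrightarrow> card A = 0 \<Longrightarrow> u - kos \<theta> i y0 A \<in> I" by auto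
    define y where "y = y0({i} := g)"
    have "kos \<theta> i y {} = kos \<theta> i y0 {}" by (rule kos_cong) (simp add: y_def)
    then have k: "kos \<theta> (Suc i) y {} = kos \<theta> i y0 {} + \<theta> i * g"
      using kos_Suc(1)[of "{}" i \<theta> y] by (simp add: y_def sg_def)
    show ?thesis
    proof (intro exI[of _ y] allI impI)
      fix A assume "A \<subseteq> {..<Suc i}" "card A = q"
      then have "A = {}" using True finite_subset by fastforce
      then show "w A - kos \<theta> (Suc i) y A \<in> I" using y0[of "{}"] k ug by simp
    qed
  next
    case False
    \<comment> \<open>The component on subsets containing \<open>i\<close>; modulo \<open>I\<close>
      it is a cycle for the first \<open>i\<close> forms.\<close>
    define w' where "w' B = w (insert i B)" for B
    have regi: "nonzerodiv (gens I \<theta> l) (\<theta> l)" if "l < i" for l using reg False that by simp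
    have c0: "kos \<theta> i w B + pm_scale (sg i B) (\<theta> i * w' B) \<in> I" if "B \<subseteq> {..<i}" "Suc (card B) = q" for B
      using cyc[of B] kos_Suc(1)[OF that(1), of \<theta> w] that by (simp add: w'_def subset_iff less_SucI)
    have "\<exists>y. \<forall>A. A \<subseteq> {..<i} \<longrightarrow> card A = q - 1 \<longrightarrow> w' A - kos \<theta> i y A \<in> I"
    proof (rule Suc.IH)
      show "nonzerodiv (gens I \<theta> l) (\<theta> l)" if "l < i" for l by (rule regi[OF that])
      \<comment> \<open>In lowest degree exactness comes from \<open>\<theta> i\<close> being
        regular modulo the earlier forms.\<close>
      show "w' {} \<in> gens I \<theta> i" if "q - 1 = 0"
      proof -
        have G: "is_ideal (gens I \<theta> i)" by (rule gens_ideal[OF I])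
        have "kos \<theta> i w {} + \<theta> i * w' {} \<in> I" using c0[of "{}"] that False by (simp add: sg_def)
        then have "kos \<theta> i w {} + \<theta> i * w' {} \<in> gens I \<theta> i" using gens_mono[of 0 i I \<theta>] by auto
        from idl.subspace_diff[OF G this kos_in_gens[OF I, of \<theta> i w "{}"]]
        have "\<theta> i * w' {} \<in> gens I \<theta> i" by simp
        moreover have "nonzerodiv (gens I \<theta> i) (\<theta> i)" using reg False by simp
        ultimately show ?thesis by (simp add: nonzerodiv_def)
      qed
      fix B assume B: "B \<subseteq> {..<i}" "Suc (card B) = q - 1"
      have "finite B" "i \<notin> B" using B(1) finite_subset by auto
      then have "Suc (card (insert i B)) = q" using B False by simp
      moreover have "insert i B \<subseteq> {..<Suc i}" using B(1) by auto
      ultimately have "kos \<theta> (Suc i) w (insert i B) \<in> I" by (intro cyc)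
      then show "kos \<theta> i w' B \<in> I" unfolding kos_Suc(2)[OF B(1)] w'_def .
    qed
    then obtain y' where y': "\<And>A. A \<subseteq> {..<i} \<Longrightarrow> card A = q - 1 \<Longrightarrow> w' A - kos \<theta> i y' A \<in> I" by auto
    \<comment> \<open>Removing the contribution of \<open>y'\<close> turns the component on subsets
      without \<open>i\<close> into a cycle, again modulo \<open>I\<close>.\<close>
    define w1 where "w1 A = w A - pm_scale (sg i A) (\<theta> i * y' A)" for A
    have "\<exists>y. \<forall>A. A \<subseteq> {..<i} \<longrightarrow> card A = q \<longrightarrow> w1 A - kos \<theta> i y A \<in> I"
    proof (rule Suc.IH)
      show "nonzerodiv (gens I \<theta> l) (\<theta> l)" if "l < i" for l by (rule regi[OF that])
      show "w1 {} \<in> gens I \<theta> i" if "q = 0" using that False by simp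
      fix B assume B: "B \<subseteq> {..<i}" "Suc (card B) = q"
      have fB: "finite B" using B(1) finite_subset by blast
      have "kos \<theta> i (\<lambda>A. pm_scale (sg i A) (\<theta> i * y' A)) B = - pm_scale (sg i B) (\<theta> i * kos \<theta> i y' B)"
        unfolding kos_def sum_distrib_left pm.scale_sum_right sum_negf[symmetric]
      proof (rule sum.cong)
        fix a assume a: "a \<in> {..<i} - B"
        then have "sg i (insert a B) = (- sg i B :: 'k)" using sg_insert[OF fB, of a i, where 'k='k] by simp
        then show "pm_scale (sg a B) (\<theta> a * pm_scale (sg i (insert a B)) (\<theta> i * y' (insert a B))) =
            - pm_scale (sg i B) (\<theta> i * pm_scale (sg a B) (\<theta> a * y' (insert a B)))"
          by (simp add: pm_scale_mult mult.commute mult.left_commute)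
      qed simp
      then have "kos \<theta> i w1 B = kos \<theta> i w B + pm_scale (sg i B) (\<theta> i * kos \<theta> i y' B)"
        unfolding w1_def kos_diff by simp
      also have "\<dots> = (kos \<theta> i w B + pm_scale (sg i B) (\<theta> i * w' B)) - pm_scale (sg i B) (\<theta> i * (w' B - kos \<theta> i y' B))"
        by (simp add: right_diff_distrib pm.scale_right_diff_distrib)
      also have "\<dots> \<in> I"
        by (intro idl.subspace_diff[OF I] c0[OF B] pm.subspace_scale[OF pm_subspace_of_ideal[OF I]]
            idl.subspace_scale[OF I] y' B(1)) (use B in simp)
      finally show "kos \<theta> i w1 B \<in> I" .
    qed
    then obtain y1 where y1: "\<And>A. A \<subseteq> {..<i} \<Longrightarrow> card A = q \<Longrightarrow> w1 A - kos \<theta> i y1 A \<in> I" by auto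
    define y where "y C = (if i \<in> C then y' (C - {i}) else y1 C)" for C
    show ?thesis
    proof (intro exI[of _ y] allI impI)
      fix A assume A: "A \<subseteq> {..<Suc i}" "card A = q"
      show "w A - kos \<theta> (Suc i) y A \<in> I"
      proof (cases "i \<in> A")
        case False
        then have Ai: "A \<subseteq> {..<i}" using A(1) by (auto simp: less_Suc_eq)
        have "kos \<theta> i y A = kos \<theta> i y1 A" by (rule kos_cong) (use False in \<open>simp add: y_def\<close>)
        moreover have "y (insert i A) = y' A" using False by (simp add: y_def)
        ultimately have "w A - kos \<theta> (Suc i) y A = w1 A - kos \<theta> i y1 A"
          unfolding kos_Suc(1)[OF Ai] w1_def by simp
        then show ?thesis using y1[OF Ai A(2)] by simp
      next
        case True
        define B where "B = A - {i}"
        have B: "B \<subseteq> {..<i}" "A = insert i B" "i \<notin> B" using True A(1) by (auto simp: B_def less_Suc_eq)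
        have fB: "finite B" using B(1) finite_subset by blast
        have "card B = q - 1" using A(2) B fB by simp
        moreover have "kos \<theta> i (\<lambda>C. y (insert i C)) B = kos \<theta> i y' B"
        proof (rule kos_cong)
          fix a assume "a < i" "a \<notin> B"
          then have "insert i (insert a B) - {i} = insert a B" using B(3) by auto
          then show "y (insert i (insert a B)) = y' (insert a B)" by (simp add: y_def)
        qed
        ultimately show ?thesis
          unfolding B(2) kos_Suc(2)[OF B(1)] using y'[OF B(1)] by (simp add: w'_def)
      qed
    qed
  qed
qed

text \<open>The differential of the complex of stars; the component at \<open>F\<close> is meant modulo \<open>fideal \<Delta> F\<close>.\<close>

definition dlt :: "('v::{finite,linorder} set \<Rightarrow> ('v, 'k::field) mpoly) \<Rightarrow> 'v set \<Rightarrow> ('v, 'k) mpoly" where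
  "dlt f F = (\<Sum>v\<in>F. pm_scale (sg v F) (f (F - {v})))"

lemma dlt_simps:
  "dlt (\<lambda>F. f F + g F) G = dlt f G + dlt g G" "dlt (\<lambda>F. f F - g F) G = dlt f G - dlt g G"
  "dlt (\<lambda>F. pm_scale a (f F)) G = pm_scale a (dlt f G)"
  by (simp_all add: dlt_def pm.scale_right_distrib pm.scale_right_diff_distrib sum.distrib
      sum_subtractf pm.scale_sum_right mult.commute)

lemma dlt_cong: "(\<And>v. v \<in> F \<Longrightarrow> f (F - {v}) = g (F - {v})) \<Longrightarrow> dlt f F = dlt g F"
  unfolding dlt_def by (rule sum.cong) auto

lemma sg_swap:
  fixes F :: "'v::{finite,linorder} set"
  assumes "v \<in> F" "w \<in> F" "v \<noteq> w"
  shows "sg v F * sg w (F - {v}) + sg w F * sg v (F - {w}) = (0 :: 'k::field)"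
proof -
  let ?A = "F - {v} - {w}"
  have 1: "F - {v} = insert w ?A" "F - {w} = insert v ?A" "F = insert v (insert w ?A)" using assms by auto
  have a: "sg w (F - {v}) = (sg w ?A :: 'k)" "sg v (F - {w}) = (sg v ?A :: 'k)"
    using sg_insert[of ?A w w, where 'k='k] sg_insert[of ?A v v, where 'k='k] 1 by auto
  have b: "sg v F = (if w < v then - sg v ?A else sg v ?A :: 'k)"
    by (subst 1(3)) (use assms sg_insert[of "insert w ?A" v v, where 'k='k] sg_insert[of ?A w v, where 'k='k] in auto)
  have c: "sg w F = (if v < w then - sg w ?A else sg w ?A :: 'k)"
    by (subst 1(3)) (use assms sg_insert[of "insert w ?A" v w, where 'k='k] sg_insert[of ?A w w, where 'k='k] in auto)
  show ?thesis unfolding a b c using assms(3) by (auto simp: mult.commute)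
qed

lemma dlt_dlt: "dlt (dlt f) (F :: 'v::{finite,linorder} set) = (0 :: ('v, 'k::field) mpoly)"
proof -
  let ?f = "\<lambda>v w. pm_scale (sg v F * sg w (F - {v})) (f (F - {v} - {w}))"
  have "dlt (dlt f) F = (\<Sum>v\<in>F. \<Sum>w\<in>F - {v}. ?f v w)"
    unfolding dlt_def by (simp add: pm.scale_sum_right)
  also have "\<dots> = 0"
  proof (rule sum_antisym)
    fix v w assume vw: "v \<in> F" "w \<in> F" "v \<noteq> w"
    have "F - {w} - {v} = F - {v} - {w}" by auto
    then have "?f v w + ?f w v = pm_scale (sg v F * sg w (F - {v}) + sg w F * sg v (F - {w})) (f (F - {v} - {w}))"
      by (simp only: pm.scale_left_distrib)
    then show "?f v w + ?f w v = 0" by (simp only: sg_swap[OF vw] pm.scale_zero_left)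
  qed simp
  finally show ?thesis .
qed

text \<open>
  In a multidegree with nonempty support the cochain complex of stars is the one of a cone; the
  apex chosen here is the least vertex of the support.
\<close>

definition cone :: "('v::{finite,linorder} set \<Rightarrow> ('v, 'k::field) mpoly) \<Rightarrow> 'v set \<Rightarrow> ('v, 'k) mpoly" where
  "cone f F = (\<Sum>g\<in>UNIV - F. pm_scale (sg g F) (restr (\<lambda>t. t \<noteq> 0 \<and> Min (Poly_Mapping.keys t) = g) (f (insert g F))))"

lemma lookup_cone:
  assumes "t \<noteq> 0"
  shows "Poly_Mapping.lookup (cone f F) t = (let g = Min (Poly_Mapping.keys t) in
    if g \<in> F then 0 else sg g F * Poly_Mapping.lookup (f (insert g F)) t)"
proof -
  have "Poly_Mapping.lookup (cone f F) t = (\<Sum>g\<in>UNIV - F. if g = Min (Poly_Mapping.keys t)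
      then sg g F * Poly_Mapping.lookup (f (insert g F)) t else 0)"
    unfolding cone_def Poly_Mapping.lookup_sum by (rule sum.cong) (auto simp: lookup_restr assms)
  then show ?thesis by (simp add: sum.delta Let_def)
qed

lemma lookup_cone_0: "Poly_Mapping.lookup (cone f F) 0 = 0"
  unfolding cone_def Poly_Mapping.lookup_sum by (rule sum.neutral) (simp add: lookup_restr)

lemma keys_cone:
  assumes "t \<in> Poly_Mapping.keys (cone f F)"
  shows "\<exists>g. g \<notin> F \<and> t \<in> Poly_Mapping.keys (f (insert g F))"
proof -
  have l: "Poly_Mapping.lookup (cone f F) t \<noteq> 0" using assms by (simp add: in_keys_iff)
  then have "t \<noteq> 0" using lookup_cone_0 by metis
  then show ?thesis using l lookup_cone[of t f F] by (auto simp: Let_def in_keys_iff split: if_splits)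
qed

context
  fixes \<Delta> :: "'v::{finite,linorder} set set"
  assumes down: "\<And>F G. F \<in> \<Delta> \<Longrightarrow> G \<subseteq> F \<Longrightarrow> G \<in> \<Delta>"
begin

lemma dlt_in_fideal:
  assumes "\<And>v. v \<in> F \<Longrightarrow> f (F - {v}) \<in> fideal \<Delta> (F - {v})"
  shows "dlt f F \<in> (fideal \<Delta> F :: ('v, 'k::field) mpoly set)"
proof -
  have I: "is_ideal (fideal \<Delta> F :: ('v, 'k) mpoly set)" by (rule fideal_ideal[OF down])
  show ?thesis unfolding dlt_def
  proof (rule pm.subspace_sum[OF pm_subspace_of_ideal[OF I]])
    fix v assume "v \<in> F"
    moreover have "fideal \<Delta> (F - {v}) \<subseteq> (fideal \<Delta> F :: ('v, 'k) mpoly set)" by (rule fideal_mono[OF down]) auto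
    ultimately have "f (F - {v}) \<in> fideal \<Delta> F" using assms by (meson subsetD)
    then show "pm_scale (sg v F) (f (F - {v})) \<in> fideal \<Delta> F"
      by (rule pm.subspace_scale[OF pm_subspace_of_ideal[OF I]])
  qed
qed

text \<open>For a monomial \<open>t\<close> other than 1, adding the apex \<open>g\<close> to
  \<open>F\<close> does not change the union with the support of \<open>t\<close>, so
  \<open>cone\<close> is a contracting homotopy there. The monomial 1 has no apex, and
  \<open>pos\<close> excludes it.\<close>

lemma dlt_exact:
  fixes f :: "'v set \<Rightarrow> ('v, 'k::field) mpoly"
  assumes cyc: "\<And>G. card G = Suc (card F) \<Longrightarrow> dlt f G \<in> fideal \<Delta> G"
    and pos: "F \<in> \<Delta> \<Longrightarrow> Poly_Mapping.lookup (f F) 0 = 0"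
  shows "f F - dlt (cone f) F \<in> fideal \<Delta> F"
  unfolding fideal_def
proof (intro CollectI ballI notI)
  fix t assume t: "t \<in> Poly_Mapping.keys (f F - dlt (cone f) F)" and tF: "Poly_Mapping.keys t \<union> F \<in> \<Delta>"
  have F: "F \<in> \<Delta>" by (rule down[OF tF]) auto
  have lk: "Poly_Mapping.lookup (dlt h G) t = (\<Sum>v\<in>G. sg v G * Poly_Mapping.lookup (h (G - {v})) t)"
    for h :: "'v set \<Rightarrow> ('v, 'k) mpoly" and G t
    unfolding dlt_def Poly_Mapping.lookup_sum by simp
  have ne: "Poly_Mapping.lookup (f F) t \<noteq> Poly_Mapping.lookup (dlt (cone f) F) t"
    using t by (simp add: in_keys_iff lookup_minus)
  have t0: "t \<noteq> 0"
  proof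
    assume "t = 0"
    then show False using ne pos[OF F] by (simp add: lk lookup_cone_0)
  qed
  define g where "g = Min (Poly_Mapping.keys t)"
  have "Poly_Mapping.keys t \<noteq> {}" using t0 by simp
  then have g: "g \<in> Poly_Mapping.keys t" unfolding g_def by (intro Min_in) simp_all
  have lc: "Poly_Mapping.lookup (cone f H) t = (if g \<in> H then 0 else sg g H * Poly_Mapping.lookup (f (insert g H)) t)" for H
    using lookup_cone[OF t0, of f H] by (simp add: Let_def g_def)
  have "Poly_Mapping.lookup (dlt (cone f) F) t = Poly_Mapping.lookup (f F) t"
  proof (cases "g \<in> F")
    case True
    have "Poly_Mapping.lookup (dlt (cone f) F) t = (\<Sum>v\<in>F. if v = g then Poly_Mapping.lookup (f F) t else 0)"
      unfolding lk
    proof (rule sum.cong)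
      fix v assume v: "v \<in> F"
      show "sg v F * Poly_Mapping.lookup (cone f (F - {v})) t = (if v = g then Poly_Mapping.lookup (f F) t else 0)"
      proof (cases "v = g")
        case eq: True
        have i: "insert g (F - {g}) = F" using True by auto
        have "sg g F = (sg g (F - {g}) :: 'k)" using sg_insert[of "F - {g}" g g, where 'k='k] i by simp
        then show ?thesis using eq i sg_sq[of g F, where 'k='k] by (simp add: lc flip: mult.assoc)
      next
        case False
        then show ?thesis using True by (simp add: lc)
      qed
    qed simp
    then show ?thesis using True by (simp add: sum.delta)
  next
    case False
    \<comment> \<open>The cocycle condition at \<open>insert g F\<close> expresses
      \<open>f F\<close> through the sets obtained from \<open>F\<close> by trading a vertex for
      \<open>g\<close>.\<close>
    let ?G = "insert g F"
    have "dlt f ?G \<in> fideal \<Delta> ?G" by (rule cyc) (use False in simp)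
    moreover have "Poly_Mapping.keys t \<union> ?G \<in> \<Delta>" using tF g by (simp add: insert_absorb)
    ultimately have "Poly_Mapping.lookup (dlt f ?G) t = 0" unfolding fideal_def by (auto simp: in_keys_iff)
    then have "sg g ?G * Poly_Mapping.lookup (f F) t + (\<Sum>v\<in>F. sg v ?G * Poly_Mapping.lookup (f (?G - {v})) t) = 0"
      using False by (simp add: lk)
    then have "sg g ?G * (sg g ?G * Poly_Mapping.lookup (f F) t + (\<Sum>v\<in>F. sg v ?G * Poly_Mapping.lookup (f (?G - {v})) t)) = 0"
      by simp
    then have "Poly_Mapping.lookup (f F) t = - (\<Sum>v\<in>F. sg g ?G * (sg v ?G * Poly_Mapping.lookup (f (?G - {v})) t))"
      using sg_sq[of g ?G, where 'k='k] by (simp add: distrib_left sum_distrib_left eq_neg_iff_add_eq_0 flip: mult.assoc)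
    moreover have "Poly_Mapping.lookup (dlt (cone f) F) t = (\<Sum>v\<in>F. - (sg g ?G * (sg v ?G * Poly_Mapping.lookup (f (?G - {v})) t)))"
      unfolding lk
    proof (rule sum.cong)
      fix v assume v: "v \<in> F"
      have vg: "v \<noteq> g" using v False by auto
      have e: "insert g (F - {v}) = ?G - {v}" using vg by auto
      have s0: "sg v ?G * sg g (?G - {v}) + sg g ?G * sg v (?G - {g}) = (0::'k)"
        by (rule sg_swap) (use v vg in auto)
      have gG: "?G - {g} = F" using False by auto
      have s1: "sg g (?G - {v}) = (sg g (F - {v}) :: 'k)"
        using sg_insert[of "F - {v}" g g, where 'k='k] False e by auto
      have s2: "sg v F * sg g (F - {v}) = (- (sg g ?G * sg v ?G) :: 'k)"
      proof -
        have e1: "sg v ?G = (if g < v then - sg v F else sg v F :: 'k)" using sg_insert[of F g v, where 'k='k] False by simp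
        have e2: "sg g F = (if v < g then - sg g (F - {v}) else sg g (F - {v}) :: 'k)"
          using sg_insert[of "F - {v}" v g, where 'k='k] v by (simp add: insert_absorb)
        have e3: "sg g ?G = (sg g F :: 'k)" using sg_insert[of F g g, where 'k='k] False by simp
        show ?thesis
        proof (cases "v < g")
          case True
          then have "\<not> g < v" by simp
          then show ?thesis unfolding e3 e1 e2 using True by (simp add: mult.commute)
        next
          case nl: False
          then have "g < v" using vg by simp
          then show ?thesis unfolding e3 e1 e2 using nl by (simp add: mult.commute)
        qed
      qed
      show "sg v F * Poly_Mapping.lookup (cone f (F - {v})) t = - (sg g ?G * (sg v ?G * Poly_Mapping.lookup (f (?G - {v})) t))"
      proof -
        have "sg v F * Poly_Mapping.lookup (cone f (F - {v})) t = (sg v F * sg g (F - {v})) * Poly_Mapping.lookup (f (?G - {v})) t"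
          using False by (simp add: lc e mult.assoc)
        then show ?thesis unfolding s2 by (simp add: mult.assoc)
      qed
    qed simp
    ultimately show ?thesis by (simp add: sum_negf)
  qed
  then show False using ne by simp
qed

end

section \<open>Degrees and the total complex\<close>

lemma lin_mult_degree:
  assumes "p \<in> supp_in {t. dg t + Suc m = s}" shows "lin c * p \<in> supp_in {t. dg t + m = s}"
  unfolding supp_in_def
proof (intro CollectI subsetI)
  fix t assume "t \<in> Poly_Mapping.keys (lin c * p)"
  from keys_times[OF this] obtain a b where ab: "a \<in> Poly_Mapping.keys (lin c)" "b \<in> Poly_Mapping.keys p" "t = a + b"
    by (elim bexE)
  have "dg a = 1" using lin_hom[of c] ab(1) by (simp add: hom_iff)
  moreover have "dg b + Suc m = s" using assms ab(2) by (auto simp: supp_in_def)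
  ultimately show "dg t + m = s" using ab(3) by simp
qed

lemma lin_mult_const: "Poly_Mapping.lookup (lin c * p) 0 = 0"
proof -
  have "0 \<notin> Poly_Mapping.keys (lin c)" using lin_hom[of c] by (auto simp: hom_iff)
  then show ?thesis by (simp add: const_coeff_hom in_keys_iff)
qed

lemma dlt_zero: "(\<And>v. v \<in> F \<Longrightarrow> f (F - {v}) = 0) \<Longrightarrow> dlt f F = 0"
  unfolding dlt_def by (rule sum.neutral) simp

lemma kos_zero: "(\<And>a. a < i \<Longrightarrow> a \<notin> A \<Longrightarrow> z (insert a A) = 0) \<Longrightarrow> kos \<theta> i z A = 0"
  unfolding kos_def by (rule sum.neutral) simp

lemma lookup_dlt: "Poly_Mapping.lookup (dlt h G) t = (\<Sum>v\<in>G. sg v G * Poly_Mapping.lookup (h (G - {v})) t)"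
  unfolding dlt_def Poly_Mapping.lookup_sum by simp

lemma const_coeff_fideal: "p \<in> fideal \<Delta> F \<Longrightarrow> F \<in> \<Delta> \<Longrightarrow> Poly_Mapping.lookup p 0 = 0"
proof (rule ccontr)
  assume p: "p \<in> fideal \<Delta> F" "F \<in> \<Delta>" and "Poly_Mapping.lookup p 0 \<noteq> 0"
  then have "0 \<in> Poly_Mapping.keys p" by (simp add: in_keys_iff)
  then have "Poly_Mapping.keys (0 :: 'a \<Rightarrow>\<^sub>0 nat) \<union> F \<notin> \<Delta>" using p(1) unfolding fideal_def by blast
  then show False using p(2) by simp
qed

text \<open>Both differentials lower \<open>card A - card F\<close> by one, so this difference is
  the total degree \<open>k\<close>; it is an integer because either set may be the larger
  one.\<close>

definition tcond :: "nat \<Rightarrow> int \<Rightarrow> 'v set \<Rightarrow> nat set \<Rightarrow> bool" where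
  "tcond i k F A \<longleftrightarrow> A \<subseteq> {..<i} \<and> int (card A) = int (card F) + k"

lemma tcond_diff: "finite F \<Longrightarrow> v \<in> F \<Longrightarrow> tcond i (k + 1) (F - {v}) A \<longleftrightarrow> tcond i k F A"
  using card_Suc_Diff1[of F v] by (auto simp: tcond_def)

lemma tcond_insert:
  assumes "a < i" "a \<notin> A" shows "tcond i (k + 1) F (insert a A) \<longleftrightarrow> tcond i k F A"
proof (cases "A \<subseteq> {..<i}")
  case True
  then have "finite A" using finite_subset by blast
  then show ?thesis using assms True by (auto simp: tcond_def)
qed (simp add: tcond_def)

context moment_curve
begin

text \<open>Total differential of the double complex; the sign makes the two differentials
  anticommute.\<close>

definition D :: "nat \<Rightarrow> ('v set \<Rightarrow> nat set \<Rightarrow> ('v, 'k) mpoly) \<Rightarrow> 'v set \<Rightarrow> nat set \<Rightarrow> ('v, 'k) mpoly" where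
  "D i z F A = dlt (\<lambda>G. z G A) F + pm_scale ((-1) ^ card F) (kos \<theta> i (z F) A)"

text \<open>\<open>k\<close> is the total cohomological degree (up to sign) and \<open>s\<close> the internal degree.\<close>

definition tc :: "nat \<Rightarrow> nat \<Rightarrow> int \<Rightarrow> ('v set \<Rightarrow> nat set \<Rightarrow> ('v, 'k) mpoly) \<Rightarrow> bool" where
  "tc i s k z \<longleftrightarrow> (\<forall>F A. tcond i k F A \<longrightarrow> z F A \<in> supp_in {t. dg t + card A = s})
    \<and> (\<forall>F A. \<not> tcond i k F A \<longrightarrow> z F A = 0)"

definition cyc :: "nat \<Rightarrow> ('v set \<Rightarrow> nat set \<Rightarrow> ('v, 'k) mpoly) \<Rightarrow> bool" where
  "cyc i z \<longleftrightarrow> (\<forall>F A. A \<subseteq> {..<i} \<longrightarrow> D i z F A \<in> fideal \<Delta> F)"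

text \<open>No part in multidegree 0 on faces, the only multidegree in which the complex of stars
  may fail to be exact.\<close>

definition pos :: "('v set \<Rightarrow> nat set \<Rightarrow> ('v, 'k) mpoly) \<Rightarrow> bool" where
  "pos z \<longleftrightarrow> (\<forall>F A. F \<in> \<Delta> \<longrightarrow> Poly_Mapping.lookup (z F A) 0 = 0)"

lemma fid: "is_ideal (fideal \<Delta> F :: ('v, 'k) mpoly set)"
  by (rule fideal_ideal[OF down])

lemma D_add: "D i (\<lambda>F A. y F A + z F A) F A = D i y F A + D i z F A"
  by (simp add: D_def dlt_simps kos_add pm.scale_right_distrib)

lemma D_diff: "D i (\<lambda>F A. y F A - z F A) F A = D i y F A - D i z F A"
  by (simp add: D_def dlt_simps kos_diff pm.scale_right_diff_distrib)

lemma D_scale: "D i (\<lambda>F A. pm_scale c (z F A)) F A = pm_scale c (D i z F A)"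
  by (simp add: D_def dlt_simps kos_scale pm.scale_right_distrib mult.commute)

lemma D_zero: "D i (\<lambda>F A. 0) F A = 0"
  by (simp add: D_def dlt_zero kos_zero)

lemma D_D:
  assumes "A \<subseteq> {..<i}" shows "D i (D i z) F A = 0"
proof -
  let ?s = "(-1) ^ card F :: 'k"
  have 1: "dlt (\<lambda>G. pm_scale ((-1) ^ card G) (kos \<theta> i (z G) A)) F = - pm_scale ?s (dlt (\<lambda>G. kos \<theta> i (z G) A) F)"
    unfolding dlt_def pm.scale_sum_right sum_negf[symmetric]
  proof (rule sum.cong)
    fix v assume "v \<in> F"
    then have "card F = Suc (card (F - {v}))" using card_Suc_Diff1[of F v] by simp
    then have "?s = - ((-1) ^ card (F - {v}))" by simp
    then show "pm_scale (sg v F) (pm_scale ((-1) ^ card (F - {v})) (kos \<theta> i (z (F - {v})) A)) =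
        - pm_scale ?s (pm_scale (sg v F) (kos \<theta> i (z (F - {v})) A))"
      by (simp add: mult.commute)
  qed simp
  have 2: "kos \<theta> i (\<lambda>B. dlt (\<lambda>G. z G B) F) A = dlt (\<lambda>G. kos \<theta> i (z G) A) F"
    unfolding dlt_def kos_sum kos_scale ..
  have "D i (D i z) F A = dlt (dlt (\<lambda>G. z G A)) F + dlt (\<lambda>G. pm_scale ((-1) ^ card G) (kos \<theta> i (z G) A)) F
      + pm_scale ?s (kos \<theta> i (\<lambda>B. dlt (\<lambda>G. z G B) F) A + pm_scale ?s (kos \<theta> i (kos \<theta> i (z F)) A))"
    unfolding D_def[abs_def] dlt_simps kos_add kos_scale ..
  then show ?thesis unfolding 1 2 kos_kos[OF assms] dlt_dlt by simp
qed

lemma tc_D: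
  assumes w: "tc i s (k + 1) w" shows "tc i s k (D i w)"
  unfolding tc_def
proof (intro conjI allI impI)
  fix F :: "'v set" and A assume c: "tcond i k F A"
  let ?S = "supp_in {t :: 'v \<Rightarrow>\<^sub>0 nat. dg t + card A = s} :: ('v, 'k) mpoly set"
  have fA: "finite A" using c finite_subset by (auto simp: tcond_def)
  show "D i w F A \<in> ?S" unfolding D_def dlt_def kos_def
  proof (intro pm.subspace_add[OF subspace_supp_in] pm.subspace_sum[OF subspace_supp_in] pm.subspace_scale[OF subspace_supp_in])
    fix v assume "v \<in> F"
    then show "w (F - {v}) A \<in> ?S" using w c tcond_diff[of F v i k A] by (simp add: tc_def)
  next
    fix a assume a: "a \<in> {..<i} - A"
    then have "tcond i (k + 1) F (insert a A)" using c tcond_insert[of a i A k F] by simp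
    then have "w F (insert a A) \<in> supp_in {t. dg t + card (insert a A) = s}" using w by (simp add: tc_def)
    then have "w F (insert a A) \<in> supp_in {t. dg t + Suc (card A) = s}" using a fA by simp
    then show "\<theta> a * w F (insert a A) \<in> ?S" unfolding \<theta>_def by (rule lin_mult_degree)
  qed
next
  fix F :: "'v set" and A assume c: "\<not> tcond i k F A"
  have "dlt (\<lambda>G. w G A) F = 0"
    by (rule dlt_zero) (use w c tcond_diff[of F _ i k A] in \<open>simp add: tc_def\<close>)
  moreover have "kos \<theta> i (w F) A = 0"
    by (rule kos_zero) (use w c tcond_insert[of _ i A k F] in \<open>simp add: tc_def\<close>)
  ultimately show "D i w F A = 0" by (simp add: D_def)
qed

lemma tc_diff: "tc i s k y \<Longrightarrow> tc i s k z \<Longrightarrow> tc i s k (\<lambda>F A. y F A - z F A)"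
  unfolding tc_def by (simp add: pm.subspace_diff[OF subspace_supp_in])

lemma tc_add: "tc i s k y \<Longrightarrow> tc i s k z \<Longrightarrow> tc i s k (\<lambda>F A. y F A + z F A)"
  unfolding tc_def by (simp add: pm.subspace_add[OF subspace_supp_in])

lemma tc_scale: "tc i s k y \<Longrightarrow> tc i s k (\<lambda>F A. pm_scale c (y F A))"
  unfolding tc_def by (simp add: pm.subspace_scale[OF subspace_supp_in])

lemma tc_zero: "tc i s k (\<lambda>F A. 0)"
  unfolding tc_def by (simp add: pm.subspace_0[OF subspace_supp_in])

lemma cyc_diff_D: "cyc i u \<Longrightarrow> cyc i (\<lambda>F A. u F A - D i w F A)"
  unfolding cyc_def D_diff by (simp add: D_D)

lemma cyc_add: "cyc i y \<Longrightarrow> cyc i z \<Longrightarrow> cyc i (\<lambda>F A. y F A + z F A)"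
  unfolding cyc_def D_add by (simp add: idl.subspace_add[OF fid])

lemma cyc_scale: "cyc i y \<Longrightarrow> cyc i (\<lambda>F A. pm_scale c (y F A))"
  unfolding cyc_def D_scale by (simp add: pm.subspace_scale[OF pm_subspace_of_ideal[OF fid]])

lemma pos_D: "pos w \<Longrightarrow> pos (D i w)"
  unfolding pos_def
proof (intro allI impI)
  fix F A assume w: "\<forall>F A. F \<in> \<Delta> \<longrightarrow> Poly_Mapping.lookup (w F A) 0 = 0" and F: "F \<in> \<Delta>"
  have "Poly_Mapping.lookup (dlt (\<lambda>G. w G A) F) 0 = 0"
    unfolding lookup_dlt by (rule sum.neutral) (use w down[OF F] in simp)
  moreover have "Poly_Mapping.lookup (kos \<theta> i (w F) A) 0 = 0"
    unfolding kos_def Poly_Mapping.lookup_sum by (rule sum.neutral) (simp add: \<theta>_def lin_mult_const)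
  ultimately show "Poly_Mapping.lookup (D i w F A) 0 = 0" by (simp add: D_def Poly_Mapping.lookup_add)
qed

lemma kos_restr:
  assumes "\<And>v t. P (Poly_Mapping.single v 1 + t) \<longleftrightarrow> Q t"
  shows "restr P (kos \<theta> i y A) = kos \<theta> i (\<lambda>B. restr Q (y B)) A"
  unfolding kos_def restr_sum
proof (rule sum.cong)
  fix a
  have "restr P (\<theta> a * y (insert a A)) = \<theta> a * restr Q (y (insert a A))"
    unfolding \<theta>_def by (rule restr_lin_mult) (rule assms)
  then show "restr P (pm_scale (sg a A) (\<theta> a * y (insert a A))) = pm_scale (sg a A) (\<theta> a * restr Q (y (insert a A)))"
    by (simp only: restr_pm_scale)
qed simp

text \<open>Koszul-exactness on the stars of nonempty faces, applied from the small faces upwards.\<close>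

lemma up_level:
  assumes i: "i \<le> d" and N: "0 \<le> int N + k"
    and u: "tc i s k u" "cyc i u" "\<And>F. int (card F) = - k \<Longrightarrow> u F {} \<in> gens (fideal \<Delta> F) \<theta> i"
      "\<And>F A. A \<subseteq> {..<i} \<Longrightarrow> card F < N \<Longrightarrow> u F A \<in> fideal \<Delta> F"
    and k: "k \<le> 0"
  shows "\<exists>w. tc i s (k + 1) w \<and> (\<forall>F A. card F \<noteq> N \<longrightarrow> w F A = 0)
    \<and> (\<forall>F A. A \<subseteq> {..<i} \<longrightarrow> card F \<le> N \<longrightarrow> u F A - D i w F A \<in> fideal \<Delta> F)"
proof -
  \<comment> \<open>Size of the Koszul index sets that accompany faces of size \<open>N\<close> in
    total degree \<open>k\<close>. As \<open>k\<close> is not positive, \<open>q\<close> is positive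
    only for nonempty faces, where the forms are regular.\<close>
  define q where "q = nat (int N + k)"
  have q: "int q = int N + k" using N by (simp add: q_def)
  have "\<exists>y. card F = N \<longrightarrow> (\<forall>A. A \<subseteq> {..<i} \<longrightarrow> card A = q \<longrightarrow> u F A - kos \<theta> i y A \<in> fideal \<Delta> F)" for F
  proof (cases "card F = N")
    case True
    have "\<exists>y. \<forall>A. A \<subseteq> {..<i} \<longrightarrow> card A = q \<longrightarrow> u F A - kos \<theta> i y A \<in> fideal \<Delta> F"
    proof (rule koszul_exact[OF fid])
      fix l assume "0 < q" "l < i"
      then have "F \<noteq> {}" using True q k by auto
      then show "nonzerodiv (gens (fideal \<Delta> F) \<theta> l) (\<theta> l)" by (rule \<theta>_regular) (use \<open>l < i\<close> i in simp)
    next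
      assume "q = 0"
      then show "u F {} \<in> gens (fideal \<Delta> F) \<theta> i" using u(3) True q by simp
    next
      fix B assume B: "B \<subseteq> {..<i}" "Suc (card B) = q"
      have "dlt (\<lambda>G. u G B) F \<in> fideal \<Delta> F"
      proof (rule dlt_in_fideal[OF down])
        fix v assume "v \<in> F"
        then have "card (F - {v}) < N" using True card_Diff1_less[of F v] by simp
        then show "u (F - {v}) B \<in> fideal \<Delta> (F - {v})" by (rule u(4)[OF B(1)])
      qed
      moreover have "D i u F B \<in> fideal \<Delta> F" using u(2) B by (simp add: cyc_def)
      ultimately have "D i u F B - dlt (\<lambda>G. u G B) F \<in> fideal \<Delta> F" by (intro idl.subspace_diff[OF fid])
      then have "pm_scale ((-1) ^ card F) (kos \<theta> i (u F) B) \<in> fideal \<Delta> F" by (simp add: D_def)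
      then have "pm_scale ((-1) ^ card F) (pm_scale ((-1) ^ card F) (kos \<theta> i (u F) B)) \<in> fideal \<Delta> F"
        by (rule pm.subspace_scale[OF pm_subspace_of_ideal[OF fid]])
      then show "kos \<theta> i (u F) B \<in> fideal \<Delta> F" by (simp flip: power_add mult_2)
    qed
    then show ?thesis by simp
  qed simp
  then have "\<exists>Y. \<forall>F. card F = N \<longrightarrow> (\<forall>A. A \<subseteq> {..<i} \<longrightarrow> card A = q \<longrightarrow> u F A - kos \<theta> i (Y F) A \<in> fideal \<Delta> F)"
    by (rule choice[OF allI])
  then obtain Y where Y: "\<And>F A. card F = N \<Longrightarrow> A \<subseteq> {..<i} \<Longrightarrow> card A = q \<Longrightarrow> u F A - kos \<theta> i (Y F) A \<in> fideal \<Delta> F"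
    by auto
  \<comment> \<open>Koszul exactness gives no control over degrees, so the primitive is cut to
    internal degree \<open>s\<close>; the sign undoes the one in \<open>D\<close>.\<close>
  define w where "w F A = (if card F = N \<and> A \<subseteq> {..<i} \<and> card A = Suc q
    then pm_scale ((-1) ^ N) (restr (\<lambda>t. dg t + card A = s) (Y F A)) else 0)" for F A
  have w0: "w F A = 0" if "card F \<noteq> N" for F A using that by (simp add: w_def)
  have tcw: "tc i s (k + 1) w"
    unfolding tc_def
  proof (intro conjI allI impI)
    fix F :: "'v set" and A :: "nat set"
    have "restr (\<lambda>t. dg t + card A = s) (Y F A) \<in> supp_in {t. dg t + card A = s}"
      by (auto simp: supp_in_def keys_restr)
    from pm.subspace_scale[OF subspace_supp_in this, of "(-1) ^ N"]
    show "w F A \<in> supp_in {t. dg t + card A = s}"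
      unfolding w_def by (simp only: pm.subspace_0[OF subspace_supp_in] split: if_split) simp
    show "w F A = 0" if "\<not> tcond i (k + 1) F A" using that q by (auto simp: w_def tcond_def)
  qed
  have main: "u F A - D i w F A \<in> fideal \<Delta> F" if A: "A \<subseteq> {..<i}" and F: "card F \<le> N" for F A
  proof -
    have fA: "finite A" using A finite_subset by blast
    have dl: "dlt (\<lambda>G. w G A) F = 0"
    proof (rule dlt_zero)
      fix v assume "v \<in> F"
      then have "card (F - {v}) < N" using F card_Diff1_less[of F v] by simp
      then show "w (F - {v}) A = 0" by (intro w0) simp
    qed
    show ?thesis
    proof (cases "card F = N")
      case False
      then have "D i w F A = 0" unfolding D_def dl using w0[OF False] by (simp add: kos_zero)
      then show ?thesis using u(4)[OF A] False F by simp
    next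
      case True
      show ?thesis
      proof (cases "card A = q")
        case False
        have "u F A = 0" using u(1) False True q by (simp add: tc_def tcond_def)
        moreover have "kos \<theta> i (w F) A = 0" by (rule kos_zero) (use False fA in \<open>simp add: w_def\<close>)
        ultimately show ?thesis using idl.subspace_0[OF fid] by (simp add: D_def dl)
      next
        case Aq: True
        have "kos \<theta> i (w F) A = kos \<theta> i (\<lambda>B. pm_scale ((-1) ^ N) (restr (\<lambda>t. dg t + Suc q = s) (Y F B))) A"
          by (rule kos_cong) (use A fA Aq True in \<open>simp add: w_def\<close>)
        also have "\<dots> = pm_scale ((-1) ^ N) (restr (\<lambda>t. dg t + q = s) (kos \<theta> i (Y F) A))"
          unfolding kos_scale by (subst kos_restr[of _ "\<lambda>t. dg t + Suc q = s"]) simp_all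
        finally have "D i w F A = restr (\<lambda>t. dg t + q = s) (kos \<theta> i (Y F) A)"
          by (simp add: D_def dl True flip: power_add mult_2)
        moreover have "u F A = restr (\<lambda>t. dg t + q = s) (u F A)"
        proof (rule restr_id[symmetric])
          fix t assume "t \<in> Poly_Mapping.keys (u F A)"
          moreover have "tcond i k F A" using True Aq A q by (simp add: tcond_def)
          then have "u F A \<in> supp_in {t. dg t + card A = s}" using u(1) unfolding tc_def by blast
          ultimately show "dg t + q = s" using Aq by (auto simp: supp_in_def)
        qed
        ultimately have "u F A - D i w F A = restr (\<lambda>t. dg t + q = s) (u F A - kos \<theta> i (Y F) A)"
          by (simp add: restr_diff)
        then show ?thesis using fideal_restr[OF Y[OF True A Aq]] by simp
      qed
    qed
  qed
  show ?thesis using tcw w0 main by (intro exI[of _ w]) simp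
qed

text \<open>A correction supported on faces of size \<open>N\<close> changes only sizes
  \<open>N\<close> and \<open>Suc N\<close>, so levels already treated stay settled. The assumption
  on \<open>u F {}\<close> supplies the lowest Koszul degree, where exactness has an
  obstruction.\<close>

lemma up:
  assumes i: "i \<le> d" and k: "k \<le> 0"
    and u: "tc i s k u" "cyc i u" "\<And>F. int (card F) = - k \<Longrightarrow> u F {} \<in> gens (fideal \<Delta> F) \<theta> i"
  shows "\<exists>w. tc i s (k + 1) w \<and> (\<forall>F A. int (card F) + k < 0 \<longrightarrow> w F A = 0)
    \<and> (\<forall>F A. A \<subseteq> {..<i} \<longrightarrow> u F A - D i w F A \<in> fideal \<Delta> F)"
proof -
  have "\<exists>w. tc i s (k + 1) w \<and> (\<forall>F A. int (card F) + k < 0 \<longrightarrow> w F A = 0)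
      \<and> (\<forall>F A. A \<subseteq> {..<i} \<longrightarrow> u F A - D i w F A \<in> fideal \<Delta> F)"
    if "N \<le> Suc CARD('v)" "tc i s k u" "cyc i u" "\<And>F. int (card F) = - k \<Longrightarrow> u F {} \<in> gens (fideal \<Delta> F) \<theta> i"
      "\<And>F A. A \<subseteq> {..<i} \<Longrightarrow> card F < N \<Longrightarrow> u F A \<in> fideal \<Delta> F" for N u
    using that
  proof (induction arbitrary: u rule: inc_induct)
    case base
    have "u F A \<in> fideal \<Delta> F" if "A \<subseteq> {..<i}" for F A
      by (rule base(4)[OF that]) (simp add: card_mono less_Suc_eq_le)
    then show ?case by (intro exI[of _ "\<lambda>F A. 0"]) (simp add: tc_zero D_zero)
  next
    case (step N)
    note u = step.prems
    show ?case
    proof (cases "0 \<le> int N + k")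
      case False
      show ?thesis
      proof (rule step.IH[OF u(1,2,3)])
        fix F :: "'v set" and A assume A: "A \<subseteq> {..<i}" and F: "card F < Suc N"
        show "u F A \<in> fideal \<Delta> F"
        proof (cases "card F = N")
          case True
          then have "\<not> tcond i k F A" using False by (simp add: tcond_def)
          then show ?thesis using u(1) idl.subspace_0[OF fid] by (simp add: tc_def)
        qed (use u(4)[OF A] F in simp)
      qed
    next
      case True
      have "\<exists>w. tc i s (k + 1) w \<and> (\<forall>F A. card F \<noteq> N \<longrightarrow> w F A = 0)
          \<and> (\<forall>F A. A \<subseteq> {..<i} \<longrightarrow> card F \<le> N \<longrightarrow> u F A - D i w F A \<in> fideal \<Delta> F)"
      proof (rule up_level[OF i True u(1,2) _ _ k])
        show "u F {} \<in> gens (fideal \<Delta> F) \<theta> i" if "int (card F) = - k" for F by (rule u(3)[OF that])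
        show "u F A \<in> fideal \<Delta> F" if "A \<subseteq> {..<i}" "card F < N" for F A by (rule u(4)[OF that])
      qed
      then obtain w where w: "tc i s (k + 1) w" "\<And>F A. card F \<noteq> N \<Longrightarrow> w F A = 0"
        "\<And>F A. A \<subseteq> {..<i} \<Longrightarrow> card F \<le> N \<Longrightarrow> u F A - D i w F A \<in> fideal \<Delta> F"
        by auto
      let ?u = "\<lambda>F A. u F A - D i w F A"
      have "\<exists>w. tc i s (k + 1) w \<and> (\<forall>F A. int (card F) + k < 0 \<longrightarrow> w F A = 0)
          \<and> (\<forall>F A. A \<subseteq> {..<i} \<longrightarrow> ?u F A - D i w F A \<in> fideal \<Delta> F)"
      proof (rule step.IH)
        show "tc i s k ?u" by (rule tc_diff[OF u(1) tc_D[OF w(1)]])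
        show "cyc i ?u" by (rule cyc_diff_D[OF u(2)])
        show "?u F {} \<in> gens (fideal \<Delta> F) \<theta> i" if F: "int (card F) = - k" for F
        proof -
          have "?u F {} \<in> fideal \<Delta> F" by (rule w(3)) (use F True in auto)
          then show ?thesis using gens_mono[of 0 i "fideal \<Delta> F" \<theta>] by auto
        qed
        show "?u F A \<in> fideal \<Delta> F" if "A \<subseteq> {..<i}" "card F < Suc N" for F A
          using w(3)[OF that(1)] that(2) by simp
      qed
      then obtain w' where w': "tc i s (k + 1) w'" "\<And>F A. int (card F) + k < 0 \<Longrightarrow> w' F A = 0"
        "\<And>F A. A \<subseteq> {..<i} \<Longrightarrow> ?u F A - D i w' F A \<in> fideal \<Delta> F" by auto
      show ?thesis
      proof (intro exI[of _ "\<lambda>F A. w F A + w' F A"] conjI allI impI)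
        show "tc i s (k + 1) (\<lambda>F A. w F A + w' F A)" by (rule tc_add[OF w(1) w'(1)])
        show "w F A + w' F A = 0" if "int (card F) + k < 0" for F A
        proof -
          have "card F \<noteq> N" using that True by auto
          then show ?thesis using w(2) w'(2)[OF that] by simp
        qed
        show "u F A - D i (\<lambda>F A. w F A + w' F A) F A \<in> fideal \<Delta> F" if "A \<subseteq> {..<i}" for F A
          using w'(3)[OF that] by (simp add: D_add diff_diff_eq)
      qed
    qed
  qed
  from this[of 0 u] show ?thesis using u by simp
qed

text \<open>Exactness of the cochain complex of stars in positive degrees, applied from the large faces downwards.\<close>

lemma down_level:
  assumes u: "tc i s k u" "cyc i u" "pos u" "\<And>F A. A \<subseteq> {..<i} \<Longrightarrow> Suc N \<le> card F \<Longrightarrow> u F A \<in> fideal \<Delta> F"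
  shows "\<exists>w. tc i s (k + 1) w \<and> pos w
    \<and> (\<forall>F A. A \<subseteq> {..<i} \<longrightarrow> N \<le> card F \<longrightarrow> u F A - D i w F A \<in> fideal \<Delta> F)"
proof -
  define w where "w F A = (if Suc (card F) = N \<and> A \<subseteq> {..<i} then cone (\<lambda>G. u G A) F else 0)" for F A
  have tcw: "tc i s (k + 1) w"
    unfolding tc_def
  proof (intro conjI allI impI)
    fix F A
    have key: "tcond i (k + 1) F A \<and> dg t + card A = s" if t: "t \<in> Poly_Mapping.keys (cone (\<lambda>G. u G A) F)" for t
    proof -
      obtain g where g: "g \<notin> F" "t \<in> Poly_Mapping.keys (u (insert g F) A)" using keys_cone[OF t] by (elim exE conjE)
      then have "u (insert g F) A \<noteq> 0" by auto
      then have c: "tcond i k (insert g F) A" using u(1) unfolding tc_def by blast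
      then have "u (insert g F) A \<in> supp_in {t. dg t + card A = s}" using u(1) by (simp add: tc_def)
      then have "dg t + card A = s" using g(2) by (auto simp: supp_in_def)
      moreover have "tcond i (k + 1) F A" using tcond_diff[of "insert g F" g i k A] c g(1) by simp
      ultimately show ?thesis by simp
    qed
    show "w F A \<in> supp_in {t. dg t + card A = s}"
      using key by (auto simp: w_def supp_in_def)
    show "w F A = 0" if n: "\<not> tcond i (k + 1) F A"
    proof -
      have "Poly_Mapping.keys (cone (\<lambda>G. u G A) F) = {}"
        using key n by (metis equals0I)
      then have "cone (\<lambda>G. u G A) F = 0" by (simp only: keys_eq_empty)
      then show ?thesis by (simp add: w_def)
    qed
  qed
  have posw: "pos w" by (simp add: pos_def w_def lookup_cone_0)
  have main: "u F A - D i w F A \<in> fideal \<Delta> F" if A: "A \<subseteq> {..<i}" and F: "N \<le> card F" for F A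
  proof -
    have kz: "kos \<theta> i (w F) A = 0" by (rule kos_zero) (use F in \<open>simp add: w_def\<close>)
    show ?thesis
    proof (cases "card F = N")
      case False
      have "dlt (\<lambda>G. w G A) F = 0"
        by (rule dlt_zero) (use False card_Suc_Diff1[of F] in \<open>simp add: w_def\<close>)
      then show ?thesis using u(4)[OF A] False F by (simp add: D_def kz)
    next
      case True
      have "dlt (\<lambda>G. w G A) F = dlt (cone (\<lambda>G. u G A)) F"
        by (rule dlt_cong) (use True A card_Suc_Diff1[of F] in \<open>simp add: w_def\<close>)
      moreover have "u F A - dlt (cone (\<lambda>G. u G A)) F \<in> fideal \<Delta> F"
      proof (rule dlt_exact[of \<Delta> F "\<lambda>G. u G A", OF down])
        fix G :: "'v set" assume G: "card G = Suc (card F)"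
        have "kos \<theta> i (u G) A \<in> fideal \<Delta> G"
          by (rule kos_in_ideal'[OF fid], rule u(4)) (use A G True in auto)
        then have "pm_scale ((-1) ^ card G) (kos \<theta> i (u G) A) \<in> fideal \<Delta> G"
          by (rule pm.subspace_scale[OF pm_subspace_of_ideal[OF fid]])
        moreover have "D i u G A \<in> fideal \<Delta> G" using u(2) A by (simp add: cyc_def)
        ultimately have "D i u G A - pm_scale ((-1) ^ card G) (kos \<theta> i (u G) A) \<in> fideal \<Delta> G"
          by (intro idl.subspace_diff[OF fid])
        then show "dlt (\<lambda>G. u G A) G \<in> fideal \<Delta> G" by (simp add: D_def)
      next
        show "Poly_Mapping.lookup (u F A) 0 = 0" if "F \<in> \<Delta>" using u(3) that by (simp add: pos_def)
      qed
      ultimately show ?thesis by (simp add: D_def kz)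
    qed
  qed
  show ?thesis using tcw posw main by (intro exI[of _ w]) simp
qed

text \<open>Here a correction for size \<open>N\<close> lives on sets with one vertex less and
  changes nothing above \<open>N\<close>. It has no constants, so \<open>pos\<close> persists
  through the sweep.\<close>

lemma dwn:
  assumes "tc i s k u" "cyc i u" "pos u"
  shows "\<exists>w. tc i s (k + 1) w \<and> pos w \<and> (\<forall>F A. A \<subseteq> {..<i} \<longrightarrow> u F A - D i w F A \<in> fideal \<Delta> F)"
proof -
  have "\<exists>w. tc i s (k + 1) w \<and> pos w \<and> (\<forall>F A. A \<subseteq> {..<i} \<longrightarrow> u F A - D i w F A \<in> fideal \<Delta> F)"
    if "tc i s k u" "cyc i u" "pos u" "\<And>F A. A \<subseteq> {..<i} \<Longrightarrow> N \<le> card F \<Longrightarrow> u F A \<in> fideal \<Delta> F" for N u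
    using that
  proof (induction N arbitrary: u)
    case 0
    then show ?case by (intro exI[of _ "\<lambda>F A. 0"]) (simp add: tc_zero D_zero pos_def)
  next
    case (Suc N)
    note u = Suc.prems
    have "\<exists>w. tc i s (k + 1) w \<and> pos w
        \<and> (\<forall>F A. A \<subseteq> {..<i} \<longrightarrow> N \<le> card F \<longrightarrow> u F A - D i w F A \<in> fideal \<Delta> F)"
    proof (rule down_level[OF u(1,2,3)])
      show "u F A \<in> fideal \<Delta> F" if "A \<subseteq> {..<i}" "Suc N \<le> card F" for F A by (rule u(4)[OF that])
    qed
    then obtain w where w: "tc i s (k + 1) w" "pos w"
      "\<And>F A. A \<subseteq> {..<i} \<Longrightarrow> N \<le> card F \<Longrightarrow> u F A - D i w F A \<in> fideal \<Delta> F"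
      by auto
    let ?u = "\<lambda>F A. u F A - D i w F A"
    have "\<exists>w. tc i s (k + 1) w \<and> pos w \<and> (\<forall>F A. A \<subseteq> {..<i} \<longrightarrow> ?u F A - D i w F A \<in> fideal \<Delta> F)"
    proof (rule Suc.IH)
      show "tc i s k ?u" by (rule tc_diff[OF u(1) tc_D[OF w(1)]])
      show "cyc i ?u" by (rule cyc_diff_D[OF u(2)])
      show "pos ?u" using u(3) pos_D[OF w(2), of i] by (simp add: pos_def lookup_minus)
    qed (rule w(3))
    then obtain w' where w': "tc i s (k + 1) w'" "pos w'"
      "\<And>F A. A \<subseteq> {..<i} \<Longrightarrow> ?u F A - D i w' F A \<in> fideal \<Delta> F" by auto
    show ?case
    proof (intro exI[of _ "\<lambda>F A. w F A + w' F A"] conjI allI impI)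
      show "tc i s (k + 1) (\<lambda>F A. w F A + w' F A)" by (rule tc_add[OF w(1) w'(1)])
      show "pos (\<lambda>F A. w F A + w' F A)" using w(2) w'(2) by (simp add: pos_def Poly_Mapping.lookup_add)
      show "u F A - D i (\<lambda>F A. w F A + w' F A) F A \<in> fideal \<Delta> F" if "A \<subseteq> {..<i}" for F A
        using w'(3)[OF that] by (simp add: D_add diff_diff_eq)
    qed
  qed
  note gen = this
  show ?thesis
  proof (rule gen[OF assms])
    fix F :: "'v set" and A assume "Suc CARD('v) \<le> card F"
    moreover have "card F \<le> CARD('v)" by (rule card_mono) auto
    ultimately show "u F A \<in> fideal \<Delta> F" by simp
  qed
qed

subsection \<open>The zeroth cohomology of the quotient complex\<close>

definition Xs :: "nat \<Rightarrow> 'v set set" where "Xs s = {F\<in>\<Delta>. card F = s}"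

definition cobd :: "('v set \<Rightarrow>\<^sub>0 'k) \<Rightarrow> 'v set \<Rightarrow> 'k" where
  "cobd b F = (\<Sum>v\<in>F. sg v F * Poly_Mapping.lookup b (F - {v}))"

text \<open>
  \<open>Zc s\<close> and \<open>Bc s\<close> are the simplicial cocycles and coboundaries on the faces with \<open>s\<close> vertices, while
  \<open>Z0 i s\<close> modulo \<open>B0 i s\<close> is the zeroth cohomology of the complex of stars modulo \<open>\<theta>\<^sub>0, \<dots>, \<theta>\<^sub>i\<^sub>-\<^sub>1\<close> in
  degree \<open>s\<close>.
\<close>

definition Zc :: "nat \<Rightarrow> ('v set \<Rightarrow>\<^sub>0 'k) set" where
  "Zc s = {b\<in>supp_in (Xs s). \<forall>F\<in>\<Delta>. card F = Suc s \<longrightarrow> cobd b F = 0}"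

text \<open>\<open>a\<close> ranges over all functions on sets: on a face, \<open>cobd\<close> reads
  only facets, which are faces again.\<close>

definition Bc :: "nat \<Rightarrow> ('v set \<Rightarrow>\<^sub>0 'k) set" where
  "Bc s = {b\<in>supp_in (Xs s). \<exists>a. \<forall>F\<in>Xs s. Poly_Mapping.lookup b F = cobd a F}"

definition Z0 :: "nat \<Rightarrow> nat \<Rightarrow> ('v, 'k) mpoly set" where
  "Z0 i s = {g\<in>hom s. \<forall>v. g \<in> gens (fideal \<Delta> {v}) \<theta> i}"

definition B0 :: "nat \<Rightarrow> nat \<Rightarrow> ('v, 'k) mpoly set" where
  "B0 i s = gens (fideal \<Delta> {}) \<theta> i \<inter> hom s"

lemma cobd_simps: "cobd (a + b) F = cobd a F + cobd b F" "cobd (pm_scale c a) F = c * cobd a F" "cobd 0 F = 0"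
  by (simp_all add: cobd_def Poly_Mapping.lookup_add distrib_left sum.distrib sum_distrib_left mult.left_commute)

lemma subspace_Zc: "pm.subspace (Zc s)"
  by (simp add: pm.subspace_def Zc_def cobd_simps pm.subspace_0[OF subspace_supp_in]
      pm.subspace_add[OF subspace_supp_in] pm.subspace_scale[OF subspace_supp_in])

lemma subspace_Bc: "pm.subspace (Bc s)"
  unfolding pm.subspace_def
proof (intro conjI ballI allI)
  show "0 \<in> Bc s" unfolding Bc_def
    by (intro CollectI conjI exI[of _ 0]) (simp_all add: pm.subspace_0[OF subspace_supp_in] cobd_simps)
  fix x assume "x \<in> Bc s"
  then obtain a where x: "x \<in> supp_in (Xs s)" "\<forall>F\<in>Xs s. Poly_Mapping.lookup x F = cobd a F"
    unfolding Bc_def by (elim CollectE conjE exE)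
  show "pm_scale c x \<in> Bc s" for c unfolding Bc_def
    by (intro CollectI conjI exI[of _ "pm_scale c a"])
      (use x in \<open>simp_all add: pm.subspace_scale[OF subspace_supp_in] cobd_simps\<close>)
  fix y assume "y \<in> Bc s"
  then obtain b where y: "y \<in> supp_in (Xs s)" "\<forall>F\<in>Xs s. Poly_Mapping.lookup y F = cobd b F"
    unfolding Bc_def by (elim CollectE conjE exE)
  show "x + y \<in> Bc s" unfolding Bc_def
    by (intro CollectI conjI exI[of _ "a + b"])
      (use x y in \<open>simp_all add: pm.subspace_add[OF subspace_supp_in] cobd_simps Poly_Mapping.lookup_add\<close>)
qed

lemma Bc_subset_Zc: "Bc s \<subseteq> Zc s"
proof
  fix b assume "b \<in> Bc s"
  then obtain a where b: "b \<in> supp_in (Xs s)" "\<forall>F\<in>Xs s. Poly_Mapping.lookup b F = cobd a F"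
    unfolding Bc_def by (elim CollectE conjE exE)
  have "cobd b F = 0" if F: "F \<in> \<Delta>" "card F = Suc s" for F
  proof -
    have "cobd b F = (\<Sum>v\<in>F. \<Sum>w\<in>F - {v}. sg v F * sg w (F - {v}) * Poly_Mapping.lookup a (F - {v} - {w}))"
      unfolding cobd_def
    proof (rule sum.cong)
      fix v assume v: "v \<in> F"
      then have "F - {v} \<in> Xs s" using F down[OF F(1), of "F - {v}"] by (auto simp: Xs_def)
      then have "Poly_Mapping.lookup b (F - {v}) = cobd a (F - {v})" using b(2) by simp
      then show "sg v F * Poly_Mapping.lookup b (F - {v}) =
          (\<Sum>w\<in>F - {v}. sg v F * sg w (F - {v}) * Poly_Mapping.lookup a (F - {v} - {w}))"
        by (simp add: cobd_def sum_distrib_left mult.assoc)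
    qed simp
    also have "\<dots> = 0"
    proof (rule sum_antisym)
      fix v w assume vw: "v \<in> F" "w \<in> F" "v \<noteq> w"
      have "F - {w} - {v} = F - {v} - {w}" by auto
      then show "sg v F * sg w (F - {v}) * Poly_Mapping.lookup a (F - {v} - {w})
          + sg w F * sg v (F - {w}) * Poly_Mapping.lookup a (F - {w} - {v}) = 0"
        using sg_swap[OF vw, where 'k='k] by (simp flip: distrib_right)
    qed simp
    finally show ?thesis .
  qed
  then show "b \<in> Zc s" using b(1) by (simp add: Zc_def)
qed

lemma subspace_Z0: "pm.subspace (Z0 i s)"
proof -
  have g: "pm.subspace (gens (fideal \<Delta> {v}) \<theta> i)" for v by (rule pm_subspace_of_ideal[OF gens_ideal[OF fid]])
  show ?thesis
    unfolding pm.subspace_def Z0_def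
    by (simp add: pm.subspace_0[OF subspace_hom] pm.subspace_add[OF subspace_hom] pm.subspace_scale[OF subspace_hom]
        pm.subspace_0[OF g] pm.subspace_add[OF g] pm.subspace_scale[OF g])
qed

lemma subspace_B0: "pm.subspace (B0 i s)"
  unfolding B0_def by (intro pm.subspace_inter subspace_hom pm_subspace_of_ideal gens_ideal fid)

lemma B0_subset_Z0: "B0 i s \<subseteq> Z0 i s"
proof
  fix g assume g: "g \<in> B0 i s"
  have "gens (fideal \<Delta> {}) \<theta> i \<subseteq> gens (fideal \<Delta> {v}) \<theta> i" for v
    by (rule gens_mono_base[OF fideal_mono[OF down]]) auto
  then show "g \<in> Z0 i s" using g by (auto simp: B0_def Z0_def)
qed

text \<open>
  The zigzag through the total complex that relates an element of \<open>Z0 i s\<close> to a family of simplicial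
  cocycles indexed by the \<open>s\<close>-subsets of \<open>{..<i}\<close>.
\<close>

definition Rel :: "nat \<Rightarrow> nat \<Rightarrow> ('v, 'k) mpoly \<Rightarrow> ('v set \<times> nat set \<Rightarrow>\<^sub>0 'k) \<Rightarrow> bool" where
  "Rel i s g c \<longleftrightarrow> (\<exists>z. tc i s 0 z \<and> cyc i z \<and> z {} {} = g
    \<and> (\<forall>F A. Poly_Mapping.lookup c (F, A) = (if F \<in> Xs s then Poly_Mapping.lookup (z F A) 0 else 0)))"

lemma Rel_0: "Rel i s 0 0"
  unfolding Rel_def
  by (intro exI[of _ "\<lambda>F A. 0"]) (simp add: tc_zero cyc_def D_zero idl.subspace_0[OF fid])

lemma Rel_add: "Rel i s x x' \<Longrightarrow> Rel i s y y' \<Longrightarrow> Rel i s (x + y) (x' + y')"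
  unfolding Rel_def
proof (elim exE conjE)
  fix z z'
  assume z: "tc i s 0 z" "cyc i z" "z {} {} = x" "\<forall>F A. Poly_Mapping.lookup x' (F, A) = (if F \<in> Xs s then Poly_Mapping.lookup (z F A) 0 else 0)"
    and z': "tc i s 0 z'" "cyc i z'" "z' {} {} = y" "\<forall>F A. Poly_Mapping.lookup y' (F, A) = (if F \<in> Xs s then Poly_Mapping.lookup (z' F A) 0 else 0)"
  show "\<exists>z. tc i s 0 z \<and> cyc i z \<and> z {} {} = x + y
    \<and> (\<forall>F A. Poly_Mapping.lookup (x' + y') (F, A) = (if F \<in> Xs s then Poly_Mapping.lookup (z F A) 0 else 0))"
    by (intro exI[of _ "\<lambda>F A. z F A + z' F A"] conjI tc_add[OF z(1) z'(1)] cyc_add[OF z(2) z'(2)])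
      (use z(3,4) z'(3,4) in \<open>simp_all add: Poly_Mapping.lookup_add\<close>)
qed

lemma Rel_scale: "Rel i s x x' \<Longrightarrow> Rel i s (pm_scale c x) (pm_scale c x')"
  unfolding Rel_def
proof (elim exE conjE)
  fix z
  assume z: "tc i s 0 z" "cyc i z" "z {} {} = x" "\<forall>F A. Poly_Mapping.lookup x' (F, A) = (if F \<in> Xs s then Poly_Mapping.lookup (z F A) 0 else 0)"
  show "\<exists>z. tc i s 0 z \<and> cyc i z \<and> z {} {} = pm_scale c x
    \<and> (\<forall>F A. Poly_Mapping.lookup (pm_scale c x') (F, A) = (if F \<in> Xs s then Poly_Mapping.lookup (z F A) 0 else 0))"
    by (intro exI[of _ "\<lambda>F A. pm_scale c (z F A)"] conjI tc_scale[OF z(1)] cyc_scale[OF z(2)])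
      (use z(3,4) in simp_all)
qed

abbreviation Ns :: "nat \<Rightarrow> nat \<Rightarrow> nat set set" where
  "Ns i s \<equiv> {A. A \<subseteq> {..<i} \<and> card A = s}"

text \<open>Membership of \<open>g\<close> in the ideals of all vertex stars is the condition under
  which \<open>up\<close> extends \<open>g\<close>, placed at the empty face, to a total cocycle;
  the constants at its other end give \<open>c\<close>.\<close>

lemma Rel_left_total:
  assumes i: "i \<le> d" and g: "g \<in> Z0 i s"
  shows "\<exists>c\<in>slices_in (Ns i s) (Zc s). Rel i s g c"
proof -
  define h where "h F A = (if F = {} \<and> A = {} then g else 0)" for F :: "'v set" and A :: "nat set"
  have tch: "tc i s 0 h"
    unfolding tc_def
  proof (intro conjI allI impI)
    fix F :: "'v set" and A :: "nat set"
    have "g \<in> supp_in {t. dg t + card ({} :: nat set) = s}" using g by (simp add: Z0_def hom_def)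
    then show "h F A \<in> supp_in {t. dg t + card A = s}"
      by (simp add: h_def pm.subspace_0[OF subspace_supp_in])
    show "h F A = 0" if "\<not> tcond i 0 F A" using that by (auto simp: h_def tcond_def)
  qed
  define u where "u F A = - D i h F A" for F A
  have uD: "u = (\<lambda>F A. (\<lambda>F A. 0) F A - D i h F A)" by (simp add: u_def fun_eq_iff)
  have tcu: "tc i s (- 1) u"
    unfolding uD by (rule tc_diff[OF tc_zero tc_D]) (use tch in simp)
  have cycu: "cyc i u" unfolding uD by (rule cyc_diff_D) (simp add: cyc_def D_zero idl.subspace_0[OF fid])
  have base: "u F {} \<in> gens (fideal \<Delta> F) \<theta> i" if F: "int (card F) = - (- 1)" for F
  proof -
    obtain v where v: "F = {v}" using F card_1_singletonE[of F] by auto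
    have "kos \<theta> i (h {v}) {} = 0" by (rule kos_zero) (simp add: h_def)
    then have "u F {} = - pm_scale (sg v {v}) g" by (simp add: u_def D_def v dlt_def h_def)
    moreover have "g \<in> gens (fideal \<Delta> {v}) \<theta> i" using g by (simp add: Z0_def)
    ultimately show ?thesis unfolding v
      using pm.subspace_neg[OF pm_subspace_of_ideal[OF gens_ideal[OF fid]]
          pm.subspace_scale[OF pm_subspace_of_ideal[OF gens_ideal[OF fid]], of g "{v}" \<theta> i "sg v {v}"]] by simp
  qed
  obtain w where w: "tc i s 0 w" "\<And>F A. int (card F) - 1 < 0 \<Longrightarrow> w F A = 0"
    "\<And>F A. A \<subseteq> {..<i} \<Longrightarrow> u F A - D i w F A \<in> fideal \<Delta> F"
    using up[OF i _ tcu cycu base] by auto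
  define z where "z F A = h F A + w F A" for F A
  have tcz: "tc i s 0 z" unfolding z_def by (rule tc_add[OF tch w(1)])
  have cycz: "cyc i z"
    unfolding cyc_def
  proof (intro allI impI)
    fix F A assume "A \<subseteq> {..<i}"
    then have "u F A - D i w F A \<in> fideal \<Delta> F" by (rule w(3))
    then have "- (u F A - D i w F A) \<in> fideal \<Delta> F" by (rule idl.subspace_neg[OF fid])
    moreover have "D i z F A = - (u F A - D i w F A)" unfolding z_def D_add u_def by simp
    ultimately show "D i z F A \<in> fideal \<Delta> F" by simp
  qed
  have z0: "z {} {} = g" using w(2)[of "{}" "{}"] by (simp add: z_def h_def)
  define c where "c = (\<Sum>p\<in>Xs s \<times> Ns i s. Poly_Mapping.single p (Poly_Mapping.lookup (z (fst p) (snd p)) 0))"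
  have fin: "finite (Xs s \<times> Ns i s)" by simp
  have lc0: "Poly_Mapping.lookup c (F, A) = (if F \<in> Xs s \<and> A \<in> Ns i s then Poly_Mapping.lookup (z F A) 0 else 0)" for F A
  proof -
    have "Poly_Mapping.lookup c (F, A) = (\<Sum>p\<in>Xs s \<times> Ns i s. if p = (F, A) then Poly_Mapping.lookup (z (fst p) (snd p)) 0 else 0)"
      unfolding c_def Poly_Mapping.lookup_sum by (rule sum.cong) (auto simp: lookup_single when_def)
    then show ?thesis using fin by (simp add: sum.delta)
  qed
  have zN: "z F A = 0" if "F \<in> Xs s" "A \<notin> Ns i s" for F A
    using tcz that by (auto simp: tc_def tcond_def Xs_def)
  have lc: "Poly_Mapping.lookup c (F, A) = (if F \<in> Xs s then Poly_Mapping.lookup (z F A) 0 else 0)" for F A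
    using lc0[of F A] zN[of F A] by auto
  have "slice A c \<in> Zc s" if A: "A \<in> Ns i s" for A
    unfolding Zc_def
  proof (intro CollectI conjI ballI impI)
    show "slice A c \<in> supp_in (Xs s)" by (simp add: supp_in_iff lc)
    fix F assume F: "F \<in> \<Delta>" "card F = Suc s"
    \<comment> \<open>An index set with \<open>Suc s\<close> elements would require internal degree
      -1, so the constants at level \<open>s\<close> meet the simplicial differential only.\<close>
    have "kos \<theta> i (z F) A = 0"
    proof (rule kos_zero)
      fix a assume a: "a < i" "a \<notin> A"
      have fA: "finite A" using A finite_subset by blast
      have c2: "card (insert a A) = Suc s" using A a fA by simp
      have "z F (insert a A) \<in> supp_in {t. dg t + card (insert a A) = s}"
        using tcz by (cases "tcond i 0 F (insert a A)") (simp_all add: tc_def pm.subspace_0[OF subspace_supp_in])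
      then have "z F (insert a A) \<in> supp_in {}" unfolding c2 by (simp add: supp_in_def)
      then show "z F (insert a A) = 0" by (simp add: supp_in_def)
    qed
    moreover have "D i z F A \<in> fideal \<Delta> F" using cycz A by (simp add: cyc_def)
    ultimately have "dlt (\<lambda>G. z G A) F \<in> fideal \<Delta> F" by (simp add: D_def)
    then have "Poly_Mapping.lookup (dlt (\<lambda>G. z G A) F) 0 = 0" by (rule const_coeff_fideal[OF _ F(1)])
    then have "(\<Sum>v\<in>F. sg v F * Poly_Mapping.lookup (z (F - {v}) A) 0) = 0" by (simp add: lookup_dlt)
    moreover have "cobd (slice A c) F = (\<Sum>v\<in>F. sg v F * Poly_Mapping.lookup (z (F - {v}) A) 0)"
      unfolding cobd_def
    proof (rule sum.cong)
      fix v assume "v \<in> F"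
      then have "F - {v} \<in> Xs s" using F down[OF F(1), of "F - {v}"] by (auto simp: Xs_def)
      then show "sg v F * Poly_Mapping.lookup (slice A c) (F - {v}) = sg v F * Poly_Mapping.lookup (z (F - {v}) A) 0"
        by (simp add: lc)
    qed simp
    ultimately show "cobd (slice A c) F = 0" by simp
  qed
  moreover have "slice A c = 0" if A: "A \<notin> Ns i s" for A
    by (rule poly_mapping_eqI) (use A in \<open>simp only: lookup_slice lc0 lookup_zero simp_thms if_False\<close>)
  ultimately have "c \<in> slices_in (Ns i s) (Zc s)" by (simp add: slices_in_def)
  moreover have "Rel i s g c" unfolding Rel_def
    by (intro exI[of _ z] conjI tcz cycz z0 allI lc)
  ultimately show ?thesis by blast
qed

text \<open>The zigzag backwards: \<open>c\<close> is placed as constants and extended by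
  \<open>dwn\<close>, whose condition \<open>pos\<close> is the cocycle condition. Reading the
  resulting total cocycle at single vertices puts its component at the empty face into all vertex
  star ideals.\<close>

lemma Rel_right_total:
  assumes c: "c \<in> slices_in (Ns i s) (Zc s)"
  shows "\<exists>g\<in>Z0 i s. Rel i s g c"
proof -
  have cs: "Poly_Mapping.lookup c (F, A) = 0" if "A \<notin> Ns i s \<or> F \<notin> Xs s" for F A
  proof (cases "A \<in> Ns i s")
    case True
    then have "slice A c \<in> supp_in (Xs s)" using c by (auto simp: slices_in_def Zc_def)
    moreover have "F \<notin> Xs s" using that True by simp
    ultimately have "Poly_Mapping.lookup (slice A c) F = 0" unfolding supp_in_iff by blast
    then show ?thesis by simp
  next
    case False
    then have "slice A c = 0" using c by (simp add: slices_in_def)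
    then have "Poly_Mapping.lookup (slice A c) F = 0" by simp
    then show ?thesis by simp
  qed
  define h where "h F A = (Poly_Mapping.single 0 (Poly_Mapping.lookup c (F, A)) :: ('v, 'k) mpoly)" for F A
  have h0: "h F A = 0" if "A \<notin> Ns i s \<or> F \<notin> Xs s" for F A using cs[OF that] by (simp add: h_def)
  have tch: "tc i s 0 h"
    unfolding tc_def
  proof (intro conjI allI impI)
    fix F :: "'v set" and A :: "nat set"
    show "h F A \<in> supp_in {t. dg t + card A = s}"
    proof (cases "A \<in> Ns i s")
      case True
      then show ?thesis by (simp add: h_def supp_in_def)
    next
      case False
      then show ?thesis using h0[of A F] by (simp add: pm.subspace_0[OF subspace_supp_in])
    qed
    show "h F A = 0" if "\<not> tcond i 0 F A"
      by (rule h0) (use that in \<open>auto simp: tcond_def Xs_def\<close>)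
  qed
  define u where "u F A = - D i h F A" for F A
  have uD: "u = (\<lambda>F A. (\<lambda>F A. 0) F A - D i h F A)" by (simp add: u_def fun_eq_iff)
  have tcu: "tc i s (- 1) u"
    unfolding uD by (rule tc_diff[OF tc_zero tc_D]) (use tch in simp)
  have cycu: "cyc i u" unfolding uD by (rule cyc_diff_D) (simp add: cyc_def D_zero idl.subspace_0[OF fid])
  have posu: "pos u"
    unfolding pos_def
  proof (intro allI impI)
    fix F A assume F: "F \<in> \<Delta>"
    have k0: "Poly_Mapping.lookup (kos \<theta> i (h F) A) 0 = 0"
      unfolding kos_def Poly_Mapping.lookup_sum by (rule sum.neutral) (simp add: \<theta>_def lin_mult_const)
    have "(\<Sum>v\<in>F. sg v F * Poly_Mapping.lookup c (F - {v}, A)) = 0"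
    proof (cases "A \<in> Ns i s \<and> card F = Suc s")
      case True
      then have "slice A c \<in> Zc s" using c by (simp add: slices_in_def)
      then have "cobd (slice A c) F = 0" using F True by (simp add: Zc_def)
      then show ?thesis by (simp add: cobd_def)
    next
      case False
      show ?thesis
      proof (rule sum.neutral, rule ballI)
        fix v assume "v \<in> F"
        then have "A \<notin> Ns i s \<or> F - {v} \<notin> Xs s" using False card_Suc_Diff1[of F v] by (auto simp: Xs_def)
        then show "sg v F * Poly_Mapping.lookup c (F - {v}, A) = 0" using cs by simp
      qed
    qed
    then show "Poly_Mapping.lookup (u F A) 0 = 0"
      by (simp add: u_def D_def lookup_minus Poly_Mapping.lookup_add lookup_dlt k0 h_def)
  qed
  obtain w where w: "tc i s 0 w" "pos w" "\<And>F A. A \<subseteq> {..<i} \<Longrightarrow> u F A - D i w F A \<in> fideal \<Delta> F"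
    using dwn[OF tcu cycu posu] by auto
  define z where "z F A = h F A + w F A" for F A
  have tcz: "tc i s 0 z" unfolding z_def by (rule tc_add[OF tch w(1)])
  have cycz: "cyc i z"
    unfolding cyc_def
  proof (intro allI impI)
    fix F A assume "A \<subseteq> {..<i}"
    then have "u F A - D i w F A \<in> fideal \<Delta> F" by (rule w(3))
    then have "- (u F A - D i w F A) \<in> fideal \<Delta> F" by (rule idl.subspace_neg[OF fid])
    moreover have "D i z F A = - (u F A - D i w F A)" unfolding z_def D_add u_def by simp
    ultimately show "D i z F A \<in> fideal \<Delta> F" by simp
  qed
  have lc: "Poly_Mapping.lookup c (F, A) = (if F \<in> Xs s then Poly_Mapping.lookup (z F A) 0 else 0)" for F A
  proof (cases "F \<in> Xs s")
    case True
    then have "Poly_Mapping.lookup (w F A) 0 = 0" using w(2) by (simp add: pos_def Xs_def)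
    then show ?thesis using True by (simp add: z_def h_def Poly_Mapping.lookup_add)
  next
    case False
    then show ?thesis using cs by simp
  qed
  have "Rel i s (z {} {}) c" unfolding Rel_def
    by (intro exI[of _ z] conjI tcz cycz refl allI lc)
  moreover have "z {} {} \<in> Z0 i s"
    unfolding Z0_def
  proof (intro CollectI conjI allI)
    have "tcond i 0 ({}::'v set) {}" by (simp add: tcond_def)
    then have "z {} {} \<in> supp_in {t. dg t + card ({}::nat set) = s}" using tcz unfolding tc_def by blast
    then show "z {} {} \<in> hom s" by (simp add: hom_def)
    fix v
    let ?G = "gens (fideal \<Delta> {v}) \<theta> i"
    have iG: "is_ideal ?G" by (rule gens_ideal[OF fid])
    have "D i z {v} {} \<in> ?G" using cycz gens_mono[of 0 i "fideal \<Delta> {v}" \<theta>] by (auto simp: cyc_def)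
    moreover have "pm_scale ((-1) ^ card {v}) (kos \<theta> i (z {v}) {}) \<in> ?G"
      by (rule pm.subspace_scale[OF pm_subspace_of_ideal[OF iG]]) (rule kos_in_gens[OF fid])
    ultimately have "D i z {v} {} - pm_scale ((-1) ^ card {v}) (kos \<theta> i (z {v}) {}) \<in> ?G" by (rule idl.subspace_diff[OF iG])
    then have "dlt (\<lambda>G. z G {}) {v} \<in> ?G" by (simp add: D_def)
    moreover have "{b\<in>{v}. b < v} = {}" by auto
    then have "sg v {v} = (1::'k)" by (simp only: sg_def card.empty power_0)
    ultimately show "z {} {} \<in> ?G" by (simp add: dlt_def)
  qed
  ultimately show ?thesis by blast
qed

text \<open>Subtracting \<open>D\<close> of constants that bound \<open>c\<close> removes all
  constants from the total cocycle, which \<open>dwn\<close> then makes a total boundary. At the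
  empty face a total boundary has only its Koszul part, which lies in the ideal of the
  forms.\<close>

lemma Rel_boundary_left:
  assumes R: "Rel i s g c" and c: "c \<in> slices_in (Ns i s) (Bc s)" and g: "g \<in> Z0 i s"
  shows "g \<in> B0 i s"
proof -
  from R obtain z where z: "tc i s 0 z" "cyc i z" "z {} {} = g"
    "\<And>F A. Poly_Mapping.lookup c (F, A) = (if F \<in> Xs s then Poly_Mapping.lookup (z F A) 0 else 0)"
    unfolding Rel_def by auto
  have "\<exists>a. A \<in> Ns i s \<longrightarrow> (\<forall>F\<in>Xs s. Poly_Mapping.lookup (slice A c) F = cobd a F)" for A
    using c by (cases "A \<in> Ns i s") (auto simp: slices_in_def Bc_def)
  then have "\<exists>a. \<forall>A. A \<in> Ns i s \<longrightarrow> (\<forall>F\<in>Xs s. Poly_Mapping.lookup (slice A c) F = cobd (a A) F)"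
    by (rule choice[OF allI])
  then obtain a where a: "\<And>A F. A \<in> Ns i s \<Longrightarrow> F \<in> Xs s \<Longrightarrow> Poly_Mapping.lookup c (F, A) = cobd (a A) F" by auto
  define w where "w F A = (if Suc (card F) = s \<and> A \<in> Ns i s then Poly_Mapping.single 0 (Poly_Mapping.lookup (a A) F) else 0 :: ('v, 'k) mpoly)" for F A
  have tcw: "tc i s 1 w"
    unfolding tc_def
  proof (intro conjI allI impI)
    fix F :: "'v set" and A :: "nat set"
    show "w F A \<in> supp_in {t. dg t + card A = s}" by (auto simp: w_def supp_in_def)
    show "w F A = 0" if "\<not> tcond i 1 F A" using that by (auto simp: w_def tcond_def)
  qed
  define u where "u F A = z F A - D i w F A" for F A
  have tcu: "tc i s 0 u" unfolding u_def by (rule tc_diff[OF z(1) tc_D]) (use tcw in simp)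
  have cycu: "cyc i u" unfolding u_def by (rule cyc_diff_D[OF z(2)])
  have posu: "pos u"
    unfolding pos_def
  proof (intro allI impI)
    fix F A assume F: "F \<in> \<Delta>"
    show "Poly_Mapping.lookup (u F A) 0 = 0"
    proof (cases "F \<in> Xs s \<and> A \<in> Ns i s")
      case True
      have k0: "Poly_Mapping.lookup (kos \<theta> i (w F) A) 0 = 0"
        unfolding kos_def Poly_Mapping.lookup_sum by (rule sum.neutral) (simp add: \<theta>_def lin_mult_const)
      have "Poly_Mapping.lookup (dlt (\<lambda>G. w G A) F) 0 = cobd (a A) F"
        unfolding lookup_dlt cobd_def
      proof (rule sum.cong)
        fix v assume "v \<in> F"
        then have "Suc (card (F - {v})) = s" using True card_Suc_Diff1[of F v] by (auto simp: Xs_def)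
        then show "sg v F * Poly_Mapping.lookup (w (F - {v}) A) 0 = sg v F * Poly_Mapping.lookup (a A) (F - {v})"
          using True by (simp add: w_def)
      qed simp
      then show ?thesis using a[of A F] z(4)[of F A] True
        by (simp add: u_def D_def Poly_Mapping.lookup_add lookup_minus k0)
    next
      case False
      have "u F A \<in> supp_in {t. dg t + card A = s} \<and> (u F A \<noteq> 0 \<longrightarrow> tcond i 0 F A)"
        using tcu by (cases "tcond i 0 F A") (simp_all add: tc_def pm.subspace_0[OF subspace_supp_in])
      then have "0 \<in> Poly_Mapping.keys (u F A) \<Longrightarrow> card A = s \<and> tcond i 0 F A" by (auto simp: supp_in_def)
      moreover have "\<not> (card A = s \<and> tcond i 0 F A)" using False F by (auto simp: Xs_def tcond_def)
      ultimately show ?thesis by (auto simp: in_keys_iff)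
    qed
  qed
  obtain w' where w': "\<And>F A. A \<subseteq> {..<i} \<Longrightarrow> u F A - D i w' F A \<in> fideal \<Delta> F"
    using dwn[OF tcu cycu posu] by auto
  let ?G = "gens (fideal \<Delta> {}) \<theta> i"
  have iG: "is_ideal ?G" by (rule gens_ideal[OF fid])
  have Dg: "D i y {} {} \<in> ?G" for y
  proof -
    have "dlt (\<lambda>G. y G {}) {} = 0" by (rule dlt_zero) simp
    then show ?thesis by (simp add: D_def kos_in_gens[OF fid])
  qed
  have "u {} {} - D i w' {} {} \<in> ?G" using w'[of "{}" "{}"] gens_mono[of 0 i "fideal \<Delta> {}" \<theta>] by auto
  from idl.subspace_add[OF iG idl.subspace_add[OF iG this Dg[of w']] Dg[of w]]
  have "g \<in> ?G" by (simp add: u_def z(3))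
  then show ?thesis using g by (simp add: B0_def Z0_def)
qed

text \<open>Membership of \<open>g\<close> in the ideal is the condition at the empty face under
  which \<open>up\<close> makes the total cocycle a boundary; the constants of the primitive then
  bound \<open>c\<close>.\<close>

lemma Rel_boundary_right:
  assumes i: "i \<le> d" and R: "Rel i s g c" and c: "c \<in> slices_in (Ns i s) (Zc s)" and g: "g \<in> B0 i s"
  shows "c \<in> slices_in (Ns i s) (Bc s)"
proof -
  from R obtain z where z: "tc i s 0 z" "cyc i z" "z {} {} = g"
    "\<And>F A. Poly_Mapping.lookup c (F, A) = (if F \<in> Xs s then Poly_Mapping.lookup (z F A) 0 else 0)"
    unfolding Rel_def by auto
  have base: "z F {} \<in> gens (fideal \<Delta> F) \<theta> i" if "int (card F) = - 0" for F
    using that z(3) g by (simp add: B0_def)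
  obtain w where w: "\<And>F A. A \<subseteq> {..<i} \<Longrightarrow> z F A - D i w F A \<in> fideal \<Delta> F"
    using up[OF i order_refl z(1,2) base] by auto
  have "slice A c \<in> Bc s" if A: "A \<in> Ns i s" for A
    unfolding Bc_def
  proof (intro CollectI conjI)
    show "slice A c \<in> supp_in (Xs s)" using c A by (auto simp: slices_in_def Zc_def)
    define a where "a = (\<Sum>F\<in>UNIV. Poly_Mapping.single F (Poly_Mapping.lookup (w F A) 0))"
    have la: "Poly_Mapping.lookup a F = Poly_Mapping.lookup (w F A) 0" for F
    proof -
      have "Poly_Mapping.lookup a F = (\<Sum>G\<in>UNIV. if G = F then Poly_Mapping.lookup (w G A) 0 else 0)"
        unfolding a_def Poly_Mapping.lookup_sum by (rule sum.cong) (auto simp: lookup_single when_def)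
      then show ?thesis by (simp add: sum.delta)
    qed
    show "\<exists>a. \<forall>F\<in>Xs s. Poly_Mapping.lookup (slice A c) F = cobd a F"
    proof (intro exI[of _ a] ballI)
      fix F assume F: "F \<in> Xs s"
      have k0: "Poly_Mapping.lookup (kos \<theta> i (w F) A) 0 = 0"
        unfolding kos_def Poly_Mapping.lookup_sum by (rule sum.neutral) (simp add: \<theta>_def lin_mult_const)
      have "Poly_Mapping.lookup (z F A - D i w F A) 0 = 0"
        by (rule const_coeff_fideal[OF w]) (use A F in \<open>auto simp: Xs_def\<close>)
      then have "Poly_Mapping.lookup (z F A) 0 = Poly_Mapping.lookup (dlt (\<lambda>G. w G A) F) 0"
        by (simp add: lookup_minus D_def Poly_Mapping.lookup_add k0)
      then show "Poly_Mapping.lookup (slice A c) F = cobd a F"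
        using F by (simp add: z(4) lookup_dlt cobd_def la)
    qed
  qed
  then show ?thesis using c by (simp add: slices_in_def)
qed

text \<open>The relation yields injections both ways between the two quotients; the binomial factor
  counts the \<open>s\<close>-subsets of \<open>{..<i}\<close>.\<close>

theorem dim_H0:
  assumes i: "i \<le> d"
  shows "int (pm.dim (Z0 i s)) - int (pm.dim (B0 i s)) = int (i choose s) * (int (pm.dim (Zc s)) - int (pm.dim (Bc s)))"
proof -
  have fN: "finite (Ns i s)" by (rule finite_subset[of _ "Pow {..<i}"]) auto
  have X: "Zc s \<subseteq> supp_in (Xs s)" "Bc s \<subseteq> supp_in (Xs s)" by (auto simp: Zc_def Bc_def)
  have fZ: "fin_span (Z0 i s)" by (rule fin_span_subset[OF fin_span_hom]) (auto simp: Z0_def)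
  have fS: "fin_span (slices_in (Ns i s) (Zc s))" by (rule fin_span_slices_in[OF finite fN X(1)])
  have sub: "slices_in (Ns i s) (Bc s) \<subseteq> slices_in (Ns i s) (Zc s)"
    using Bc_subset_Zc by (auto simp: slices_in_def)
  have "int (pm.dim (Z0 i s)) - int (pm.dim (B0 i s))
      \<le> int (pm.dim (slices_in (Ns i s) (Zc s))) - int (pm.dim (slices_in (Ns i s) (Bc s)))"
  proof (rule dim_diff_le_of_relation[where R = "Rel i s"])
    show "x \<in> B0 i s" if "x \<in> Z0 i s" "x' \<in> slices_in (Ns i s) (Bc s)" "Rel i s x x'" for x x'
      by (rule Rel_boundary_left[OF that(3,2,1)])
    show "x' \<in> slices_in (Ns i s) (Bc s)" if "x' \<in> slices_in (Ns i s) (Zc s)" "x \<in> B0 i s" "Rel i s x x'" for x x'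
      by (rule Rel_boundary_right[OF i that(3,1,2)])
    show "\<exists>x'\<in>slices_in (Ns i s) (Zc s). Rel i s x x'" if "x \<in> Z0 i s" for x by (rule Rel_left_total[OF i that])
  qed (fact subspace_Z0 fZ B0_subset_Z0 subspace_B0 fS sub Rel_0 Rel_add Rel_scale
      subspace_slices_in[OF subspace_Zc] subspace_slices_in[OF subspace_Bc])+
  moreover have "int (pm.dim (slices_in (Ns i s) (Zc s))) - int (pm.dim (slices_in (Ns i s) (Bc s)))
      \<le> int (pm.dim (Z0 i s)) - int (pm.dim (B0 i s))"
  proof (rule dim_diff_le_of_relation[where R = "\<lambda>c g. Rel i s g c"])
    show "x' \<in> B0 i s" if "x' \<in> Z0 i s" "x \<in> slices_in (Ns i s) (Bc s)" "Rel i s x' x" for x x'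
      by (rule Rel_boundary_left[OF that(3,2,1)])
    show "x \<in> slices_in (Ns i s) (Bc s)" if "x \<in> slices_in (Ns i s) (Zc s)" "x' \<in> B0 i s" "Rel i s x' x" for x x'
      by (rule Rel_boundary_right[OF i that(3,1,2)])
    show "\<exists>x'\<in>Z0 i s. Rel i s x' x" if "x \<in> slices_in (Ns i s) (Zc s)" for x by (rule Rel_right_total[OF that])
  qed (fact subspace_Z0 fZ B0_subset_Z0 subspace_B0 fS sub Rel_0 Rel_add Rel_scale
      subspace_slices_in[OF subspace_Zc] subspace_slices_in[OF subspace_Bc])+
  moreover have "card (Ns i s) = i choose s" using n_subsets[of "{..<i}" s] by simp
  ultimately show ?thesis
    using dim_slices_in[OF finite fN subspace_Zc X(1)] dim_slices_in[OF finite fN subspace_Bc X(2)]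
    by (simp add: right_diff_distrib)
qed

end

section \<open>Macaulay's theorem\<close>

lemma keys_var_mult: "Poly_Mapping.keys (var v * p) = (+) (Poly_Mapping.single v 1) ` Poly_Mapping.keys (p :: ('v, 'k::field) mpoly)"
proof (intro equalityI subsetI)
  fix t assume "t \<in> Poly_Mapping.keys (var v * p)"
  then show "t \<in> (+) (Poly_Mapping.single v 1) ` Poly_Mapping.keys p" by (rule var_in_keys) simp
next
  fix t assume "t \<in> (+) (Poly_Mapping.single v 1) ` Poly_Mapping.keys p"
  then obtain u where u: "u \<in> Poly_Mapping.keys p" "t = Poly_Mapping.single v 1 + u" by (elim imageE)
  have "Poly_Mapping.lookup p u \<noteq> 0" using u(1) by (simp add: in_keys_iff)
  moreover have "Poly_Mapping.lookup (var v * p) t = Poly_Mapping.lookup p u"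
    unfolding u(2) by (rule lookup_var_mult)
  ultimately show "t \<in> Poly_Mapping.keys (var v * p)" by (simp add: in_keys_iff)
qed

lemma Max_keys_var_mult:
  fixes p :: "('v::{finite,linorder}, 'k::field) mpoly"
  assumes "p \<noteq> 0"
  shows "var v * p \<noteq> 0" "Max (Poly_Mapping.keys (var v * p)) = Poly_Mapping.single v 1 + Max (Poly_Mapping.keys p)"
proof -
  have ne: "Poly_Mapping.keys p \<noteq> {}" using assms by simp
  show "var v * p \<noteq> 0" using keys_var_mult[of v p] ne by auto
  have "mono ((+) (Poly_Mapping.single v (1::nat)))" by (rule monoI) (rule add_left_mono)
  then show "Max (Poly_Mapping.keys (var v * p)) = Poly_Mapping.single v 1 + Max (Poly_Mapping.keys p)"
    unfolding keys_var_mult by (rule mono_Max_commute[symmetric]) (use ne in simp_all)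
qed

lemma lookup_single_plus: "Poly_Mapping.lookup (Poly_Mapping.single v 1 + t) = inc v (Poly_Mapping.lookup t)"
  by (rule ext) (simp add: inc_def Poly_Mapping.lookup_add lookup_single when_def)

text \<open>Leading monomials preserve dimensions and commute with multiplication by a variable, so
  the monomials that do not lead satisfy the shadow condition. Only two consecutive degrees enter,
  so the spaces are given directly rather than as parts of an ideal.\<close>

theorem Macaulay_bound:
  fixes W U :: "('v::{finite,linorder}, 'k::field) mpoly set"
  assumes j: "1 \<le> j" and W: "pm.subspace W" "W \<subseteq> hom j" and U: "pm.subspace U" "U \<subseteq> hom (Suc j)"
    and WU: "\<And>v w. w \<in> W \<Longrightarrow> var v * w \<in> U"
  shows "card {t :: 'v \<Rightarrow>\<^sub>0 nat. dg t = Suc j} - pm.dim U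
    \<le> pseudo_power (card {t :: 'v \<Rightarrow>\<^sub>0 nat. dg t = j} - pm.dim W) j"
proof -
  let ?lm = "\<lambda>p :: ('v, 'k) mpoly. Max (Poly_Mapping.keys p)"
  have lm_in: "?lm ` (P - {0}) \<subseteq> {t. dg t = n}" if "P \<subseteq> hom n" for P n
  proof (rule image_subsetI)
    fix p assume p: "p \<in> P - {0}"
    then have "?lm p \<in> Poly_Mapping.keys p" by (intro Max_in) simp_all
    then show "?lm p \<in> {t. dg t = n}" using p that by (auto simp: hom_iff)
  qed
  have lm_card: "card ({t. dg t = n} - ?lm ` (P - {0})) = card {t :: 'v \<Rightarrow>\<^sub>0 nat. dg t = n} - pm.dim P"
    if "pm.subspace P" "P \<subseteq> hom n" for P n
    using card_Diff_subset[OF finite_subset[OF lm_in[OF that(2)] finite_dg] lm_in[OF that(2)]]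
      card_Max_keys_eq_dim[OF finite_dg that(1) that(2)[unfolded hom_def]] by simp
  define A where "A = {t. dg t = j} - ?lm ` (W - {0})"
  define B where "B = {t. dg t = Suc j} - ?lm ` (U - {0})"
  have inj: "inj_on Poly_Mapping.lookup X" for X :: "('v \<Rightarrow>\<^sub>0 nat) set"
    by (rule inj_onI) (rule lookup_inject[THEN iffD1])
  have "card (Poly_Mapping.lookup ` B) \<le> pseudo_power (card (Poly_Mapping.lookup ` A)) j"
  proof (rule card_le_pseudo_power_of_shadow[OF j])
    show "fdeg f = j" if "f \<in> Poly_Mapping.lookup ` A" for f
      using that by (auto simp: A_def dg_eq_fdeg)
    show "fdeg f = Suc j" if "f \<in> Poly_Mapping.lookup ` B" for f
      using that by (auto simp: B_def dg_eq_fdeg)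
    fix f v assume f: "inc v f \<in> Poly_Mapping.lookup ` B"
    define t where "t = Abs_poly_mapping f"
    have t: "f = Poly_Mapping.lookup t" by (simp add: t_def)
    obtain u where u: "u \<in> B" "inc v f = Poly_Mapping.lookup u" using f by (elim imageE)
    then have "u = Poly_Mapping.single v 1 + t"
      using lookup_inject[of u "Poly_Mapping.single v 1 + t"] by (simp only: t lookup_single_plus simp_thms)
    then have B: "Poly_Mapping.single v 1 + t \<in> B" using u(1) by simp
    have "t \<notin> ?lm ` (W - {0})"
    proof
      assume "t \<in> ?lm ` (W - {0})"
      then obtain p where p: "p \<in> W" "p \<noteq> 0" "t = ?lm p" by auto
      have "var v * p \<in> U - {0}" using WU[OF p(1)] Max_keys_var_mult(1)[OF p(2)] by simp
      moreover have "?lm (var v * p) = Poly_Mapping.single v 1 + t" using Max_keys_var_mult(2)[OF p(2)] p(3) by simp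
      ultimately have "Poly_Mapping.single v 1 + t \<in> ?lm ` (U - {0})" by (metis imageI)
      then show False using B by (simp add: B_def)
    qed
    moreover have "dg t = j" using B by (simp add: B_def)
    ultimately have "t \<in> A" by (simp add: A_def)
    then show "f \<in> Poly_Mapping.lookup ` A" unfolding t by (rule imageI)
  qed
  then show ?thesis using lm_card[OF W] lm_card[OF U] by (simp add: card_image[OF inj] A_def B_def)
qed

section \<open>Hilbert functions and h-numbers\<close>

text \<open>Multiplication of the generating function by \<open>1 - t\<close>.\<close>

definition nabla :: "(nat \<Rightarrow> int) \<Rightarrow> nat \<Rightarrow> int" where
  "nabla f s = f s - (if s = 0 then 0 else f (s - 1))"

text \<open>Multiplication of the generating function by \<open>t\<close>.\<close>

definition delay :: "(nat \<Rightarrow> int) \<Rightarrow> nat \<Rightarrow> int" where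
  "delay f s = (if s = 0 then 0 else f (s - 1))"

lemma nabla_delay: "nabla (delay f) = delay (nabla f)"
  by (rule ext) (simp add: nabla_def delay_def)

lemma nabla_power_delay: "(nabla ^^ m) (delay f) = delay ((nabla ^^ m) f)"
  by (induction m) (simp_all add: nabla_delay)

lemma nabla_sum: "nabla (\<lambda>s. \<Sum>x\<in>A. f x s) = (\<lambda>s. \<Sum>x\<in>A. nabla (f x) s)"
  by (rule ext) (simp add: nabla_def sum_subtractf)

lemma nabla_power_sum: "(nabla ^^ m) (\<lambda>s. \<Sum>x\<in>A. f x s) = (\<lambda>s. \<Sum>x\<in>A. (nabla ^^ m) (f x) s)"
  by (induction m) (simp_all add: nabla_sum)

definition supp_count :: "'v::finite set \<Rightarrow> nat \<Rightarrow> int" where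
  "supp_count G s = int (card {t :: 'v \<Rightarrow>\<^sub>0 nat. dg t = s \<and> Poly_Mapping.keys t = G})"

text \<open>Each vertex of the support contributes a factor \<open>t / (1 - t)\<close> to the
  generating function: removing one factor \<open>v\<close> either keeps \<open>v\<close> in the
  support or not.\<close>

lemma nabla_supp_count_insert:
  assumes "v \<notin> G" shows "nabla (supp_count (insert v G)) = delay (supp_count G)"
proof (rule ext)
  fix s
  show "nabla (supp_count (insert v G)) s = delay (supp_count G) s"
  proof (cases s)
    case 0
    have "{t :: 'a \<Rightarrow>\<^sub>0 nat. dg t = 0 \<and> Poly_Mapping.keys t = insert v G} = {}" by (auto simp: dg_eq_0_iff)
    then have "card {t :: 'a \<Rightarrow>\<^sub>0 nat. dg t = 0 \<and> Poly_Mapping.keys t = insert v G} = 0" by (simp only: card.empty)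
    then have "supp_count (insert v G) 0 = 0" unfolding supp_count_def by (simp only: of_nat_0)
    then show ?thesis using 0 by (simp add: nabla_def delay_def)
  next
    case (Suc r)
    let ?X = "{t :: 'a \<Rightarrow>\<^sub>0 nat. dg t = r \<and> Poly_Mapping.keys t = insert v G}"
    let ?Y = "{t :: 'a \<Rightarrow>\<^sub>0 nat. dg t = r \<and> Poly_Mapping.keys t = G}"
    let ?Z = "{t :: 'a \<Rightarrow>\<^sub>0 nat. dg t = Suc r \<and> Poly_Mapping.keys t = insert v G}"
    have "?Z = (+) (Poly_Mapping.single v 1) ` (?X \<union> ?Y)"
    proof (intro equalityI subsetI)
      fix t assume t: "t \<in> ?Z"
      define u where "u = t - Poly_Mapping.single v 1"
      have "v \<in> Poly_Mapping.keys t" using t by simp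
      then have tv: "Poly_Mapping.lookup t v \<noteq> 0" by (simp add: in_keys_iff)
      have tu: "t = Poly_Mapping.single v 1 + u"
        unfolding u_def by (rule poly_mapping_eqI)
          (use tv in \<open>auto simp: Poly_Mapping.lookup_add lookup_minus lookup_single when_def\<close>)
      have "insert v (Poly_Mapping.keys u) = insert v G" using t tu by (simp add: keys_plus_nat)
      then have "Poly_Mapping.keys u = insert v G \<or> Poly_Mapping.keys u = G"
        using assms by (metis insert_absorb insert_ident)
      moreover have "dg u = r" using t tu by simp
      ultimately show "t \<in> (+) (Poly_Mapping.single v 1) ` (?X \<union> ?Y)" using tu by auto
    next
      fix t assume "t \<in> (+) (Poly_Mapping.single v 1) ` (?X \<union> ?Y)"
      then obtain u where u: "u \<in> ?X \<union> ?Y" "t = Poly_Mapping.single v 1 + u" by (elim imageE)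
      have "dg u = r" "insert v (Poly_Mapping.keys u) = insert v G" using u(1) by auto
      then show "t \<in> ?Z" unfolding u(2) by (simp add: keys_plus_nat)
    qed
    moreover have "inj_on ((+) (Poly_Mapping.single v (1::nat))) (?X \<union> ?Y)" by (simp add: inj_on_def)
    ultimately have "card ?Z = card (?X \<union> ?Y)" by (simp add: card_image)
    also have "\<dots> = card ?X + card ?Y"
    proof (rule card_Un_disjoint)
      show "finite ?X" "finite ?Y" by (rule finite_subset[OF _ finite_dg[of r]], auto)+
      show "?X \<inter> ?Y = {}" using assms by auto
    qed
    finally show ?thesis using Suc by (simp add: nabla_def delay_def supp_count_def)
  qed
qed

lemma nabla_power_supp_count:
  "(nabla ^^ card G) (supp_count G) = (\<lambda>s. if s = card G then 1 else 0)"
proof (induction G rule: finite_induct[OF finite])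
  case 1
  have "{t :: 'a \<Rightarrow>\<^sub>0 nat. dg t = s \<and> t = 0} = (if s = 0 then {0} else {})" for s by auto
  then show ?case by (simp add: supp_count_def fun_eq_iff)
next
  case (2 v G)
  have "(nabla ^^ card (insert v G)) (supp_count (insert v G)) = (nabla ^^ card G) (nabla (supp_count (insert v G)))"
    using 2 by (simp add: funpow_swap1)
  also have "\<dots> = delay ((nabla ^^ card G) (supp_count G))"
    unfolding nabla_supp_count_insert[OF 2(2)] nabla_power_delay ..
  also have "\<dots> = (\<lambda>s. if s = card (insert v G) then 1 else 0)"
    unfolding 2(3) by (rule ext) (use 2 in \<open>auto simp: delay_def\<close>)
  finally show ?case .
qed

text \<open>These are the coefficients of \<open>t^m (1 - t)^k\<close>.\<close>

lemma nabla_power_indicator: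
  "(nabla ^^ k) (\<lambda>s. if s = m then 1 else 0) s = (if s < m then 0 else (-1) ^ (s - m) * int (k choose (s - m)))"
proof (induction k arbitrary: s)
  case 0
  show ?case by (cases "s - m") auto
next
  case (Suc k)
  let ?f = "(nabla ^^ k) (\<lambda>s. if s = m then 1 else 0)"
  have "(nabla ^^ Suc k) (\<lambda>s. if s = m then 1 else 0) s = ?f s - (if s = 0 then 0 else ?f (s - 1))"
    by (simp add: nabla_def)
  also have "\<dots> = (if s < m then 0 else (-1) ^ (s - m) * int (Suc k choose (s - m)))"
  proof (cases "m < s")
    case True
    then obtain r where r: "s - m = Suc r" "s - 1 - m = r" by (metis Suc_diff_Suc diff_Suc_1 diff_commute)
    show ?thesis using True unfolding Suc.IH r by (auto simp: algebra_simps)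
  next
    case False
    then show ?thesis unfolding Suc.IH by (cases "s = m") auto
  qed
  finally show ?case .
qed

lemma coeff_linear_power:
  "poly.coeff ([:-1, 1:] ^ n :: int poly) j = (if j \<le> n then (-1) ^ (n - j) * int (n choose j) else 0)"
proof (induction n arbitrary: j)
  case 0
  show ?case by (cases j) auto
next
  case (Suc n)
  let ?p = "[:-1, 1:] ^ n :: int poly"
  have e: "[:-1, 1:] ^ Suc n = - ?p + pCons 0 ?p" by simp
  show ?case
  proof (cases j)
    case 0
    then show ?thesis unfolding e by (simp add: Suc.IH)
  next
    case (Suc r)
    have "poly.coeff ([:-1, 1:] ^ Suc n) j = - poly.coeff ?p (Suc r) + poly.coeff ?p r" unfolding e Suc by simp
    also have "\<dots> = (if j \<le> Suc n then (-1) ^ (Suc n - j) * int (Suc n choose j) else 0)"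
    proof (cases "r < n")
      case True
      then have "n - r = Suc (n - Suc r)" by simp
      then show ?thesis using True unfolding Suc.IH Suc by (simp add: algebra_simps)
    next
      case False
      then show ?thesis unfolding Suc.IH Suc by (cases "r = n") auto
    qed
    finally show ?thesis .
  qed
qed

section \<open>The Hilbert function of the quotients and the numbers h'\<close>

context moment_curve
begin

definition mon_count :: "nat \<Rightarrow> int" where
  "mon_count s = int (card {t. dg t = s \<and> Poly_Mapping.keys t \<in> \<Delta>})"

definition bt :: "nat \<Rightarrow> int" where
  "bt s = int (pm.dim (Zc s)) - int (pm.dim (Bc s))"

lemma mon_count_eq: "mon_count = (\<lambda>s. \<Sum>G\<in>\<Delta>. supp_count G s)"
proof (rule ext)
  fix s
  have "{t. dg t = s \<and> Poly_Mapping.keys t \<in> \<Delta>} = (\<Union>G\<in>\<Delta>. {t. dg t = s \<and> Poly_Mapping.keys t = G})" by auto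
  moreover have "finite {t. dg t = s \<and> Poly_Mapping.keys t = G}" for G :: "'v set"
    by (rule finite_subset[OF _ finite_dg[of s]]) auto
  then have "card (\<Union>G\<in>\<Delta>. {t. dg t = s \<and> Poly_Mapping.keys t = G}) = (\<Sum>G\<in>\<Delta>. card {t. dg t = s \<and> Poly_Mapping.keys t = G})"
    by (intro card_UN_disjoint) auto
  ultimately show "mon_count s = (\<Sum>G\<in>\<Delta>. supp_count G s)" by (simp add: mon_count_def supp_count_def)
qed

text \<open>A face with \<open>m\<close> vertices contributes \<open>t^m / (1 - t)^m\<close> to the
  Hilbert series; multiplied by \<open>(1 - t)^d\<close> the series becomes the h-polynomial under
  \<open>x = 1 / t\<close>, read from the top coefficient.\<close>

lemma nabla_mon_count:
  assumes "s \<le> d" shows "(nabla ^^ d) mon_count s = h_num d \<Delta> s"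
proof -
  let ?c = "\<lambda>m. if s < m then 0 else (-1) ^ (s - m) * int ((d - m) choose (s - m))"
  have 1: "(nabla ^^ d) (supp_count G) s = ?c (card G)" if G: "G \<in> \<Delta>" for G
  proof -
    have "d = (d - card G) + card G" using card_face[OF G] by simp
    then have "(nabla ^^ d) (supp_count G) = (nabla ^^ (d - card G)) ((nabla ^^ card G) (supp_count G))"
      by (metis comp_apply funpow_add)
    then show ?thesis by (simp only: nabla_power_supp_count nabla_power_indicator)
  qed
  have "(nabla ^^ d) mon_count s = (\<Sum>G\<in>\<Delta>. ?c (card G))"
    unfolding mon_count_eq nabla_power_sum by (rule sum.cong) (use 1 in auto)
  also have "\<dots> = (\<Sum>m\<le>d. \<Sum>G\<in>{G\<in>\<Delta>. card G = m}. ?c (card G))"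
    by (rule sum.group[symmetric]) (use card_face in auto)
  also have "\<dots> = (\<Sum>m\<le>d. int (f_num \<Delta> (int m - 1)) * poly.coeff ([:-1, 1:] ^ (d - m)) (d - s))"
  proof (rule sum.cong)
    fix m assume m: "m \<in> {..d}"
    have "{F \<in> \<Delta>. face_dim F = int m - 1} = {G\<in>\<Delta>. card G = m}" by (auto simp: face_dim_def)
    then have "(\<Sum>G\<in>{G\<in>\<Delta>. card G = m}. ?c (card G)) = int (f_num \<Delta> (int m - 1)) * ?c m"
      by (simp add: f_num_def)
    moreover have "?c m = poly.coeff ([:-1, 1:] ^ (d - m)) (d - s)"
    proof (cases "s < m")
      case True
      then show ?thesis using m by (simp add: coeff_linear_power)
    next
      case False
      then have "d - m - (d - s) = s - m" "d - s \<le> d - m" using assms m by auto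
      then show ?thesis using False binomial_symmetric[of "d - s" "d - m"] by (simp add: coeff_linear_power)
    qed
    ultimately show "(\<Sum>G\<in>{G\<in>\<Delta>. card G = m}. ?c (card G)) = int (f_num \<Delta> (int m - 1)) * poly.coeff ([:-1, 1:] ^ (d - m)) (d - s)"
      by (simp only:)
  qed simp
  also have "\<dots> = h_num d \<Delta> s" by (simp add: h_num_def h_poly_def coeff_sum)
  finally show ?thesis .
qed

text \<open>Multiplication by \<open>var v\<close> carries the star ideal of \<open>v\<close> into
  the ideal of the complex and is compatible with adding the forms. Hence elements vanishing on all
  vertex stars are killed by every variable.\<close>

lemma star_cancel:
  assumes "p \<in> gens (fideal \<Delta> {v}) \<theta> i" shows "var v * p \<in> gens (fideal \<Delta> {}) \<theta> i"
  using assms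
proof (induction i arbitrary: p)
  case 0
  then show ?case using prod_var_mult_fideal[of \<Delta> p "{v}", OF down] by simp
next
  case (Suc i)
  from Suc.prems obtain u h where p: "p = u + \<theta> i * h" "u \<in> gens (fideal \<Delta> {v}) \<theta> i" unfolding gens.simps by (rule adjE)
  have "var v * p = var v * u + \<theta> i * (var v * h)" unfolding p(1) by (simp only: distrib_left mult.left_commute)
  then show ?case using adjI[OF Suc.IH[OF p(2)]] by simp
qed

text \<open>One inclusion is the regularity of \<open>\<theta> i\<close> on vertex stars; for the
  other, every variable, hence every linear form, sends an element of \<open>Z0 i s\<close> into the
  ideal.\<close>

lemma colon_eq_Z0:
  assumes "i < d" shows "{g\<in>hom s. \<theta> i * g \<in> gens (fideal \<Delta> {}) \<theta> i} = Z0 i s"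
proof (intro equalityI subsetI)
  fix g assume g: "g \<in> {g\<in>hom s. \<theta> i * g \<in> gens (fideal \<Delta> {}) \<theta> i}"
  have "g \<in> gens (fideal \<Delta> {v}) \<theta> i" for v
  proof -
    have "gens (fideal \<Delta> {}) \<theta> i \<subseteq> gens (fideal \<Delta> {v}) \<theta> i"
      by (rule gens_mono_base[OF fideal_mono[OF down]]) auto
    then have "\<theta> i * g \<in> gens (fideal \<Delta> {v}) \<theta> i" using g by auto
    then show ?thesis using \<theta>_regular[of "{v}" i] assms by (simp add: nonzerodiv_def)
  qed
  then show "g \<in> Z0 i s" using g by (simp add: Z0_def)
next
  fix g assume g: "g \<in> Z0 i s"
  have iG: "is_ideal (gens (fideal \<Delta> {}) \<theta> i)" by (rule gens_ideal[OF fid])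
  have "\<theta> i * g \<in> gens (fideal \<Delta> {}) \<theta> i"
    unfolding \<theta>_def[of i] lin_mult
  proof (rule pm.subspace_sum[OF pm_subspace_of_ideal[OF iG]])
    fix w
    have "var w * g \<in> gens (fideal \<Delta> {}) \<theta> i" by (rule star_cancel) (use g in \<open>simp add: Z0_def\<close>)
    then show "pm_scale (pt w ^ i) (var w * g) \<in> gens (fideal \<Delta> {}) \<theta> i"
      by (rule pm.subspace_scale[OF pm_subspace_of_ideal[OF iG]])
  qed
  then show "g \<in> {g\<in>hom s. \<theta> i * g \<in> gens (fideal \<Delta> {}) \<theta> i}" using g by (simp add: Z0_def)
qed

abbreviation Hf :: "nat \<Rightarrow> nat \<Rightarrow> int" where
  "Hf i s \<equiv> HF (gens (fideal \<Delta> {}) \<theta> i) s"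

lemma graded_gens: "graded_ideal (gens (fideal \<Delta> {}) \<theta> i)"
  unfolding \<theta>_def[abs_def] by (rule gens_graded[OF fideal_graded[OF down]])

lemma Hf_Suc:
  assumes "i < d" shows "Hf (Suc i) (Suc s) = Hf i (Suc s) - Hf i s + int (i choose s) * bt s"
proof -
  have "Hf (Suc i) (Suc s) = Hf i (Suc s) - Hf i s
      + (int (pm.dim {g\<in>hom s. \<theta> i * g \<in> gens (fideal \<Delta> {}) \<theta> i}) - int (pm.dim (gens (fideal \<Delta> {}) \<theta> i \<inter> hom s)))"
    using HF_adj_Suc[OF graded_gens[of i], where c = "\<lambda>w. pt w ^ i" and s = s] by (simp only: gens.simps \<theta>_def[of i])
  then show ?thesis unfolding colon_eq_Z0[OF assms] B0_def[symmetric]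
    using dim_H0[of i s] assms by (simp add: bt_def)
qed

lemma Hf_0: "Hf (Suc i) 0 = Hf i 0"
  using HF_adj_0[OF graded_gens[of i], where c = "\<lambda>w. pt w ^ i"] by (simp only: gens.simps \<theta>_def[of i])

lemma Hf_base: "Hf 0 s = mon_count s"
proof -
  have e: "fideal \<Delta> {} \<inter> hom s = supp_in {t. Poly_Mapping.keys t \<notin> \<Delta>} \<inter> (supp_in {t. dg t = s} :: ('v, 'k) mpoly set)"
    by (simp only: fideal_empty_eq[OF down] hom_def)
  have "{t. dg t = s} - {t. Poly_Mapping.keys t \<notin> \<Delta>} = {t. dg t = s \<and> Poly_Mapping.keys t \<in> \<Delta>}" by auto
  then show ?thesis
    using dim_Int_monomials[OF finite_dg[of s], of "{t. Poly_Mapping.keys t \<notin> \<Delta>}", where 'k='k]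
    unfolding HF_def gens.simps e by (simp only: hom_def mon_count_def)
qed

text \<open>The alternating sum obeys \<open>E (Suc s) = bt s - E s\<close>, so the Betti term of
  \<open>Hf_Suc\<close> turns the two binomials of level \<open>i\<close> into one of level
  \<open>Suc i\<close> by Pascal's rule.\<close>

lemma Hf_eq:
  assumes "i \<le> d"
  shows "Hf i s = (nabla ^^ i) mon_count s + int (i choose s) * (\<Sum>l<s. (-1) ^ (s - l - 1) * bt l)"
  using assms
proof (induction i arbitrary: s)
  case 0
  show ?case by (cases s) (simp_all add: Hf_base[simplified])
next
  case (Suc i)
  define E where "E s = (\<Sum>l<s. (-1) ^ (s - l - 1) * bt l)" for s
  have E: "E (Suc s) = bt s - E s" for s
  proof -
    have "(\<Sum>l<s. (-1) ^ (Suc s - l - 1) * bt l) = (\<Sum>l<s. - ((-1) ^ (s - l - 1) * bt l))"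
    proof (rule sum.cong)
      fix l assume "l \<in> {..<s}"
      then have "Suc s - l - 1 = Suc (s - l - 1)" by auto
      then show "(-1) ^ (Suc s - l - 1) * bt l = - ((-1) ^ (s - l - 1) * bt l)" by simp
    qed simp
    then show ?thesis by (simp add: E_def sum_negf)
  qed
  have IH: "Hf i s = (nabla ^^ i) mon_count s + int (i choose s) * E s" for s
    unfolding E_def by (rule Suc.IH) (use Suc.prems in simp)
  have "Hf (Suc i) s = (nabla ^^ Suc i) mon_count s + int (Suc i choose s) * E s"
  proof (cases s)
    case 0
    then show ?thesis using IH[of 0] unfolding 0 Hf_0 by (simp add: nabla_def)
  next
    case (Suc r)
    have "Hf (Suc i) (Suc r) = Hf i (Suc r) - Hf i r + int (i choose r) * bt r"
      by (rule Hf_Suc) (use Suc.prems in simp)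
    then show ?thesis unfolding Suc IH by (simp add: nabla_def E algebra_simps)
  qed
  then show ?case by (simp only: E_def)
qed

subsection \<open>Betti numbers\<close>

lemma chains_eq: "chains \<Delta> (int s - 1) = (supp_in (Xs s) :: ('v set \<Rightarrow>\<^sub>0 'k) set)"
  by (auto simp: chains_def supp_in_def Xs_def face_dim_def)

lemma lookup_boundary:
  "Poly_Mapping.lookup (boundary (c :: 'v set \<Rightarrow>\<^sub>0 'k)) G = (\<Sum>F\<in>UNIV. \<Sum>v\<in>F. if F - {v} = G then sg v F * Poly_Mapping.lookup c F else 0)"
proof -
  have "Poly_Mapping.lookup (boundary c) G = (\<Sum>F\<in>Poly_Mapping.keys c. \<Sum>v\<in>F. if F - {v} = G then sg v F * Poly_Mapping.lookup c F else 0)"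
    unfolding boundary_def Poly_Mapping.lookup_sum
    by (intro sum.cong refl) (simp add: lookup_single when_def sg_def)
  also have "\<dots> = (\<Sum>F\<in>UNIV. \<Sum>v\<in>F. if F - {v} = G then sg v F * Poly_Mapping.lookup c F else 0)"
    by (rule sum.mono_neutral_left) (auto simp: in_keys_iff intro!: sum.neutral)
  finally show ?thesis .
qed

text \<open>The boundary map and \<open>cobd\<close> are adjoint for the standard pairing, as both
  use the same sign.\<close>

lemma boundary_pairing:
  "(\<Sum>G\<in>UNIV. Poly_Mapping.lookup b G * Poly_Mapping.lookup (boundary c) G) = (\<Sum>F\<in>UNIV. Poly_Mapping.lookup c F * cobd b F)"
proof -
  have "(\<Sum>G\<in>UNIV. Poly_Mapping.lookup b G * Poly_Mapping.lookup (boundary c) G)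
      = (\<Sum>G\<in>UNIV. \<Sum>F\<in>UNIV. \<Sum>v\<in>F. if F - {v} = G then Poly_Mapping.lookup b G * (sg v F * Poly_Mapping.lookup c F) else 0)"
    unfolding lookup_boundary sum_distrib_left by (intro sum.cong refl) simp
  also have "\<dots> = (\<Sum>F\<in>UNIV. \<Sum>G\<in>UNIV. \<Sum>v\<in>F. if F - {v} = G then Poly_Mapping.lookup b G * (sg v F * Poly_Mapping.lookup c F) else 0)"
    by (rule sum.swap)
  also have "\<dots> = (\<Sum>F\<in>UNIV. Poly_Mapping.lookup c F * cobd b F)"
  proof (rule sum.cong)
    fix F :: "'v set"
    have "(\<Sum>G\<in>UNIV. \<Sum>v\<in>F. if F - {v} = G then Poly_Mapping.lookup b G * (sg v F * Poly_Mapping.lookup c F) else 0)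
        = (\<Sum>v\<in>F. \<Sum>G\<in>UNIV. if F - {v} = G then Poly_Mapping.lookup b G * (sg v F * Poly_Mapping.lookup c F) else 0)"
      by (rule sum.swap)
    also have "\<dots> = (\<Sum>v\<in>F. Poly_Mapping.lookup b (F - {v}) * (sg v F * Poly_Mapping.lookup c F))"
      by (rule sum.cong) (simp_all add: sum.delta')
    also have "\<dots> = Poly_Mapping.lookup c F * cobd b F"
      by (simp add: cobd_def sum_distrib_left mult_ac)
    finally show "(\<Sum>G\<in>UNIV. \<Sum>v\<in>F. if F - {v} = G then Poly_Mapping.lookup b G * (sg v F * Poly_Mapping.lookup c F) else 0)
        = Poly_Mapping.lookup c F * cobd b F" .
  qed simp
  finally show ?thesis .
qed

lemma pm_linear_boundary: "pm_linear (boundary :: ('v set \<Rightarrow>\<^sub>0 'k) \<Rightarrow> _)"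
proof -
  have "boundary (x + y) = boundary x + boundary y" for x y :: "'v set \<Rightarrow>\<^sub>0 'k"
    by (rule poly_mapping_eqI, unfold lookup_boundary Poly_Mapping.lookup_add sum.distrib[symmetric])
      (intro sum.cong refl, simp add: Poly_Mapping.lookup_add distrib_left)
  moreover have "boundary (pm_scale a x) = pm_scale a (boundary x)" for a and x :: "'v set \<Rightarrow>\<^sub>0 'k"
    by (rule poly_mapping_eqI) (simp add: lookup_boundary sum_distrib_left, intro sum.cong refl, simp add: mult.left_commute)
  ultimately show ?thesis unfolding Vector_Spaces.linear_iff using pm.vector_space_axioms by blast
qed

lemma sum_Xs: "b \<in> supp_in (Xs s) \<Longrightarrow> (\<Sum>G\<in>Xs s. Poly_Mapping.lookup b G * f G) = (\<Sum>G\<in>UNIV. Poly_Mapping.lookup b G * (f G :: 'k))"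
  by (rule sum.mono_neutral_left) (simp_all add: supp_in_iff)

lemma boundary_in:
  assumes "c \<in> supp_in (Xs (Suc s))" shows "boundary c \<in> (supp_in (Xs s) :: ('v set \<Rightarrow>\<^sub>0 'k) set)"
  unfolding supp_in_iff
proof (intro allI impI)
  fix G assume G: "G \<notin> Xs s"
  have "(if F - {v} = G then sg v F * Poly_Mapping.lookup c F else 0) = 0" if "v \<in> F" for F v
  proof (cases "F \<in> Xs (Suc s)")
    case True
    then have "F \<in> \<Delta>" "card F = Suc s" by (simp_all add: Xs_def)
    then have "F - {v} \<in> Xs s" using that down[of F "F - {v}"] by (auto simp: Xs_def)
    then show ?thesis using G by auto
  next
    case False
    then show ?thesis using assms by (simp add: supp_in_iff)
  qed
  then show "Poly_Mapping.lookup (boundary c) G = 0" unfolding lookup_boundary by (intro sum.neutral ballI)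
qed

lemma Zc_eq_perp: "Zc s = perp (Xs s) (boundary ` supp_in (Xs (Suc s)))"
proof (intro equalityI subsetI)
  fix b assume b: "b \<in> Zc s"
  then have bX: "b \<in> supp_in (Xs s)" by (simp add: Zc_def)
  have "(\<Sum>G\<in>Xs s. Poly_Mapping.lookup b G * Poly_Mapping.lookup (boundary c) G) = 0" if c: "c \<in> supp_in (Xs (Suc s))" for c
  proof -
    have "Poly_Mapping.lookup c F * cobd b F = 0" for F
      using b c by (cases "F \<in> Xs (Suc s)") (simp_all add: Zc_def Xs_def supp_in_iff)
    then show ?thesis unfolding sum_Xs[OF bX] boundary_pairing by (simp only: sum.neutral_const)
  qed
  then show "b \<in> perp (Xs s) (boundary ` supp_in (Xs (Suc s)))" using bX by (auto simp: perp_def)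
next
  fix b :: "'v set \<Rightarrow>\<^sub>0 'k"
  assume b: "b \<in> perp (Xs s) (boundary ` supp_in (Xs (Suc s)))"
  then have bX: "b \<in> supp_in (Xs s)" by (simp add: perp_def)
  have "cobd b F = 0" if F: "F \<in> \<Delta>" "card F = Suc s" for F
  proof -
    let ?c = "Poly_Mapping.single F (1::'k)"
    have "?c \<in> supp_in (Xs (Suc s))" using F by (simp add: supp_in_def Xs_def)
    then have "(\<Sum>G\<in>Xs s. Poly_Mapping.lookup b G * Poly_Mapping.lookup (boundary ?c) G) = 0" using b by (simp add: perp_def)
    then have "(\<Sum>H\<in>UNIV. Poly_Mapping.lookup ?c H * cobd b H) = 0" unfolding sum_Xs[OF bX] boundary_pairing .
    moreover have "(\<Sum>H\<in>UNIV. Poly_Mapping.lookup ?c H * cobd b H) = (\<Sum>H\<in>UNIV. if H = F then cobd b H else 0)"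
      by (rule sum.cong) (auto simp: lookup_single when_def)
    ultimately show ?thesis by (simp add: sum.delta)
  qed
  then show "b \<in> Zc s" using bX by (simp add: Zc_def)
qed

lemma cycles_eq_perp: "{c \<in> supp_in (Xs s). boundary c = 0} = perp (Xs s) (Bc s)"
proof (intro equalityI subsetI)
  fix c assume c: "c \<in> {c \<in> supp_in (Xs s). boundary c = (0 :: 'v set \<Rightarrow>\<^sub>0 'k)}"
  then have cX: "c \<in> supp_in (Xs s)" by simp
  have "(\<Sum>F\<in>Xs s. Poly_Mapping.lookup c F * Poly_Mapping.lookup b F) = 0" if b: "b \<in> Bc s" for b
  proof -
    from b obtain a where a: "\<forall>F\<in>Xs s. Poly_Mapping.lookup b F = cobd a F" unfolding Bc_def by (elim CollectE conjE exE)
    have "(\<Sum>F\<in>Xs s. Poly_Mapping.lookup c F * Poly_Mapping.lookup b F) = (\<Sum>F\<in>Xs s. Poly_Mapping.lookup c F * cobd a F)"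
      by (rule sum.cong) (use a in auto)
    also have "\<dots> = (\<Sum>G\<in>UNIV. Poly_Mapping.lookup a G * Poly_Mapping.lookup (boundary c) G)"
      unfolding sum_Xs[OF cX] boundary_pairing ..
    also have "\<dots> = 0" using c by simp
    finally show ?thesis .
  qed
  then show "c \<in> perp (Xs s) (Bc s)" using cX by (simp add: perp_def)
next
  fix c assume c: "c \<in> perp (Xs s) (Bc s)"
  then have cX: "c \<in> supp_in (Xs s)" by (simp add: perp_def)
  have "Poly_Mapping.lookup (boundary c) G = 0" for G
  proof -
    let ?a = "Poly_Mapping.single G (1::'k)"
    define b where "b = (\<Sum>F\<in>Xs s. Poly_Mapping.single F (cobd ?a F))"
    have lb: "Poly_Mapping.lookup b F = (if F \<in> Xs s then cobd ?a F else 0)" for F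
    proof -
      have "Poly_Mapping.lookup b F = (\<Sum>H\<in>Xs s. if H = F then cobd ?a H else 0)"
        unfolding b_def Poly_Mapping.lookup_sum by (rule sum.cong) (auto simp: lookup_single when_def)
      then show ?thesis by (simp add: sum.delta)
    qed
    have "b \<in> Bc s" unfolding Bc_def
      by (intro CollectI conjI exI[of _ ?a]) (simp_all add: supp_in_iff lb)
    then have "(\<Sum>F\<in>Xs s. Poly_Mapping.lookup c F * Poly_Mapping.lookup b F) = 0" using c by (simp add: perp_def)
    moreover have "(\<Sum>F\<in>Xs s. Poly_Mapping.lookup c F * Poly_Mapping.lookup b F) = (\<Sum>F\<in>Xs s. Poly_Mapping.lookup c F * cobd ?a F)"
      by (rule sum.cong) (simp_all add: lb)
    ultimately have "(\<Sum>H\<in>UNIV. Poly_Mapping.lookup ?a H * Poly_Mapping.lookup (boundary c) H) = 0"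
      unfolding boundary_pairing sum_Xs[OF cX, symmetric] by simp
    moreover have "(\<Sum>H\<in>UNIV. Poly_Mapping.lookup ?a H * Poly_Mapping.lookup (boundary c) H)
        = (\<Sum>H\<in>UNIV. if H = G then Poly_Mapping.lookup (boundary c) H else 0)"
      by (rule sum.cong) (auto simp: lookup_single when_def)
    ultimately show ?thesis by (simp add: sum.delta)
  qed
  then have "boundary c = 0" by (intro poly_mapping_eqI) simp
  then show "c \<in> {c \<in> supp_in (Xs s). boundary c = 0}" using cX by simp
qed

text \<open>Cycles are the annihilator of coboundaries and cocycles that of boundaries, so homology
  and cohomology have equal dimension over the field. The shift by one passes from numbers of
  vertices to dimensions of faces.\<close>

lemma reduced_betti_eq: "reduced_betti TYPE('k) \<Delta> (int s - 1) = bt s"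
proof -
  let ?B = "boundary ` supp_in (Xs (Suc s)) :: ('v set \<Rightarrow>\<^sub>0 'k) set"
  have c: "cycles \<Delta> (int s - 1) = perp (Xs s) (Bc s)"
    unfolding cycles_def chains_eq by (rule cycles_eq_perp)
  have "int s - 1 + 1 = int (Suc s) - 1" by simp
  then have b: "boundaries \<Delta> (int s - 1) = ?B" unfolding boundaries_def by (simp only: chains_eq)
  have "pm.dim (perp (Xs s) (Bc s)) + pm.dim (Bc s) = card (Xs s)"
    by (rule dim_perp[OF finite subspace_Bc]) (auto simp: Bc_def)
  moreover have "pm.dim (perp (Xs s) ?B) + pm.dim ?B = card (Xs s)"
  proof (rule dim_perp[OF finite])
    show "pm.subspace ?B" by (rule pmp.linear_subspace_image[OF pm_linear_boundary subspace_supp_in])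
    show "?B \<subseteq> supp_in (Xs s)" using boundary_in by auto
  qed
  ultimately show ?thesis
    unfolding reduced_betti_def chain_scale_eq_pm_scale c b bt_def Zc_eq_perp[of s] by linarith
qed

lemma h'_num_eq: "s \<le> d \<Longrightarrow> h'_num TYPE('k) d \<Delta> s = Hf d s"
  by (simp only: h'_num_def reduced_betti_eq Hf_eq[OF order_refl] nabla_mon_count)

section \<open>The values of h' at 0 and 1\<close>

lemma nabla_power_0: "(nabla ^^ i) f 0 = f 0"
  by (induction i) (simp_all add: nabla_def)

lemma nabla_power_1: "(nabla ^^ i) f 1 = f 1 - int i * f 0"
proof (induction i)
  case (Suc i)
  have "(nabla ^^ Suc i) f 1 = (nabla ^^ i) f 1 - (nabla ^^ i) f 0"
    unfolding funpow.simps comp_apply nabla_def[of "(nabla ^^ i) f"] by simp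
  then show ?case unfolding Suc.IH nabla_power_0 by (simp add: algebra_simps)
qed simp

lemma empty_face: "{} \<in> \<Delta>"
  by (rule down[OF verts]) simp

lemma mon_count_0: "mon_count 0 = 1"
proof -
  have "{t. dg t = 0 \<and> Poly_Mapping.keys t \<in> \<Delta>} = {0}" using empty_face by (auto simp: dg_eq_0_iff)
  then show ?thesis by (simp add: mon_count_def)
qed

lemma mon_count_1: "mon_count 1 = int CARD('v)"
proof -
  have "{t. dg t = 1 \<and> Poly_Mapping.keys t \<in> \<Delta>} = (\<lambda>v. Poly_Mapping.single v 1) ` UNIV"
  proof (intro equalityI subsetI)
    fix t assume t: "t \<in> {t. dg t = 1 \<and> Poly_Mapping.keys t \<in> \<Delta>}"
    then have "t \<noteq> 0" by auto
    then obtain v where v: "Poly_Mapping.lookup t v \<noteq> 0" by (metis lookup_zero poly_mapping_eqI)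
    define u where "u = t - Poly_Mapping.single v 1"
    have tu: "t = Poly_Mapping.single v 1 + u"
      unfolding u_def by (rule poly_mapping_eqI)
        (use v in \<open>auto simp: Poly_Mapping.lookup_add lookup_minus lookup_single when_def\<close>)
    then have "dg u = 0" using t by simp
    then have "t = Poly_Mapping.single v 1" using tu by (simp add: dg_eq_0_iff)
    then show "t \<in> (\<lambda>v. Poly_Mapping.single v 1) ` UNIV" by simp
  qed (use verts in auto)
  moreover have "inj (\<lambda>v :: 'v. Poly_Mapping.single v (1::nat))"
  proof (rule injI)
    fix v w :: 'v assume "Poly_Mapping.single v (1::nat) = Poly_Mapping.single w 1"
    then have "Poly_Mapping.keys (Poly_Mapping.single v (1::nat)) = Poly_Mapping.keys (Poly_Mapping.single w (1::nat))" by simp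
    then show "v = w" by simp
  qed
  ultimately show ?thesis by (simp add: mon_count_def card_image)
qed

text \<open>A cocycle on the empty face has coboundary zero at any vertex, which forces its only
  coefficient to vanish.\<close>

lemma bt_0: "bt 0 = 0"
proof -
  have "b = 0" if b: "b \<in> Zc 0" for b
  proof (rule poly_mapping_eqI)
    fix F
    show "Poly_Mapping.lookup b F = Poly_Mapping.lookup 0 F"
    proof (cases "F = {}")
      case True
      obtain v :: 'v where True by simp
      have "cobd b {v} = 0" using b verts by (simp add: Zc_def)
      moreover have "sg v {v} = (1::'k)"
      proof -
        have "{b\<in>{v}. b < v} = {}" by auto
        then show ?thesis by (simp only: sg_def card.empty power_0)
      qed
      ultimately show ?thesis using True by (simp add: cobd_def)
    next
      case False
      then have "F \<notin> Xs 0" by (simp add: Xs_def)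
      then show ?thesis using b by (simp add: Zc_def supp_in_iff)
    qed
  qed
  then have "Zc 0 = {0}" using pm.subspace_0[OF subspace_Zc] by blast
  moreover have "Bc 0 = {0}" using Bc_subset_Zc[of 0] calculation pm.subspace_0[OF subspace_Bc] by blast
  ultimately show ?thesis by (simp add: bt_def)
qed

lemma h'_0: "h'_num TYPE('k) d \<Delta> 0 = 1"
  using h'_num_eq[of 0] Hf_eq[OF order_refl, of 0] by (simp add: nabla_power_0 mon_count_0)

lemma h'_1: "1 \<le> d \<Longrightarrow> h'_num TYPE('k) d \<Delta> 1 = int CARD('v) - int d"
  using h'_num_eq[of 1] Hf_eq[OF order_refl, of 1] nabla_power_1[of d mon_count]
  by (simp add: mon_count_0 mon_count_1[simplified] bt_0)

text \<open>
  The forms of degree \<open>j\<close> in \<open>Z0 d j\<close> are socle elements of the Artinian reduction; killing them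
  turns Macaulay's theorem into the sharpened inequality.
\<close>

lemma h'_bound:
  assumes "1 \<le> j" "j \<le> d - 1"
  shows "0 \<le> h'_num TYPE('k) d \<Delta> j - int (d choose j) * reduced_betti TYPE('k) \<Delta> (int j - 1)"
    and "h'_num TYPE('k) d \<Delta> (j + 1) \<le> int (pseudo_power
      (nat (h'_num TYPE('k) d \<Delta> j - int (d choose j) * reduced_betti TYPE('k) \<Delta> (int j - 1))) j)"
proof -
  let ?N = "\<lambda>n. card {t :: 'v \<Rightarrow>\<^sub>0 nat. dg t = n}"
  \<comment> \<open>By \<open>dim_H0\<close>, subtracting the Betti term enlarges the ideal in
    degree \<open>j\<close> from \<open>B0 d j\<close> to \<open>Z0 d j\<close>.\<close>
  have Z: "h'_num TYPE('k) d \<Delta> j - int (d choose j) * reduced_betti TYPE('k) \<Delta> (int j - 1) = int (?N j) - int (pm.dim (Z0 d j))"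
  proof -
    have "h'_num TYPE('k) d \<Delta> j = int (?N j) - int (pm.dim (B0 d j))"
      using h'_num_eq[of j] assms by (simp add: HF_def dim_hom B0_def)
    then show ?thesis using dim_H0[of d j] by (simp add: reduced_betti_eq bt_def)
  qed
  have le: "pm.dim (Z0 d j) \<le> ?N j"
    using dim_mono_fin[OF fin_span_hom, of "Z0 d j" j] by (simp add: dim_hom Z0_def)
  \<comment> \<open>Nonnegativity ensures that \<open>nat\<close> in the bound does not
    truncate.\<close>
  show "0 \<le> h'_num TYPE('k) d \<Delta> j - int (d choose j) * reduced_betti TYPE('k) \<Delta> (int j - 1)"
    unfolding Z using le by simp
  have "?N (Suc j) - pm.dim (B0 d (Suc j)) \<le> pseudo_power (?N j - pm.dim (Z0 d j)) j"
  proof (rule Macaulay_bound[OF assms(1) subspace_Z0 _ subspace_B0])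
    show "Z0 d j \<subseteq> hom j" by (auto simp: Z0_def)
    show "B0 d (Suc j) \<subseteq> hom (Suc j)" by (auto simp: B0_def)
    \<comment> \<open>Socle property: the products with variables are already in the ideal, so
      degree \<open>Suc j\<close> is unaffected by the enlargement in degree
      \<open>j\<close>.\<close>
    fix v g assume g: "g \<in> Z0 d j"
    have "var v * g \<in> hom (Suc j)" unfolding var_eq_lin by (rule mult_hom_lin) (use g in \<open>simp add: Z0_def\<close>)
    moreover have "var v * g \<in> gens (fideal \<Delta> {}) \<theta> d" by (rule star_cancel) (use g in \<open>simp add: Z0_def\<close>)
    ultimately show "var v * g \<in> B0 d (Suc j)" by (simp add: B0_def)
  qed
  moreover have "h'_num TYPE('k) d \<Delta> (j + 1) = int (?N (Suc j)) - int (pm.dim (B0 d (Suc j)))"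
    using h'_num_eq[of "Suc j"] assms by (simp add: HF_def dim_hom B0_def)
  moreover have "int (?N (Suc j)) - int (pm.dim (B0 d (Suc j))) \<le> int (?N (Suc j) - pm.dim (B0 d (Suc j)))" by simp
  ultimately have "h'_num TYPE('k) d \<Delta> (j + 1) \<le> int (pseudo_power (?N j - pm.dim (Z0 d j)) j)" by linarith
  moreover have "nat (int (?N j) - int (pm.dim (Z0 d j))) = ?N j - pm.dim (Z0 d j)" by simp
  ultimately show "h'_num TYPE('k) d \<Delta> (j + 1) \<le> int (pseudo_power
      (nat (h'_num TYPE('k) d \<Delta> j - int (d choose j) * reduced_betti TYPE('k) \<Delta> (int j - 1))) j)"
    unfolding Z by (simp only:)
qed

end

theorem theorem4p3:
  fixes \<Delta> :: "'v::{finite,linorder} set set" and d :: nat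
  assumes "infinite (UNIV :: 'k::field set)"
    and "simplicial_complex \<Delta>"
    and "complex_dim \<Delta> = int d - 1"
    and "buchsbaum_complex TYPE('k) \<Delta>"
  shows "h'_num TYPE('k) d \<Delta> 0 = 1
    \<and> h'_num TYPE('k) d \<Delta> 1 = int CARD('v) - int d
    \<and> (\<forall>j. 1 \<le> j \<and> j \<le> d - 1 \<longrightarrow>
         0 \<le> h'_num TYPE('k) d \<Delta> j - int (d choose j) * reduced_betti TYPE('k) \<Delta> (int j - 1)
         \<and> h'_num TYPE('k) d \<Delta> (j + 1) \<le>
           int (pseudo_power
             (nat (h'_num TYPE('k) d \<Delta> j - int (d choose j) * reduced_betti TYPE('k) \<Delta> (int j - 1))) j))"
proof -
  \<comment> \<open>The infinite field provides as many distinct points as there are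
    vertices.\<close>
  obtain X :: "'k set" where X: "finite X" "card X = CARD('v)"
    using infinite_arbitrarily_large[OF assms(1), of "CARD('v)"] by auto
  obtain pt :: "'v \<Rightarrow> 'k" where pt: "bij_betw pt UNIV X"
    using finite_same_card_bij[of "UNIV :: 'v set" X] X by auto
  have down: "G \<in> \<Delta>" if "F \<in> \<Delta>" "G \<subseteq> F" for F G
    using assms(2) that unfolding simplicial_complex_def by auto
  have verts: "{v} \<in> \<Delta>" for v using assms(2) unfolding simplicial_complex_def by auto
  have fin: "finite (face_dim ` \<Delta>)" by simp
  have card_face: "card F \<le> d" if "F \<in> \<Delta>" for F
  proof -
    have "face_dim F \<le> complex_dim \<Delta>" unfolding complex_dim_def by (rule Max_ge[OF fin]) (use that in simp)
    then show ?thesis using assms(3) by (simp add: face_dim_def)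
  qed
  have top: "\<exists>F\<in>\<Delta>. card F = d"
  proof -
    have "complex_dim \<Delta> \<in> face_dim ` \<Delta>" unfolding complex_dim_def by (rule Max_in[OF fin]) (use verts in auto)
    then obtain F where "F \<in> \<Delta>" "face_dim F = complex_dim \<Delta>" by auto
    then show ?thesis using assms(3) by (intro bexI[of _ F]) (simp_all add: face_dim_def)
  qed
  have "SR_ideal \<Delta> = (fideal \<Delta> {} :: ('v, 'k) mpoly set)" by (rule SR_ideal_eq[OF down])
  then have bb: "buchsbaum_quotient (fideal \<Delta> {} :: ('v, 'k) mpoly set)"
    using assms(4) by (simp add: buchsbaum_complex_def)
  have inj: "inj pt" by (rule bij_betw_imp_inj_on[OF pt])
  have "moment_curve \<Delta> d pt"
    by (rule moment_curve.intro; fact down verts card_face top inj bb)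
  then interpret moment_curve \<Delta> d pt .
  have "1 \<le> d" using card_face[OF verts] by simp
  then show ?thesis using h'_0 h'_1 h'_bound by blast
qed

end
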